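(* Let $\mathcal K$ be a simplicial complex on vertex set $\mathcal V$. Let $i\in\mathbb Z_{\ge 1}$. Let $\mathbf c=\mathbf a-\mathbf b\in\mathbb Z^{\mathcal V}$, where $\mathbf a,\mathbf b\in\mathbb Z_{\ge 0}^{\mathcal V}$ have disjoint supports $a,b\subseteq\mathcal V$. Then: (1) if $a\notin\mathcal K$, then $T^i_{\mathbf c}(\mathcal K)=0$; (2) if $a\in\mathcal K$, then $T^i_{\mathbf c}(\mathcal K)\cong T^i_{-\mathbf b}(\operatorname{lk}(a,\mathcal K))$.
   Context: $\Bbbk$ is a field of characteristic zero and $\mathcal V$ is a finite non-empty set. A simplicial complex on vertex set $\mathcal V$ is a collection $\mathcal K$ of subsets of $\mathcal V$ (its faces) closed under taking subsets; not every element of $\mathcal V$ need be a vertex of $\mathcal K$. Its Stanley-Reisner ideal is $I_{\mathcal K}=\langle \prod_{v\in f}x_v \mid f\subseteq\mathcal V,\ f\notin\mathcal K\rangle\subseteq \Bbbk[x_v\mid v\in\mathcal V]$ and $S_{\mathcal K}=\Bbbk[x_v\mid v\in\mathcal V]/I_{\mathcal K}$, which is $\mathbb Z^{\mathcal V}$-graded. For a finitely generated commutative $\Bbbk$-algebra $S$, a Koszul-Tate resolution of $S$ is a commutative differential graded algebra $P=P_\bullet$ ($P_i=0$ for $i<0$, differential lowering degree by one), free as a graded-commutative algebra after forgetting the differential, with a quasi-isomorphism $P\to S$. The cotangent cohomology is $T^i_{S/\Bbbk}=H^i(\operatorname{Der}^\bullet_{\Bbbk}(P,S))$, where $\operatorname{Der}^i_{\Bbbk}(P,S)$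 consists of the $\Bbbk$-linear maps $\phi:P\to S$ vanishing on $P_j$ for $j\ne i$ and satisfying the graded Leibniz rule, with differential $\phi\mapsto(-1)^{\deg\phi+1}\phi\circ\partial$. If $S$ is $\mathbb Z^{\mathcal V}$-graded, $P$ is chosen compatibly graded, and $T^i_{S/\Bbbk}$ inherits a $\mathbb Z^{\mathcal V}$-grading. Put $T^i(\mathcal K)=T^i_{S_{\mathcal K}/\Bbbk}$, and let $T^i_{\mathbf c}(\mathcal K)$ be its weight $\mathbf c$ piece. The support of $\mathbf a\in\mathbb Z_{\ge0}^{\mathcal V}$ is $a=\{v\in\mathcal V\mid \mathbf a_v\ne0\}$; likewise $b$ is the support of $\mathbf b$. The link of a face $f$ is $\operatorname{lk}(f,\mathcal K)=\{g\in\mathcal K\mid f\cap g=\emptyset,\ f\cup g\in\mathcal K\}$. Here $\operatorname{lk}(a,\mathcal K)$ is viewed as a simplicial complex on $\mathcal V\setminus a$, and $-\mathbf b$ as an element of $\mathbb Z^{\mathcal V\setminus a}$. *)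

theory Defs
  imports
    "HOL-Algebra.Algebra"
    "HOL-Algebra.Algebraic_Closure_Type"
    "HOL-Library.Poly_Mapping"
    "HOL-Library.Multiset"
begin

section \<open>Modules over the ground field\<close>

text \<open>
  The ground field is a type \<open>'k\<close> of class \<^class>\<open>field\<close>, regarded as the ring record
  \<^const>\<open>ring_of_type_algebra\<close>. The fields \<^const>\<open>monoid.mult\<close> and \<^const>\<open>one\<close> of a
  \<open>module\<close> record play no role when the record only serves as a vector space.
\<close>

abbreviation ground :: "'k::field ring" where
  "ground \<equiv> ring_of_type_algebra"

definition linear_maps ::
    "('k::field, 'a, 'm) module_scheme \<Rightarrow> ('k, 'b, 'n) module_scheme \<Rightarrow> ('a \<Rightarrow> 'b) set" where
  "linear_maps M N = {h \<in> carrier M \<rightarrow> carrier N.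
      (\<forall>x\<in>carrier M. \<forall>y\<in>carrier M. h (x \<oplus>\<^bsub>M\<^esub> y) = h x \<oplus>\<^bsub>N\<^esub> h y) \<and>
      (\<forall>c. \<forall>x\<in>carrier M. h (c \<odot>\<^bsub>M\<^esub> x) = c \<odot>\<^bsub>N\<^esub> h x)}"

definition module_isomorphic ::
    "('k::field, 'a, 'm) module_scheme \<Rightarrow> ('k, 'b, 'n) module_scheme \<Rightarrow> bool" where
  "module_isomorphic M N \<longleftrightarrow> (\<exists>h\<in>linear_maps M N. bij_betw h (carrier M) (carrier N))"

definition quot_module ::
    "('k::field, 'a, 'm) module_scheme \<Rightarrow> 'a set \<Rightarrow> ('k, 'a set) module" where
  "quot_module M N =
     \<lparr>carrier = a_rcosets\<^bsub>M\<^esub> N, monoid.mult = undefined, one = undefined,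
      ring.zero = N, add = set_add M,
      module.smult = (\<lambda>c C. \<Union>x\<in>C. N +>\<^bsub>M\<^esub> (c \<odot>\<^bsub>M\<^esub> x))\<rparr>"

definition direct_sum_decomp ::
    "('k::field, 'a, 'm) module_scheme \<Rightarrow> 'i set \<Rightarrow> ('i \<Rightarrow> 'a set) \<Rightarrow> bool" where
  "direct_sum_decomp M I A \<longleftrightarrow>
     (\<forall>i\<in>I. submodule (A i) ground M) \<and>
     (\<forall>x\<in>carrier M. \<exists>!f. (\<forall>i\<in>I. f i \<in> A i) \<and> (\<forall>i. i \<notin> I \<longrightarrow> f i = \<zero>\<^bsub>M\<^esub>) \<and>
        finite {i. f i \<noteq> \<zero>\<^bsub>M\<^esub>} \<and> x = (\<Oplus>\<^bsub>M\<^esub>i\<in>{i. f i \<noteq> \<zero>\<^bsub>M\<^esub>}. f i))"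

definition koszul_sign :: "int \<Rightarrow> 'k::field" where
  "koszul_sign n = (if even n then 1 else -1)"


section \<open>Commutative differential graded algebras\<close>

record ('k, 'p) dga = "('k, 'p) module" +
  deg_part :: "int \<Rightarrow> 'p set"
  bd :: "'p \<Rightarrow> 'p"

locale cdga = module ground P + ring P for P :: "('k::field, 'p, 'm) dga_scheme" (structure) +
  assumes smult_mult_left: "\<lbrakk>x \<in> carrier P; y \<in> carrier P\<rbrakk> \<Longrightarrow> (c \<odot> x) \<otimes> y = c \<odot> (x \<otimes> y)"
    and smult_mult_right: "\<lbrakk>x \<in> carrier P; y \<in> carrier P\<rbrakk> \<Longrightarrow> x \<otimes> (c \<odot> y) = c \<odot> (x \<otimes> y)"
    and deg_decomp: "direct_sum_decomp P UNIV (deg_part P)"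
    and deg_negative: "i < 0 \<Longrightarrow> deg_part P i = {\<zero>}"
    and deg_one: "\<one> \<in> deg_part P 0"
    and deg_mult: "\<lbrakk>x \<in> deg_part P i; y \<in> deg_part P j\<rbrakk> \<Longrightarrow> x \<otimes> y \<in> deg_part P (i + j)"
    and graded_commute:
      "\<lbrakk>x \<in> deg_part P i; y \<in> deg_part P j\<rbrakk> \<Longrightarrow> x \<otimes> y = koszul_sign (i * j) \<odot> (y \<otimes> x)"
    and bd_linear: "bd P \<in> linear_maps P P"
    and bd_deg: "x \<in> deg_part P i \<Longrightarrow> bd P x \<in> deg_part P (i - 1)"
    and bd_bd: "x \<in> carrier P \<Longrightarrow> bd P (bd P x) = \<zero>"
    and bd_leibniz: "\<lbrakk>x \<in> deg_part P i; y \<in> carrier P\<rbrakk> \<Longrightarrow>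
      bd P (x \<otimes> y) = bd P x \<otimes> y \<oplus> koszul_sign i \<odot> (x \<otimes> bd P y)"

text \<open>
  \<open>P\<close> is the free graded-commutative algebra on a set \<open>G\<close> of homogeneous elements, i.e. the
  polynomial algebra on the even elements of \<open>G\<close> tensored with the exterior algebra on the odd
  ones: the monomials in \<open>G\<close> in which odd generators are not repeated form a basis. A monomial
  is given by a multiset; the listing \<open>arr\<close> chooses the order in which its factors are
  multiplied, and by graded commutativity only the sign of the product depends on this choice.
\<close>

definition free_monomials :: "('k::field, 'p, 'm) dga_scheme \<Rightarrow> 'p set \<Rightarrow> 'p multiset set" where
  "free_monomials P G = {M. set_mset M \<subseteq> G \<and>
      (\<forall>x\<in>G. (\<exists>i. odd i \<and> x \<in> deg_part P i) \<longrightarrow> count M x \<le> 1)}"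

definition freely_generates :: "('k::field, 'p, 'm) dga_scheme \<Rightarrow> 'p set \<Rightarrow> bool" where
  "freely_generates P G \<longleftrightarrow> G \<subseteq> (\<Union>i. deg_part P i) \<and>
     (\<exists>arr. (\<forall>M. mset (arr M) = M) \<and>
        (\<forall>p\<in>carrier P. \<exists>!f :: 'p multiset \<Rightarrow> 'k.
           finite {M. f M \<noteq> 0} \<and> {M. f M \<noteq> 0} \<subseteq> free_monomials P G \<and>
           p = (\<Oplus>\<^bsub>P\<^esub>M\<in>{M. f M \<noteq> 0}. f M \<odot>\<^bsub>P\<^esub> foldr (\<otimes>\<^bsub>P\<^esub>) (arr M) \<one>\<^bsub>P\<^esub>)))"

definition cycles :: "('k::field, 'p, 'm) dga_scheme \<Rightarrow> int \<Rightarrow> 'p set" where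
  "cycles P i = {x \<in> deg_part P i. bd P x = \<zero>\<^bsub>P\<^esub>}"

definition boundaries :: "('k::field, 'p, 'm) dga_scheme \<Rightarrow> int \<Rightarrow> 'p set" where
  "boundaries P i = bd P ` deg_part P (i + 1)"

definition homology :: "('k::field, 'p, 'm) dga_scheme \<Rightarrow> int \<Rightarrow> ('k, 'p set) module" where
  "homology P i = quot_module (P\<lparr>carrier := cycles P i\<rparr>) (boundaries P i)"

definition dga_homs ::
    "('k::field, 'p, 'm) dga_scheme \<Rightarrow> ('k, 'q, 'n) dga_scheme \<Rightarrow> ('p \<Rightarrow> 'q) set" where
  "dga_homs P Q = {h \<in> linear_maps P Q \<inter> ring_hom P Q.
      (\<forall>i. h ` deg_part P i \<subseteq> deg_part Q i) \<and> (\<forall>x\<in>carrier P. h (bd P x) = bd Q (h x))}"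

definition homology_map :: "('k::field, 'q, 'n) dga_scheme \<Rightarrow> ('p \<Rightarrow> 'q) \<Rightarrow> int \<Rightarrow> 'p set \<Rightarrow> 'q set" where
  "homology_map Q h i C = (\<Union>x\<in>C. boundaries Q i +>\<^bsub>Q\<^esub> h x)"

definition quasi_isomorphism ::
    "('k::field, 'p, 'm) dga_scheme \<Rightarrow> ('k, 'q, 'n) dga_scheme \<Rightarrow> ('p \<Rightarrow> 'q) \<Rightarrow> bool" where
  "quasi_isomorphism P Q h \<longleftrightarrow> h \<in> dga_homs P Q \<and>
     (\<forall>i. bij_betw (homology_map Q h i) (carrier (homology P i)) (carrier (homology Q i)))"

definition in_degree_zero :: "('k::field, 's) module \<Rightarrow> ('k, 's) dga" where
  "in_degree_zero S =
     module.extend S (dga.fields (\<lambda>i. if i = 0 then carrier S else {\<zero>\<^bsub>S\<^esub>}) (\<lambda>_. \<zero>\<^bsub>S\<^esub>))"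

definition koszul_tate_resolution ::
    "('k::field, 's) module \<Rightarrow> ('k, 'p) dga \<Rightarrow> ('p \<Rightarrow> 's) \<Rightarrow> bool" where
  "koszul_tate_resolution S P \<epsilon> \<longleftrightarrow>
     cdga P \<and> (\<exists>G. freely_generates P G) \<and> quasi_isomorphism P (in_degree_zero S) \<epsilon>"


section \<open>Cotangent cohomology\<close>

text \<open>
  \<open>S\<close> is a \<open>P\<close>-module through \<open>\<epsilon>\<close>. Derivations are functions on \<open>carrier P\<close>, made total in
  the standard way by being \<^const>\<open>undefined\<close> elsewhere.
\<close>

definition Der ::
    "('k::field, 's) module \<Rightarrow> ('k, 'p) dga \<Rightarrow> ('p \<Rightarrow> 's) \<Rightarrow> int \<Rightarrow> ('k, 'p \<Rightarrow> 's) module" where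
  "Der S P \<epsilon> i =
     \<lparr>carrier = {\<phi> \<in> linear_maps P S \<inter> extensional (carrier P).
        (\<forall>j x. j \<noteq> i \<longrightarrow> x \<in> deg_part P j \<longrightarrow> \<phi> x = \<zero>\<^bsub>S\<^esub>) \<and>
        (\<forall>j. \<forall>x\<in>deg_part P j. \<forall>y\<in>carrier P.
           \<phi> (x \<otimes>\<^bsub>P\<^esub> y) =
             \<phi> x \<otimes>\<^bsub>S\<^esub> \<epsilon> y \<oplus>\<^bsub>S\<^esub> koszul_sign (i * j) \<odot>\<^bsub>S\<^esub> (\<epsilon> x \<otimes>\<^bsub>S\<^esub> \<phi> y))},
      monoid.mult = undefined, one = undefined,
      ring.zero = (\<lambda>x\<in>carrier P. \<zero>\<^bsub>S\<^esub>),
      add = (\<lambda>\<phi> \<psi>. \<lambda>x\<in>carrier P. \<phi> x \<oplus>\<^bsub>S\<^esub> \<psi> x),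
      module.smult = (\<lambda>c \<phi>. \<lambda>x\<in>carrier P. c \<odot>\<^bsub>S\<^esub> \<phi> x)\<rparr>"

definition der_diff ::
    "('k::field, 's) module \<Rightarrow> ('k, 'p) dga \<Rightarrow> int \<Rightarrow> ('p \<Rightarrow> 's) \<Rightarrow> ('p \<Rightarrow> 's)" where
  "der_diff S P i \<phi> = (\<lambda>x\<in>carrier P. koszul_sign (i + 1) \<odot>\<^bsub>S\<^esub> \<phi> (bd P x))"

definition der_cocycles ::
    "('k::field, 's) module \<Rightarrow> ('k, 'p) dga \<Rightarrow> ('p \<Rightarrow> 's) \<Rightarrow> int \<Rightarrow> ('p \<Rightarrow> 's) set" where
  "der_cocycles S P \<epsilon> i =
     {\<phi> \<in> carrier (Der S P \<epsilon> i). der_diff S P i \<phi> = \<zero>\<^bsub>Der S P \<epsilon> (i + 1)\<^esub>}"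

definition der_coboundaries ::
    "('k::field, 's) module \<Rightarrow> ('k, 'p) dga \<Rightarrow> ('p \<Rightarrow> 's) \<Rightarrow> int \<Rightarrow> ('p \<Rightarrow> 's) set" where
  "der_coboundaries S P \<epsilon> i = der_diff S P (i - 1) ` carrier (Der S P \<epsilon> (i - 1))"

definition cotangent_cohomology ::
    "('k::field, 's) module \<Rightarrow> ('k, 'p) dga \<Rightarrow> ('p \<Rightarrow> 's) \<Rightarrow> int \<Rightarrow> ('k, ('p \<Rightarrow> 's) set) module" where
  "cotangent_cohomology S P \<epsilon> i =
     quot_module ((Der S P \<epsilon> i)\<lparr>carrier := der_cocycles S P \<epsilon> i\<rparr>) (der_coboundaries S P \<epsilon> i)"


section \<open>Multigradings\<close>

text \<open>
  An element of \<open>\<int>\<^sup>V\<close> is a function on the whole type of potential vertices that vanishes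
  outside \<open>V\<close>.
\<close>

definition weights :: "'v set \<Rightarrow> ('v \<Rightarrow> int) set" where
  "weights V = {w. \<forall>v. v \<notin> V \<longrightarrow> w v = 0}"

text \<open>
  Given the \<open>\<int>\<^sup>V\<close>-graded pieces \<open>SW\<close> of \<open>S\<close>, the pieces \<open>W\<close> make the resolution \<open>P\<close> of \<open>S\<close>
  compatibly graded; this includes that \<open>P\<close> is free on generators homogeneous for both the
  degree and the weight.
\<close>

definition compatible_grading ::
    "'v set \<Rightarrow> ('k::field, 's) module \<Rightarrow> (('v \<Rightarrow> int) \<Rightarrow> 's set) \<Rightarrow>
     ('k, 'p) dga \<Rightarrow> ('p \<Rightarrow> 's) \<Rightarrow> (('v \<Rightarrow> int) \<Rightarrow> 'p set) \<Rightarrow> bool" where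
  "compatible_grading V S SW P \<epsilon> W \<longleftrightarrow>
     direct_sum_decomp P (weights V) W \<and>
     (\<forall>i. direct_sum_decomp (P\<lparr>carrier := deg_part P i\<rparr>) (weights V) (\<lambda>w. deg_part P i \<inter> W w)) \<and>
     \<one>\<^bsub>P\<^esub> \<in> W (\<lambda>_. 0) \<and>
     (\<forall>w\<in>weights V. \<forall>w'\<in>weights V. \<forall>x\<in>W w. \<forall>y\<in>W w'. x \<otimes>\<^bsub>P\<^esub> y \<in> W (\<lambda>v. w v + w' v)) \<and>
     (\<forall>w\<in>weights V. bd P ` W w \<subseteq> W w) \<and>
     (\<forall>w\<in>weights V. \<epsilon> ` W w \<subseteq> SW w) \<and>
     (\<exists>G. freely_generates P G \<and> G \<subseteq> (\<Union>w\<in>weights V. W w))"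

text \<open>
  The weight \<open>c\<close> piece of the cohomology consists of the classes of those cocycles that shift
  weights by \<open>c\<close>.
\<close>

definition weight_derivations ::
    "'v set \<Rightarrow> (('v \<Rightarrow> int) \<Rightarrow> 's set) \<Rightarrow> (('v \<Rightarrow> int) \<Rightarrow> 'p set) \<Rightarrow> ('v \<Rightarrow> int) \<Rightarrow> ('p \<Rightarrow> 's) set" where
  "weight_derivations V SW W c =
     {\<phi>. \<forall>w\<in>weights V. \<forall>x\<in>W w. \<phi> x \<in> SW (\<lambda>v. w v + c v)}"

definition cotangent_cohomology_weight ::
    "'v set \<Rightarrow> ('k::field, 's) module \<Rightarrow> (('v \<Rightarrow> int) \<Rightarrow> 's set) \<Rightarrow>
     ('k, 'p) dga \<Rightarrow> ('p \<Rightarrow> 's) \<Rightarrow> (('v \<Rightarrow> int) \<Rightarrow> 'p set) \<Rightarrow>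
     int \<Rightarrow> ('v \<Rightarrow> int) \<Rightarrow> ('k, ('p \<Rightarrow> 's) set) module" where
  "cotangent_cohomology_weight V S SW P \<epsilon> W i c =
     (cotangent_cohomology S P \<epsilon> i)\<lparr>carrier :=
        {der_coboundaries S P \<epsilon> i +>\<^bsub>Der S P \<epsilon> i\<^esub> \<phi> | \<phi>.
           \<phi> \<in> der_cocycles S P \<epsilon> i \<inter> weight_derivations V SW W c}\<rparr>"


section \<open>Simplicial complexes and Stanley-Reisner rings\<close>

text \<open>The void complex \<open>{}\<close> is allowed; its Stanley-Reisner ring is zero.\<close>

definition simplicial_complex :: "'v set \<Rightarrow> 'v set set \<Rightarrow> bool" where
  "simplicial_complex V K \<longleftrightarrow> K \<subseteq> Pow V \<and> (\<forall>f\<in>K. \<forall>g. g \<subseteq> f \<longrightarrow> g \<in> K)"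

definition link :: "'v set \<Rightarrow> 'v set set \<Rightarrow> 'v set set" where
  "link f K = {g \<in> K. f \<inter> g = {} \<and> f \<union> g \<in> K}"

type_synonym ('v, 'k) mpoly = "('v \<Rightarrow>\<^sub>0 nat) \<Rightarrow>\<^sub>0 'k"

definition mpoly_ring :: "'v set \<Rightarrow> ('v, 'k::field) mpoly ring" where
  "mpoly_ring V = ring_of_type_algebra\<lparr>carrier := {p. \<forall>m\<in>Poly_Mapping.keys p. Poly_Mapping.keys m \<subseteq> V}\<rparr>"

definition SR_ideal :: "'v set \<Rightarrow> 'v set set \<Rightarrow> ('v, 'k::field) mpoly set" where
  "SR_ideal V K = Idl\<^bsub>mpoly_ring V\<^esub>
     {\<Prod>v\<in>f. Poly_Mapping.single (Poly_Mapping.single v 1) 1 | f. f \<subseteq> V \<and> f \<notin> K}"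

definition SR_algebra :: "'v set \<Rightarrow> 'v set set \<Rightarrow> ('k::field, ('v, 'k) mpoly set) module" where
  "SR_algebra V K =
     ring.extend (mpoly_ring V Quot SR_ideal V K)
       (module.fields (\<lambda>c C. (SR_ideal V K +>\<^bsub>mpoly_ring V\<^esub> Poly_Mapping.single 0 c)
           \<otimes>\<^bsub>mpoly_ring V Quot SR_ideal V K\<^esub> C))"

definition SR_weight ::
    "'v set \<Rightarrow> 'v set set \<Rightarrow> ('v \<Rightarrow> int) \<Rightarrow> ('v, 'k::field) mpoly set set" where
  "SR_weight V K w = {SR_ideal V K +>\<^bsub>mpoly_ring V\<^esub> p | p. p \<in> carrier (mpoly_ring V) \<and>
      (\<forall>m\<in>Poly_Mapping.keys p. \<forall>v. int (Poly_Mapping.lookup m v) = w v)}"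

definition SR_resolution ::
    "'v set \<Rightarrow> 'v set set \<Rightarrow> ('k::field, 'p) dga \<Rightarrow> ('p \<Rightarrow> ('v, 'k) mpoly set) \<Rightarrow>
     (('v \<Rightarrow> int) \<Rightarrow> 'p set) \<Rightarrow> bool" where
  "SR_resolution V K P \<epsilon> W \<longleftrightarrow>
     koszul_tate_resolution (SR_algebra V K) P \<epsilon> \<and>
     compatible_grading V (SR_algebra V K) (SR_weight V K) P \<epsilon> W"

definition SR_cotangent ::
    "'v set \<Rightarrow> 'v set set \<Rightarrow> ('k::field, 'p) dga \<Rightarrow> ('p \<Rightarrow> ('v, 'k) mpoly set) \<Rightarrow>
     (('v \<Rightarrow> int) \<Rightarrow> 'p set) \<Rightarrow> int \<Rightarrow> ('v \<Rightarrow> int) \<Rightarrow>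
     ('k, ('p \<Rightarrow> ('v, 'k) mpoly set) set) module" where
  "SR_cotangent V K P \<epsilon> W i c =
     cotangent_cohomology_weight V (SR_algebra V K) (SR_weight V K) P \<epsilon> W i c"

definition supp :: "('v \<Rightarrow> nat) \<Rightarrow> 'v set" where
  "supp a = {v. a v \<noteq> 0}"

end

theory Submission
  imports Defs "HOL-Library.Function_Algebras"
begin

text \<open>
  Two maps between Koszul-Tate resolutions of the same algebra are homotopic through a polynomial
  path object, and integration along the path shows that they induce the same map on the
  cohomology of derivations. Hence \<open>T\<^sup>i\<^bsub>c\<^esub>\<close> may be computed from any multigraded
  resolution, and the vertices of \<open>a\<close> can be removed one at a time.

  Let \<open>v\<close> be a vertex with \<open>c v \<ge> 1\<close> and let \<open>P\<close> resolve the Stanley-Reisner ring of \<open>K\<close>. Up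
  to homotopy, a derivation of weight \<open>c\<close> is zero on elements of negative \<open>v\<close>-weight, so its
  values are multiples of \<open>x\<^sub>v\<close>. Such monomials lie over faces that contain \<open>v\<close>; thus setting
  \<open>x\<^sub>v = 1\<close> loses no information and turns derivations of weight \<open>c\<close> into derivations with
  values in the Stanley-Reisner ring of the link of \<open>v\<close>, of weight \<open>c\<close> with its \<open>v\<close>-component
  forgotten. On the other hand \<open>x\<^sub>v - 1\<close> is a nonzerodivisor whose quotient is the ring of
  the link. So the extension of \<open>P\<close> by a generator of degree one whose boundary \<open>u\<close> lifts
  \<open>x\<^sub>v - 1\<close> resolves that ring, and its derivations have the same cohomology in degrees
  \<open>i \<ge> 1\<close>. If the support of \<open>a\<close> is not a face, the iterated link is void and its ring is zero.

  The calculations take place on functions of finite support on a homogeneous basis.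
\<close>

section \<open>Linear maps between spaces of finitely supported functions\<close>

text \<open>A derivation integrated along a homotopy is again a derivation only if the augmentation
  is constant along the path. It is: an element of degree zero is closed, so for
  \<open>k \<ge> 1\<close> the \<open>t^k\<close>-coefficient of its path is a boundary divided by
  \<open>k\<close>. Characteristic zero serves here and in the integrals \<open>t^k / k\<close>.

  The inverse of setting \<open>x_v = 1\<close> multiplies the value at weight \<open>w\<close> by
  \<open>x_v\<close> to the power \<open>w v + c v\<close>, which works only for positive exponents.
  Lifts between resolutions are therefore chosen to kill everything of negative weight, which is
  possible since the ring has no such weights. On the rest the exponent is at least
  \<open>c v\<close>.

  As \<open>u\<close> is homogeneous only once the \<open>v\<close>-component of the weight is
  forgotten, homotopies are needed on a resolution of the ring of \<open>K\<close> with coarser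
  weights and with coefficients in the ring of the link; hence two augmentations in the homotopy
  theorem. The forgotten component returns as an Euler derivation, whose value 1 on \<open>u\<close>
  settles the case \<open>i = 1\<close>, where a derivation may be nonzero on the new
  generator.\<close>

abbreviation keys :: "('x \<Rightarrow>\<^sub>0 'k::zero) \<Rightarrow> 'x set" where "keys \<equiv> Poly_Mapping.keys"
abbreviation lookup :: "('x \<Rightarrow>\<^sub>0 'k::zero) \<Rightarrow> 'x \<Rightarrow> 'k" where "lookup \<equiv> Poly_Mapping.lookup"

definition smul :: "'k::field \<Rightarrow> ('x \<Rightarrow>\<^sub>0 'k) \<Rightarrow> ('x \<Rightarrow>\<^sub>0 'k)" (infixr \<open>\<bullet>\<close> 75) where
  "c \<bullet> f = Poly_Mapping.map ((*) c) f"

abbreviation bas :: "'x \<Rightarrow> ('x \<Rightarrow>\<^sub>0 'k::field)" where "bas x \<equiv> Poly_Mapping.single x 1"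

lemma lookup_smul [simp]: "lookup (c \<bullet> f) x = c * lookup f x"
  by (cases "lookup f x = 0") (simp_all add: smul_def Poly_Mapping.map.rep_eq when_def)

lemma smul_simps:
  "c \<bullet> (x + y) = c \<bullet> x + c \<bullet> y" "c \<bullet> (x - y) = c \<bullet> x - c \<bullet> y" "c \<bullet> (- x) = - (c \<bullet> x)"
  "(c + d) \<bullet> x = c \<bullet> x + d \<bullet> x" "c \<bullet> d \<bullet> x = (c * d) \<bullet> x"
  by (rule poly_mapping_eqI; simp add: lookup_add lookup_minus algebra_simps)+

lemma smul_0 [simp]: "c \<bullet> 0 = 0" "0 \<bullet> x = 0" and smul_1 [simp]: "1 \<bullet> x = x"
  and smul_m1 [simp]: "(- 1) \<bullet> x = - x"
  by (rule poly_mapping_eqI; simp)+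

lemma smul_eq_0: "c \<bullet> x = 0 \<longleftrightarrow> c = 0 \<or> x = 0"
proof
  assume a: "c \<bullet> x = 0"
  have "c * lookup x z = 0" for z using arg_cong[OF a, of "\<lambda>f. lookup f z"] by simp
  then show "c = 0 \<or> x = 0" by (auto intro!: poly_mapping_eqI)
qed auto

lemma keys_smul: "keys (c \<bullet> f) \<subseteq> keys f"
  by (auto simp: in_keys_iff)

lemma keys_addI: "keys f \<subseteq> Y \<Longrightarrow> keys g \<subseteq> Y \<Longrightarrow> keys (f + g) \<subseteq> Y"
  using Poly_Mapping.keys_add[of f g] by blast

lemma keys_uminusI: "keys f \<subseteq> Y \<Longrightarrow> keys (- f) \<subseteq> Y"
  by (auto simp: in_keys_iff subset_iff)

lemma keys_diffI: "keys (f :: 'x \<Rightarrow>\<^sub>0 'k::ab_group_add) \<subseteq> Y \<Longrightarrow> keys g \<subseteq> Y \<Longrightarrow> keys (f - g) \<subseteq> Y"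
  using keys_addI[OF _ keys_uminusI, of f Y g] by simp

lemma keys_smulI: "keys f \<subseteq> Y \<Longrightarrow> keys (c \<bullet> f) \<subseteq> Y"
  using keys_smul by fastforce

lemma keys_sumI: "(\<And>i. i \<in> I \<Longrightarrow> keys (f i) \<subseteq> Y) \<Longrightarrow> keys (sum f I) \<subseteq> Y"
  by (induction I rule: infinite_finite_induct) (simp_all add: keys_addI)

lemma bas_nz [simp]: "(bas x :: 'x \<Rightarrow>\<^sub>0 'k::field) \<noteq> 0"
  by (metis lookup_single_eq lookup_zero zero_neq_one)

definition lin :: "(('x \<Rightarrow>\<^sub>0 'k::field) \<Rightarrow> ('y \<Rightarrow>\<^sub>0 'k)) \<Rightarrow> bool" where
  "lin h \<longleftrightarrow> (\<forall>x y. h (x + y) = h x + h y) \<and> (\<forall>c x. h (c \<bullet> x) = c \<bullet> h x)"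

lemma linI: "(\<And>x y. h (x + y) = h x + h y) \<Longrightarrow> (\<And>c x. h (c \<bullet> x) = c \<bullet> h x) \<Longrightarrow> lin h"
  by (simp add: lin_def)

lemma lin_add: "lin h \<Longrightarrow> h (x + y) = h x + h y"
  and lin_smul: "lin h \<Longrightarrow> h (c \<bullet> x) = c \<bullet> h x"
  by (auto simp: lin_def)

lemma lin_0: "lin h \<Longrightarrow> h 0 = 0"
  by (metis lin_smul smul_0(2))

lemma lin_uminus: "lin h \<Longrightarrow> h (- x) = - h x"
  by (metis lin_smul smul_m1)

lemma lin_diff: "lin h \<Longrightarrow> h (x - y) = h x - h y"
  using lin_add[of h x "- y"] lin_uminus[of h y] by simp

lemma lin_sum: "lin h \<Longrightarrow> h (sum f I) = (\<Sum>i\<in>I. h (f i))"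
  by (induction I rule: infinite_finite_induct) (simp_all add: lin_0 lin_add)

lemmas lin_simps = lin_add lin_smul lin_0 lin_uminus lin_diff

lemma lin_id: "lin (\<lambda>x. x)" and lin_zero: "lin (\<lambda>x. 0)"
  and lin_smulI: "lin h \<Longrightarrow> lin (\<lambda>x. c \<bullet> h x)"
  and lin_addI: "lin h \<Longrightarrow> lin h' \<Longrightarrow> lin (\<lambda>x. h x + h' x)"
  and lin_diffI: "lin h \<Longrightarrow> lin h' \<Longrightarrow> lin (\<lambda>x. h x - h' x)"
  and lin_uminusI: "lin h \<Longrightarrow> lin (\<lambda>x. - h x)"
  by (auto intro!: linI simp: lin_add lin_smul smul_simps mult.commute)

lemma lin_comp: "lin g \<Longrightarrow> lin h \<Longrightarrow> lin (\<lambda>x. g (h x))"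
  by (simp add: lin_def)

lemma lin_sumI: "(\<And>i. i \<in> I \<Longrightarrow> lin (h i)) \<Longrightarrow> lin (\<lambda>x. \<Sum>i\<in>I. h i x)"
  by (induction I rule: infinite_finite_induct) (auto intro: lin_zero lin_addI)

lemma bas_expand: "f = (\<Sum>x\<in>keys f. lookup f x \<bullet> bas x)"
proof (rule poly_mapping_eqI)
  fix z
  have "lookup (\<Sum>x\<in>keys f. lookup f x \<bullet> bas x) z = (\<Sum>x\<in>keys f. if x = z then lookup f x else 0)"
    by (simp add: lookup_sum lookup_single when_def if_distrib cong: if_cong)
  also have "\<dots> = lookup f z" by (auto simp: sum.delta in_keys_iff)
  finally show "lookup f z = lookup (\<Sum>x\<in>keys f. lookup f x \<bullet> bas x) z" by simp
qed

lemma lin_expand: "lin h \<Longrightarrow> h f = (\<Sum>x\<in>keys f. lookup f x \<bullet> h (bas x))"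
  by (subst bas_expand) (simp add: lin_sum lin_smul)

text \<open>Agreement is asked only on the basis vectors that occur in \<open>f\<close>. Inductions
  on the degree need this localized form, because there two maps are known to agree only below a
  given degree.\<close>

lemma lin_eq_keys:
  assumes "lin g" "lin h" "\<And>x. x \<in> keys f \<Longrightarrow> g (bas x) = h (bas x)" shows "g f = h f"
  by (simp add: lin_expand[OF assms(1), of f] lin_expand[OF assms(2), of f] assms(3) cong: sum.cong)

lemma lin_eqI: "lin g \<Longrightarrow> lin h \<Longrightarrow> (\<And>x. g (bas x) = h (bas x)) \<Longrightarrow> g f = h f"
  by (rule lin_eq_keys)

lemma lin_keys:
  assumes "lin h" "\<And>x. x \<in> keys f \<Longrightarrow> keys (h (bas x)) \<subseteq> Y" shows "keys (h f) \<subseteq> Y"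
  by (subst lin_expand[OF assms(1)]) (intro keys_sumI keys_smulI assms(2))

definition lext :: "('x \<Rightarrow> ('y \<Rightarrow>\<^sub>0 'k::field)) \<Rightarrow> ('x \<Rightarrow>\<^sub>0 'k) \<Rightarrow> ('y \<Rightarrow>\<^sub>0 'k)" where
  "lext g f = (\<Sum>x\<in>keys f. lookup f x \<bullet> g x)"

lemma lext_sup: "finite Y \<Longrightarrow> keys f \<subseteq> Y \<Longrightarrow> lext g f = (\<Sum>x\<in>Y. lookup f x \<bullet> g x)"
  unfolding lext_def by (rule sum.mono_neutral_left) (auto simp: in_keys_iff)

lemma lin_lext: "lin (lext g)"
proof (rule linI)
  fix x y :: "'a \<Rightarrow>\<^sub>0 'b"
  have 1: "keys (x + y) \<subseteq> keys x \<union> keys y" by (rule Poly_Mapping.keys_add)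
  show "lext g (x + y) = lext g x + lext g y"
    by (simp add: lext_sup[of "keys x \<union> keys y"] 1 lookup_add smul_simps sum.distrib)
next
  fix c and x :: "'a \<Rightarrow>\<^sub>0 'b"
  show "lext g (c \<bullet> x) = c \<bullet> lext g x"
    by (simp add: lext_sup[of "keys x"] keys_smul lin_sum[OF lin_smulI[OF lin_id]] smul_simps)
qed

lemma lext_bas [simp]: "lext g (bas x) = g x"
  by (simp add: lext_def)

text \<open>The coordinate projection with image the span of \<open>Y\<close>. It serves as
  projection onto homogeneous components, as reduction modulo the Stanley-Reisner ideal (for
  \<open>Y = faces K\<close>), and as the identity map of an algebra whose basis is not the whole
  index type.\<close>

definition restr :: "'x set \<Rightarrow> ('x \<Rightarrow>\<^sub>0 'k::field) \<Rightarrow> ('x \<Rightarrow>\<^sub>0 'k)" where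
  "restr Y = lext (\<lambda>x. if x \<in> Y then bas x else 0)"

lemma lin_restr: "lin (restr Y)"
  by (simp add: restr_def lin_lext)

lemma restr_bas [simp]: "restr Y (bas x) = (if x \<in> Y then bas x else 0)"
  by (simp add: restr_def)

lemma lookup_restr [simp]: "lookup (restr Y f) x = (if x \<in> Y then lookup f x else 0)"
proof -
  have "lookup (restr Y f) x = (\<Sum>z\<in>keys f. if z = x then (if x \<in> Y then lookup f z else 0) else 0)"
    unfolding restr_def lext_def lookup_sum by (rule sum.cong) (auto simp: lookup_single when_def)
  then show ?thesis by (auto simp: sum.delta in_keys_iff)
qed

lemma keys_restr: "keys (restr Y f) = keys f \<inter> Y"
  by (auto simp: in_keys_iff split: if_splits)

lemma restr_id: "keys f \<subseteq> Y \<Longrightarrow> restr Y f = f"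
  by (rule poly_mapping_eqI) (auto simp: in_keys_iff)

lemma restr_0: "keys f \<inter> Y = {} \<Longrightarrow> restr Y f = 0"
  by (rule poly_mapping_eqI) (auto simp: in_keys_iff)

definition bilin :: "(('x \<Rightarrow>\<^sub>0 'k::field) \<Rightarrow> ('y \<Rightarrow>\<^sub>0 'k) \<Rightarrow> ('z \<Rightarrow>\<^sub>0 'k)) \<Rightarrow> bool" where
  "bilin m \<longleftrightarrow> (\<forall>y. lin (\<lambda>x. m x y)) \<and> (\<forall>x. lin (m x))"

lemma bilin_left: "bilin m \<Longrightarrow> lin (\<lambda>x. m x y)" and bilin_right: "bilin m \<Longrightarrow> lin (m x)"
  by (auto simp: bilin_def)

lemma bilin_keys:
  assumes "bilin m" "\<And>x y. x \<in> keys f \<Longrightarrow> y \<in> keys g \<Longrightarrow> keys (m (bas x) (bas y)) \<subseteq> Y"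
  shows "keys (m f g) \<subseteq> Y"
  by (rule lin_keys[OF bilin_left[OF assms(1)]]) (rule lin_keys[OF bilin_right[OF assms(1)] assms(2)])

lemma bilin_eq_keys:
  assumes "bilin m" "bilin m'"
    "\<And>x y. x \<in> keys f \<Longrightarrow> y \<in> keys g \<Longrightarrow> m (bas x) (bas y) = m' (bas x) (bas y)"
  shows "m f g = m' f g"
  by (rule lin_eq_keys[OF bilin_left[OF assms(1)] bilin_left[OF assms(2)]])
    (rule lin_eq_keys[OF bilin_right[OF assms(1)] bilin_right[OF assms(2)] assms(3)])

definition bext :: "('x \<Rightarrow> 'y \<Rightarrow> ('z \<Rightarrow>\<^sub>0 'k::field)) \<Rightarrow> ('x \<Rightarrow>\<^sub>0 'k) \<Rightarrow> ('y \<Rightarrow>\<^sub>0 'k) \<Rightarrow> ('z \<Rightarrow>\<^sub>0 'k)" where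
  "bext m f g = lext (\<lambda>x. lext (m x) g) f"

lemma bilin_bext: "bilin (bext m)"
proof -
  have "lin (bext m f)" for f
    unfolding bext_def lext_def[of _ f] by (intro lin_sumI lin_smulI lin_lext)
  moreover have "lin (\<lambda>f. bext m f g)" for g
    unfolding bext_def by (rule lin_lext)
  ultimately show ?thesis by (simp add: bilin_def)
qed

lemma bext_bas [simp]: "bext m (bas x) (bas y) = m x y"
  by (simp add: bext_def)


section \<open>Graded-commutative differential algebras with a homogeneous basis\<close>

lemma koszul_sign_mult: "koszul_sign i * koszul_sign j = (koszul_sign (i + j) :: 'k::field)"
  by (auto simp: koszul_sign_def)

lemma koszul_sign_0 [simp]: "koszul_sign 0 = 1"
  by (simp add: koszul_sign_def)

text \<open>Vectors on the whole index type are allowed, while the algebra that is meant is spanned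
  by \<open>bidx\<close>. In this way all operations are total and linear, no carrier conditions
  arise, and a homogeneous component is just a set of indices.\<close>

record (overloaded) ('x, 'k, 'w) balg =
  bidx :: "'x set"
  bmul :: "('x \<Rightarrow>\<^sub>0 'k) \<Rightarrow> ('x \<Rightarrow>\<^sub>0 'k) \<Rightarrow> ('x \<Rightarrow>\<^sub>0 'k)"
  bone :: "'x \<Rightarrow>\<^sub>0 'k"
  bdif :: "('x \<Rightarrow>\<^sub>0 'k) \<Rightarrow> ('x \<Rightarrow>\<^sub>0 'k)"
  bdeg :: "'x \<Rightarrow> int"
  bwt :: "'x \<Rightarrow> 'w"

text \<open>The grading involution. It absorbs the sign of the Leibniz rule, which can then be
  stated for inhomogeneous elements.\<close>

definition sg :: "('x, 'k::field, 'w) balg \<Rightarrow> ('x \<Rightarrow>\<^sub>0 'k) \<Rightarrow> ('x \<Rightarrow>\<^sub>0 'k)" where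
  "sg A = lext (\<lambda>x. koszul_sign (bdeg A x) \<bullet> bas x)"

definition hidx :: "('x, 'k::field, 'w) balg \<Rightarrow> int \<Rightarrow> 'w \<Rightarrow> 'x set" where
  "hidx A n w = {x \<in> bidx A. bdeg A x = n \<and> bwt A x = w}"

lemma lin_sg: "lin (sg A)" by (simp add: sg_def lin_lext)
lemma sg_bas [simp]: "sg A (bas x) = koszul_sign (bdeg A x) \<bullet> bas x" by (simp add: sg_def)

lemma sg_sg [simp]: "sg A (sg A x) = x"
  by (rule lin_eqI[OF lin_comp[OF lin_sg lin_sg] lin_id])
    (simp add: lin_smul[OF lin_sg] smul_simps koszul_sign_def)

lemma keys_sg: "keys (sg A f) \<subseteq> keys f"
  by (rule lin_keys[OF lin_sg]) (auto intro!: keys_smulI)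

text \<open>
  The products and differentials of basis elements outside \<open>bidx A\<close> are zero, so that all laws
  except for the unit laws hold unconditionally.
\<close>

locale balg = fixes A :: "('x, 'k::field_char_0, 'w::ab_group_add) balg"
  assumes bilin: "bilin (bmul A)"
    and assoc: "bmul A (bmul A x y) z = bmul A x (bmul A y z)"
    and comm: "bmul A (bas i) (bas j) = koszul_sign (bdeg A i * bdeg A j) \<bullet> bmul A (bas j) (bas i)"
    and mul_off: "i \<notin> bidx A \<Longrightarrow> bmul A (bas i) x = 0"
    and mul_keys: "keys (bmul A (bas i) (bas j)) \<subseteq> hidx A (bdeg A i + bdeg A j) (bwt A i + bwt A j)"
    and one_keys: "keys (bone A) \<subseteq> hidx A 0 0"
    and one_mul_bas: "i \<in> bidx A \<Longrightarrow> bmul A (bone A) (bas i) = bas i"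
    and lin_dif: "lin (bdif A)"
    and dif_off: "i \<notin> bidx A \<Longrightarrow> bdif A (bas i) = 0"
    and dif_keys: "keys (bdif A (bas i)) \<subseteq> hidx A (bdeg A i - 1) (bwt A i)"
    and dif_dif: "bdif A (bdif A x) = 0"
    and leibniz: "bdif A (bmul A x y) = bmul A (bdif A x) y + bmul A (sg A x) (bdif A y)"
begin

lemma lin_mul_left: "lin (\<lambda>x. bmul A x y)" and lin_mul_right: "lin (bmul A x)"
  using bilin by (auto simp: bilin_def)

lemmas mul_simps = lin_simps[OF lin_mul_left] lin_simps[OF lin_mul_right]
lemmas dif_simps = lin_simps[OF lin_dif]

lemma mul_off': "j \<notin> bidx A \<Longrightarrow> bmul A x (bas j) = 0"
  by (rule lin_eqI[OF lin_mul_left lin_zero]) (simp add: comm[of _ j] mul_off)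

lemma sg_mul: "sg A (bmul A x y) = bmul A (sg A x) (sg A y)"
proof (rule bilin_eq_keys[where m = "\<lambda>x y. sg A (bmul A x y)" and m' = "\<lambda>x y. bmul A (sg A x) (sg A y)"])
  show "bilin (\<lambda>x y. sg A (bmul A x y))"
    by (auto simp: bilin_def intro!: lin_comp[OF lin_sg] lin_mul_left lin_mul_right)
  show "bilin (\<lambda>x y. bmul A (sg A x) (sg A y))"
    by (auto simp: bilin_def intro!: lin_comp[OF _ lin_sg] lin_mul_right
        lin_comp[of "\<lambda>z. bmul A z _" "sg A"] lin_mul_left lin_sg)
  fix i j
  have "sg A (bmul A (bas i) (bas j)) = koszul_sign (bdeg A i + bdeg A j) \<bullet> bmul A (bas i) (bas j)"
    by (rule lin_eq_keys[OF lin_sg lin_smulI[OF lin_id]])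
      (use mul_keys[of i j] in \<open>auto simp: hidx_def\<close>)
  then show "sg A (bmul A (bas i) (bas j)) = bmul A (sg A (bas i)) (sg A (bas j))"
    by (simp add: mul_simps smul_simps koszul_sign_mult add.commute)
qed

lemma sg_dif: "sg A (bdif A x) = - bdif A (sg A x)"
proof (rule lin_eqI[OF lin_comp[OF lin_sg lin_dif] lin_uminusI[OF lin_comp[OF lin_dif lin_sg]]])
  fix i
  have "sg A (bdif A (bas i)) = koszul_sign (bdeg A i - 1) \<bullet> bdif A (bas i)"
    by (rule lin_eq_keys[OF lin_sg lin_smulI[OF lin_id]])
      (use dif_keys[of i] in \<open>auto simp: hidx_def\<close>)
  also have "koszul_sign (bdeg A i - 1) = (- koszul_sign (bdeg A i) :: 'k)"
    by (simp add: koszul_sign_def)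
  also have "(- koszul_sign (bdeg A i) :: 'k) \<bullet> bdif A (bas i) = - (koszul_sign (bdeg A i) \<bullet> bdif A (bas i))"
    by (rule poly_mapping_eqI) simp
  finally show "sg A (bdif A (bas i)) = - bdif A (sg A (bas i))"
    by (simp add: dif_simps)
qed

lemma hidx_sub: "hidx A n w \<subseteq> bidx A" by (auto simp: hidx_def)

lemma dif_sub: "keys (bdif A f) \<subseteq> bidx A"
  by (rule lin_keys[OF lin_dif]) (use dif_keys hidx_sub in blast)

lemma dif_hom: "keys f \<subseteq> hidx A n w \<Longrightarrow> keys (bdif A f) \<subseteq> hidx A (n - 1) w"
  by (rule lin_keys[OF lin_dif]) (use dif_keys in \<open>fastforce simp: hidx_def\<close>)

lemma mul_hom: "keys f \<subseteq> hidx A n w \<Longrightarrow> keys g \<subseteq> hidx A m u \<Longrightarrow> keys (bmul A f g) \<subseteq> hidx A (n + m) (w + u)"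
  by (rule bilin_keys[OF bilin]) (use mul_keys in \<open>fastforce simp: hidx_def\<close>)

lemma mul_sub: "keys (bmul A f g) \<subseteq> bidx A"
  by (rule bilin_keys[OF bilin]) (use mul_keys hidx_sub in blast)

lemma comm_hom:
  assumes "keys f \<subseteq> {x. bdeg A x = n}" "keys g \<subseteq> {x. bdeg A x = m}"
  shows "bmul A f g = koszul_sign (n * m) \<bullet> bmul A g f"
proof (rule bilin_eq_keys[OF bilin, of "\<lambda>f g. koszul_sign (n * m) \<bullet> bmul A g f"])
  show "bilin (\<lambda>f g. koszul_sign (n * m) \<bullet> bmul A g f)"
    by (simp add: bilin_def lin_smulI lin_mul_left lin_mul_right)
  fix x y assume "x \<in> keys f" "y \<in> keys g"
  then show "bmul A (bas x) (bas y) = koszul_sign (n * m) \<bullet> bmul A (bas y) (bas x)"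
    using assms comm[of x y] by auto
qed

lemma one_mul: "keys f \<subseteq> bidx A \<Longrightarrow> bmul A (bone A) f = f"
  by (rule lin_eq_keys[OF lin_mul_right lin_id]) (auto intro: one_mul_bas)

lemma mul_one: "keys f \<subseteq> bidx A \<Longrightarrow> bmul A f (bone A) = f"
proof (rule lin_eq_keys[OF lin_mul_left lin_id])
  fix x assume "keys f \<subseteq> bidx A" "x \<in> keys f"
  then show "bmul A (bas x) (bone A) = bas x"
    using comm_hom[of "bas x" "bdeg A x" "bone A" 0] one_keys one_mul_bas[of x]
    by (auto simp: hidx_def subset_iff)
qed

lemma sg_one: "sg A (bone A) = bone A"
  by (rule lin_eq_keys[OF lin_sg lin_id]) (use one_keys in \<open>auto simp: hidx_def\<close>)

lemma dif_one: "bdif A (bone A) = 0"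
proof -
  have o: "keys (bone A) \<subseteq> bidx A" using one_keys hidx_sub by blast
  have "bdif A (bone A) = bdif A (bone A) + bdif A (bone A)"
    using leibniz[of "bone A" "bone A"] by (simp add: sg_one one_mul mul_one dif_sub o)
  then show ?thesis by simp
qed

text \<open>The differential has bidegree \<open>(-1, 0)\<close>, so it respects bihomogeneous
  components. The purpose is that a preimage under the differential may be replaced with one of its
  components.\<close>

lemma dif_restr: "bdif A (restr (hidx A n w) f) = restr (hidx A (n - 1) w) (bdif A f)"
proof (rule lin_eqI[OF lin_comp[OF lin_dif lin_restr] lin_comp[OF lin_restr lin_dif]])
  fix x
  show "bdif A (restr (hidx A n w) (bas x)) = restr (hidx A (n - 1) w) (bdif A (bas x))"
  proof (cases "x \<in> hidx A n w")
    case True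
    then have "keys (bdif A (bas x)) \<subseteq> hidx A (n - 1) w" using dif_keys[of x] by (auto simp: hidx_def)
    then show ?thesis using True by (simp add: restr_id)
  next
    case False
    then have "restr (hidx A (n - 1) w) (bdif A (bas x)) = 0"
      using dif_keys[of x] dif_off[of x]
      by (cases "x \<in> bidx A") (auto intro!: restr_0 simp: hidx_def)
    then show ?thesis using False by (simp add: lin_0[OF lin_dif])
  qed
qed

end

text \<open>By the last clause a homomorphism is zero on indices outside the algebra. It is then
  determined by its values on the algebra, and its laws hold for all vectors.\<close>

definition ghom :: "('x, 'k::field_char_0, 'w::ab_group_add) balg \<Rightarrow> ('y, 'k, 'w) balg \<Rightarrow>
    (('x \<Rightarrow>\<^sub>0 'k) \<Rightarrow> ('y \<Rightarrow>\<^sub>0 'k)) \<Rightarrow> bool" where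
  "ghom A B h \<longleftrightarrow> lin h \<and> (\<forall>x y. h (bmul A x y) = bmul B (h x) (h y)) \<and> h (bone A) = bone B \<and>
     (\<forall>i. keys (h (bas i)) \<subseteq> hidx B (bdeg A i) (bwt A i)) \<and> (\<forall>i. i \<notin> bidx A \<longrightarrow> h (bas i) = 0)"

definition bhom :: "('x, 'k::field_char_0, 'w::ab_group_add) balg \<Rightarrow> ('y, 'k, 'w) balg \<Rightarrow>
    (('x \<Rightarrow>\<^sub>0 'k) \<Rightarrow> ('y \<Rightarrow>\<^sub>0 'k)) \<Rightarrow> bool" where
  "bhom A B h \<longleftrightarrow> ghom A B h \<and> (\<forall>x. h (bdif A x) = bdif B (h x))"

lemma ghomD: assumes "ghom A B h"
  shows ghom_lin: "lin h" and ghom_mul: "h (bmul A x y) = bmul B (h x) (h y)"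
    and ghom_one: "h (bone A) = bone B" and ghom_keys: "keys (h (bas i)) \<subseteq> hidx B (bdeg A i) (bwt A i)"
    and ghom_off: "i \<notin> bidx A \<Longrightarrow> h (bas i) = 0"
  using assms by (auto simp: ghom_def)

lemma bhom_ghom: "bhom A B h \<Longrightarrow> ghom A B h" by (simp add: bhom_def)
lemma bhom_dif: "bhom A B h \<Longrightarrow> h (bdif A x) = bdif B (h x)" by (simp add: bhom_def)
lemma bhom_lin: "bhom A B h \<Longrightarrow> lin h" by (simp add: bhom_def ghom_def)

lemma ghom_hom: "ghom A B h \<Longrightarrow> keys f \<subseteq> hidx A n w \<Longrightarrow> keys (h f) \<subseteq> hidx B n w"
  by (rule lin_keys[OF ghom_lin], assumption) (frule ghom_keys, fastforce simp: hidx_def)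

lemma ghom_sg: assumes "ghom A B h" shows "h (sg A x) = sg B (h x)"
proof (rule lin_eqI[OF lin_comp[OF ghom_lin[OF assms] lin_sg] lin_comp[OF lin_sg ghom_lin[OF assms]]])
  fix i
  have "sg B (h (bas i)) = koszul_sign (bdeg A i) \<bullet> h (bas i)"
    by (rule lin_eq_keys[OF lin_sg lin_smulI[OF lin_id]])
      (use ghom_keys[OF assms, of i] in \<open>auto simp: hidx_def\<close>)
  then show "h (sg A (bas i)) = sg B (h (bas i))" by (simp add: lin_smul[OF ghom_lin[OF assms]])
qed

lemma ghom_comp: assumes "ghom A B h" "ghom B C g" shows "ghom A C (\<lambda>x. g (h x))"
  unfolding ghom_def
proof (intro conjI allI impI)
  show "lin (\<lambda>x. g (h x))" by (rule lin_comp[OF ghom_lin[OF assms(2)] ghom_lin[OF assms(1)]])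
  show "keys (g (h (bas i))) \<subseteq> hidx C (bdeg A i) (bwt A i)" for i
    by (rule ghom_hom[OF assms(2) ghom_keys[OF assms(1)]])
qed (simp_all add: ghom_mul[OF assms(1)] ghom_mul[OF assms(2)] ghom_one[OF assms(1)] ghom_one[OF assms(2)]
  ghom_off[OF assms(1)] lin_0[OF ghom_lin[OF assms(2)]])

lemma bhom_comp: "bhom A B h \<Longrightarrow> bhom B C g \<Longrightarrow> bhom A C (\<lambda>x. g (h x))"
  unfolding bhom_def by (auto intro: ghom_comp[of A B h C g])

section \<open>Free algebras and the lifting theorem\<close>

definition lprod :: "('x, 'k::field, 'w) balg \<Rightarrow> ('x \<Rightarrow>\<^sub>0 'k) list \<Rightarrow> ('x \<Rightarrow>\<^sub>0 'k)" where
  "lprod A xs = foldr (bmul A) xs (bone A)"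

lemma lprod_simps [simp]: "lprod A [] = bone A" "lprod A (x # xs) = bmul A x (lprod A xs)"
  by (simp_all add: lprod_def)

lemma neg_self_eq_0: "(x :: 'x \<Rightarrow>\<^sub>0 'k::field_char_0) = - x \<Longrightarrow> x = 0"
proof (rule poly_mapping_eqI)
  fix z assume "x = - x"
  then have "lookup x z = - lookup x z" by (metis lookup_uminus)
  then have "2 * lookup x z = 0" by (simp only: mult_2) (metis add.right_inverse)
  then show "lookup x z = lookup 0 z" by simp
qed

context balg
begin

lemma one_sub: "keys (bone A) \<subseteq> bidx A"
  using one_keys hidx_sub by blast

lemma lprod_sub: "keys (lprod A xs) \<subseteq> bidx A"
  by (cases xs) (simp_all add: mul_sub one_sub)

lemma lprod_append: "lprod A (xs @ ys) = bmul A (lprod A xs) (lprod A ys)"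
  by (induction xs) (simp_all add: one_mul lprod_sub assoc)

lemma lprod_hom:
  assumes "\<And>g. g \<in> set ws \<Longrightarrow> keys (r g) \<subseteq> hidx A (d g) (w g)"
  shows "keys (lprod A (map r ws)) \<subseteq> hidx A (\<Sum>g\<leftarrow>ws. d g) (\<Sum>g\<leftarrow>ws. w g)"
  using assms
proof (induction ws)
  case (Cons g ws)
  then show ?case using mul_hom[of "r g" "d g" "w g" "lprod A (map r ws)"] by simp
qed (simp add: one_keys)

lemma lprod_move:
  assumes "\<And>g. g \<in> insert x (set us) \<Longrightarrow> keys (r g) \<subseteq> {z. bdeg A z = d g}"
  shows "lprod A (map r (us @ x # vs)) =
    koszul_sign (d x * (\<Sum>g\<leftarrow>us. d g)) \<bullet> lprod A (map r (x # us @ vs))"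
  using assms
proof (induction us)
  case (Cons u us)
  let ?L = "lprod A (map r (us @ vs))"
  have IH: "lprod A (map r (us @ x # vs)) = koszul_sign (d x * (\<Sum>g\<leftarrow>us. d g)) \<bullet> bmul A (r x) ?L"
  proof -
    have "keys (r g) \<subseteq> {z. bdeg A z = d g}" if "g \<in> insert x (set us)" for g
      using Cons.prems[of g] that by auto
    from Cons.IH[OF this] show ?thesis by simp
  qed
  have "bmul A (r u) (bmul A (r x) ?L) = koszul_sign (d u * d x) \<bullet> bmul A (r x) (bmul A (r u) ?L)"
    using comm_hom[of "r u" "d u" "r x" "d x"] Cons.prems
    by (simp add: assoc[symmetric] mul_simps)
  then show ?case
    using IH by (simp add: mul_simps smul_simps koszul_sign_mult algebra_simps)
qed simp

text \<open>Graded commutativity gives \<open>f f = - f f\<close>, and 2 is invertible.\<close>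

lemma odd_square:
  assumes "keys f \<subseteq> {z. bdeg A z = n}" "odd n" shows "bmul A f f = 0"
  using comm_hom[OF assms(1) assms(1)] assms(2)
  by (intro neg_self_eq_0) (simp add: koszul_sign_def)

end

text \<open>The sign of a rearrangement depends only on the degrees of the factors, so one scalar
  serves two algebras at once. Thanks to this a homomorphism can be prescribed on words although
  words are determined only up to the order of their letters.\<close>

lemma lprod_perm:
  assumes A: "balg A" and B: "balg B" and "mset xs = mset ys"
    and "\<And>g. g \<in> set xs \<Longrightarrow> keys (r g) \<subseteq> {z. bdeg A z = d g}"
    and "\<And>g. g \<in> set xs \<Longrightarrow> keys (s g) \<subseteq> {z. bdeg B z = d g}"
  shows "\<exists>c. lprod A (map r xs) = c \<bullet> lprod A (map r ys) \<and> lprod B (map s xs) = c \<bullet> lprod B (map s ys)"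
  using assms(3-5)
proof (induction ys arbitrary: xs)
  case Nil
  then show ?case by (intro exI[of _ 1]) simp
next
  case (Cons y ys)
  have "y \<in> set xs" using Cons.prems(1) by (metis list.set_intros(1) set_mset_mset)
  then obtain us vs where xs: "xs = us @ y # vs" by (meson split_list)
  have "mset (us @ vs) = mset ys" using Cons.prems(1) xs by simp
  then obtain c where c: "lprod A (map r (us @ vs)) = c \<bullet> lprod A (map r ys)"
    "lprod B (map s (us @ vs)) = c \<bullet> lprod B (map s ys)"
    using Cons.IH[of "us @ vs"] Cons.prems(2,3) xs by fastforce
  have "lprod A (map r xs) = (koszul_sign (d y * (\<Sum>g\<leftarrow>us. d g)) * c) \<bullet> lprod A (map r (y # ys))"
    unfolding xs by (subst balg.lprod_move[OF A, of _ _ _ d])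
      (use Cons.prems(2) xs c in \<open>auto simp: balg.mul_simps[OF A] smul_simps\<close>)
  moreover have "lprod B (map s xs) = (koszul_sign (d y * (\<Sum>g\<leftarrow>us. d g)) * c) \<bullet> lprod B (map s (y # ys))"
    unfolding xs by (subst balg.lprod_move[OF B, of _ _ _ d])
      (use Cons.prems(3) xs c in \<open>auto simp: balg.mul_simps[OF B] smul_simps\<close>)
  ultimately show ?case by blast
qed

lemma ghom_lprod: "ghom A B h \<Longrightarrow> h (lprod A xs) = lprod B (map h xs)"
  by (induction xs) (simp_all add: ghom_one ghom_mul)

text \<open>Independence of the monomials is built in, since distinct indices are distinct basis
  vectors. What has to be stated is that each index is the product of its word, and that every list
  without repeated odd generators is a rearrangement of some word. Degrees are required to be
  nonnegative here as well.\<close>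

definition bfree :: "('x, 'k::field_char_0, 'w::ab_group_add) balg \<Rightarrow> 'x set \<Rightarrow> ('x \<Rightarrow> 'x list) \<Rightarrow> bool" where
  "bfree A G word \<longleftrightarrow> G \<subseteq> bidx A \<and>
     (\<forall>x\<in>bidx A. 0 \<le> bdeg A x \<and> set (word x) \<subseteq> G \<and> bas x = lprod A (map bas (word x))) \<and>
     (\<forall>g\<in>G. word g = [g]) \<and>
     (\<forall>ws. set ws \<subseteq> G \<longrightarrow> (\<forall>g\<in>set ws. odd (bdeg A g) \<longrightarrow> count (mset ws) g \<le> 1) \<longrightarrow>
        (\<exists>x\<in>bidx A. mset (word x) = mset ws))"

definition hext :: "('x, 'k::field_char_0, 'w) balg \<Rightarrow> ('y, 'k, 'w) balg \<Rightarrow> ('x \<Rightarrow> 'x list) \<Rightarrow>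
    ('x \<Rightarrow> ('y \<Rightarrow>\<^sub>0 'k)) \<Rightarrow> ('x \<Rightarrow>\<^sub>0 'k) \<Rightarrow> ('y \<Rightarrow>\<^sub>0 'k)" where
  "hext A B word r = lext (\<lambda>x. if x \<in> bidx A then lprod B (map r (word x)) else 0)"

locale free_balg = balg A for A :: "('x, 'k::field_char_0, 'w::ab_group_add) balg" +
  fixes G word
  assumes free: "bfree A G word"
begin

lemma gen_idx: "g \<in> G \<Longrightarrow> g \<in> bidx A"
  and deg_nonneg: "x \<in> bidx A \<Longrightarrow> 0 \<le> bdeg A x"
  and word_sub: "x \<in> bidx A \<Longrightarrow> set (word x) \<subseteq> G"
  and bas_word: "x \<in> bidx A \<Longrightarrow> bas x = lprod A (map bas (word x))"
  and word_gen: "g \<in> G \<Longrightarrow> word g = [g]"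
  using free by (auto simp: bfree_def)

lemma word_ex: "set ws \<subseteq> G \<Longrightarrow> (\<And>g. g \<in> set ws \<Longrightarrow> odd (bdeg A g) \<Longrightarrow> count (mset ws) g \<le> 1) \<Longrightarrow>
    \<exists>x\<in>bidx A. mset (word x) = mset ws"
  using free by (auto simp: bfree_def)

lemma word_deg:
  assumes "x \<in> bidx A"
  shows "bdeg A x = (\<Sum>g\<leftarrow>word x. bdeg A g)" "bwt A x = (\<Sum>g\<leftarrow>word x. bwt A g)"
proof -
  have "keys (lprod A (map bas (word x))) \<subseteq> hidx A (\<Sum>g\<leftarrow>word x. bdeg A g) (\<Sum>g\<leftarrow>word x. bwt A g)"
    by (rule lprod_hom) (use word_sub[OF assms] gen_idx in \<open>auto simp: hidx_def\<close>)
  then have "x \<in> hidx A (\<Sum>g\<leftarrow>word x. bdeg A g) (\<Sum>g\<leftarrow>word x. bwt A g)"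
    by (simp add: bas_word[OF assms, symmetric])
  then show "bdeg A x = (\<Sum>g\<leftarrow>word x. bdeg A g)" "bwt A x = (\<Sum>g\<leftarrow>word x. bwt A g)"
    by (auto simp: hidx_def)
qed

lemma word_deg_le:
  assumes "x \<in> bidx A" "g \<in> set (word x)" shows "bdeg A g \<le> bdeg A x"
proof -
  obtain us vs where w: "word x = us @ g # vs" using assms(2) by (meson split_list)
  have "0 \<le> bdeg A g'" if "g' \<in> set (word x)" for g'
    using word_sub[OF assms(1)] gen_idx deg_nonneg that by blast
  then have "0 \<le> (\<Sum>g\<leftarrow>us. bdeg A g)" "0 \<le> (\<Sum>g\<leftarrow>vs. bdeg A g)"
    unfolding w by (auto intro!: sum_list_nonneg)
  then show ?thesis unfolding word_deg(1)[OF assms(1)] w by simp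
qed

lemma hext_bas: "x \<in> bidx A \<Longrightarrow> hext A B word r (bas x) = lprod B (map r (word x))"
  by (simp add: hext_def)

text \<open>A list without repeated odd generators is rearranged into the word of an index, with the
  same scalar on both sides. Otherwise a repeated odd generator is moved to the front, and its
  square makes both sides vanish.\<close>

lemma hext_lprod:
  assumes B: "balg B" and r: "\<And>g. g \<in> G \<Longrightarrow> keys (r g) \<subseteq> hidx B (bdeg A g) (bwt A g)"
    and ws: "set ws \<subseteq> G"
  shows "hext A B word r (lprod A (map bas ws)) = lprod B (map r ws)"
proof -
  have rA: "\<And>g. g \<in> set ws \<Longrightarrow> keys (bas g :: _ \<Rightarrow>\<^sub>0 'k) \<subseteq> {z. bdeg A z = bdeg A g}" by simp
  have rB: "\<And>g. g \<in> set ws \<Longrightarrow> keys (r g) \<subseteq> {z. bdeg B z = bdeg A g}"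
    using r ws by (fastforce simp: hidx_def)
  show ?thesis
  proof (cases "\<forall>g\<in>set ws. odd (bdeg A g) \<longrightarrow> count (mset ws) g \<le> 1")
    case True
    then obtain x where x: "x \<in> bidx A" "mset (word x) = mset ws" using word_ex ws by blast
    have "mset ws = mset (word x)" using x(2) by simp
    from lprod_perm[where r = bas and s = r and d = "bdeg A", OF balg_axioms B this rA rB]
    obtain c where "lprod A (map bas ws) = c \<bullet> lprod A (map bas (word x))"
      "lprod B (map r ws) = c \<bullet> lprod B (map r (word x))" by blast
    then show ?thesis using x(1)
      by (simp add: bas_word[OF x(1), symmetric] hext_bas lin_smul[OF lin_lext, folded hext_def] hext_def)
  next
    case False
    then obtain g where g: "g \<in> set ws" "odd (bdeg A g)" "count (mset ws) g \<ge> 2" by force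
    obtain us where us: "mset ws = mset (g # us)" using g(1)
      by (metis mset.simps(2) mset_remove1 insert_DiffM set_mset_mset)
    then have "count (mset us) g \<ge> 1" using g(3) by simp
    then have "g \<in># mset us" by (metis count_greater_eq_one_iff)
    then obtain vs where "mset us = mset (g # vs)"
      by (metis mset.simps(2) mset_remove1 insert_DiffM)
    then have "mset ws = mset (g # g # vs)" using us by simp
    from lprod_perm[where r = bas and s = r and d = "bdeg A", OF balg_axioms B this rA rB]
    obtain c where "lprod A (map bas ws) = c \<bullet> lprod A (map bas (g # g # vs))"
      "lprod B (map r ws) = c \<bullet> lprod B (map r (g # g # vs))" by blast
    moreover have "lprod A (map bas (g # g # vs)) = 0"
      using odd_square[of "bas g", OF _ g(2)] by (simp add: assoc[symmetric] mul_simps)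
    moreover have "lprod B (map r (g # g # vs)) = 0"
      using balg.odd_square[OF B rB[OF g(1)] g(2)]
      by (simp add: balg.assoc[OF B, symmetric] balg.mul_simps[OF B])
    ultimately show ?thesis by (simp add: hext_def lin_0[OF lin_lext])
  qed
qed

text \<open>The universal property of a free algebra. A product of basis vectors is the product of
  the concatenated words, so multiplicativity reduces to \<open>hext_lprod\<close>.\<close>

lemma ghom_hext:
  assumes B: "balg B" and r: "\<And>g. g \<in> G \<Longrightarrow> keys (r g) \<subseteq> hidx B (bdeg A g) (bwt A g)"
  shows "ghom A B (hext A B word r)" and "g \<in> G \<Longrightarrow> hext A B word r (bas g) = r g"
proof -
  let ?h = "hext A B word r"
  have l: "lin ?h" by (simp add: hext_def lin_lext)
  show "ghom A B ?h" unfolding ghom_def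
  proof (intro conjI allI impI)
    show "lin ?h" by (rule l)
    fix x y
    show "?h (bmul A x y) = bmul B (?h x) (?h y)"
    proof (rule bilin_eq_keys[where m = "\<lambda>x y. ?h (bmul A x y)" and m' = "\<lambda>x y. bmul B (?h x) (?h y)"])
      show "bilin (\<lambda>x y. ?h (bmul A x y))" unfolding bilin_def
        by (intro conjI allI lin_comp[OF l] lin_mul_left lin_mul_right)
      show "bilin (\<lambda>x y. bmul B (?h x) (?h y))" unfolding bilin_def
        by (intro conjI allI lin_comp[OF _ l] lin_comp[OF balg.lin_mul_left[OF B] l]
            balg.lin_mul_right[OF B])
      fix i j
      show "?h (bmul A (bas i) (bas j)) = bmul B (?h (bas i)) (?h (bas j))"
      proof (cases "i \<in> bidx A \<and> j \<in> bidx A")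
        case True
        have "bmul A (bas i) (bas j) = lprod A (map bas (word i @ word j))"
          using True by (simp add: lprod_append bas_word[symmetric])
        then have "?h (bmul A (bas i) (bas j)) = lprod B (map r (word i @ word j))"
          using True word_sub by (simp only: hext_lprod[OF B r] set_append Un_least)
        then show ?thesis using True by (simp add: hext_bas balg.lprod_append[OF B])
      next
        case False
        then show ?thesis
          by (auto simp: mul_off mul_off' hext_def lin_0[OF lin_lext] balg.mul_simps[OF B])
      qed
    qed
  next
    show "?h (bone A) = bone B" using hext_lprod[OF B r, of "[]"] by simp
  next
    fix i
    show "keys (?h (bas i)) \<subseteq> hidx B (bdeg A i) (bwt A i)"
    proof (cases "i \<in> bidx A")
      case True
      show ?thesis unfolding hext_bas[OF True] word_deg(1)[OF True] word_deg(2)[OF True]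
        by (rule balg.lprod_hom[OF B]) (use r word_sub[OF True] in auto)
    qed (simp add: hext_def)
  qed (simp add: hext_def)
  show "?h (bas g) = r g" if "g \<in> G"
    using that r[OF that] balg.hidx_sub[of B]
    by (simp add: hext_bas gen_idx word_gen balg.mul_one[OF B] subset_trans[OF r[OF that] balg.hidx_sub[OF B]])
qed

lemma ghom_eq_bas:
  assumes "ghom A B h" "ghom A B h'" "x \<in> bidx A" "\<And>g. g \<in> set (word x) \<Longrightarrow> h (bas g) = h' (bas g)"
  shows "h (bas x) = h' (bas x)"
  unfolding bas_word[OF assms(3)] ghom_lprod[OF assms(1)] ghom_lprod[OF assms(2)]
  by (simp add: assms(4) cong: map_cong)

text \<open>Both composites obey the same twisted Leibniz rule, so agreement on the letters of a
  word propagates to their product.\<close>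

lemma ghom_chain_bas:
  assumes B: "balg B" and h: "ghom A B h" and x: "x \<in> bidx A"
    and c: "\<And>g. g \<in> set (word x) \<Longrightarrow> h (bdif A (bas g)) = bdif B (h (bas g))"
  shows "h (bdif A (bas x)) = bdif B (h (bas x))"
proof -
  have "h (bdif A (lprod A (map bas ws))) = bdif B (h (lprod A (map bas ws)))"
    if "set ws \<subseteq> set (word x)" for ws
    using that
  proof (induction ws)
    case Nil
    show ?case by (simp add: dif_one lin_0[OF ghom_lin[OF h]] ghom_one[OF h] balg.dif_one[OF B])
  next
    case (Cons g ws)
    then show ?case using c[of g]
      by (simp add: leibniz balg.leibniz[OF B] lin_add[OF ghom_lin[OF h]] ghom_mul[OF h]
          ghom_sg[OF h, symmetric] del: sg_bas)
  qed
  from this[of "word x"] show ?thesis by (simp add: bas_word[OF x, symmetric])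
qed

text \<open>Values on the generators are chosen by recursion on the degree. The step is handed a
  homomorphism that is a chain map below the degree of \<open>g\<close> and has to supply one value
  with the correct boundary. \<open>Good\<close> carries along any further condition on the values,
  such as compatibility with augmentations or prescribed ends of a homotopy.\<close>

theorem lifting:
  fixes B :: "('y, 'k, 'w) balg"
  assumes B: "balg B"
    and step: "\<And>g h. g \<in> G \<Longrightarrow> ghom A B h \<Longrightarrow>
      (\<And>x. x \<in> bidx A \<Longrightarrow> bdeg A x < bdeg A g \<Longrightarrow> h (bdif A (bas x)) = bdif B (h (bas x))) \<Longrightarrow>
      (\<And>g'. g' \<in> G \<Longrightarrow> bdeg A g' < bdeg A g \<Longrightarrow> Good g' (h (bas g'))) \<Longrightarrow>
      \<exists>y. keys y \<subseteq> hidx B (bdeg A g) (bwt A g) \<and> bdif B y = h (bdif A (bas g)) \<and> Good g y"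
  shows "\<exists>h. bhom A B h \<and> (\<forall>g\<in>G. Good g (h (bas g)))"
proof -
  define R where "R = {(g', g). g' \<in> G \<and> g \<in> G \<and> bdeg A g' < bdeg A g}"
  \<comment> \<open>Replacing the values in degrees not below that of \<open>g\<close> by zero gives
    admissible values on all generators, so that \<open>hext\<close> is a homomorphism even in the
    middle of the recursion.\<close>
  define trunc where "trunc f g = (\<lambda>g'. if (g', g) \<in> R then f g' else (0 :: 'y \<Rightarrow>\<^sub>0 'k))" for f g
  define P where "P f g y \<longleftrightarrow> (g \<in> G \<longrightarrow> keys y \<subseteq> hidx B (bdeg A g) (bwt A g) \<and>
      bdif B y = hext A B word (trunc f g) (bdif A (bas g)) \<and> Good g y)" for f g y
  have "wf R"
    by (rule wf_subset[OF wf_measure[of "\<lambda>g. nat (bdeg A g)"]])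
      (use deg_nonneg gen_idx in \<open>force simp: R_def\<close>)
  \<comment> \<open>The boundary of \<open>g\<close> lies in a lower degree, so its words involve
    only generators on which \<open>trunc\<close> changes nothing.\<close>
  have agree: "hext A B word r (bdif A (bas g)) = hext A B word (trunc f g) (bdif A (bas g))"
    if "g \<in> G" "\<And>g'. (g', g) \<in> R \<Longrightarrow> r g' = f g'" for r f g
    unfolding hext_def
  proof (rule lin_eq_keys[OF lin_lext lin_lext], unfold lext_bas)
    fix x assume "x \<in> keys (bdif A (bas g))"
    then have x: "x \<in> bidx A" "bdeg A x < bdeg A g" using dif_keys[of g] by (auto simp: hidx_def)
    have "(g', g) \<in> R" if "g' \<in> set (word x)" for g'
      using word_sub[OF x(1)] word_deg_le[OF x(1) that] x(2) that \<open>g \<in> G\<close> by (auto simp: R_def)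
    then have "map r (word x) = map (trunc f g) (word x)" by (auto simp: trunc_def that(2))
    then show "(if x \<in> bidx A then lprod B (map r (word x)) else 0) =
      (if x \<in> bidx A then lprod B (map (trunc f g) (word x)) else 0)" by (simp only:)
  qed
  have "\<exists>f :: 'x \<Rightarrow> ('y \<Rightarrow>\<^sub>0 'k). \<forall>g. P f g (f g)"
  proof (rule dependent_wf_choice[OF \<open>wf R\<close>])
    fix f f' :: "'x \<Rightarrow> ('y \<Rightarrow>\<^sub>0 'k)" and g r assume "\<And>z. (z, g) \<in> R \<Longrightarrow> f z = f' z"
    then have "trunc f g = trunc f' g" by (auto simp: trunc_def)
    then show "P f g r = P f' g r" by (simp add: P_def)
  next
    fix g and f :: "'x \<Rightarrow> ('y \<Rightarrow>\<^sub>0 'k)" assume IH: "\<And>y. (y, g) \<in> R \<Longrightarrow> P f y (f y)"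
    show "\<exists>r. P f g r"
    proof (cases "g \<in> G")
      case g: True
      have r: "keys (trunc f g g') \<subseteq> hidx B (bdeg A g') (bwt A g')" if "g' \<in> G" for g'
        using IH[of g'] that by (auto simp: trunc_def P_def)
      let ?h = "hext A B word (trunc f g)"
      note gh = ghom_hext[OF B r]
      have val: "?h (bas g') = f g'" if "(g', g) \<in> R" for g'
        using gh(2)[of g'] that by (auto simp: trunc_def R_def)
      have "?h (bdif A (bas x)) = bdif B (?h (bas x))" if "x \<in> bidx A" "bdeg A x < bdeg A g" for x
      proof (rule ghom_chain_bas[OF B gh(1) that(1)])
        fix g' assume "g' \<in> set (word x)"
        then have g': "(g', g) \<in> R"
          using word_sub[OF that(1)] word_deg_le[OF that(1)] that(2) g by (force simp: R_def)
        then have "g' \<in> G" by (simp add: R_def)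
        have "?h (bdif A (bas g')) = hext A B word (trunc f g') (bdif A (bas g'))"
          by (rule agree[OF \<open>g' \<in> G\<close>]) (use g' in \<open>auto simp: trunc_def R_def\<close>)
        also have "\<dots> = bdif B (f g')" using IH[OF g'] \<open>g' \<in> G\<close> by (simp add: P_def)
        finally show "?h (bdif A (bas g')) = bdif B (?h (bas g'))" by (simp add: val[OF g'])
      qed
      moreover have "Good g' (?h (bas g'))" if "g' \<in> G" "bdeg A g' < bdeg A g" for g'
        using IH[of g'] val[of g'] that g by (auto simp: P_def R_def)
      ultimately show ?thesis using step[OF g gh(1)] by (simp add: P_def)
    qed (simp add: P_def)
  qed
  then obtain f where f: "\<And>g. P f g (f g)" by blast
  let ?h = "hext A B word f"
  have r: "keys (f g') \<subseteq> hidx B (bdeg A g') (bwt A g')" if "g' \<in> G" for g'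
    using f[of g'] that by (simp add: P_def)
  note gh = ghom_hext[OF B r]
  have "?h (bdif A (bas g)) = bdif B (?h (bas g))" if "g \<in> G" for g
    using agree[OF that, of f f] f[of g] that gh(2)[of g] by (simp add: P_def)
  then have ch: "?h (bdif A (bas x)) = bdif B (?h (bas x))" for x
    using ghom_chain_bas[OF B gh(1), of x] word_sub[of x]
    by (cases "x \<in> bidx A")
      (auto simp: dif_off ghom_off[OF gh(1)] lin_0[OF ghom_lin[OF gh(1)]] lin_0[OF balg.lin_dif[OF B]])
  have "?h (bdif A x) = bdif B (?h x)" for x
    by (rule lin_eqI[OF lin_comp[OF ghom_lin[OF gh(1)] lin_dif]
          lin_comp[OF balg.lin_dif[OF B] ghom_lin[OF gh(1)]]]) (assumption | rule ch)+
  then have "bhom A B ?h" using gh(1) by (simp add: bhom_def)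
  moreover have "Good g (?h (bas g))" if "g \<in> G" for g
    using f[of g] gh(2)[OF _ that] that by (simp add: P_def)
  ultimately show ?thesis by blast
qed

end

section \<open>Adjoining a polynomial and an odd variable\<close>

text \<open>
  The free extension of \<open>A\<close> by a variable \<open>t\<close> of degree \<open>0\<close> and a variable \<open>\<theta>\<close> of odd degree
  \<open>d\<close>; the index \<open>(k, \<alpha>)\<close> stands for \<open>t\<^sup>k\<theta>\<^sup>\<alpha>\<close>, and \<open>M0\<close> selects a subalgebra. It is used with
  \<open>\<theta> = d log t\<close>, which makes it a path object, and without \<open>t\<close>, which gives a Koszul extension.
  The injection \<open>pr\<close> codes the new basis; keeping it abstract allows iterated extensions to
  live on one and the same type.
\<close>

locale tens = balg A for A :: "('x, 'k::field_char_0, 'w::ab_group_add) balg" +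
  fixes d :: int and M0 :: "(nat \<times> bool) set"
    and pr :: "'x \<Rightarrow> nat \<times> bool \<Rightarrow> 'z" and p1 :: "'z \<Rightarrow> 'x" and p2 :: "'z \<Rightarrow> nat \<times> bool"
  assumes odd_d: "odd d" and M0_one: "(0, False) \<in> M0"
    and M0_closed: "(i, \<alpha>) \<in> M0 \<Longrightarrow> (j, \<beta>) \<in> M0 \<Longrightarrow> \<not> (\<alpha> \<and> \<beta>) \<Longrightarrow> (i + j, \<alpha> \<or> \<beta>) \<in> M0"
    and p1_pr: "x \<in> bidx A \<Longrightarrow> m \<in> M0 \<Longrightarrow> p1 (pr x m) = x"
    and p2_pr: "x \<in> bidx A \<Longrightarrow> m \<in> M0 \<Longrightarrow> p2 (pr x m) = m"
begin

definition tidx :: "'z set" where "tidx = {pr x m | x m. x \<in> bidx A \<and> m \<in> M0}"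

definition emb :: "nat \<times> bool \<Rightarrow> ('x \<Rightarrow>\<^sub>0 'k) \<Rightarrow> ('z \<Rightarrow>\<^sub>0 'k)" where
  "emb m = lext (\<lambda>x. if x \<in> bidx A then bas (pr x m) else 0)"

text \<open>One scheme for the differential, the evaluations and the integrals: each is given by its
  restrictions \<open>E m\<close> to the summands of the extension.\<close>

definition tlift :: "(nat \<times> bool \<Rightarrow> ('x \<Rightarrow>\<^sub>0 'k) \<Rightarrow> ('y \<Rightarrow>\<^sub>0 'k)) \<Rightarrow> ('z \<Rightarrow>\<^sub>0 'k) \<Rightarrow> ('y \<Rightarrow>\<^sub>0 'k)" where
  "tlift E = lext (\<lambda>z. if z \<in> tidx then E (p2 z) (bas (p1 z)) else 0)"

definition sgb :: "bool \<Rightarrow> ('x \<Rightarrow>\<^sub>0 'k) \<Rightarrow> ('x \<Rightarrow>\<^sub>0 'k)" where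
  "sgb \<alpha> f = (if \<alpha> then sg A f else f)"

text \<open>In \<open>f t^k \<theta>^\<alpha>\<close> the coefficient stands on the left. Moving an
  odd \<open>\<theta>\<close> past the second coefficient produces the sign in \<open>sgb\<close>,
  and the square of \<open>\<theta>\<close> is zero.\<close>

definition tmul :: "('z \<Rightarrow>\<^sub>0 'k) \<Rightarrow> ('z \<Rightarrow>\<^sub>0 'k) \<Rightarrow> ('z \<Rightarrow>\<^sub>0 'k)" where
  "tmul = bext (\<lambda>z z'. if z \<in> tidx \<and> z' \<in> tidx \<and> \<not> (snd (p2 z) \<and> snd (p2 z')) then
     emb (fst (p2 z) + fst (p2 z'), snd (p2 z) \<or> snd (p2 z'))
       (bmul A (bas (p1 z)) (sgb (snd (p2 z)) (bas (p1 z')))) else 0)"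

definition T :: "(nat \<times> bool \<Rightarrow> ('x \<Rightarrow>\<^sub>0 'k) \<Rightarrow> ('z \<Rightarrow>\<^sub>0 'k)) \<Rightarrow> ('z, 'k, 'w) balg" where
  "T E = \<lparr>bidx = tidx, bmul = tmul, bone = emb (0, False) (bone A), bdif = tlift E,
     bdeg = (\<lambda>z. bdeg A (p1 z) + (if snd (p2 z) then d else 0)), bwt = (\<lambda>z. bwt A (p1 z))\<rparr>"

lemma T_simps [simp]: "bidx (T E) = tidx" "bmul (T E) = tmul" "bone (T E) = emb (0, False) (bone A)"
  "bdif (T E) = tlift E" "bdeg (T E) z = bdeg A (p1 z) + (if snd (p2 z) then d else 0)"
  "bwt (T E) z = bwt A (p1 z)"
  by (simp_all add: T_def)

lemma tidxE: assumes "z \<in> tidx" obtains x m where "x \<in> bidx A" "m \<in> M0" "z = pr x m" "p1 z = x" "p2 z = m"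
  using assms p1_pr p2_pr by (auto simp: tidx_def)

lemma pr_tidx: "x \<in> bidx A \<Longrightarrow> m \<in> M0 \<Longrightarrow> pr x m \<in> tidx"
  unfolding tidx_def by blast

lemma lin_emb: "lin (emb m)" by (simp add: emb_def lin_lext)
lemma lin_tlift: "lin (tlift E)" by (simp add: tlift_def lin_lext)
lemma bilin_tmul: "bilin tmul" by (simp add: tmul_def bilin_bext)
lemma lin_sgb: "lin (sgb \<alpha>)" by (cases \<alpha>) (simp_all add: sgb_def[abs_def] lin_sg lin_id)
lemma emb_bas: "emb m (bas x) = (if x \<in> bidx A then bas (pr x m) else 0)" by (simp add: emb_def)
lemmas emb_simps = lin_simps[OF lin_emb]
lemmas tlift_simps = lin_simps[OF lin_tlift]
lemmas tmul_simps = lin_simps[OF bilin_left[OF bilin_tmul]] lin_simps[OF bilin_right[OF bilin_tmul]]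

lemma tmul_off: "z \<notin> tidx \<Longrightarrow> tmul (bas z) y = 0" "z \<notin> tidx \<Longrightarrow> tmul y (bas z) = 0"
  by (rule lin_eqI[OF bilin_right[OF bilin_tmul] lin_zero], simp add: tmul_def)
    (rule lin_eqI[OF bilin_left[OF bilin_tmul] lin_zero], simp add: tmul_def)

lemma tmul_bas: "tmul (bas z) (bas z') = (if z \<in> tidx \<and> z' \<in> tidx \<and> \<not> (snd (p2 z) \<and> snd (p2 z')) then
     emb (fst (p2 z) + fst (p2 z'), snd (p2 z) \<or> snd (p2 z'))
       (bmul A (bas (p1 z)) (sgb (snd (p2 z)) (bas (p1 z')))) else 0)"
  by (simp add: tmul_def)

lemma tlift_off: "z \<notin> tidx \<Longrightarrow> tlift E (bas z) = 0"
  by (simp add: tlift_def)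

lemma tens_eqI:
  assumes "lin h" "lin h'" "\<And>z. z \<notin> tidx \<Longrightarrow> h (bas z) = h' (bas z)"
    "\<And>m x. m \<in> M0 \<Longrightarrow> x \<in> bidx A \<Longrightarrow> h (emb m (bas x)) = h' (emb m (bas x))"
  shows "h y = h' y"
proof (rule lin_eqI[OF assms(1,2)])
  fix z show "h (bas z) = h' (bas z)"
  proof (cases "z \<in> tidx")
    case True
    then obtain x m where "x \<in> bidx A" "m \<in> M0" "z = pr x m" by (rule tidxE)
    then show ?thesis using assms(4)[of m x] by (simp add: emb_bas)
  qed (rule assms(3))
qed

lemma tlift_emb:
  assumes "m \<in> M0" "lin (E m)" "\<And>x. x \<notin> bidx A \<Longrightarrow> E m (bas x) = 0"
  shows "tlift E (emb m f) = E m f"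
  by (rule lin_eqI[OF lin_comp[OF lin_tlift lin_emb] assms(2)])
    (use assms in \<open>auto simp: emb_bas tlift_def lin_0[OF lin_lext] p1_pr p2_pr pr_tidx\<close>)

lemma tmul_emb:
  assumes "(i, \<alpha>) \<in> M0" "(j, \<beta>) \<in> M0"
  shows "tmul (emb (i, \<alpha>) f) (emb (j, \<beta>) g) =
    (if \<alpha> \<and> \<beta> then 0 else emb (i + j, \<alpha> \<or> \<beta>) (bmul A f (sgb \<alpha> g)))"
proof (rule bilin_eq_keys[where m = "\<lambda>f g. tmul (emb (i, \<alpha>) f) (emb (j, \<beta>) g)" and
      m' = "\<lambda>f g. if \<alpha> \<and> \<beta> then 0 else emb (i + j, \<alpha> \<or> \<beta>) (bmul A f (sgb \<alpha> g))"])
  show "bilin (\<lambda>f g. tmul (emb (i, \<alpha>) f) (emb (j, \<beta>) g))" unfolding bilin_def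
    by (intro conjI allI lin_comp[OF bilin_left[OF bilin_tmul] lin_emb] lin_comp[OF bilin_right[OF bilin_tmul] lin_emb])
  show "bilin (\<lambda>f g. if \<alpha> \<and> \<beta> then 0 else emb (i + j, \<alpha> \<or> \<beta>) (bmul A f (sgb \<alpha> g)))" unfolding bilin_def
    by (cases "\<alpha> \<and> \<beta>") (auto intro!: lin_zero lin_comp[OF lin_emb] lin_mul_left lin_comp[OF lin_mul_right lin_sgb])
  fix x y
  have "bmul A (bas x) (sgb \<alpha> (bas y)) = 0" if "x \<notin> bidx A \<or> y \<notin> bidx A"
    using that by (auto simp: mul_off mul_off' sgb_def mul_simps)
  then show "tmul (emb (i, \<alpha>) (bas x)) (emb (j, \<beta>) (bas y)) =
    (if \<alpha> \<and> \<beta> then 0 else emb (i + j, \<alpha> \<or> \<beta>) (bmul A (bas x) (sgb \<alpha> (bas y))))"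
    by (cases "x \<in> bidx A \<and> y \<in> bidx A")
      (use assms in \<open>auto simp: emb_bas tmul_simps emb_simps tmul_bas pr_tidx p1_pr p2_pr\<close>)
qed

lemma sg_emb: "m \<in> M0 \<Longrightarrow> sg (T E) (emb m f) = (if snd m then - emb m (sg A f) else emb m (sg A f))"
proof -
  assume m: "m \<in> M0"
  have "sg (T E) (emb m f) = (if snd m then - 1 else 1) \<bullet> emb m (sg A f)"
  proof (rule lin_eqI[OF lin_comp[OF lin_sg lin_emb] lin_smulI[OF lin_comp[OF lin_emb lin_sg]]])
    fix x show "sg (T E) (emb m (bas x)) = (if snd m then - 1 else 1) \<bullet> emb m (sg A (bas x))"
      using m odd_d by (auto simp: emb_bas emb_simps lin_0[OF lin_sg] p1_pr p2_pr smul_simps koszul_sign_def)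
  qed
  then show ?thesis by simp
qed

lemma emb_keys: "m \<in> M0 \<Longrightarrow> keys f \<subseteq> hidx A n w \<Longrightarrow>
    keys (emb m f) \<subseteq> hidx (T E) (n + (if snd m then d else 0)) w"
  by (rule lin_keys[OF lin_emb]) (auto simp: emb_bas hidx_def pr_tidx p1_pr p2_pr)

text \<open>The laws of the product hold for every choice of \<open>E\<close>. What depends on
  \<open>E\<close>, namely homogeneity, square zero and the Leibniz rule, has to be verified on
  single summands only.\<close>

lemma balg_T:
  assumes lin: "\<And>m. m \<in> M0 \<Longrightarrow> lin (E m)"
    and off: "\<And>m x. m \<in> M0 \<Longrightarrow> x \<notin> bidx A \<Longrightarrow> E m (bas x) = 0"
    and keys: "\<And>m x. m \<in> M0 \<Longrightarrow> x \<in> bidx A \<Longrightarrow>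
      keys (E m (bas x)) \<subseteq> hidx (T E) (bdeg A x + (if snd m then d else 0) - 1) (bwt A x)"
    and EE: "\<And>m f. m \<in> M0 \<Longrightarrow> tlift E (E m f) = 0"
    and leib: "\<And>m m' f g. m \<in> M0 \<Longrightarrow> m' \<in> M0 \<Longrightarrow> tlift E (tmul (emb m f) (emb m' g)) =
      tmul (E m f) (emb m' g) + tmul (sg (T E) (emb m f)) (E m' g)"
  shows "balg (T E)"
proof (unfold_locales, unfold T_simps)
  note E = tlift_emb[of _ E, OF _ lin off]
  show "bilin tmul" by (rule bilin_tmul)
  fix x y z :: "'z \<Rightarrow>\<^sub>0 'k" and i j :: 'z
  note L = lin_comp[of "\<lambda>u. tmul u _", OF bilin_left[OF bilin_tmul]] lin_comp[OF bilin_right[OF bilin_tmul]]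
  show "tmul (tmul x y) z = tmul x (tmul y z)"
  proof (rule tens_eqI[where y = x])
    fix m x assume m: "m \<in> M0"
    let ?x = "emb m (bas x)"
    show "tmul (tmul ?x y) z = tmul ?x (tmul y z)"
    proof (rule tens_eqI[where y = y])
      fix m' y assume m': "m' \<in> M0"
      let ?y = "emb m' (bas y)"
      show "tmul (tmul ?x ?y) z = tmul ?x (tmul ?y z)"
      proof (rule tens_eqI[where y = z])
        fix m'' z assume m'': "m'' \<in> M0"
        obtain i \<alpha> j \<beta> k \<gamma> where mm: "m = (i, \<alpha>)" "m' = (j, \<beta>)" "m'' = (k, \<gamma>)"
          by (metis prod.exhaust)
        show "tmul (tmul ?x ?y) (emb m'' (bas z)) = tmul ?x (tmul ?y (emb m'' (bas z)))"
          using m m' m'' M0_closed[of i \<alpha> j \<beta>] M0_closed[of j \<beta> k \<gamma>] unfolding mm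
          by (cases \<alpha>; cases \<beta>; cases \<gamma>)
            (simp_all add: tmul_emb tmul_simps sgb_def sg_mul assoc add.assoc del: sg_bas)
      qed (intro L bilin_left[OF bilin_tmul] bilin_right[OF bilin_tmul],
          intro L bilin_right[OF bilin_tmul], simp add: tmul_off tmul_simps)
    qed (intro lin_comp[OF bilin_left[OF bilin_tmul] bilin_right[OF bilin_tmul]],
        intro lin_comp[OF bilin_right[OF bilin_tmul] bilin_left[OF bilin_tmul]],
        simp add: tmul_off tmul_simps)
  qed (intro lin_comp[OF bilin_left[OF bilin_tmul] bilin_left[OF bilin_tmul]],
      intro bilin_left[OF bilin_tmul], simp add: tmul_off tmul_simps)
  show "tmul (bas i) (bas j) = koszul_sign ((bdeg A (p1 i) + (if snd (p2 i) then d else 0)) *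
      (bdeg A (p1 j) + (if snd (p2 j) then d else 0))) \<bullet> tmul (bas j) (bas i)"
  proof (cases "i \<in> tidx \<and> j \<in> tidx")
    case True
    then obtain x m y m' where *: "x \<in> bidx A" "m \<in> M0" "i = pr x m" "y \<in> bidx A" "m' \<in> M0" "j = pr y m'"
      by (meson tidxE)
    obtain a \<alpha> b \<beta> where mm: "m = (a, \<alpha>)" "m' = (b, \<beta>)" by (metis prod.exhaust)
    have e: "bas i = emb m (bas x)" "bas j = emb m' (bas y)" using * by (simp_all add: emb_bas)
    have c: "emb n (bmul A (bas x) (bas y)) = koszul_sign (bdeg A x * bdeg A y) \<bullet> emb n (bmul A (bas y) (bas x))" for n
      by (subst comm) (simp add: emb_simps)
    show ?thesis unfolding e unfolding *(3,6) p1_pr[OF *(1,2)] p2_pr[OF *(1,2)] p1_pr[OF *(4,5)] p2_pr[OF *(4,5)]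
      using * odd_d unfolding mm
      by (cases \<alpha>; cases \<beta>)
        (auto simp: tmul_emb tmul_simps sgb_def add.commute mul_simps emb_simps c smul_simps koszul_sign_def)
  qed (auto simp: tmul_off)
  show "i \<notin> tidx \<Longrightarrow> tmul (bas i) x = 0" by (rule tmul_off)
  show "keys (tmul (bas i) (bas j)) \<subseteq> hidx (T E) (bdeg A (p1 i) + (if snd (p2 i) then d else 0) +
      (bdeg A (p1 j) + (if snd (p2 j) then d else 0))) (bwt A (p1 i) + bwt A (p1 j))"
  proof (cases "i \<in> tidx \<and> j \<in> tidx")
    case True
    then obtain x m y m' where *: "x \<in> bidx A" "m \<in> M0" "i = pr x m" "y \<in> bidx A" "m' \<in> M0" "j = pr y m'"
      by (meson tidxE)
    obtain a \<alpha> b \<beta> where mm: "m = (a, \<alpha>)" "m' = (b, \<beta>)" by (metis prod.exhaust)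
    have e: "bas i = emb m (bas x)" "bas j = emb m' (bas y)" using * by (simp_all add: emb_bas)
    have k: "keys (bmul A (bas x) (bas y)) \<subseteq> hidx A (bdeg A x + bdeg A y) (bwt A x + bwt A y)"
      by (rule mul_keys)
    have k': "keys (bmul A (bas x) (sgb \<alpha> (bas y))) \<subseteq> hidx A (bdeg A x + bdeg A y) (bwt A x + bwt A y)"
      using k by (cases \<alpha>) (simp_all add: sgb_def mul_simps keys_smulI)
    show ?thesis unfolding e unfolding *(3,6) p1_pr[OF *(1,2)] p2_pr[OF *(1,2)] p1_pr[OF *(4,5)] p2_pr[OF *(4,5)]
      using * emb_keys[OF M0_closed[of a \<alpha> b \<beta>] k', of E] unfolding mm
      by (cases \<alpha>; cases \<beta>) (simp_all add: tmul_emb algebra_simps)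
  qed (auto simp: tmul_off)
  show "keys (emb (0, False) (bone A)) \<subseteq> hidx (T E) 0 0"
    using emb_keys[OF M0_one one_keys, of E] by simp
  show "tmul (emb (0, False) (bone A)) (bas i) = bas i" if i: "i \<in> tidx"
  proof -
    obtain x m where *: "x \<in> bidx A" "m \<in> M0" "i = pr x m" using i by (rule tidxE)
    have e: "bas i = emb m (bas x)" using * by (simp add: emb_bas)
    obtain a \<alpha> where m: "m = (a, \<alpha>)" by (metis prod.exhaust)
    show ?thesis unfolding e m using *(1,2) m M0_one
      by (simp add: tmul_emb sgb_def one_mul_bas)
  qed
  show "lin (tlift E)" by (rule lin_tlift)
  show "i \<notin> tidx \<Longrightarrow> tlift E (bas i) = 0" by (rule tlift_off)
  show "keys (tlift E (bas i)) \<subseteq> hidx (T E) (bdeg A (p1 i) + (if snd (p2 i) then d else 0) - 1) (bwt A (p1 i))"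
  proof (cases "i \<in> tidx")
    case True
    then obtain x m where *: "x \<in> bidx A" "m \<in> M0" "i = pr x m" "p1 i = x" "p2 i = m" by (rule tidxE)
    then show ?thesis using keys[OF *(2,1)] True by (simp add: tlift_def)
  qed (simp add: tlift_off)
  show "tlift E (tlift E x) = 0"
    by (rule tens_eqI[OF lin_comp[OF lin_tlift lin_tlift] lin_zero])
      (simp_all add: tlift_off tlift_simps E EE)
  show "tlift E (tmul x y) = tmul (tlift E x) y + tmul (sg (T E) x) (tlift E y)"
  proof (rule tens_eqI[where y = x])
    fix m x assume m: "m \<in> M0"
    show "tlift E (tmul (emb m (bas x)) y) =
      tmul (tlift E (emb m (bas x))) y + tmul (sg (T E) (emb m (bas x))) (tlift E y)"
    proof (rule tens_eqI[where y = y])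
      fix m' y assume "m' \<in> M0"
      then show "tlift E (tmul (emb m (bas x)) (emb m' (bas y))) =
        tmul (tlift E (emb m (bas x))) (emb m' (bas y)) + tmul (sg (T E) (emb m (bas x))) (tlift E (emb m' (bas y)))"
        using leib[OF m] E m by simp
    qed (intro lin_addI lin_comp[OF lin_tlift] lin_comp[OF _ lin_tlift] bilin_right[OF bilin_tmul],
        intro lin_addI lin_comp[OF bilin_right[OF bilin_tmul] lin_tlift] bilin_right[OF bilin_tmul],
        simp add: tmul_off tmul_simps tlift_simps tlift_off)
  next
    show "lin (\<lambda>x. tlift E (tmul x y))" by (intro lin_comp[OF lin_tlift bilin_left[OF bilin_tmul]])
    show "lin (\<lambda>x. tmul (tlift E x) y + tmul (sg (T E) x) (tlift E y))"
      by (intro lin_addI lin_comp[OF bilin_left[OF bilin_tmul] lin_tlift] lin_comp[OF bilin_left[OF bilin_tmul] lin_sg])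
  qed (simp add: tmul_off tmul_simps tlift_simps tlift_off)
qed

end

section \<open>The path object and homotopies\<close>

lemma lin_ifI: "lin h \<Longrightarrow> lin h' \<Longrightarrow> lin (\<lambda>x. if P then h x else h' x)"
  by (cases P) simp_all

text \<open>With \<open>\<theta> = d log t\<close> the product \<open>t^k \<theta>\<close> is
  \<open>t^(k-1) dt\<close>, so requiring a positive power of \<open>t\<close> next to
  \<open>\<theta>\<close> singles out the polynomial differential forms on the line.\<close>

definition pM0 :: "(nat \<times> bool) set" where "pM0 = {(k, \<alpha>). \<alpha> \<longrightarrow> 1 \<le> k}"

lemma pM0_iff [simp]: "(k, \<alpha>) \<in> pM0 \<longleftrightarrow> (\<alpha> \<longrightarrow> 1 \<le> k)"
  by (simp add: pM0_def)

locale path_balg = balg A for A :: "('x, 'k::field_char_0, 'w::ab_group_add) balg"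

sublocale path_balg \<subseteq> tens A "- 1" "pM0" Pair fst snd
  by unfold_locales auto

context path_balg
begin

text \<open>The advantage of \<open>d log t\<close> over \<open>dt\<close>: since
  \<open>d (t^k) = k t^k \<theta>\<close>, differentiation and integration preserve the exponent,
  and formulas can be checked for one \<open>k\<close> at a time.\<close>

definition pD :: "nat \<times> bool \<Rightarrow> ('x \<Rightarrow>\<^sub>0 'k) \<Rightarrow> ('x \<times> nat \<times> bool \<Rightarrow>\<^sub>0 'k)" where
  "pD m f = emb m (bdif A f) + (if snd m then 0 else emb (fst m, True) (of_nat (fst m) \<bullet> sg A f))"

definition ev0 :: "('x \<times> nat \<times> bool \<Rightarrow>\<^sub>0 'k) \<Rightarrow> ('x \<Rightarrow>\<^sub>0 'k)" where
  "ev0 = tlift (\<lambda>m f. if m = (0, False) then restr (bidx A) f else 0)"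

definition ev1 :: "('x \<times> nat \<times> bool \<Rightarrow>\<^sub>0 'k) \<Rightarrow> ('x \<Rightarrow>\<^sub>0 'k)" where
  "ev1 = tlift (\<lambda>m f. if snd m then 0 else restr (bidx A) f)"

definition cf :: "nat \<times> bool \<Rightarrow> ('x \<times> nat \<times> bool \<Rightarrow>\<^sub>0 'k) \<Rightarrow> ('x \<Rightarrow>\<^sub>0 'k)" where
  "cf n = tlift (\<lambda>m f. if m = n then restr (bidx A) f else 0)"

text \<open>The two integrations \<open>t\<^sup>k\<theta> \<mapsto> t\<^sup>k / k\<close> and \<open>\<integral>\<^sub>0\<^sup>1\<close>, where \<open>\<theta> = d log t\<close>.\<close>

definition pJ :: "('x \<times> nat \<times> bool \<Rightarrow>\<^sub>0 'k) \<Rightarrow> ('x \<times> nat \<times> bool \<Rightarrow>\<^sub>0 'k)" where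
  "pJ = tlift (\<lambda>m f. if snd m then emb (fst m, False) ((1 / of_nat (fst m)) \<bullet> sg A f) else 0)"

definition pI :: "('x \<times> nat \<times> bool \<Rightarrow>\<^sub>0 'k) \<Rightarrow> ('x \<Rightarrow>\<^sub>0 'k)" where
  "pI = tlift (\<lambda>m f. if snd m then (1 / of_nat (fst m)) \<bullet> restr (bidx A) f else 0)"

abbreviation PT where "PT \<equiv> T pD"

lemma lin_pD: "lin (pD m)"
  unfolding pD_def by (cases "snd m")
    (auto intro!: lin_addI lin_comp[OF lin_emb] lin_dif lin_smulI lin_sg lin_zero)

lemma pD_off: "x \<notin> bidx A \<Longrightarrow> pD m (bas x) = 0"
  by (simp add: pD_def dif_off emb_simps emb_bas)

lemma pD_emb: "m \<in> pM0 \<Longrightarrow> tlift pD (emb m f) = pD m f"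
  by (rule tlift_emb[OF _ lin_pD pD_off])

sublocale PT: balg PT
proof (rule balg_T[OF lin_pD pD_off])
  fix m :: "nat \<times> bool" and x assume m: "m \<in> pM0" and x: "x \<in> bidx A"
  have "keys (emb m (bdif A (bas x))) \<subseteq> hidx PT (bdeg A x - 1 + (if snd m then - 1 else 0)) (bwt A x)"
    by (rule emb_keys[OF m dif_keys])
  moreover have "keys (emb (fst m, True) (of_nat (fst m) \<bullet> sg A (bas x))) \<subseteq> hidx PT (bdeg A x - 1) (bwt A x)"
    if "\<not> snd m"
  proof (cases "fst m = 0")
    case False
    have "keys (emb (fst m, True) (bas x)) \<subseteq> hidx PT (bdeg A x + (if snd (fst m, True) then - 1 else 0)) (bwt A x)"
      by (rule emb_keys) (use x False in \<open>auto simp: hidx_def\<close>)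
    then show ?thesis by (simp add: emb_simps keys_smulI)
  qed (simp add: emb_simps)
  ultimately show "keys (pD m (bas x)) \<subseteq> hidx PT (bdeg A x + (if snd m then - 1 else 0) - 1) (bwt A x)"
    by (cases "snd m") (simp_all add: pD_def keys_addI algebra_simps del: sg_bas)
next
  fix m :: "nat \<times> bool" and f assume m: "m \<in> pM0"
  show "tlift pD (pD m f) = 0"
  proof (cases "snd m \<or> fst m = 0")
    case True
    have "tlift pD (pD m f) = tlift pD (emb m (bdif A f))" using True
      by (auto simp: pD_def emb_simps)
    also have "\<dots> = 0" using True by (auto simp: pD_emb[OF m] pD_def dif_dif emb_simps)
    finally show ?thesis .
  next
    case False
    then have m': "(fst m, True) \<in> pM0" by simp
    have p: "pD m f = emb m (bdif A f) + emb (fst m, True) (of_nat (fst m) \<bullet> sg A f)"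
      using False by (simp add: pD_def)
    show ?thesis unfolding p tlift_simps pD_emb[OF m] pD_emb[OF m']
      using False by (simp add: pD_def dif_dif sg_dif emb_simps dif_simps smul_simps)
  qed
next
  fix m m' :: "nat \<times> bool" and f g
  assume m: "m \<in> pM0" and m': "m' \<in> pM0"
  obtain i \<alpha> j \<beta> where mm: "m = (i, \<alpha>)" "m' = (j, \<beta>)" by (metis prod.exhaust)
  have M: "(i + j, \<alpha> \<or> \<beta>) \<in> pM0" using m m' mm by auto
  \<comment> \<open>For \<open>k = 0\<close> the index \<open>(0, True)\<close> is outside
    \<open>pM0\<close> and \<open>tmul_emb\<close> does not apply; the scalar factor
    \<open>k\<close> then makes both sides zero. The same holds for the three facts that
    follow.\<close>
  have tm1: "of_nat k \<bullet> tmul (emb (k, True) h) (emb (j, False) g) = of_nat k \<bullet> emb (k + j, True) (bmul A h (sg A g))"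
    for k h by (cases "k = 0") (simp_all add: tmul_emb sgb_def)
  have tm2: "of_nat k \<bullet> tmul (emb (i, False) h) (emb (k, True) g) = of_nat k \<bullet> emb (i + k, True) (bmul A h g)"
    for k h g by (cases "k = 0") (simp_all add: tmul_emb sgb_def)
  have tm3: "of_nat k \<bullet> tmul (emb (k, True) h) (emb (l, True) g) = 0" if "1 \<le> l" for k h l g
    using that by (cases "k = 0") (simp_all add: tmul_emb)
  have tm4: "of_nat k \<bullet> tmul (emb (l, True) g) (emb (k, True) h) = 0" if "1 \<le> l" for k h l g
    using that by (cases "k = 0") (simp_all add: tmul_emb)
  show "tlift pD (tmul (emb m f) (emb m' g)) =
      tmul (pD m f) (emb m' g) + tmul (sg (T pD) (emb m f)) (pD m' g)"
    using m m' M unfolding mm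
    by (cases \<alpha>; cases \<beta>)
      (simp_all add: tmul_emb pD_emb pD_def sg_emb sgb_def tmul_simps emb_simps tm1 tm2 tm3 tm4
        leibniz sg_mul sg_dif smul_simps mul_simps tlift_simps)
qed

lemma val_emb:
  assumes "m \<in> pM0"
  shows "ev0 (emb m f) = (if m = (0, False) then restr (bidx A) f else 0)"
    "ev1 (emb m f) = (if snd m then 0 else restr (bidx A) f)"
    "cf n (emb m f) = (if m = n then restr (bidx A) f else 0)"
    "pJ (emb m f) = (if snd m then emb (fst m, False) ((1 / of_nat (fst m)) \<bullet> sg A f) else 0)"
    "pI (emb m f) = (if snd m then (1 / of_nat (fst m)) \<bullet> restr (bidx A) f else 0)"
proof -
  note i = lin_ifI lin_restr lin_zero lin_smulI lin_comp[OF lin_emb] lin_sg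
  show "ev0 (emb m f) = (if m = (0, False) then restr (bidx A) f else 0)"
    unfolding ev0_def by (subst tlift_emb[OF assms]) (intro i, simp_all)
  show "ev1 (emb m f) = (if snd m then 0 else restr (bidx A) f)"
    unfolding ev1_def by (subst tlift_emb[OF assms]) (intro i, simp_all)
  show "cf n (emb m f) = (if m = n then restr (bidx A) f else 0)"
    unfolding cf_def by (subst tlift_emb[OF assms]) (intro i, simp_all)
  show "pJ (emb m f) = (if snd m then emb (fst m, False) ((1 / of_nat (fst m)) \<bullet> sg A f) else 0)"
    unfolding pJ_def by (subst tlift_emb[OF assms]) (intro i, simp_all add: emb_simps emb_bas)
  show "pI (emb m f) = (if snd m then (1 / of_nat (fst m)) \<bullet> restr (bidx A) f else 0)"
    unfolding pI_def by (subst tlift_emb[OF assms]) (intro i, simp_all)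
qed

lemma val_lin: "lin ev0" "lin ev1" "lin (cf n)" "lin pJ" "lin pI"
  by (simp_all add: ev0_def ev1_def cf_def pJ_def pI_def lin_tlift)

lemma val_off: assumes "z \<notin> tidx"
  shows "ev0 (bas z) = 0" "ev1 (bas z) = 0" "cf n (bas z) = 0" "pJ (bas z) = 0" "pI (bas z) = 0"
  using assms by (simp_all add: ev0_def ev1_def cf_def pJ_def pI_def tlift_off)

lemmas val_simps = lin_simps[OF val_lin(1)] lin_simps[OF val_lin(2)] lin_simps[OF val_lin(3)]
  lin_simps[OF val_lin(4)] lin_simps[OF val_lin(5)]

lemma restr_dif: "restr (bidx A) (bdif A f) = bdif A f" by (rule restr_id[OF dif_sub])
lemma restr_mul: "restr (bidx A) (bmul A f g) = bmul A f g" by (rule restr_id[OF mul_sub])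

lemma ev_dif: "ev0 (tlift pD y) = bdif A (ev0 y)" "ev1 (tlift pD y) = bdif A (ev1 y)"
proof -
  have e: "ev0 (pD m (bas x)) = bdif A (ev0 (emb m (bas x)))" "ev1 (pD m (bas x)) = bdif A (ev1 (emb m (bas x)))"
    if "m \<in> pM0" "x \<in> bidx A" for m x
    using that by (cases "fst m = 0"; auto simp: pD_def val_simps val_emb restr_dif dif_simps emb_simps)+
  show "ev0 (tlift pD y) = bdif A (ev0 y)"
    by (rule tens_eqI[OF lin_comp[OF val_lin(1) lin_tlift] lin_comp[OF lin_dif val_lin(1)]])
      (simp_all add: val_off tlift_off val_simps dif_simps pD_emb e)
  show "ev1 (tlift pD y) = bdif A (ev1 y)"
    by (rule tens_eqI[OF lin_comp[OF val_lin(2) lin_tlift] lin_comp[OF lin_dif val_lin(2)]])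
      (simp_all add: val_off tlift_off val_simps dif_simps pD_emb e)
qed

lemma ghom_ev: "ghom PT A ev0" "ghom PT A ev1"
proof -
  have mul: "h (tmul x y) = bmul A (h x) (h y)" if h: "lin h" "\<And>z. z \<notin> tidx \<Longrightarrow> h (bas z) = 0"
    and e: "\<And>m m' x y. m \<in> pM0 \<Longrightarrow> m' \<in> pM0 \<Longrightarrow> x \<in> bidx A \<Longrightarrow> y \<in> bidx A \<Longrightarrow>
      h (tmul (emb m (bas x)) (emb m' (bas y))) = bmul A (h (emb m (bas x))) (h (emb m' (bas y)))" for h x y
  proof (rule tens_eqI[where y = x])
    fix m x assume m: "m \<in> pM0" "x \<in> bidx A"
    show "h (tmul (emb m (bas x)) y) = bmul A (h (emb m (bas x))) (h y)"
      by (rule tens_eqI[OF lin_comp[OF h(1) bilin_right[OF bilin_tmul]] lin_comp[OF lin_mul_right h(1)]])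
        (simp_all add: e m h(2) tmul_off lin_0[OF h(1)] mul_simps)
  qed (intro lin_comp[OF h(1)] bilin_left[OF bilin_tmul], intro lin_comp[OF lin_mul_left h(1)],
       simp add: h(2) tmul_off lin_0[OF h(1)] mul_simps)
  have k: "keys (h (bas z)) \<subseteq> hidx A (bdeg PT z) (bwt PT z)"
    if "\<And>m x. m \<in> pM0 \<Longrightarrow> x \<in> bidx A \<Longrightarrow> h (emb m (bas x)) = 0 \<or> h (emb m (bas x)) = bas x \<and> \<not> snd m"
      "\<And>z. z \<notin> tidx \<Longrightarrow> h (bas z) = 0" for h z
  proof (cases "z \<in> tidx")
    case True
    then obtain x m where z: "x \<in> bidx A" "m \<in> pM0" "z = (x, m)" by (rule tidxE)
    then have "bas z = (emb m (bas x) :: _ \<Rightarrow>\<^sub>0 'k)" by (simp add: emb_bas)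
    then show ?thesis using that(1)[OF z(2,1)] z by (auto simp: hidx_def)
  qed (simp add: that(2))
  show "ghom PT A ev0" unfolding ghom_def
  proof (intro conjI allI impI)
    fix y y' i
    show "ev0 (bmul PT y y') = bmul A (ev0 y) (ev0 y')" unfolding T_simps
    proof (rule mul[OF val_lin(1) val_off(1)])
      fix m m' :: "nat \<times> bool" and x y assume m: "m \<in> pM0" "m' \<in> pM0" and xy: "x \<in> bidx A" "y \<in> bidx A"
      obtain i \<alpha> j \<beta> where mm: "m = (i, \<alpha>)" "m' = (j, \<beta>)" by (metis prod.exhaust)
      show "ev0 (tmul (emb m (bas x)) (emb m' (bas y))) = bmul A (ev0 (emb m (bas x))) (ev0 (emb m' (bas y)))"
        using m xy unfolding mm by (cases \<alpha>; cases \<beta>)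
          (simp_all add: tmul_emb val_emb sgb_def restr_mul mul_simps val_simps)
    qed
    show "ev0 (bone PT) = bone A" by (simp add: val_emb restr_id[OF one_sub])
    show "keys (ev0 (bas i)) \<subseteq> hidx A (bdeg PT i) (bwt PT i)"
      by (rule k) (simp_all add: val_off val_emb)
    show "i \<notin> bidx PT \<Longrightarrow> ev0 (bas i) = 0" by (simp add: val_off)
  qed (rule val_lin)
  show "ghom PT A ev1" unfolding ghom_def
  proof (intro conjI allI impI)
    fix y y' i
    show "ev1 (bmul PT y y') = bmul A (ev1 y) (ev1 y')" unfolding T_simps
    proof (rule mul[OF val_lin(2) val_off(2)])
      fix m m' :: "nat \<times> bool" and x y assume m: "m \<in> pM0" "m' \<in> pM0" and xy: "x \<in> bidx A" "y \<in> bidx A"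
      obtain i \<alpha> j \<beta> where mm: "m = (i, \<alpha>)" "m' = (j, \<beta>)" by (metis prod.exhaust)
      show "ev1 (tmul (emb m (bas x)) (emb m' (bas y))) = bmul A (ev1 (emb m (bas x))) (ev1 (emb m' (bas y)))"
        using m xy unfolding mm by (cases \<alpha>; cases \<beta>)
          (simp_all add: tmul_emb val_emb sgb_def restr_mul mul_simps val_simps)
    qed
    show "ev1 (bone PT) = bone A" by (simp add: val_emb restr_id[OF one_sub])
    show "keys (ev1 (bas i)) \<subseteq> hidx A (bdeg PT i) (bwt PT i)"
      by (rule k) (simp_all add: val_off val_emb)
    show "i \<notin> bidx PT \<Longrightarrow> ev1 (bas i) = 0" by (simp add: val_off)
  qed (rule val_lin)
qed

text \<open>The Poincare lemma for polynomial forms with coefficients in \<open>A\<close>: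
  integration from 0 to \<open>t\<close> contracts the path object onto the constants.\<close>

lemma pJ_homotopy: "tlift pD (pJ y) + pJ (tlift pD y) = restr tidx y - emb (0, False) (ev0 y)"
proof (rule tens_eqI[where y = y])
  show "lin (\<lambda>y. tlift pD (pJ y) + pJ (tlift pD y))"
    by (intro lin_addI lin_comp[OF lin_tlift] lin_comp[OF _ lin_tlift] val_lin)
  show "lin (\<lambda>y. restr tidx y - emb (0, False) (ev0 y))"
    by (intro lin_diffI lin_restr lin_comp[OF lin_emb] val_lin)
  fix m x assume m: "m \<in> pM0" and x: "x \<in> bidx A"
  obtain k \<alpha> where mm: "m = (k, \<alpha>)" by (metis prod.exhaust)
  have r: "restr tidx (emb m (bas x)) = emb m (bas x)" using m x by (simp add: emb_bas pr_tidx)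
  have k0: "(of_nat k :: 'k) \<noteq> 0" if "1 \<le> k" using that by simp
  show "tlift pD (pJ (emb m (bas x))) + pJ (tlift pD (emb m (bas x))) =
      restr tidx (emb m (bas x)) - emb (0, False) (ev0 (emb m (bas x)))"
    unfolding r
    using m k0 x unfolding mm
    by (cases \<alpha>; cases "k = 0")
      (simp_all add: val_emb pD_emb pD_def val_simps tlift_simps emb_simps lin_simps[OF lin_sg] smul_simps
        dif_simps sg_dif del: sg_bas)
qed (simp_all add: val_off tlift_off tlift_simps val_simps emb_simps)

lemma ev0_pJ: "ev0 (pJ y) = 0"
  by (rule tens_eqI[OF lin_comp[OF val_lin(1) val_lin(4)] lin_zero])
    (auto simp: val_off val_simps val_emb)

text \<open>The fundamental theorem of calculus on the unit interval. The involution
  \<open>sg\<close> is the one that \<open>pD\<close> puts in front of the derivative in direction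
  \<open>t\<close>.\<close>

lemma pI_dif: "pI (tlift pD y) = sg A (ev1 y - ev0 y) + bdif A (pI y)"
proof (rule tens_eqI[where y = y])
  show "lin (\<lambda>y. pI (tlift pD y))" by (intro lin_comp[OF _ lin_tlift] val_lin)
  show "lin (\<lambda>y. sg A (ev1 y - ev0 y) + bdif A (pI y))"
    by (intro lin_addI lin_comp[OF lin_sg] lin_comp[OF lin_dif] lin_diffI val_lin)
  fix m x assume m: "m \<in> pM0" and x: "x \<in> bidx A"
  obtain k \<alpha> where mm: "m = (k, \<alpha>)" by (metis prod.exhaust)
  have k0: "(of_nat k :: 'k) \<noteq> 0" if "1 \<le> k" using that by simp
  show "pI (tlift pD (emb m (bas x))) =
      sg A (ev1 (emb m (bas x)) - ev0 (emb m (bas x))) + bdif A (pI (emb m (bas x)))"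
    using m k0 x unfolding mm
    by (cases \<alpha>; cases "k = 0")
      (simp_all add: val_emb pD_emb pD_def val_simps emb_simps lin_simps[OF lin_sg] smul_simps
        dif_simps restr_dif lin_simps[OF lin_restr])
qed (simp_all add: val_off tlift_off val_simps lin_simps[OF lin_sg] dif_simps)

text \<open>A comparison of the coefficients of \<open>t^k \<theta>\<close>. For a closed element it
  exhibits \<open>k\<close> times the coefficient of \<open>t^k\<close> as a boundary up to sign,
  which is why augmentations turn out constant along homotopies.\<close>

lemma cf_dif: "1 \<le> k \<Longrightarrow> cf (k, True) (tlift pD y) = bdif A (cf (k, True) y) + of_nat k \<bullet> sg A (cf (k, False) y)"
proof (rule tens_eqI[where y = y])
  show "lin (\<lambda>y. cf (k, True) (tlift pD y))" by (intro lin_comp[OF _ lin_tlift] val_lin)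
  show "lin (\<lambda>y. bdif A (cf (k, True) y) + of_nat k \<bullet> sg A (cf (k, False) y))"
    by (intro lin_addI lin_smulI lin_comp[OF lin_sg] lin_comp[OF lin_dif] val_lin)
  fix m x assume m: "m \<in> pM0" and x: "x \<in> bidx A" and k: "1 \<le> k"
  obtain l \<alpha> where mm: "m = (l, \<alpha>)" by (metis prod.exhaust)
  show "cf (k, True) (tlift pD (emb m (bas x))) =
      bdif A (cf (k, True) (emb m (bas x))) + of_nat k \<bullet> sg A (cf (k, False) (emb m (bas x)))"
    using m k x unfolding mm
    by (cases \<alpha>; cases "l = 0")
      (simp_all add: val_emb pD_emb pD_def val_simps emb_simps lin_simps[OF lin_sg] smul_simps
        dif_simps restr_dif lin_simps[OF lin_restr])
qed (simp_all add: val_off tlift_off val_simps lin_simps[OF lin_sg] dif_simps)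

lemma val_hom:
  assumes "keys y \<subseteq> hidx PT n w"
  shows "keys (pJ y) \<subseteq> hidx PT (n + 1) w" "keys (pI y) \<subseteq> hidx A (n + 1) w"
    "keys (cf m y) \<subseteq> hidx A (n + (if snd m then 1 else 0)) w"
proof -
  have z: "\<exists>x k \<alpha>. x \<in> bidx A \<and> (k, \<alpha>) \<in> pM0 \<and> bas z = (emb (k, \<alpha>) (bas x) :: _ \<Rightarrow>\<^sub>0 'k) \<and>
    bwt A x = w \<and> bdeg A x = n + (if \<alpha> then 1 else 0)" if "z \<in> keys y" for z
  proof -
    have z: "z \<in> hidx PT n w" using that assms by blast
    then have "z \<in> tidx" by (simp add: hidx_def)
    then obtain x m where *: "x \<in> bidx A" "m \<in> pM0" "z = (x, m)" by (rule tidxE)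
    obtain k \<alpha> where mm: "m = (k, \<alpha>)" by (metis prod.exhaust)
    show ?thesis using * z unfolding mm by (intro exI[of _ x] exI[of _ k] exI[of _ \<alpha>]) (auto simp: emb_bas hidx_def)
  qed
  show "keys (pJ y) \<subseteq> hidx PT (n + 1) w"
  proof (rule lin_keys[OF val_lin(4)])
    fix z assume "z \<in> keys y"
    then obtain x k \<alpha> where *: "x \<in> bidx A" "(k, \<alpha>) \<in> pM0" "bas z = (emb (k, \<alpha>) (bas x) :: _ \<Rightarrow>\<^sub>0 'k)"
      "bwt A x = w" "bdeg A x = n + (if \<alpha> then 1 else 0)" using z by blast
    have "keys (emb (k, False) (bas x) :: _ \<Rightarrow>\<^sub>0 'k) \<subseteq> hidx PT (bdeg A x + (if snd (k, False) then - 1 else 0)) w"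
      by (rule emb_keys) (use * in \<open>auto simp: hidx_def\<close>)
    then show "keys (pJ (bas z)) \<subseteq> hidx PT (n + 1) w"
      using * by (cases \<alpha>) (simp_all add: val_emb emb_simps lin_simps[OF lin_sg] keys_smulI)
  qed
  show "keys (pI y) \<subseteq> hidx A (n + 1) w"
  proof (rule lin_keys[OF val_lin(5)])
    fix z assume "z \<in> keys y"
    then obtain x k \<alpha> where *: "x \<in> bidx A" "(k, \<alpha>) \<in> pM0" "bas z = (emb (k, \<alpha>) (bas x) :: _ \<Rightarrow>\<^sub>0 'k)"
      "bwt A x = w" "bdeg A x = n + (if \<alpha> then 1 else 0)" using z by blast
    have "keys (bas x :: _ \<Rightarrow>\<^sub>0 'k) \<subseteq> hidx A (bdeg A x) w" using * by (auto simp: hidx_def)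
    then show "keys (pI (bas z)) \<subseteq> hidx A (n + 1) w"
      using * by (cases \<alpha>) (simp_all add: val_emb keys_smulI)
  qed
  show "keys (cf m y) \<subseteq> hidx A (n + (if snd m then 1 else 0)) w"
  proof (rule lin_keys[OF val_lin(3)])
    fix z assume "z \<in> keys y"
    then obtain x k \<alpha> where *: "x \<in> bidx A" "(k, \<alpha>) \<in> pM0" "bas z = (emb (k, \<alpha>) (bas x) :: _ \<Rightarrow>\<^sub>0 'k)"
      "bwt A x = w" "bdeg A x = n + (if \<alpha> then 1 else 0)" using z by blast
    then show "keys (cf m (bas z)) \<subseteq> hidx A (n + (if snd m then 1 else 0)) w"
      by (cases \<alpha>) (auto simp: val_emb hidx_def split: if_splits)
  qed
qed

lemma decomp:
  assumes "keys y \<subseteq> tidx" "finite F" "snd ` keys y \<subseteq> F"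
  shows "y = (\<Sum>m\<in>F. emb m (cf m y))"
proof (rule lin_eq_keys[OF lin_id, of "\<lambda>y. \<Sum>m\<in>F. emb m (cf m y)"])
  show "lin (\<lambda>y. \<Sum>m\<in>F. emb m (cf m y))" by (intro lin_sumI lin_comp[OF lin_emb] val_lin)
  fix z assume z: "z \<in> keys y"
  then have "z \<in> tidx" using assms(1) by blast
  then obtain x m where *: "x \<in> bidx A" "m \<in> pM0" "z = (x, m)" by (rule tidxE)
  have e: "bas z = (emb m (bas x) :: _ \<Rightarrow>\<^sub>0 'k)" using * by (simp add: emb_bas)
  have "(\<Sum>n\<in>F. emb n (cf n (bas z))) = (\<Sum>n\<in>F. if m = n then bas z else 0 :: _ \<Rightarrow>\<^sub>0 'k)"
    unfolding e by (rule sum.cong[OF refl]) (use * in \<open>auto simp: val_emb[OF *(2)] emb_simps\<close>)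
  also have "\<dots> = bas z" using assms(2,3) z * by (auto simp: sum.delta' image_subset_iff)
  finally show "bas z = (\<Sum>m\<in>F. emb m (cf m (bas z)))" by simp
qed

end

text \<open>Any preimage may be projected to the right component by \<open>dif_restr\<close>.
  Acyclicity can therefore be assumed without reference to the gradings and still be used with
  them.\<close>

lemma (in balg) acyclic_hom:
  assumes acyc: "\<And>x. keys x \<subseteq> bidx A \<Longrightarrow> bdif A x = 0 \<Longrightarrow> e x = 0 \<Longrightarrow> \<exists>y. keys y \<subseteq> bidx A \<and> bdif A y = x"
    and x: "keys x \<subseteq> hidx A n w" "bdif A x = 0" "e x = 0"
  shows "\<exists>y. keys y \<subseteq> hidx A (n + 1) w \<and> bdif A y = x"
proof -
  obtain y where y: "bdif A y = x" using acyc[of x] x hidx_sub by blast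
  have "bdif A (restr (hidx A (n + 1) w) y) = restr (hidx A n w) x"
    using dif_restr[of "n + 1" w y] y by simp
  then show ?thesis using restr_id[OF x(1)] by (intro exI[of _ "restr (hidx A (n + 1) w) y"]) (auto simp: keys_restr)
qed

text \<open>A value on a generator is found in two moves: integrating the prescribed boundary from 0
  gives a path that starts correctly, and adding the boundary of some \<open>t s\<close> corrects
  its end.\<close>

theorem (in free_balg) homotopy_ex:
  fixes B :: "('y, 'k, 'w) balg"
  assumes B: "balg B" and f: "bhom A B f0" "bhom A B f1"
    and e: "lin e" "\<And>z. bdeg B z \<noteq> 0 \<Longrightarrow> e (bas z) = 0"
    and acyc: "\<And>x. keys x \<subseteq> bidx B \<Longrightarrow> bdif B x = 0 \<Longrightarrow> e x = 0 \<Longrightarrow> \<exists>y. keys y \<subseteq> bidx B \<and> bdif B y = x"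
    and ee: "\<And>x. e (f0 x) = e (f1 x)"
  shows "\<exists>h. bhom A (path_balg.PT B) h \<and> (\<forall>x. path_balg.ev0 B (h x) = f0 x \<and> path_balg.ev1 B (h x) = f1 x)"
proof -
  interpret P: path_balg B using B by (simp add: path_balg_def)
  note f_lin = bhom_lin[OF f(1)] bhom_lin[OF f(2)]
  have zz: "(0, False) \<in> pM0" "(1, False) \<in> pM0" by simp_all
  have D0: "tens.tlift B pM0 Pair fst snd P.pD (P.emb (0, False) u) = P.emb (0, False) (bdif B u)" for u
    by (simp add: P.pD_emb P.pD_def P.emb_simps)
  have "\<exists>h. bhom A P.PT h \<and> (\<forall>g\<in>G. P.ev0 (h (bas g)) = f0 (bas g) \<and> P.ev1 (h (bas g)) = f1 (bas g))"
  proof (rule lifting[OF P.PT.balg_axioms])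
    fix g h assume g: "g \<in> G" and h: "ghom A P.PT h"
      and chain: "\<And>x. x \<in> bidx A \<Longrightarrow> bdeg A x < bdeg A g \<Longrightarrow> h (bdif A (bas x)) = bdif P.PT (h (bas x))"
      and good: "\<And>g'. g' \<in> G \<Longrightarrow> bdeg A g' < bdeg A g \<Longrightarrow>
        P.ev0 (h (bas g')) = f0 (bas g') \<and> P.ev1 (h (bas g')) = f1 (bas g')"
    define n w where "n = bdeg A g" and "w = bwt A g"
    define dg where "dg = bdif A (bas g)"
    define a where "a = h dg"
    note gx = gen_idx[OF g]
    have dg: "keys dg \<subseteq> hidx A (n - 1) w" unfolding dg_def n_def w_def by (rule dif_keys)
    have low: "x \<in> bidx A \<and> bdeg A x < bdeg A g" if "x \<in> keys dg" for x
      using dg that by (auto simp: hidx_def n_def)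
    have ev: "P.ev0 (h (bas x)) = f0 (bas x)" "P.ev1 (h (bas x)) = f1 (bas x)" if x: "x \<in> keys dg" for x
    proof -
      have lt: "g' \<in> G \<and> bdeg A g' < bdeg A g" if "g' \<in> set (word x)" for g'
        using word_sub word_deg_le[OF _ that] low[OF x] that by fastforce
      show "P.ev0 (h (bas x)) = f0 (bas x)"
        by (rule ghom_eq_bas[OF ghom_comp[OF h P.ghom_ev(1)] bhom_ghom[OF f(1)]])
          (use low[OF x] lt good in auto)
      show "P.ev1 (h (bas x)) = f1 (bas x)"
        by (rule ghom_eq_bas[OF ghom_comp[OF h P.ghom_ev(2)] bhom_ghom[OF f(2)]])
          (use low[OF x] lt good in auto)
    qed
    note h_lin = ghom_lin[OF h]
    have ev0a: "P.ev0 a = f0 dg" unfolding a_def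
      by (rule lin_eq_keys[OF lin_comp[OF P.val_lin(1) h_lin] f_lin(1)]) (rule ev)
    have ev1a: "P.ev1 a = f1 dg" unfolding a_def
      by (rule lin_eq_keys[OF lin_comp[OF P.val_lin(2) h_lin] f_lin(2)]) (rule ev)
    have "h (bdif A dg) = bdif P.PT (h dg)"
      by (rule lin_eq_keys[OF lin_comp[OF h_lin lin_dif] lin_comp[OF P.PT.lin_dif h_lin]])
        (use chain low in blast)
    then have Da: "P.tlift P.pD a = 0" by (simp add: a_def dg_def dif_dif lin_0[OF h_lin])
    have a_hom: "keys a \<subseteq> hidx P.PT (n - 1) w" unfolding a_def by (rule ghom_hom[OF h dg])
    have a_sub: "keys a \<subseteq> P.tidx" using a_hom by (auto simp: hidx_def)
    have f_hom: "keys (f0 (bas g)) \<subseteq> hidx B n w" "keys (f1 (bas g)) \<subseteq> hidx B n w"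
      using ghom_keys[OF bhom_ghom[OF f(1)], of g] ghom_keys[OF bhom_ghom[OF f(2)], of g]
      by (simp_all add: n_def w_def)
    note sub = subset_trans[OF _ P.hidx_sub]
    \<comment> \<open>By the contraction formula this element has boundary \<open>a\<close>; the
      integral vanishes at 0, so the path starts at the value of \<open>f0\<close>.\<close>
    define y1 where "y1 = P.pJ a + P.emb (0, False) (f0 (bas g))"
    have Dy1: "P.tlift P.pD y1 = a"
    proof -
      have "P.tlift P.pD (P.pJ a) = a - P.emb (0, False) (f0 dg)"
        using P.pJ_homotopy[of a] by (simp add: Da P.val_simps restr_id[OF a_sub] ev0a)
      then show ?thesis
        by (simp add: y1_def P.tlift_simps D0 bhom_dif[OF f(1), symmetric] dg_def)
    qed
    have y1_hom: "keys y1 \<subseteq> hidx P.PT n w"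
      unfolding y1_def using P.val_hom(1)[OF a_hom] P.emb_keys[OF zz(1) f_hom(1), of P.pD]
      by (intro keys_addI) simp_all
    have ev0y1: "P.ev0 y1 = f0 (bas g)"
      by (simp add: y1_def P.val_simps P.ev0_pJ P.val_emb restr_id[OF sub[OF f_hom(1)]])
    define R where "R = f1 (bas g) - P.ev1 y1"
    have R_hom: "keys R \<subseteq> hidx B n w" unfolding R_def
      by (intro keys_diffI f_hom ghom_hom[OF P.ghom_ev(2) y1_hom])
    have "bdif B R = 0"
      by (simp add: R_def P.dif_simps P.ev_dif(2)[symmetric] Dy1 ev1a dg_def bhom_dif[OF f(2)])
    \<comment> \<open>Only degree zero needs an argument. There the boundary of \<open>g\<close> is
      zero and \<open>y1\<close> is a constant path, so \<open>R\<close> is the difference of the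
      values of \<open>f1\<close> and \<open>f0\<close>, which agree under \<open>e\<close>.\<close>
    moreover have "e R = 0"
    proof (cases "n = 0")
      case True
      have "keys dg = {}" using low deg_nonneg True unfolding n_def by fastforce
      then have "dg = 0" by simp
      then have "y1 = P.emb (0, False) (f0 (bas g))" by (simp add: y1_def a_def lin_0[OF h_lin] P.val_simps)
      then have "P.ev1 y1 = f0 (bas g)" by (simp add: P.val_emb restr_id[OF sub[OF f_hom(1)]])
      then show ?thesis by (simp add: R_def lin_diff[OF e(1)] ee)
    next
      case False
      show ?thesis by (rule lin_eq_keys[OF e(1) lin_zero]) (use R_hom False e(2) in \<open>auto simp: hidx_def\<close>)
    qed
    ultimately obtain s where s: "keys s \<subseteq> hidx B (n + 1) w" "bdif B s = R"
      using P.acyclic_hom[OF acyc R_hom, of e] by blast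
    \<comment> \<open>The element \<open>t s\<close> is 0 at 0 and \<open>s\<close> at 1; adding its
      boundary keeps the boundary of \<open>y1\<close> and the start, and moves the end by
      \<open>bdif B s = R\<close>.\<close>
    define y where "y = y1 + P.tlift P.pD (P.emb (1, False) s)"
    have "keys (P.emb (1, False) s) \<subseteq> hidx P.PT (n + 1) w"
      using P.emb_keys[OF zz(2) s(1), of P.pD] by simp
    from P.PT.dif_hom[OF this] have "keys y \<subseteq> hidx P.PT n w"
      unfolding y_def by (intro keys_addI y1_hom) simp
    moreover have "bdif P.PT y = a"
      using P.PT.dif_dif[of "P.emb (1, False) s"] by (simp add: y_def P.tlift_simps Dy1)
    moreover have "P.ev0 y = f0 (bas g)"
      by (simp add: y_def P.val_simps P.ev_dif P.val_emb ev0y1 P.dif_simps)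
    moreover have "P.ev1 y = f1 (bas g)"
      by (simp add: y_def P.val_simps P.ev_dif P.val_emb restr_id[OF sub[OF s(1)]] s(2) R_def)
    ultimately show "\<exists>y. keys y \<subseteq> hidx P.PT (bdeg A g) (bwt A g) \<and> bdif P.PT y = h (bdif A (bas g)) \<and>
        P.ev0 y = f0 (bas g) \<and> P.ev1 y = f1 (bas g)"
      by (auto simp: n_def w_def a_def dg_def)
  qed
  then obtain h where h: "bhom A P.PT h"
    "\<And>g. g \<in> G \<Longrightarrow> P.ev0 (h (bas g)) = f0 (bas g) \<and> P.ev1 (h (bas g)) = f1 (bas g)" by blast
  have bas_eq: "P.ev0 (h (bas x)) = f0 (bas x) \<and> P.ev1 (h (bas x)) = f1 (bas x)" for x
  proof (cases "x \<in> bidx A")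
    case True
    show ?thesis using h(2) word_sub[OF True]
      by (intro conjI ghom_eq_bas[OF ghom_comp[OF bhom_ghom[OF h(1)] P.ghom_ev(1)] bhom_ghom[OF f(1)] True]
          ghom_eq_bas[OF ghom_comp[OF bhom_ghom[OF h(1)] P.ghom_ev(2)] bhom_ghom[OF f(2)] True]) auto
  qed (simp add: ghom_off[OF bhom_ghom[OF h(1)]] ghom_off[OF bhom_ghom[OF f(1)]]
      ghom_off[OF bhom_ghom[OF f(2)]] P.val_simps)
  have "P.ev0 (h x) = f0 x" "P.ev1 (h x) = f1 x" for x
    by (rule lin_eqI[OF lin_comp[OF P.val_lin(1) bhom_lin[OF h(1)]] f_lin(1)], simp add: bas_eq)
      (rule lin_eqI[OF lin_comp[OF P.val_lin(2) bhom_lin[OF h(1)]] f_lin(2)], simp add: bas_eq)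
  then show ?thesis using h(1) by blast
qed


section \<open>Stanley-Reisner rings and derivations\<close>

type_synonym 'v mon = "'v \<Rightarrow>\<^sub>0 nat"

definition mwt :: "'v mon \<Rightarrow> 'v \<Rightarrow> int" where "mwt m v = int (lookup m v)"

definition faces :: "'v set set \<Rightarrow> 'v mon set" where "faces K = {m. keys m \<in> K}"

text \<open>The monomials supported on faces form a basis of the quotient ring, so that reduction
  modulo the ideal is \<open>restr (faces K)\<close>. The unit is reduced as well, because the ring
  of the void complex is zero.\<close>

definition SR :: "'v set set \<Rightarrow> ('v mon, 'k::field_char_0, 'v \<Rightarrow> int) balg" where
  "SR K = \<lparr>bidx = faces K, bmul = (\<lambda>f g. restr (faces K) (f * g)), bone = restr (faces K) 1,
     bdif = (\<lambda>_. 0), bdeg = (\<lambda>_. 0), bwt = mwt\<rparr>"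

lemma SR_simps [simp]: "bidx (SR K) = faces K" "bmul (SR K) f g = restr (faces K) (f * g)"
  "bone (SR K) = restr (faces K) 1" "bdif (SR K) f = 0" "bdeg (SR K) m = 0" "bwt (SR K) m = mwt m"
  by (simp_all add: SR_def)

definition dcl :: "'v set set \<Rightarrow> bool" where "dcl K \<longleftrightarrow> (\<forall>f\<in>K. \<forall>g. g \<subseteq> f \<longrightarrow> g \<in> K)"

lemma keys_add_nat: "keys (m + n :: 'v mon) = keys m \<union> keys n"
  by (auto simp: in_keys_iff lookup_add)

lemma faces_add: "dcl K \<Longrightarrow> m + n \<in> faces K \<Longrightarrow> m \<in> faces K"
  by (auto simp: dcl_def faces_def keys_add_nat)

lemma smul_times: fixes f g :: "'v mon \<Rightarrow>\<^sub>0 'k::field"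
  shows "(c \<bullet> f) * g = c \<bullet> (f * g)" "f * (c \<bullet> g) = c \<bullet> (f * g)"
  by (simp_all add: smul_def mult_map_scale_conv_mult ac_simps)

lemma restr_zero [simp]: "restr Y 0 = 0" by (rule lin_0[OF lin_restr])

lemma bilin_times: "bilin (\<lambda>f g :: 'v mon \<Rightarrow>\<^sub>0 'k::field. f * g)"
  by (auto simp: bilin_def intro!: linI simp: algebra_simps smul_times)

lemma bilin_comp: "lin h \<Longrightarrow> bilin m \<Longrightarrow> bilin (\<lambda>f g. h (m f g))"
  by (auto simp: bilin_def intro: lin_comp)

lemma bilin_restr_times: "bilin (\<lambda>f g :: 'v mon \<Rightarrow>\<^sub>0 'k::field. restr Y (f * g))"
  by (rule bilin_comp[OF lin_restr bilin_times])

lemma bas_times [simp]: "(bas m :: 'v mon \<Rightarrow>\<^sub>0 'k::field) * bas n = bas (m + n)"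
  by (simp add: mult_single)

text \<open>Faces are closed under subsets, hence the monomials outside \<open>faces K\<close> span
  an ideal, and reduction before a product changes nothing after it.\<close>

lemma restr_times:
  fixes f g :: "'v mon \<Rightarrow>\<^sub>0 'k::field"
  assumes "dcl K" shows "restr (faces K) (restr (faces K) f * g) = restr (faces K) (f * g)"
    and "restr (faces K) (f * restr (faces K) g) = restr (faces K) (f * g)"
proof -
  have 1: "restr (faces K) (restr (faces K) f * g) = restr (faces K) (f * g)" for f g :: "'v mon \<Rightarrow>\<^sub>0 'k"
  proof (rule bilin_eq_keys[OF _ bilin_restr_times, of "\<lambda>f g. restr (faces K) (restr (faces K) f * g)"])
    show "bilin (\<lambda>f g :: 'v mon \<Rightarrow>\<^sub>0 'k. restr (faces K) (restr (faces K) f * g))"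
      unfolding bilin_def
      by (intro conjI allI lin_comp[OF bilin_left[OF bilin_restr_times] lin_restr] bilin_right[OF bilin_restr_times])
  qed (use faces_add[OF assms] in auto)
  show "restr (faces K) (restr (faces K) f * g) = restr (faces K) (f * g)" by (rule 1)
  show "restr (faces K) (f * restr (faces K) g) = restr (faces K) (f * g)"
    using 1[of g f] by (simp add: mult.commute)
qed

lemma mwt_0 [simp]: "mwt 0 = 0" and mwt_add: "mwt (m + n) = mwt m + mwt n"
  by (auto simp: mwt_def lookup_add)

lemma hidx_SR: "hidx (SR K) n w = {m \<in> faces K. n = 0 \<and> mwt m = w}"
  by (auto simp: hidx_def)

lemma sg_SR [simp]: "sg (SR K) f = f"
  by (rule lin_eqI[OF lin_sg lin_id]) simp

text \<open>
  Since \<open>e\<close> vanishes in nonzero degrees, no signs occur in the Leibniz rule.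
\<close>

definition bder :: "('x, 'k::field_char_0, 'v \<Rightarrow> int) balg \<Rightarrow> 'v set set \<Rightarrow> (('x \<Rightarrow>\<^sub>0 'k) \<Rightarrow> ('v mon \<Rightarrow>\<^sub>0 'k)) \<Rightarrow>
    ('v \<Rightarrow> int) \<Rightarrow> int \<Rightarrow> (('x \<Rightarrow>\<^sub>0 'k) \<Rightarrow> ('v mon \<Rightarrow>\<^sub>0 'k)) set" where
  "bder A L e c i = {\<phi>. lin \<phi> \<and>
     (\<forall>x y. \<phi> (bmul A x y) = restr (faces L) (\<phi> x * e y) + restr (faces L) (e x * \<phi> y)) \<and>
     (\<forall>x. \<not> (x \<in> bidx A \<and> bdeg A x = i) \<longrightarrow> \<phi> (bas x) = 0) \<and>
     (\<forall>x. keys (\<phi> (bas x)) \<subseteq> {m \<in> faces L. mwt m = bwt A x + c})}"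

lemma bderD: assumes "\<phi> \<in> bder A L e c i"
  shows bder_lin: "lin \<phi>"
    and bder_mul: "\<phi> (bmul A x y) = restr (faces L) (\<phi> x * e y) + restr (faces L) (e x * \<phi> y)"
    and bder_off: "\<not> (z \<in> bidx A \<and> bdeg A z = i) \<Longrightarrow> \<phi> (bas z) = 0"
    and bder_keys: "keys (\<phi> (bas z)) \<subseteq> {m \<in> faces L. mwt m = bwt A z + c}"
  using assms by (auto simp: bder_def)

lemma bder_hom:
  assumes "\<phi> \<in> bder A L e c i" "keys f \<subseteq> hidx A n w"
  shows "keys (\<phi> f) \<subseteq> {m \<in> faces L. mwt m = w + c}"
  by (rule lin_keys[OF bder_lin[OF assms(1)]]) (use assms(2) bder_keys[OF assms(1)] in \<open>fastforce simp: hidx_def\<close>)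

lemma bder_sg: assumes "\<phi> \<in> bder A L e c i" shows "\<phi> (sg A x) = koszul_sign i \<bullet> \<phi> x"
proof (rule lin_eqI[OF lin_comp[OF bder_lin[OF assms] lin_sg] lin_smulI[OF bder_lin[OF assms]]])
  fix z show "\<phi> (sg A (bas z)) = koszul_sign i \<bullet> \<phi> (bas z)"
    using bder_off[OF assms, of z] by (cases "bdeg A z = i") (simp_all add: lin_smul[OF bder_lin[OF assms]])
qed

lemma bder_comp:
  assumes \<phi>: "\<phi> \<in> bder B L e c i" and h: "ghom A B h"
  shows "(\<lambda>x. \<phi> (h x)) \<in> bder A L (\<lambda>x. e (h x)) c i"
  unfolding bder_def
proof (intro CollectI conjI allI impI)
  show "lin (\<lambda>x. \<phi> (h x))" by (rule lin_comp[OF bder_lin[OF \<phi>] ghom_lin[OF h]])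
  show "\<phi> (h (bmul A x y)) = restr (faces L) (\<phi> (h x) * e (h y)) + restr (faces L) (e (h x) * \<phi> (h y))" for x y
    by (simp add: ghom_mul[OF h] bder_mul[OF \<phi>])
  show "\<phi> (h (bas x)) = 0" if "\<not> (x \<in> bidx A \<and> bdeg A x = i)" for x
  proof (cases "x \<in> bidx A")
    case True
    show ?thesis by (rule lin_eq_keys[OF bder_lin[OF \<phi>] lin_zero])
        (use ghom_keys[OF h, of x] bder_off[OF \<phi>] that True in \<open>auto simp: hidx_def\<close>)
  qed (simp add: ghom_off[OF h] lin_0[OF bder_lin[OF \<phi>]])
  show "keys (\<phi> (h (bas x))) \<subseteq> {m \<in> faces L. mwt m = bwt A x + c}" for x
    by (rule bder_hom[OF \<phi> ghom_keys[OF h]])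
qed

lemma bilin_sum:
  assumes "bilin m" shows "m (sum a F) (sum b F') = (\<Sum>i\<in>F. \<Sum>j\<in>F'. m (a i) (b j))"
  by (simp add: lin_sum[OF bilin_left[OF assms]] lin_sum[OF bilin_right[OF assms]]) (rule sum.swap)

text \<open>The derivation sought is, up to sign, \<open>\<phi>\<close> applied to the integral of
  the homotopy. The homotopy comes from \<open>e\<close>, with respect to which \<open>B\<close> is
  acyclic, whereas the coefficients are taken along \<open>e'\<close>. Keeping the two apart allows
  coefficients in the ring of a link on a resolution of the ring of \<open>K\<close>.\<close>

theorem homotopy_der:
  fixes A :: "('x, 'k::field_char_0, 'v \<Rightarrow> int) balg" and B :: "('y, 'k, 'v \<Rightarrow> int) balg"
  assumes "free_balg A G word" and B: "balg B" and f: "bhom A B f0" "bhom A B f1"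
    and e: "lin e" "\<And>z. bdeg B z \<noteq> 0 \<Longrightarrow> e (bas z) = 0"
    and acyc: "\<And>x. keys x \<subseteq> bidx B \<Longrightarrow> bdif B x = 0 \<Longrightarrow> e x = 0 \<Longrightarrow> \<exists>y. keys y \<subseteq> bidx B \<and> bdif B y = x"
    and ee: "\<And>x. e (f0 x) = e (f1 x)"
    and e': "bhom B (SR L) e'" and \<phi>: "\<phi> \<in> bder B L e' c i" and cyc: "\<And>x. \<phi> (bdif B x) = 0"
  shows "\<exists>\<psi>\<in>bder A L (\<lambda>x. e' (f0 x)) c (i - 1). \<forall>x. \<phi> (f1 x) - \<phi> (f0 x) = \<psi> (bdif A x)"
proof -
  interpret free_balg A G word by fact
  interpret P: path_balg B using B by (simp add: path_balg_def)
  obtain h where h: "bhom A P.PT h" and ev: "\<And>x. P.ev0 (h x) = f0 x" "\<And>x. P.ev1 (h x) = f1 x"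
    using homotopy_ex[OF B f e acyc ee] by blast
  note hl = bhom_lin[OF h] and el = bhom_lin[OF e'] and pl = bder_lin[OF \<phi>]
  let ?r = "restr (faces L) :: ('v mon \<Rightarrow>\<^sub>0 'k) \<Rightarrow> _"
  let ?F = "\<lambda>y. \<phi> (P.pI y)"
  have e'0: "e' u = 0" if "keys u \<subseteq> hidx B n w" "n \<noteq> 0" for u n w
    using ghom_hom[OF bhom_ghom[OF e'] that(1)] that(2) by (simp add: hidx_SR)
  have e'd: "e' (bdif B u) = 0" for u by (simp add: bhom_dif[OF e'])
  have e'sg: "e' (sg B u) = e' u" for u by (simp add: ghom_sg[OF bhom_ghom[OF e']])
  \<comment> \<open>The augmentation \<open>e'\<close> is constant along the homotopy. In nonzero
    degree it vanishes; an element of degree zero is closed, so by \<open>cf_dif\<close> its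
    \<open>t^k\<close>-coefficient, multiplied by \<open>k \<ge> 1\<close>, is a boundary up to
    sign, and boundaries go to zero.\<close>
  have cf0: "e' (P.cf m (h x)) = 0" if m: "m \<in> pM0" "m \<noteq> (0, False)" for m x
  proof (rule lin_eqI[OF lin_comp[OF el lin_comp[OF P.val_lin(3) hl]] lin_zero])
    fix z show "e' (P.cf m (h (bas z))) = 0"
    proof (cases "z \<in> bidx A")
      case z: True
      have k: "keys (P.cf m (h (bas z))) \<subseteq> hidx B (bdeg A z + (if snd m then 1 else 0)) (bwt A z)" for m
        by (rule P.val_hom[OF ghom_keys[OF bhom_ghom[OF h]]])
      show ?thesis
      proof (cases "snd m \<or> bdeg A z \<noteq> 0")
        case True
        then show ?thesis using e'0[OF k[of m]] deg_nonneg[OF z] by auto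
      next
        case False
        then obtain k where mm: "m = (k, False)" "1 \<le> k" using m by (cases m) auto
        have "keys (bdif A (bas z)) \<subseteq> {}"
          using dif_keys[of z] deg_nonneg False by (force simp: hidx_def)
        then have "P.tlift P.pD (h (bas z)) = 0" using bhom_dif[OF h, of "bas z"] by (simp add: lin_0[OF hl])
        then have "e' (bdif B (P.cf (k, True) (h (bas z))) + of_nat k \<bullet> sg B (P.cf (k, False) (h (bas z)))) = 0"
          using P.cf_dif[OF mm(2), of "h (bas z)"] by (simp add: P.val_simps lin_0[OF el])
        then have "of_nat k \<bullet> e' (P.cf (k, False) (h (bas z))) = 0"
          by (simp add: lin_simps[OF el] e'd e'sg)
        then show ?thesis using mm by (simp add: smul_eq_0)
      qed
    qed (simp add: ghom_off[OF bhom_ghom[OF h]] P.val_simps lin_0[OF el])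
  qed
  \<comment> \<open>Integration does not commute with products in general. Here \<open>e'\<close>
    sees only the constant coefficients of the two paths, so each integral gets multiplied by a
    constant and the Leibniz rule survives.\<close>
  have leib: "?F (P.tmul (h x) (h y)) = ?r (?F (h x) * e' (P.ev0 (h y))) + ?r (e' (P.ev0 (h x)) * ?F (h y))" for x y
  proof -
    define F where "F = snd ` keys (h x) \<union> snd ` keys (h y)"
    have sub: "keys (h u) \<subseteq> P.tidx" for u
      by (rule lin_keys[OF hl]) (use ghom_keys[OF bhom_ghom[OF h]] in \<open>auto simp: hidx_def\<close>)
    have F: "finite F" "F \<subseteq> pM0"
      using sub[of x] sub[of y] by (auto simp: F_def elim!: P.tidxE)
    have dx: "h x = (\<Sum>m\<in>F. P.emb m (P.cf m (h x)))" and dy: "h y = (\<Sum>m\<in>F. P.emb m (P.cf m (h y)))"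
      by (rule P.decomp[OF sub F(1)], simp add: F_def)+
    let ?L = "\<lambda>u v. ?F (P.tmul u v)"
    let ?R = "\<lambda>u v. ?r (?F u * e' (P.ev0 v)) + ?r (e' (P.ev0 u) * ?F v)"
    have Fl: "lin ?F" and El: "lin (\<lambda>u. e' (P.ev0 u))"
      by (intro lin_comp[OF pl P.val_lin(5)] lin_comp[OF el P.val_lin(1)])+
    have bL: "bilin ?L" by (rule bilin_comp[OF Fl P.bilin_tmul])
    have bR: "bilin ?R" unfolding bilin_def
      by (intro conjI allI lin_addI lin_comp[OF bilin_left[OF bilin_restr_times] Fl] lin_comp[OF bilin_right[OF bilin_restr_times] Fl]
          lin_comp[OF bilin_left[OF bilin_restr_times] El] lin_comp[OF bilin_right[OF bilin_restr_times] El])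
    have trm: "?L (P.emb m f) (P.emb m' g) = ?R (P.emb m f) (P.emb m' g)"
      if m: "m \<in> pM0" "m' \<in> pM0" and ff: "keys f \<subseteq> bidx B" "keys g \<subseteq> bidx B"
        and e0: "m \<noteq> (0, False) \<Longrightarrow> e' f = 0" "m' \<noteq> (0, False) \<Longrightarrow> e' g = 0" for m m' f g
    proof -
      obtain i \<alpha> j \<beta> where mm: "m = (i, \<alpha>)" "m' = (j, \<beta>)" by (metis prod.exhaust)
      show ?thesis
        using m e0 unfolding mm
        by (cases \<alpha>; cases \<beta>; cases "i = 0"; cases "j = 0")
          (simp_all add: P.tmul_emb P.val_emb restr_id[OF ff(1)] restr_id[OF ff(2)] P.restr_mul P.sgb_def
            lin_simps[OF pl] lin_simps[OF el] bder_mul[OF \<phi>] e'sg P.val_simps smul_times lin_simps[OF lin_restr])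
    qed
    have sub_cf: "keys (P.cf m u) \<subseteq> bidx B" for m u
      by (rule lin_keys[OF P.val_lin(3)], rename_tac z, case_tac "z \<in> P.tidx")
        (auto simp: P.cf_def P.tlift_def keys_restr split: if_splits)
    have "?L (h x) (h y) = (\<Sum>m\<in>F. \<Sum>m'\<in>F. ?L (P.emb m (P.cf m (h x))) (P.emb m' (P.cf m' (h y))))"
      by (subst dx, subst dy) (rule bilin_sum[OF bL])
    also have "\<dots> = (\<Sum>m\<in>F. \<Sum>m'\<in>F. ?R (P.emb m (P.cf m (h x))) (P.emb m' (P.cf m' (h y))))"
      by (intro sum.cong refl trm sub_cf) (use F(2) cf0 in auto)
    also have "\<dots> = ?R (\<Sum>m\<in>F. P.emb m (P.cf m (h x))) (\<Sum>m\<in>F. P.emb m (P.cf m (h y)))"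
      by (rule bilin_sum[OF bR, symmetric])
    also have "\<dots> = ?R (h x) (h y)" by (simp only: dx[symmetric] dy[symmetric])
    finally show ?thesis .
  qed
  \<comment> \<open>The factor \<open>koszul_sign i\<close> cancels the sign that
    \<open>\<phi>\<close> produces from the involution in \<open>pI_dif\<close>.\<close>
  define \<psi> where "\<psi> x = koszul_sign i \<bullet> \<phi> (P.pI (h x))" for x
  have "\<psi> \<in> bder A L (\<lambda>x. e' (f0 x)) c (i - 1)"
    unfolding bder_def
  proof (intro CollectI conjI allI impI)
    show "lin \<psi>" unfolding \<psi>_def by (intro lin_smulI lin_comp[OF pl] lin_comp[OF P.val_lin(5)] hl)
    show "\<psi> (bmul A x y) = ?r (\<psi> x * e' (f0 y)) + ?r (e' (f0 x) * \<psi> y)" for x y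
      by (simp add: \<psi>_def ghom_mul[OF bhom_ghom[OF h]] leib ev smul_simps smul_times lin_simps[OF lin_restr])
    fix z
    have k: "keys (P.pI (h (bas z))) \<subseteq> hidx B (bdeg A z + 1) (bwt A z)"
      by (rule P.val_hom[OF ghom_keys[OF bhom_ghom[OF h]]])
    show "keys (\<psi> (bas z)) \<subseteq> {m \<in> faces L. mwt m = bwt A z + c}"
      unfolding \<psi>_def by (intro keys_smulI bder_hom[OF \<phi> k])
    show "\<psi> (bas z) = 0" if "\<not> (z \<in> bidx A \<and> bdeg A z = i - 1)"
    proof (cases "z \<in> bidx A")
      case True
      have "\<phi> (P.pI (h (bas z))) = 0"
        by (rule lin_eq_keys[OF pl lin_zero]) (use k that True bder_off[OF \<phi>] in \<open>auto simp: hidx_def\<close>)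
      then show ?thesis by (simp add: \<psi>_def)
    qed (simp add: \<psi>_def ghom_off[OF bhom_ghom[OF h]] P.val_simps lin_0[OF pl])
  qed
  moreover have "\<phi> (f1 x) - \<phi> (f0 x) = \<psi> (bdif A x)" for x
  proof -
    have "\<psi> (bdif A x) = koszul_sign i \<bullet> \<phi> (sg B (f1 x - f0 x))"
      using P.pI_dif[of "h x"] bhom_dif[OF h, of x] by (simp add: \<psi>_def ev lin_add[OF pl] cyc)
    also have "\<dots> = \<phi> (f1 x) - \<phi> (f0 x)"
      by (simp add: bder_sg[OF \<phi>] smul_simps lin_diff[OF pl] koszul_sign_def)
    finally show ?thesis by simp
  qed
  ultimately show ?thesis by blast
qed

section \<open>Cohomology and independence of the resolution\<close>

definition bcoc where
  "bcoc A L e c i = {\<phi> \<in> bder A L e c i. \<forall>x. \<phi> (bdif A x) = 0}"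

text \<open>The sign in the differential of the derivation complex is omitted; it changes neither
  the cocycles nor the set of coboundaries.\<close>

definition bcob where
  "bcob A L e c i = {\<phi>. \<exists>\<psi>\<in>bder A L e c (i - 1). \<phi> = (\<lambda>x. \<psi> (bdif A x))}"

definition linclosed :: "('a \<Rightarrow> ('y \<Rightarrow>\<^sub>0 'k::field)) set \<Rightarrow> bool" where
  "linclosed Z \<longleftrightarrow> (\<lambda>x. 0) \<in> Z \<and> (\<forall>\<phi>\<in>Z. \<forall>\<psi>\<in>Z. (\<lambda>x. \<phi> x + \<psi> x) \<in> Z) \<and> (\<forall>c. \<forall>\<phi>\<in>Z. (\<lambda>x. c \<bullet> \<phi> x) \<in> Z)"

lemma linclosed_diff: "linclosed Z \<Longrightarrow> \<phi> \<in> Z \<Longrightarrow> \<psi> \<in> Z \<Longrightarrow> (\<lambda>x. \<phi> x - \<psi> x) \<in> Z"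
proof -
  assume Z: "linclosed Z" "\<phi> \<in> Z" "\<psi> \<in> Z"
  then have "(\<lambda>x. (- 1) \<bullet> \<psi> x) \<in> Z" unfolding linclosed_def by blast
  then have "(\<lambda>x. \<phi> x + (- 1) \<bullet> \<psi> x) \<in> Z" using Z unfolding linclosed_def by fast
  then show ?thesis by simp
qed

text \<open>
  An isomorphism of \<open>Z1 / B1\<close> with \<open>Z2 / B2\<close>, given as a linear relation; in this form it is
  evidently symmetric.
\<close>

definition hiso :: "('a \<Rightarrow> ('y \<Rightarrow>\<^sub>0 'k::field)) set \<Rightarrow> ('a \<Rightarrow> ('y \<Rightarrow>\<^sub>0 'k)) set \<Rightarrow>
    ('b \<Rightarrow> ('y \<Rightarrow>\<^sub>0 'k)) set \<Rightarrow> ('b \<Rightarrow> ('y \<Rightarrow>\<^sub>0 'k)) set \<Rightarrow> bool" where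
  "hiso Z1 B1 Z2 B2 \<longleftrightarrow> (\<exists>R. (\<forall>\<phi>\<in>Z1. \<exists>\<psi>\<in>Z2. R \<phi> \<psi>) \<and> (\<forall>\<psi>\<in>Z2. \<exists>\<phi>\<in>Z1. R \<phi> \<psi>) \<and>
     (\<forall>\<phi>\<in>Z1. \<forall>\<psi>\<in>Z2. R \<phi> \<psi> \<longrightarrow> (\<phi> \<in> B1 \<longleftrightarrow> \<psi> \<in> B2)) \<and>
     (\<forall>\<phi> \<phi>' \<psi> \<psi>'. R \<phi> \<psi> \<longrightarrow> R \<phi>' \<psi>' \<longrightarrow> R (\<lambda>x. \<phi> x + \<phi>' x) (\<lambda>x. \<psi> x + \<psi>' x)) \<and>
     (\<forall>c \<phi> \<psi>. R \<phi> \<psi> \<longrightarrow> R (\<lambda>x. c \<bullet> \<phi> x) (\<lambda>x. c \<bullet> \<psi> x)))"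

lemma hiso_sym: "hiso Z1 B1 Z2 B2 \<Longrightarrow> hiso Z2 B2 Z1 B1"
  unfolding hiso_def by (elim exE, rule_tac x = "\<lambda>a b. R b a" in exI) blast

text \<open>The composite relation runs through elements of \<open>Z2\<close>; for it to be linear,
  sums and multiples of such elements must stay in \<open>Z2\<close>.\<close>

lemma hiso_trans:
  assumes "hiso Z1 B1 Z2 B2" "hiso Z2 B2 Z3 B3" "linclosed Z2"
  shows "hiso Z1 B1 Z3 B3"
proof -
  obtain R where R: "\<forall>\<phi>\<in>Z1. \<exists>\<psi>\<in>Z2. R \<phi> \<psi>" "\<forall>\<psi>\<in>Z2. \<exists>\<phi>\<in>Z1. R \<phi> \<psi>"
     "\<forall>\<phi>\<in>Z1. \<forall>\<psi>\<in>Z2. R \<phi> \<psi> \<longrightarrow> (\<phi> \<in> B1 \<longleftrightarrow> \<psi> \<in> B2)"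
     "\<forall>\<phi> \<phi>' \<psi> \<psi>'. R \<phi> \<psi> \<longrightarrow> R \<phi>' \<psi>' \<longrightarrow> R (\<lambda>x. \<phi> x + \<phi>' x) (\<lambda>x. \<psi> x + \<psi>' x)"
     "\<forall>c \<phi> \<psi>. R \<phi> \<psi> \<longrightarrow> R (\<lambda>x. c \<bullet> \<phi> x) (\<lambda>x. c \<bullet> \<psi> x)"
    using assms(1) unfolding hiso_def by blast
  obtain S where S: "\<forall>\<phi>\<in>Z2. \<exists>\<psi>\<in>Z3. S \<phi> \<psi>" "\<forall>\<psi>\<in>Z3. \<exists>\<phi>\<in>Z2. S \<phi> \<psi>"
     "\<forall>\<phi>\<in>Z2. \<forall>\<psi>\<in>Z3. S \<phi> \<psi> \<longrightarrow> (\<phi> \<in> B2 \<longleftrightarrow> \<psi> \<in> B3)"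
     "\<forall>\<phi> \<phi>' \<psi> \<psi>'. S \<phi> \<psi> \<longrightarrow> S \<phi>' \<psi>' \<longrightarrow> S (\<lambda>x. \<phi> x + \<phi>' x) (\<lambda>x. \<psi> x + \<psi>' x)"
     "\<forall>c \<phi> \<psi>. S \<phi> \<psi> \<longrightarrow> S (\<lambda>x. c \<bullet> \<phi> x) (\<lambda>x. c \<bullet> \<psi> x)"
    using assms(2) unfolding hiso_def by blast
  define T where "T \<phi> \<chi> \<longleftrightarrow> (\<exists>\<psi>\<in>Z2. R \<phi> \<psi> \<and> S \<psi> \<chi>)" for \<phi> \<chi>
  show ?thesis unfolding hiso_def
  proof (intro exI[of _ T] conjI)
    show "\<forall>\<phi>\<in>Z1. \<exists>\<psi>\<in>Z3. T \<phi> \<psi>" "\<forall>\<psi>\<in>Z3. \<exists>\<phi>\<in>Z1. T \<phi> \<psi>"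
      using R(1,2) S(1,2) unfolding T_def by blast+
    show "\<forall>\<phi>\<in>Z1. \<forall>\<psi>\<in>Z3. T \<phi> \<psi> \<longrightarrow> (\<phi> \<in> B1 \<longleftrightarrow> \<psi> \<in> B3)"
      using R(3) S(3) unfolding T_def by blast
    show "\<forall>\<phi> \<phi>' \<psi> \<psi>'. T \<phi> \<psi> \<longrightarrow> T \<phi>' \<psi>' \<longrightarrow> T (\<lambda>x. \<phi> x + \<phi>' x) (\<lambda>x. \<psi> x + \<psi>' x)"
    proof (intro allI impI)
      fix \<phi> \<phi>' \<psi> \<psi>' assume "T \<phi> \<psi>" "T \<phi>' \<psi>'"
      then obtain a b where "a \<in> Z2" "b \<in> Z2" "R \<phi> a" "S a \<psi>" "R \<phi>' b" "S b \<psi>'" unfolding T_def by blast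
      then show "T (\<lambda>x. \<phi> x + \<phi>' x) (\<lambda>x. \<psi> x + \<psi>' x)" unfolding T_def
        using assms(3) R(4) S(4) by (intro bexI[of _ "\<lambda>x. a x + b x"]) (auto simp: linclosed_def)
    qed
    show "\<forall>c \<phi> \<psi>. T \<phi> \<psi> \<longrightarrow> T (\<lambda>x. c \<bullet> \<phi> x) (\<lambda>x. c \<bullet> \<psi> x)"
    proof (intro allI impI)
      fix c \<phi> \<psi> assume "T \<phi> \<psi>"
      then obtain a where "a \<in> Z2" "R \<phi> a" "S a \<psi>" unfolding T_def by blast
      then show "T (\<lambda>x. c \<bullet> \<phi> x) (\<lambda>x. c \<bullet> \<psi> x)" unfolding T_def
        using assms(3) R(5) S(5) by (intro bexI[of _ "\<lambda>x. c \<bullet> a x"]) (auto simp: linclosed_def)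
    qed
  qed
qed

text \<open>A linear map on cocycles becomes the relation of being its value up to a coboundary. It
  then suffices to invert the map up to coboundaries.\<close>

lemma hiso_fun:
  assumes F: "\<And>\<phi> \<psi>. F (\<lambda>x. \<phi> x + \<psi> x) = (\<lambda>x. F \<phi> x + F \<psi> x)" "\<And>c \<phi>. F (\<lambda>x. c \<bullet> \<phi> x) = (\<lambda>x. c \<bullet> F \<phi> x)"
    and Z: "\<And>\<phi>. \<phi> \<in> Z1 \<Longrightarrow> F \<phi> \<in> Z2" and B: "\<And>\<phi>. \<phi> \<in> Z1 \<Longrightarrow> F \<phi> \<in> B2 \<longleftrightarrow> \<phi> \<in> B1"
    and surj: "\<And>\<psi>. \<psi> \<in> Z2 \<Longrightarrow> \<exists>\<phi>\<in>Z1. (\<lambda>x. \<psi> x - F \<phi> x) \<in> B2"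
    and B2: "linclosed B2"
  shows "hiso Z1 B1 Z2 B2"
  unfolding hiso_def
proof (intro exI[of _ "\<lambda>\<phi> \<psi>. (\<lambda>x. \<psi> x - F \<phi> x) \<in> B2"] conjI ballI allI impI)
  show "\<exists>\<psi>\<in>Z2. (\<lambda>x. \<psi> x - F \<phi> x) \<in> B2" if "\<phi> \<in> Z1" for \<phi>
    using B2 Z[OF that] by (intro bexI[of _ "F \<phi>"]) (simp_all add: linclosed_def)
  show "\<exists>\<phi>\<in>Z1. (\<lambda>x. \<psi> x - F \<phi> x) \<in> B2" if "\<psi> \<in> Z2" for \<psi> by (rule surj[OF that])
  show "\<phi> \<in> B1 \<longleftrightarrow> \<psi> \<in> B2" if "\<phi> \<in> Z1" "\<psi> \<in> Z2" and d: "(\<lambda>x. \<psi> x - F \<phi> x) \<in> B2" for \<phi> \<psi>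
  proof -
    have "\<psi> \<in> B2 \<longleftrightarrow> F \<phi> \<in> B2"
    proof
      assume "\<psi> \<in> B2"
      from linclosed_diff[OF B2 this d] show "F \<phi> \<in> B2" by simp
    next
      assume "F \<phi> \<in> B2"
      then have "(\<lambda>x. (\<psi> x - F \<phi> x) + F \<phi> x) \<in> B2" using d B2 unfolding linclosed_def by fast
      then show "\<psi> \<in> B2" by simp
    qed
    then show ?thesis using B[OF that(1)] by simp
  qed
  show "(\<lambda>x. (\<psi> x + \<psi>' x) - F (\<lambda>x. \<phi> x + \<phi>' x) x) \<in> B2"
    if "(\<lambda>x. \<psi> x - F \<phi> x) \<in> B2" "(\<lambda>x. \<psi>' x - F \<phi>' x) \<in> B2" for \<phi> \<phi>' \<psi> \<psi>'
  proof -
    have "(\<lambda>x. (\<psi> x - F \<phi> x) + (\<psi>' x - F \<phi>' x)) \<in> B2" using that B2 unfolding linclosed_def by fast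
    then show ?thesis by (simp add: F algebra_simps)
  qed
  show "(\<lambda>x. c \<bullet> \<psi> x - F (\<lambda>x. c \<bullet> \<phi> x) x) \<in> B2" if "(\<lambda>x. \<psi> x - F \<phi> x) \<in> B2" for c \<phi> \<psi>
  proof -
    have "(\<lambda>x. c \<bullet> (\<psi> x - F \<phi> x)) \<in> B2" using that B2 unfolding linclosed_def by fast
    then show ?thesis by (simp add: F smul_simps)
  qed
qed

lemma linclosed_bder: "linclosed (bder A L e c i)"
  unfolding linclosed_def
proof (intro conjI ballI allI)
  show "(\<lambda>x. 0) \<in> bder A L e c i" by (simp add: bder_def lin_zero)
  show "(\<lambda>x. \<phi> x + \<psi> x) \<in> bder A L e c i" if p: "\<phi> \<in> bder A L e c i" "\<psi> \<in> bder A L e c i" for \<phi> \<psi>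
    unfolding bder_def
    using keys_addI[OF bder_keys[OF p(1)] bder_keys[OF p(2)]]
    by (auto simp: bder_mul[OF p(1)] bder_mul[OF p(2)] algebra_simps lin_add[OF lin_restr]
        bder_off[OF p(1)] bder_off[OF p(2)] intro!: lin_addI bder_lin[OF p(1)] bder_lin[OF p(2)])
  show "(\<lambda>x. a \<bullet> \<phi> x) \<in> bder A L e c i" if p: "\<phi> \<in> bder A L e c i" for a \<phi>
    unfolding bder_def
    using keys_smulI[OF bder_keys[OF p]]
    by (auto simp: bder_mul[OF p] smul_simps smul_times lin_smul[OF lin_restr]
        bder_off[OF p] intro!: lin_smulI bder_lin[OF p])
qed

lemma linclosed_bcoc: "linclosed (bcoc A L e c i)"
  using linclosed_bder[of A L e c i] unfolding linclosed_def bcoc_def by simp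

lemma linclosed_bcob: "linclosed (bcob A L e c i)"
  unfolding linclosed_def
proof (intro conjI ballI allI)
  note l = linclosed_bder[of A L e c "i - 1", unfolded linclosed_def]
  show "(\<lambda>x. 0) \<in> bcob A L e c i" unfolding bcob_def using l by (auto intro!: bexI[of _ "\<lambda>x. 0"])
  show "(\<lambda>x. \<phi> x + \<psi> x) \<in> bcob A L e c i" if p: "\<phi> \<in> bcob A L e c i" "\<psi> \<in> bcob A L e c i" for \<phi> \<psi>
  proof -
    obtain a b where "a \<in> bder A L e c (i - 1)" "b \<in> bder A L e c (i - 1)" "\<phi> = (\<lambda>x. a (bdif A x))"
      "\<psi> = (\<lambda>x. b (bdif A x))" using p unfolding bcob_def by blast
    then show ?thesis unfolding bcob_def using l by (auto intro!: bexI[of _ "\<lambda>x. a x + b x"])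
  qed
  show "(\<lambda>x. k \<bullet> \<phi> x) \<in> bcob A L e c i" if p: "\<phi> \<in> bcob A L e c i" for k \<phi>
  proof -
    obtain a where "a \<in> bder A L e c (i - 1)" "\<phi> = (\<lambda>x. a (bdif A x))" using p unfolding bcob_def by blast
    then show ?thesis unfolding bcob_def using l by (auto intro!: bexI[of _ "\<lambda>x. k \<bullet> a x"])
  qed
qed

lemma bcoc_comp:
  assumes "\<phi> \<in> bcoc B L e c i" "bhom A B h"
  shows "(\<lambda>x. \<phi> (h x)) \<in> bcoc A L (\<lambda>x. e (h x)) c i"
  using assms bder_comp[of \<phi> B L e c i A h] by (auto simp: bcoc_def bhom_ghom bhom_dif)

lemma bcob_comp:
  assumes "\<phi> \<in> bcob B L e c i" "bhom A B h"
  shows "(\<lambda>x. \<phi> (h x)) \<in> bcob A L (\<lambda>x. e (h x)) c i"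
proof -
  obtain \<psi> where \<psi>: "\<psi> \<in> bder B L e c (i - 1)" "\<phi> = (\<lambda>x. \<psi> (bdif B x))" using assms(1) by (auto simp: bcob_def)
  show ?thesis unfolding bcob_def \<psi>(2)
    by (intro CollectI bexI[OF _ bder_comp[OF \<psi>(1) bhom_ghom[OF assms(2)]]]) (simp add: bhom_dif[OF assms(2)])
qed

section \<open>Resolutions of Stanley-Reisner rings in coordinates, and lifts between them\<close>

lemma mwt_neg: "m \<in> faces K \<Longrightarrow> mwt m v < 0 \<Longrightarrow> False" by (simp add: mwt_def)

text \<open>A multigraded Koszul-Tate resolution of the ring of \<open>K\<close>: since
  \<open>e_hom\<close> sends boundaries to zero, \<open>acyc\<close> and \<open>surj\<close> make
  \<open>e\<close> a quasi-isomorphism.\<close>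

locale bresol = free_balg A G word for A :: "('x, 'k::field_char_0, 'v \<Rightarrow> int) balg" and G word +
  fixes K :: "'v set set" and e
  assumes dcl: "dcl K" and e_hom: "bhom A (SR K) e"
    and acyc: "keys x \<subseteq> bidx A \<Longrightarrow> bdif A x = 0 \<Longrightarrow> e x = 0 \<Longrightarrow> \<exists>y. keys y \<subseteq> bidx A \<and> bdif A y = x"
    and surj: "keys s \<subseteq> faces K \<Longrightarrow> \<exists>x. keys x \<subseteq> bidx A \<and> e x = s"
begin

lemmas e_lin = bhom_lin[OF e_hom] and e_ghom = bhom_ghom[OF e_hom]
lemmas e_simps = lin_simps[OF e_lin]

lemma e_keys: "keys (e (bas x)) \<subseteq> {m \<in> faces K. bdeg A x = 0 \<and> mwt m = bwt A x}"
  using ghom_keys[OF e_ghom] by (simp add: hidx_SR)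

lemma e_deg: "bdeg A x \<noteq> 0 \<Longrightarrow> e (bas x) = 0"
  using e_keys[of x] by simp

lemma e_neg: "bwt A x v < 0 \<Longrightarrow> e (bas x) = 0"
  using e_keys[of x] mwt_neg[of _ K v] by (metis (mono_tags, lifting) Collect_empty_eq keys_eq_empty subset_empty)

lemma e_mul: "e (bmul A x y) = restr (faces K) (e x * e y)"
  by (simp add: ghom_mul[OF e_ghom])

lemma e_dif: "e (bdif A x) = 0" by (simp add: bhom_dif[OF e_hom])
lemma e_sg: "e (sg A x) = e x" by (simp add: ghom_sg[OF e_ghom])

lemma e_restr: "e (restr (hidx A 0 w) x) = restr {m \<in> faces K. mwt m = w} (e x)"
proof (rule lin_eqI[OF lin_comp[OF e_lin lin_restr] lin_comp[OF lin_restr e_lin]])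
  fix z show "e (restr (hidx A 0 w) (bas z)) = restr {m \<in> faces K. mwt m = w} (e (bas z))"
  proof (cases "z \<in> hidx A 0 w")
    case True
    then show ?thesis using e_keys[of z] by (auto simp: hidx_def intro!: restr_id[symmetric])
  next
    case False
    then have "restr {m \<in> faces K. mwt m = w} (e (bas z)) = 0"
      using e_keys[of z] ghom_off[OF e_ghom, of z] by (cases "z \<in> bidx A") (auto simp: hidx_def intro!: restr_0)
    then show ?thesis using False by (simp add: e_simps)
  qed
qed

lemma surj_hom:
  assumes "keys s \<subseteq> {m \<in> faces K. mwt m = w}"
  shows "\<exists>x. keys x \<subseteq> hidx A 0 w \<and> e x = s"
proof -
  obtain x where "e x = s" using surj[of s] assms by blast
  then show ?thesis using e_restr[of w x] restr_id[OF assms]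
    by (intro exI[of _ "restr (hidx A 0 w) x"]) (auto simp: keys_restr)
qed

lemma acyc_hom:
  assumes "keys x \<subseteq> hidx A n w" "bdif A x = 0" "e x = 0"
  shows "\<exists>y. keys y \<subseteq> hidx A (n + 1) w \<and> bdif A y = x"
  by (rule acyclic_hom[where e = e, OF acyc assms])

lemma dif_deg_0:
  assumes "x \<in> hidx A 0 w" shows "bdif A (bas x) = 0"
proof -
  have "keys (bdif A (bas x)) \<subseteq> {}"
    using dif_keys[of x] assms deg_nonneg by (force simp: hidx_def)
  then show ?thesis by simp
qed

lemma dif_hom_0: "keys f \<subseteq> hidx A 0 w \<Longrightarrow> bdif A f = 0"
  by (rule lin_eq_keys[OF lin_dif lin_zero]) (use dif_deg_0 in blast)

end

lemma lprod_zero: "balg B \<Longrightarrow> 0 \<in> set xs \<Longrightarrow> lprod B xs = 0"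
  by (induction xs) (auto simp: balg.mul_simps)

text \<open>Besides the usual lifting, the map is made to vanish in negative weights. This is
  consistent: the augmentations vanish there, and a monomial with a negative weight component
  contains a generator with the same defect, so the boundary of such a generator also goes to zero
  once all of them do.\<close>

lemma lift_resolution:
  fixes A :: "('x, 'k::field_char_0, 'v \<Rightarrow> int) balg" and B :: "('y, 'k, 'v \<Rightarrow> int) balg"
  assumes "bresol A G word K eA" "bresol B G' word' K eB"
  shows "\<exists>h. bhom A B h \<and> (\<forall>x. eB (h x) = eA x) \<and> (\<forall>x v. bwt A x v < 0 \<longrightarrow> h (bas x) = 0)"
proof -
  interpret A: bresol A G word K eA by fact
  interpret B: bresol B G' word' K eB by fact
  have wneg: "\<exists>g\<in>set (word x). bwt A g v < 0" if "x \<in> bidx A" "bwt A x v < 0" for x v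
  proof (rule ccontr)
    have s: "(\<Sum>g\<leftarrow>ws. bwt A g) v = (\<Sum>g\<leftarrow>ws. bwt A g v)" for ws by (induction ws) simp_all
    assume "\<not> ?thesis"
    then have "0 \<le> (\<Sum>g\<leftarrow>word x. bwt A g v)" by (intro sum_list_nonneg) auto
    then show False using that(2) A.word_deg(2)[OF that(1)] s[of "word x"] by simp
  qed
  have neg0: "h (bas x) = 0" if h: "ghom A B h" and x: "bwt A x v < 0"
    and z: "\<And>g. g \<in> G \<Longrightarrow> bdeg A g \<le> bdeg A x \<Longrightarrow> bwt A g v < 0 \<Longrightarrow> h (bas g) = 0" for h x v
  proof (cases "x \<in> bidx A")
    case True
    obtain g where g: "g \<in> set (word x)" "bwt A g v < 0" using wneg[OF True x] by blast
    have "h (bas g) = 0" using z[OF _ A.word_deg_le[OF True g(1)] g(2)] A.word_sub[OF True] g(1) by blast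
    then have "0 \<in> set (map h (map bas (word x)))" using g(1) by force
    then have "lprod B (map h (map bas (word x))) = 0" by (rule lprod_zero[OF B.balg_axioms])
    then show ?thesis using ghom_lprod[OF h, of "map bas (word x)"] A.bas_word[OF True] by simp
  qed (simp add: ghom_off[OF h])
  have "\<exists>h. bhom A B h \<and> (\<forall>g\<in>G. eB (h (bas g)) = eA (bas g) \<and> (\<forall>v. bwt A g v < 0 \<longrightarrow> h (bas g) = 0))"
  proof (rule A.lifting[OF B.balg_axioms])
    fix g h assume g: "g \<in> G" and h: "ghom A B h"
      and chain: "\<And>x. x \<in> bidx A \<Longrightarrow> bdeg A x < bdeg A g \<Longrightarrow> h (bdif A (bas x)) = bdif B (h (bas x))"
      and good: "\<And>g'. g' \<in> G \<Longrightarrow> bdeg A g' < bdeg A g \<Longrightarrow>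
        eB (h (bas g')) = eA (bas g') \<and> (\<forall>v. bwt A g' v < 0 \<longrightarrow> h (bas g') = 0)"
    note hl = ghom_lin[OF h]
    let ?dg = "bdif A (bas g)"
    have low: "x \<in> bidx A \<and> bdeg A x < bdeg A g \<and> bwt A x = bwt A g" if "x \<in> keys ?dg" for x
      using A.dif_keys[of g] that by (auto simp: hidx_def)
    have "h (bdif A ?dg) = bdif B (h ?dg)"
      by (rule lin_eq_keys[OF lin_comp[OF hl A.lin_dif] lin_comp[OF B.lin_dif hl]]) (use chain low in blast)
    then have cyc: "bdif B (h ?dg) = 0" by (simp add: A.dif_dif lin_0[OF hl])
    have "eB (h ?dg) = eA ?dg"
    proof (rule lin_eq_keys[OF lin_comp[OF B.e_lin hl] A.e_lin])
      fix x assume x: "x \<in> keys ?dg"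
      show "eB (h (bas x)) = eA (bas x)"
        by (rule A.ghom_eq_bas[OF ghom_comp[OF h B.e_ghom] A.e_ghom])
          (use low[OF x] A.word_sub A.word_deg_le good in \<open>fastforce+\<close>)
    qed
    then have e0: "eB (h ?dg) = 0" by (simp add: A.e_dif)
    have hom: "keys (h ?dg) \<subseteq> hidx B (bdeg A g - 1) (bwt A g)" by (rule ghom_hom[OF h A.dif_keys])
    show "\<exists>y. keys y \<subseteq> hidx B (bdeg A g) (bwt A g) \<and> bdif B y = h ?dg \<and>
        (eB y = eA (bas g) \<and> (\<forall>v. bwt A g v < 0 \<longrightarrow> y = 0))"
    proof (cases "\<exists>v. bwt A g v < 0")
      case True
      then obtain v where v: "bwt A g v < 0" by blast
      have "h ?dg = 0"
      proof (rule lin_eq_keys[OF hl lin_zero])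
        fix x assume x: "x \<in> keys ?dg"
        show "h (bas x) = 0"
        proof (rule neg0[OF h, of x v])
          show "bwt A x v < 0" using low[OF x] v by simp
          fix g' assume "g' \<in> G" "bdeg A g' \<le> bdeg A x" "bwt A g' v < 0"
          then show "h (bas g') = 0" using good[of g'] low[OF x] by force
        qed
      qed
      then show ?thesis using A.e_neg[OF v] by (intro exI[of _ 0]) (simp add: B.dif_simps B.e_simps)
    next
      case nn: False
      show ?thesis
      proof (cases "bdeg A g = 0")
        case True
        obtain y where "keys y \<subseteq> hidx B 0 (bwt A g)" "eB y = eA (bas g)"
          using B.surj_hom[of "eA (bas g)" "bwt A g"] A.e_keys[of g] by auto
        moreover have "?dg = 0" using A.dif_deg_0[of g "bwt A g"] True A.gen_idx[OF g] by (simp add: hidx_def)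
        ultimately show ?thesis using True nn B.dif_hom_0 by (intro exI[of _ y]) (auto simp: lin_0[OF hl])
      next
        case False
        obtain y where y: "keys y \<subseteq> hidx B (bdeg A g) (bwt A g)" "bdif B y = h ?dg"
          using B.acyc_hom[OF hom cyc e0] by auto
        have "eB y = 0" by (rule lin_eq_keys[OF B.e_lin lin_zero]) (use y(1) False B.e_deg in \<open>auto simp: hidx_def\<close>)
        then show ?thesis using y nn A.e_deg[OF False] by auto
      qed
    qed
  qed
  then obtain h where h: "bhom A B h"
    and good: "\<And>g. g \<in> G \<Longrightarrow> eB (h (bas g)) = eA (bas g) \<and> (\<forall>v. bwt A g v < 0 \<longrightarrow> h (bas g) = 0)" by blast
  have "eB (h (bas x)) = eA (bas x)" for x
  proof (cases "x \<in> bidx A")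
    case True
    show ?thesis
      by (rule A.ghom_eq_bas[OF ghom_comp[OF bhom_ghom[OF h] B.e_ghom] A.e_ghom True])
        (use A.word_sub[OF True] good in blast)
  qed (simp add: ghom_off[OF bhom_ghom[OF h]] ghom_off[OF A.e_ghom] B.e_simps)
  then have "eB (h x) = eA x" for x
    by (rule lin_eqI[OF lin_comp[OF B.e_lin bhom_lin[OF h]] A.e_lin])
  moreover have "h (bas x) = 0" if "bwt A x v < 0" for x v
    by (rule neg0[OF bhom_ghom[OF h] that]) (use good in blast)
  ultimately show ?thesis using h by blast
qed

text \<open>The projection replaces the identity because homomorphisms have to vanish off the
  basis.\<close>

lemma bhom_id: "bhom A A (\<lambda>x. restr (bidx A) x)" if "balg A"
proof -
  interpret balg A by fact
  have r: "restr (bidx A) (bmul A x y) = bmul A x y" for x y by (rule restr_id[OF mul_sub])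
  have m: "bmul A (restr (bidx A) x) (restr (bidx A) y) = bmul A x y" for x y
  proof (rule bilin_eq_keys[OF _ bilin, of "\<lambda>x y. bmul A (restr (bidx A) x) (restr (bidx A) y)"])
    show "bilin (\<lambda>x y. bmul A (restr (bidx A) x) (restr (bidx A) y))" unfolding bilin_def
      by (intro conjI allI lin_comp[OF lin_mul_left lin_restr] lin_comp[OF lin_mul_right lin_restr])
  qed (auto simp: mul_simps mul_off mul_off')
  have d: "bdif A (restr (bidx A) x) = bdif A x" for x
    by (rule lin_eqI[OF lin_comp[OF lin_dif lin_restr] lin_dif]) (auto simp: dif_off dif_simps)
  show ?thesis unfolding bhom_def ghom_def
    by (auto simp: r m d restr_id[OF dif_sub] restr_id[OF one_sub] lin_restr[unfolded lin_def] lin_def hidx_def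
        lin_simps[OF lin_restr])
qed

text \<open>An endomorphism compatible with \<open>e\<close> is homotopic to the identity and so
  acts trivially on cohomology, also for coefficients along another augmentation
  \<open>e'\<close>.\<close>

lemma homotopy_endo:
  fixes A :: "('x, 'k::field_char_0, 'v \<Rightarrow> int) balg"
  assumes "bresol A G word K e" "bhom A A f" "\<And>x. e (f x) = e x"
    and "bhom A (SR L) e'" "\<phi> \<in> bcoc A L e' c i"
  shows "(\<lambda>x. \<phi> (f x) - \<phi> x) \<in> bcob A L e' c i"
proof -
  interpret bresol A G word K e by fact
  let ?id = "\<lambda>x. restr (bidx A) x"
  have \<phi>: "\<phi> \<in> bder A L e' c i" "\<And>x. \<phi> (bdif A x) = 0" using assms(5) by (auto simp: bcoc_def)
  have pid: "\<phi> (?id x) = \<phi> x" for x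
    by (rule lin_eqI[OF lin_comp[OF bder_lin[OF \<phi>(1)] lin_restr] bder_lin[OF \<phi>(1)]])
      (simp add: lin_0[OF bder_lin[OF \<phi>(1)]] bder_off[OF \<phi>(1)])
  have eid: "h (?id x) = h x" if "ghom A B h" for h x and B :: "('v mon, 'k, 'v \<Rightarrow> int) balg"
    by (rule lin_eqI[OF lin_comp[OF ghom_lin[OF that] lin_restr] ghom_lin[OF that]])
      (simp add: lin_0[OF ghom_lin[OF that]] ghom_off[OF that])
  have ee: "e (?id x) = e (f x)" for x by (simp add: eid[OF e_ghom] assms(3))
  have "\<exists>\<psi>\<in>bder A L (\<lambda>x. e' (?id x)) c (i - 1). \<forall>x. \<phi> (f x) - \<phi> (?id x) = \<psi> (bdif A x)"
    by (rule homotopy_der[OF free_balg_axioms balg_axioms bhom_id[OF balg_axioms] assms(2) e_lin e_deg acyc ee assms(4) \<phi>])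
  then obtain \<psi> where "\<psi> \<in> bder A L (\<lambda>x. e' (?id x)) c (i - 1)" "\<And>x. \<phi> (f x) - \<phi> x = \<psi> (bdif A x)"
    unfolding pid by blast
  then show ?thesis unfolding bcob_def eid[OF bhom_ghom[OF assms(4)]] by auto
qed

theorem resolution_independent:
  assumes "bresol A G word K eA" "bresol B G' word' K eB"
  shows "hiso (bcoc A K eA c i) (bcob A K eA c i) (bcoc B K eB c i) (bcob B K eB c i)"
proof -
  interpret A: bresol A G word K eA by fact
  interpret B: bresol B G' word' K eB by fact
  obtain h where h: "bhom B A h" "\<And>x. eA (h x) = eB x"
    using lift_resolution[OF assms(2,1)] by blast
  obtain k where k: "bhom A B k" "\<And>x. eB (k x) = eA x"
    using lift_resolution[OF assms] by blast
  have hk: "bhom A A (\<lambda>x. h (k x))" "bhom B B (\<lambda>x. k (h x))" by (rule bhom_comp[OF k(1) h(1)], rule bhom_comp[OF h(1) k(1)])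
  show ?thesis
  proof (rule hiso_fun[where F = "\<lambda>\<phi> x. \<phi> (h x)", OF refl refl _ _ _ linclosed_bcob])
    show "(\<lambda>x. \<phi> (h x)) \<in> bcoc B K eB c i" if "\<phi> \<in> bcoc A K eA c i" for \<phi>
      using bcoc_comp[OF that h(1)] by (simp add: h(2))
    show "(\<lambda>x. \<phi> (h x)) \<in> bcob B K eB c i \<longleftrightarrow> \<phi> \<in> bcob A K eA c i" if \<phi>: "\<phi> \<in> bcoc A K eA c i" for \<phi>
    proof
      assume "(\<lambda>x. \<phi> (h x)) \<in> bcob B K eB c i"
      from bcob_comp[OF this k(1)] have 1: "(\<lambda>x. \<phi> (h (k x))) \<in> bcob A K eA c i" by (simp add: k(2))
      have 2: "(\<lambda>x. \<phi> (h (k x)) - \<phi> x) \<in> bcob A K eA c i"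
        by (rule homotopy_endo[OF assms(1) hk(1) _ A.e_hom \<phi>]) (simp add: h(2) k(2))
      from linclosed_diff[OF linclosed_bcob 1 2] show "\<phi> \<in> bcob A K eA c i" by simp
    next
      assume "\<phi> \<in> bcob A K eA c i"
      from bcob_comp[OF this h(1)] show "(\<lambda>x. \<phi> (h x)) \<in> bcob B K eB c i" by (simp add: h(2))
    qed
    show "\<exists>\<phi>\<in>bcoc A K eA c i. (\<lambda>x. \<psi> x - \<phi> (h x)) \<in> bcob B K eB c i" if \<psi>: "\<psi> \<in> bcoc B K eB c i" for \<psi>
    proof (rule bexI[of _ "\<lambda>x. \<psi> (k x)"])
      show "(\<lambda>x. \<psi> (k x)) \<in> bcoc A K eA c i" using bcoc_comp[OF \<psi> k(1)] by (simp add: k(2))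
      have "(\<lambda>x. \<psi> (k (h x)) - \<psi> x) \<in> bcob B K eB c i"
        by (rule homotopy_endo[OF assms(2) hk(2) _ B.e_hom \<psi>]) (simp add: h(2) k(2))
      moreover have "(\<lambda>x. 0) \<in> bcob B K eB c i" using linclosed_bcob unfolding linclosed_def by blast
      ultimately show "(\<lambda>x. \<psi> x - \<psi> (k (h x))) \<in> bcob B K eB c i"
        using linclosed_diff[OF linclosed_bcob, of "\<lambda>x. 0"] by fastforce
    qed
  qed
qed

section \<open>Passing to the link of a vertex\<close>

text \<open>The element \<open>x_v - 1\<close> is homogeneous only after the component of
  \<open>v\<close> has been dropped from the weights; this is the use of changing them along a map
  \<open>\<tau>\<close>.\<close>

definition rewt :: "('w \<Rightarrow> 'w) \<Rightarrow> ('x, 'k::field, 'w) balg \<Rightarrow> ('x, 'k, 'w) balg" where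
  "rewt \<tau> A = A\<lparr>bwt := (\<lambda>x. \<tau> (bwt A x))\<rparr>"

lemma rewt_simps [simp]: "bidx (rewt \<tau> A) = bidx A" "bmul (rewt \<tau> A) = bmul A" "bone (rewt \<tau> A) = bone A"
  "bdif (rewt \<tau> A) = bdif A" "bdeg (rewt \<tau> A) = bdeg A" "bwt (rewt \<tau> A) x = \<tau> (bwt A x)"
  "sg (rewt \<tau> A) = sg A"
  by (simp_all add: rewt_def sg_def)

lemma hidx_rewt: "hidx A n w \<subseteq> hidx (rewt \<tau> A) n (\<tau> w)"
  by (auto simp: hidx_def)

lemma balg_rewt:
  assumes "balg A" "\<tau> 0 = 0" "\<And>w w'. \<tau> (w + w') = \<tau> w + \<tau> w'"
  shows "balg (rewt \<tau> A)"
proof -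
  interpret balg A by fact
  show ?thesis
  proof (unfold_locales, unfold rewt_simps)
    show "bilin (bmul A)" by (rule bilin)
    show "bmul A (bmul A x y) z = bmul A x (bmul A y z)" for x y z by (rule assoc)
    show "bmul A (bas i) (bas j) = koszul_sign (bdeg A i * bdeg A j) \<bullet> bmul A (bas j) (bas i)" for i j by (rule comm)
    show "i \<notin> bidx A \<Longrightarrow> bmul A (bas i) x = 0" for i x by (rule mul_off)
    show "keys (bmul A (bas i) (bas j)) \<subseteq> hidx (rewt \<tau> A) (bdeg A i + bdeg A j) (\<tau> (bwt A i) + \<tau> (bwt A j))" for i j
      using mul_keys[of i j] hidx_rewt[of A _ "bwt A i + bwt A j" \<tau>] unfolding assms(3) by blast
    show "keys (bone A) \<subseteq> hidx (rewt \<tau> A) 0 0"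
      using one_keys hidx_rewt[of A 0 0 \<tau>] unfolding assms(2) by blast
    show "i \<in> bidx A \<Longrightarrow> bmul A (bone A) (bas i) = bas i" for i by (rule one_mul_bas)
    show "lin (bdif A)" by (rule lin_dif)
    show "i \<notin> bidx A \<Longrightarrow> bdif A (bas i) = 0" for i by (rule dif_off)
    show "keys (bdif A (bas i)) \<subseteq> hidx (rewt \<tau> A) (bdeg A i - 1) (\<tau> (bwt A i))" for i
      by (rule subset_trans[OF dif_keys hidx_rewt])
    show "bdif A (bdif A x) = 0" for x by (rule dif_dif)
    show "bdif A (bmul A x y) = bmul A (bdif A x) y + bmul A (sg A x) (bdif A y)" for x y by (rule leibniz)
  qed
qed

lemma bfree_rewt: "bfree A G word \<Longrightarrow> bfree (rewt \<tau> A) G word"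
  unfolding bfree_def by (simp add: lprod_def)

lemma bhom_rewt: "bhom A B h \<Longrightarrow> bhom (rewt \<tau> A) (rewt \<tau> B) h"
  unfolding bhom_def ghom_def using hidx_rewt[of B _ _ \<tau>] by (simp, blast)

section \<open>Monomials of the link of a vertex\<close>

definition erase :: "'v \<Rightarrow> 'v mon \<Rightarrow> 'v mon" where
  "erase v m = Poly_Mapping.update v 0 m"

lemma lookup_erase [simp]: "lookup (erase v m) u = (if u = v then 0 else lookup m u)"
  by (simp add: erase_def lookup_update)

lemma erase_add: "erase v (m + n) = erase v m + erase v n"
  by (rule poly_mapping_eqI) (simp add: lookup_add)

lemma erase_decomp: "Poly_Mapping.single v (lookup m v) + erase v m = m"
  by (rule poly_mapping_eqI) (simp add: lookup_add lookup_single when_def)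

lemma erase_id: "lookup m v = 0 \<Longrightarrow> erase v m = m"
  by (rule poly_mapping_eqI) simp

lemma erase_single: "erase v (Poly_Mapping.single v n) = 0"
  by (rule poly_mapping_eqI) (simp add: lookup_single when_def)

lemma mwt_erase: "mwt (erase v m) = (mwt m)(v := 0)"
  by (auto simp: mwt_def)

lemma mwt_single: "mwt (Poly_Mapping.single v n) = (\<lambda>_. 0)(v := int n)"
  by (auto simp: mwt_def lookup_single when_def)

lemma dcl_link: "dcl K \<Longrightarrow> dcl (link f K)"
  unfolding dcl_def link_def by (intro ballI allI impI) (auto intro: Un_mono)

text \<open>Only supports matter, so any positive exponent of \<open>x_v\<close> tests membership in
  the link. This is why setting \<open>x_v = 1\<close> is injective on each part of positive
  \<open>v\<close>-degree.\<close>

lemma faces_link: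
  assumes "dcl K" "1 \<le> n"
  shows "m \<in> faces (link {v} K) \<longleftrightarrow> lookup m v = 0 \<and> Poly_Mapping.single v n + m \<in> faces K"
proof -
  have k: "keys (Poly_Mapping.single v n + m) = insert v (keys m)" using assms(2) by (simp add: keys_add_nat)
  have "keys m \<in> K" if "insert v (keys m) \<in> K" using that assms(1) by (auto simp: dcl_def)
  then show ?thesis by (auto simp: faces_def link_def k in_keys_iff)
qed

lemma restr_one: "restr Y (1 :: 'v mon \<Rightarrow>\<^sub>0 'k::field) = (if 0 \<in> Y then 1 else 0)"
  using restr_bas[of Y "0 :: 'v mon", where 'b = 'k] by simp

definition kM0 :: "(nat \<times> bool) set" where "kM0 = {0} \<times> UNIV"

lemma kM0_iff [simp]: "(k, \<alpha>) \<in> kM0 \<longleftrightarrow> k = 0"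
  by (simp add: kM0_def)

text \<open>Condition \<open>cv\<close> keeps the exponents of \<open>x_v\<close> positive when
  values are carried back from the link. Condition \<open>i1\<close> makes a derivation of degree
  \<open>i\<close> vanish on the degree-zero element \<open>u\<close>, so that it can be extended by
  zero to a generator with boundary \<open>u\<close>.\<close>

locale vertex_step = bresol P G word K e for P :: "('x, 'k::field_char_0, 'v \<Rightarrow> int) balg" and G word K e +
  fixes v :: 'v and c :: "'v \<Rightarrow> int" and i :: int
    and pr :: "'x \<Rightarrow> nat \<times> bool \<Rightarrow> 'z" and p1 :: "'z \<Rightarrow> 'x" and p2 :: "'z \<Rightarrow> nat \<times> bool"
  assumes cv: "1 \<le> c v" and i1: "1 \<le> i"
    and p1_pr: "x \<in> bidx P \<Longrightarrow> m \<in> kM0 \<Longrightarrow> p1 (pr x m) = x"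
    and p2_pr: "x \<in> bidx P \<Longrightarrow> m \<in> kM0 \<Longrightarrow> p2 (pr x m) = m"
begin

definition L where "L = link {v} K"
definition \<tau> :: "('v \<Rightarrow> int) \<Rightarrow> 'v \<Rightarrow> int" where "\<tau> w = w(v := 0)"
definition P' where "P' = rewt \<tau> P"
text \<open>The ring homomorphism \<open>x_v = 1\<close>. A monomial outside the star of
  \<open>v\<close> becomes zero in the ring of \<open>K\<close> when multiplied by
  \<open>x_v\<close>, so it has to be sent to zero; hence the restriction to
  \<open>faces L\<close>.\<close>

definition rho :: "('v mon \<Rightarrow>\<^sub>0 'k) \<Rightarrow> ('v mon \<Rightarrow>\<^sub>0 'k)" where
  "rho = lext (\<lambda>m. restr (faces L) (bas (erase v m)))"
definition e' where "e' x = rho (e x)"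
definition mulv :: "nat \<Rightarrow> ('v mon \<Rightarrow>\<^sub>0 'k) \<Rightarrow> ('v mon \<Rightarrow>\<^sub>0 'k)" where
  "mulv n s = restr (faces K) (bas (Poly_Mapping.single v n) * s)"

lemma dcl_L: "dcl L" unfolding L_def by (rule dcl_link[OF dcl])

lemmas L_iff = faces_link[OF dcl, where v = v, folded L_def]

lemma lin_rho: "lin rho" by (simp add: rho_def lin_lext)
lemma rho_bas: "rho (bas m) = (if erase v m \<in> faces L then bas (erase v m) else 0)" by (simp add: rho_def)
lemmas rho_simps = lin_simps[OF lin_rho]
lemma lin_mulv: "lin (mulv n)"
  unfolding mulv_def by (intro lin_comp[OF lin_restr] bilin_right[OF bilin_times])
lemmas mulv_simps = lin_simps[OF lin_mulv]
lemmas restr_simps = lin_simps[OF lin_restr]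

lemma \<tau>_add: "\<tau> 0 = 0" "\<tau> (w + w') = \<tau> w + \<tau> w'" by (auto simp: \<tau>_def)

lemma P'_simps [simp]: "bidx P' = bidx P" "bmul P' = bmul P" "bone P' = bone P"
  "bdif P' = bdif P" "bdeg P' = bdeg P" "bwt P' x = \<tau> (bwt P x)" "sg P' = sg P"
  by (simp_all add: P'_def)

lemma hidx_P': "hidx P n w \<subseteq> hidx P' n (\<tau> w)" unfolding P'_def by (rule hidx_rewt)

lemma erase_L: "erase v m \<in> faces L \<Longrightarrow> m \<in> faces K"
proof -
  assume "erase v m \<in> faces L"
  then have "Poly_Mapping.single v (Suc (lookup m v)) + erase v m \<in> faces K" by (simp add: L_iff[of "Suc (lookup m v)"])
  moreover have "Poly_Mapping.single v (Suc (lookup m v)) + erase v m = m + Poly_Mapping.single v 1"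
    by (rule poly_mapping_eqI) (simp add: lookup_add lookup_single when_def)
  ultimately show "m \<in> faces K" using faces_add[OF dcl] by metis
qed

lemma rho_times: "rho (restr (faces K) (f * g)) = restr (faces L) (rho f * rho g)"
proof (rule bilin_eq_keys[of "\<lambda>f g. rho (restr (faces K) (f * g))" "\<lambda>f g. restr (faces L) (rho f * rho g)"])
  show "bilin (\<lambda>f g. rho (restr (faces K) (f * g)))" by (rule bilin_comp[OF lin_rho bilin_restr_times])
  show "bilin (\<lambda>f g. restr (faces L) (rho f * rho g))" unfolding bilin_def
    by (intro conjI allI lin_comp[OF bilin_left[OF bilin_restr_times] lin_rho] lin_comp[OF bilin_right[OF bilin_restr_times] lin_rho])
  fix m n
  have "rho (restr (faces K) (bas m * bas n)) = restr (faces L) (bas (erase v m + erase v n))"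
    using erase_L[of "m + n"] by (simp add: rho_bas rho_simps erase_add)
  also have "\<dots> = restr (faces L) (rho (bas m) * rho (bas n))"
    by (simp only: rho_def lext_bas restr_times[OF dcl_L] bas_times)
  finally show "rho (restr (faces K) (bas m * bas n)) = restr (faces L) (rho (bas m) * rho (bas n))" .
qed

lemma rho_one: "rho (restr (faces K) 1) = restr (faces L) 1"
proof -
  have "rho (restr (faces K) (bas 0)) = restr (faces L) (bas 0)"
    using erase_L[of 0] erase_id[of 0 v] by (simp add: rho_bas rho_simps restr_one del: single_one)
  then show ?thesis by simp
qed

lemma e'_lin: "lin e'" unfolding e'_def by (rule lin_comp[OF lin_rho e_lin])
lemmas e'_simps = lin_simps[OF e'_lin]

lemma e'_bhom: "bhom P' (SR L) e'"
  unfolding bhom_def ghom_def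
proof (intro conjI allI impI)
  show "lin e'" by (rule e'_lin)
  show "e' (bmul P' x y) = bmul (SR L) (e' x) (e' y)" for x y by (simp add: e'_def e_mul rho_times)
  show "e' (bone P') = bone (SR L)" using ghom_one[OF e_ghom] by (simp add: e'_def rho_one)
  show "keys (e' (bas x)) \<subseteq> hidx (SR L) (bdeg P' x) (bwt P' x)" for x
    unfolding e'_def
  proof (rule lin_keys[OF lin_rho])
    fix m assume "m \<in> keys (e (bas x))"
    then have "bdeg P x = 0" "mwt m = bwt P x" using e_keys[of x] by auto
    then show "keys (rho (bas m)) \<subseteq> hidx (SR L) (bdeg P' x) (bwt P' x)"
      by (simp add: rho_bas hidx_SR mwt_erase \<tau>_def)
  qed
  show "e' (bas x) = 0" if "x \<notin> bidx P'" for x using that ghom_off[OF e_ghom, of x] by (simp add: e'_def rho_simps)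
  show "e' (bdif P' x) = bdif (SR L) (e' x)" for x by (simp add: e'_def e_dif rho_simps)
qed

lemma e'_dif: "e' (bdif P x) = 0" by (simp add: e'_def e_dif rho_simps)
lemma e'_sg: "e' (sg P x) = e' x" by (simp add: e'_def e_sg)
lemma e'_mul: "e' (bmul P x y) = restr (faces L) (e' x * e' y)" by (simp add: e'_def e_mul rho_times)

lemma balg_P': "balg P'" unfolding P'_def by (rule balg_rewt[OF balg_axioms \<tau>_add])
lemma free_P': "free_balg P' G word"
  using balg_P' bfree_rewt[OF free, of \<tau>] by (simp add: free_balg_def free_balg_axioms_def P'_def)

text \<open>Together with \<open>mulv_rho\<close> this says that multiplication by
  \<open>x_v^n\<close>, for \<open>n \<ge> 1\<close>, is an isomorphism of the ring of the link with
  the part of \<open>v\<close>-degree \<open>n\<close> in the ring of \<open>K\<close>.\<close>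

lemma rho_mulv: "1 \<le> n \<Longrightarrow> keys s \<subseteq> faces L \<Longrightarrow> rho (mulv n s) = s"
proof (rule lin_eq_keys[OF lin_comp[OF lin_rho lin_mulv] lin_id])
  fix m assume "1 \<le> n" "keys s \<subseteq> faces L" "m \<in> keys s"
  then have m: "m \<in> faces L" "1 \<le> n" by auto
  then have "lookup m v = 0" "Poly_Mapping.single v n + m \<in> faces K" using L_iff[OF m(2)] by auto
  then show "rho (mulv n (bas m)) = bas m"
    using m by (simp add: mulv_def rho_bas erase_add erase_single erase_id)
qed

lemma mulv_rho: "1 \<le> n \<Longrightarrow> keys t \<subseteq> {m \<in> faces K. lookup m v = n} \<Longrightarrow> mulv n (rho t) = t"
proof (rule lin_eq_keys[OF lin_comp[OF lin_mulv lin_rho] lin_id])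
  fix m assume "1 \<le> n" "keys t \<subseteq> {m \<in> faces K. lookup m v = n}" "m \<in> keys t"
  then have m: "m \<in> faces K" "lookup m v = n" "1 \<le> n" by auto
  have d: "Poly_Mapping.single v n + erase v m = m" using erase_decomp[of v m] m(2) by simp
  then have "erase v m \<in> faces L" using L_iff[OF m(3), of "erase v m"] m(1) by simp
  then show "mulv n (rho (bas m)) = bas m" using m d by (simp add: mulv_def rho_bas)
qed

text \<open>Exponents of \<open>x_v\<close> add while coefficients multiply in the ring of the link.
  This yields the Leibniz rule when a derivation is carried back from the link.\<close>

lemma mulv_times:
  assumes n: "1 \<le> n" and s: "keys s \<subseteq> faces L" and t: "keys t \<subseteq> {m \<in> faces K. lookup m v = k}"
  shows "mulv (n + k) (restr (faces L) (s * rho t)) = restr (faces K) (mulv n s * t)"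
proof (rule bilin_eq_keys[of "\<lambda>s t. mulv (n + k) (restr (faces L) (s * rho t))" "\<lambda>s t. restr (faces K) (mulv n s * t)"])
  show "bilin (\<lambda>s t. mulv (n + k) (restr (faces L) (s * rho t)))" unfolding bilin_def
    by (intro conjI allI lin_comp[OF lin_mulv] bilin_left[OF bilin_restr_times]
        lin_comp[OF bilin_right[OF bilin_restr_times] lin_rho])
  show "bilin (\<lambda>s t. restr (faces K) (mulv n s * t))" unfolding bilin_def
    by (intro conjI allI lin_comp[OF bilin_left[OF bilin_restr_times] lin_mulv] bilin_right[OF bilin_restr_times])
  fix a m assume "a \<in> keys s" "m \<in> keys t"
  then have a: "a \<in> faces L" and m: "m \<in> faces K" "lookup m v = k" using s t by auto
  have a0: "lookup a v = 0" using a L_iff[OF n, of a] by simp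
  have eq: "Poly_Mapping.single v (n + k) + (a + erase v m) = Poly_Mapping.single v n + a + m"
    by (rule poly_mapping_eqI) (use a0 m(2) in \<open>auto simp: lookup_add lookup_single when_def\<close>)
  have iff: "a + erase v m \<in> faces L \<longleftrightarrow> Poly_Mapping.single v n + a + m \<in> faces K"
    using L_iff[of "n + k" "a + erase v m"] n a0 by (simp add: eq lookup_add)
  have "restr (faces L) (bas a * rho (bas m)) = restr (faces L) (bas (a + erase v m))"
    by (simp only: rho_def lext_bas restr_times[OF dcl_L] bas_times)
  moreover have "restr (faces K) (mulv n (bas a) * bas m) = restr (faces K) (bas (Poly_Mapping.single v n + a + m))"
    by (simp only: mulv_def restr_times[OF dcl] bas_times)
  ultimately show "mulv (n + k) (restr (faces L) (bas a * rho (bas m))) = restr (faces K) (mulv n (bas a) * bas m)"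
    using iff by (simp add: mulv_def eq)
qed

text \<open>Composition with \<open>x_v = 1\<close> is to be inverted by multiplying values at
  weight \<open>w\<close> with \<open>x_v^(w v + c v)\<close>, which needs a positive exponent.
  Precomposing with an endomorphism \<open>r\<close> that kills negative weights secures this, and
  it changes cocycles only by coboundaries since \<open>r\<close> is homotopic to the
  identity.\<close>

lemma step_coefficients:
  "hiso (bcoc P K e c i) (bcob P K e c i) (bcoc P' L e' (\<tau> c) i) (bcob P' L e' (\<tau> c) i)"
proof -
  obtain r where r: "bhom P P r" "\<And>x. e (r x) = e x" "\<And>x u. bwt P x u < 0 \<Longrightarrow> r (bas x) = 0"
    using lift_resolution[OF bresol_axioms bresol_axioms] by blast
  note rl = bhom_lin[OF r(1)] and rg = bhom_ghom[OF r(1)]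
  have r': "bhom P' P' r" unfolding P'_def by (rule bhom_rewt[OF r(1)])
  \<comment> \<open>In negative \<open>v\<close>-weight \<open>r\<close> gives zero, whatever
    exponent \<open>nat\<close> produces; elsewhere the exponent is at least
    \<open>c v \<ge> 1\<close>.\<close>
  define Lam where "Lam \<phi> = lext (\<lambda>x. if x \<in> bidx P then mulv (nat (bwt P x v + c v)) (\<phi> (r (bas x))) else 0)"
    for \<phi> :: "('x \<Rightarrow>\<^sub>0 'k) \<Rightarrow> ('v mon \<Rightarrow>\<^sub>0 'k)"
  have Lam_lin: "lin (Lam \<phi>)" for \<phi> by (simp add: Lam_def lin_lext)
  have Lam_hom: "Lam \<phi> f = mulv (nat (w v + c v)) (\<phi> (r f))" if "lin \<phi>" "keys f \<subseteq> hidx P n w" for \<phi> f n w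
    by (rule lin_eq_keys[OF Lam_lin lin_comp[OF lin_mulv lin_comp[OF that(1) rl]]])
      (use that(2) in \<open>auto simp: Lam_def hidx_def\<close>)
  have Lam_bas: "Lam \<phi> (bas x) = mulv (nat (bwt P x v + c v)) (\<phi> (r (bas x)))" if "lin \<phi>" for \<phi> x
    by (simp add: Lam_def ghom_off[OF rg] lin_0[OF that] mulv_simps)
  have sub: "keys (\<phi> f) \<subseteq> faces L" if "\<phi> \<in> bder P' L e' (\<tau> c) j" for \<phi> f j
    by (rule lin_keys[OF bder_lin[OF that]]) (use bder_keys[OF that] in blast)
  have Lam_der: "Lam \<phi> \<in> bder P K e c j" if \<phi>: "\<phi> \<in> bder P' L e' (\<tau> c) j" for \<phi> j
    unfolding bder_def
  proof (intro CollectI conjI allI impI)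
    note pl = bder_lin[OF \<phi>]
    show "lin (Lam \<phi>)" by (rule Lam_lin)
    show "Lam \<phi> (bas x) = 0" if "\<not> (x \<in> bidx P \<and> bdeg P x = j)" for x
      using bder_off[OF bder_comp[OF \<phi> bhom_ghom[OF r']], of x] that by (simp add: Lam_bas[OF pl] mulv_simps)
    show "keys (Lam \<phi> (bas x)) \<subseteq> {m \<in> faces K. mwt m = bwt P x + c}" for x
    proof (cases "bwt P x v < 0")
      case True
      then show ?thesis by (simp add: Lam_bas[OF pl] r(3) lin_0[OF pl] mulv_simps)
    next
      case False
      have k: "keys (\<phi> (r (bas x))) \<subseteq> {m \<in> faces L. mwt m = \<tau> (bwt P x) + \<tau> c}"
        using bder_keys[OF bder_comp[OF \<phi> bhom_ghom[OF r']], of x] by simp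
      show ?thesis unfolding Lam_bas[OF pl]
      proof (rule lin_keys[OF lin_mulv])
        fix m assume "m \<in> keys (\<phi> (r (bas x)))"
        then have "mwt m = \<tau> (bwt P x) + \<tau> c" using k by blast
        then have "mwt (Poly_Mapping.single v (nat (bwt P x v + c v)) + m) = bwt P x + c"
          using False cv by (auto simp: mwt_add mwt_single \<tau>_def)
        then show "keys (mulv (nat (bwt P x v + c v)) (bas m)) \<subseteq> {m \<in> faces K. mwt m = bwt P x + c}"
          by (simp add: mulv_def)
      qed
    qed
    show "Lam \<phi> (bmul P x y) = restr (faces K) (Lam \<phi> x * e y) + restr (faces K) (e x * Lam \<phi> y)" for x y
    proof (rule bilin_eq_keys[of "\<lambda>x y. Lam \<phi> (bmul P x y)"
          "\<lambda>x y. restr (faces K) (Lam \<phi> x * e y) + restr (faces K) (e x * Lam \<phi> y)"])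
      show "bilin (\<lambda>x y. Lam \<phi> (bmul P x y))" by (rule bilin_comp[OF Lam_lin bilin])
      show "bilin (\<lambda>x y. restr (faces K) (Lam \<phi> x * e y) + restr (faces K) (e x * Lam \<phi> y))"
        unfolding bilin_def
        by (intro conjI allI lin_addI lin_comp[OF bilin_left[OF bilin_restr_times] Lam_lin]
            lin_comp[OF bilin_right[OF bilin_restr_times] Lam_lin]
            lin_comp[OF bilin_left[OF bilin_restr_times] e_lin] lin_comp[OF bilin_right[OF bilin_restr_times] e_lin])
      fix x y
      have prod: "Lam \<phi> (bmul P (bas x) (bas y)) =
          mulv (nat (bwt P x v + bwt P y v + c v)) (\<phi> (bmul P (r (bas x)) (r (bas y))))"
        using Lam_hom[OF pl mul_keys[of x y]] by (simp add: ghom_mul[OF rg])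
      show "Lam \<phi> (bmul P (bas x) (bas y)) =
          restr (faces K) (Lam \<phi> (bas x) * e (bas y)) + restr (faces K) (e (bas x) * Lam \<phi> (bas y))"
      proof (cases "bwt P x v < 0 \<or> bwt P y v < 0")
        \<comment> \<open>The factor of negative \<open>v\<close>-weight is killed by
          \<open>r\<close> and by \<open>e\<close>, so every term is zero.\<close>
        case True
        then show ?thesis unfolding prod
          by (auto simp: Lam_bas[OF pl] r(3) e_neg mul_simps lin_0[OF pl] mulv_simps)
      next
        case False
        define nx ny k l where "nx = nat (bwt P x v + c v)" and "ny = nat (bwt P y v + c v)"
          and "k = nat (bwt P x v)" and "l = nat (bwt P y v)"
        \<comment> \<open>One exponent is split in two ways, for the two terms of the Leibniz
          rule.\<close>
        have n: "1 \<le> nx" "1 \<le> ny" "nat (bwt P x v + bwt P y v + c v) = nx + l"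
          "nat (bwt P x v + bwt P y v + c v) = ny + k"
          using False cv unfolding nx_def ny_def k_def l_def by arith+
        have ek: "keys (e (bas z)) \<subseteq> {m \<in> faces K. lookup m v = nat (bwt P z v)}" for z
          using e_keys[of z] by (auto simp: mwt_def dest!: fun_cong[of _ _ v])
        let ?fx = "\<phi> (r (bas x))" and ?fy = "\<phi> (r (bas y))"
        have "\<phi> (bmul P (r (bas x)) (r (bas y))) =
            restr (faces L) (?fx * rho (e (bas y))) + restr (faces L) (?fy * rho (e (bas x)))"
          using bder_mul[OF \<phi>, of "r (bas x)" "r (bas y)"] by (simp add: e'_def r(2) mult.commute)
        then have "Lam \<phi> (bmul P (bas x) (bas y)) =
            mulv (nx + l) (restr (faces L) (?fx * rho (e (bas y)))) + mulv (ny + k) (restr (faces L) (?fy * rho (e (bas x))))"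
          unfolding prod by (simp add: mulv_simps n(3)[symmetric] n(4)[symmetric])
        also have "\<dots> = restr (faces K) (mulv nx ?fx * e (bas y)) + restr (faces K) (mulv ny ?fy * e (bas x))"
          by (simp add: mulv_times[OF n(1) sub[OF \<phi>] ek[of y, folded l_def]]
              mulv_times[OF n(2) sub[OF \<phi>] ek[of x, folded k_def]])
        finally show ?thesis by (simp add: Lam_bas[OF pl] nx_def ny_def mult.commute)
      qed
    qed
  qed
  \<comment> \<open>The differential preserves weights, so the exponent of \<open>x_v\<close> is the
    same before and after it.\<close>
  have Lam_dif: "Lam \<phi> (bdif P x) = Lam (\<lambda>x. \<phi> (bdif P x)) x" if pl: "lin \<phi>" for \<phi> x
  proof (rule lin_eqI[OF lin_comp[OF Lam_lin lin_dif] Lam_lin])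
    fix z
    show "Lam \<phi> (bdif P (bas z)) = Lam (\<lambda>x. \<phi> (bdif P x)) (bas z)"
      using Lam_hom[OF pl dif_keys[of z]] by (simp add: Lam_bas[OF lin_comp[OF pl lin_dif]] bhom_dif[OF r(1)])
  qed
  have rho_der: "(\<lambda>x. rho (\<phi> x)) \<in> bder P' L e' (\<tau> c) j" if \<phi>: "\<phi> \<in> bder P K e c j" for \<phi> j
    unfolding bder_def
  proof (intro CollectI conjI allI impI)
    show "lin (\<lambda>x. rho (\<phi> x))" by (rule lin_comp[OF lin_rho bder_lin[OF \<phi>]])
    show "rho (\<phi> (bmul P' x y)) = restr (faces L) (rho (\<phi> x) * e' y) + restr (faces L) (e' x * rho (\<phi> y))" for x y
      by (simp add: bder_mul[OF \<phi>] rho_simps rho_times e'_def)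
    show "rho (\<phi> (bas x)) = 0" if "\<not> (x \<in> bidx P' \<and> bdeg P' x = j)" for x
      using bder_off[OF \<phi>, of x] that by (simp add: rho_simps)
    show "keys (rho (\<phi> (bas x))) \<subseteq> {m \<in> faces L. mwt m = bwt P' x + \<tau> c}" for x
    proof (rule lin_keys[OF lin_rho])
      fix m assume "m \<in> keys (\<phi> (bas x))"
      then have "mwt m = bwt P x + c" using bder_keys[OF \<phi>] by blast
      then have "mwt (erase v m) = bwt P' x + \<tau> c" by (auto simp: mwt_erase \<tau>_def)
      then show "keys (rho (bas m)) \<subseteq> {m \<in> faces L. mwt m = bwt P' x + \<tau> c}" by (simp add: rho_bas)
    qed
  qed
  have Lam_rho: "Lam (\<lambda>x. rho (\<phi> x)) x = \<phi> (r x)" if \<phi>: "\<phi> \<in> bder P K e c j" for \<phi> j x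
  proof (rule lin_eqI[OF Lam_lin lin_comp[OF bder_lin[OF \<phi>] rl]])
    fix z
    have pl: "lin (\<lambda>x. rho (\<phi> x))" by (rule lin_comp[OF lin_rho bder_lin[OF \<phi>]])
    show "Lam (\<lambda>x. rho (\<phi> x)) (bas z) = \<phi> (r (bas z))"
    proof (cases "bwt P z v < 0")
      case True
      then show ?thesis by (simp add: Lam_bas[OF pl] r(3) lin_0[OF bder_lin[OF \<phi>]] rho_simps mulv_simps)
    next
      case False
      have "keys (\<phi> (r (bas z))) \<subseteq> {m \<in> faces K. lookup m v = nat (bwt P z v + c v)}"
        using bder_hom[OF \<phi> ghom_keys[OF rg, of z]] by (auto simp: mwt_def dest!: fun_cong[of _ _ v])
      then show ?thesis using False cv by (simp add: Lam_bas[OF pl] mulv_rho)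
    qed
  qed
  have rho_Lam: "rho (Lam \<phi> x) = \<phi> (r x)" if \<phi>: "\<phi> \<in> bder P' L e' (\<tau> c) j" for \<phi> j x
  proof (rule lin_eqI[OF lin_comp[OF lin_rho Lam_lin] lin_comp[OF bder_lin[OF \<phi>] rl]])
    fix z show "rho (Lam \<phi> (bas z)) = \<phi> (r (bas z))"
    proof (cases "bwt P z v < 0")
      case True
      then show ?thesis by (simp add: Lam_bas[OF bder_lin[OF \<phi>]] r(3) lin_0[OF bder_lin[OF \<phi>]] rho_simps mulv_simps)
    next
      case False
      then show ?thesis using cv by (simp add: Lam_bas[OF bder_lin[OF \<phi>]] rho_mulv sub[OF \<phi>])
    qed
  qed
  have Lam_cob: "Lam \<phi> \<in> bcob P K e c i" if \<phi>: "\<phi> \<in> bcob P' L e' (\<tau> c) i" for \<phi>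
  proof -
    obtain \<psi> where \<psi>: "\<psi> \<in> bder P' L e' (\<tau> c) (i - 1)" "\<phi> = (\<lambda>x. \<psi> (bdif P x))" using \<phi> by (auto simp: bcob_def)
    show ?thesis unfolding bcob_def \<psi>(2)
      by (intro CollectI bexI[OF _ Lam_der[OF \<psi>(1)]]) (simp add: Lam_dif[OF bder_lin[OF \<psi>(1)]])
  qed
  show ?thesis
  proof (rule hiso_fun[where F = "\<lambda>\<phi> x. rho (\<phi> x)"])
    show "(\<lambda>x. rho (\<phi> x + \<psi> x)) = (\<lambda>x. rho (\<phi> x) + rho (\<psi> x))" for \<phi> \<psi> :: "('x \<Rightarrow>\<^sub>0 'k) \<Rightarrow> _" by (simp add: rho_simps)
    show "(\<lambda>x. rho (k \<bullet> \<phi> x)) = (\<lambda>x. k \<bullet> rho (\<phi> x))" for k and \<phi> :: "('x \<Rightarrow>\<^sub>0 'k) \<Rightarrow> _" by (simp add: rho_simps)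
    show "(\<lambda>x. rho (\<phi> x)) \<in> bcoc P' L e' (\<tau> c) i" if "\<phi> \<in> bcoc P K e c i" for \<phi>
      using that rho_der[of \<phi> i] by (simp add: bcoc_def rho_simps)
    show "(\<lambda>x. rho (\<phi> x)) \<in> bcob P' L e' (\<tau> c) i \<longleftrightarrow> \<phi> \<in> bcob P K e c i" if \<phi>: "\<phi> \<in> bcoc P K e c i" for \<phi>
    proof
      have \<phi>': "\<phi> \<in> bder P K e c i" using \<phi> by (simp add: bcoc_def)
      assume "(\<lambda>x. rho (\<phi> x)) \<in> bcob P' L e' (\<tau> c) i"
      from Lam_cob[OF this] have 1: "Lam (\<lambda>x. rho (\<phi> x)) \<in> bcob P K e c i" .
      have 2: "(\<lambda>x. \<phi> (r x) - \<phi> x) \<in> bcob P K e c i"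
        by (rule homotopy_endo[OF bresol_axioms r(1,2) e_hom \<phi>])
      from linclosed_diff[OF linclosed_bcob 1 2] show "\<phi> \<in> bcob P K e c i" by (simp add: Lam_rho[OF \<phi>'])
    next
      assume "\<phi> \<in> bcob P K e c i"
      then obtain \<psi> where \<psi>: "\<psi> \<in> bder P K e c (i - 1)" "\<phi> = (\<lambda>x. \<psi> (bdif P x))" by (auto simp: bcob_def)
      show "(\<lambda>x. rho (\<phi> x)) \<in> bcob P' L e' (\<tau> c) i" unfolding bcob_def \<psi>(2)
        by (intro CollectI bexI[OF _ rho_der[OF \<psi>(1)]]) simp
    qed
    show "\<exists>\<phi>\<in>bcoc P K e c i. (\<lambda>x. \<psi> x - rho (\<phi> x)) \<in> bcob P' L e' (\<tau> c) i" if \<psi>: "\<psi> \<in> bcoc P' L e' (\<tau> c) i" for \<psi>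
    proof (rule bexI[of _ "Lam \<psi>"])
      have \<psi>': "\<psi> \<in> bder P' L e' (\<tau> c) i" "\<And>x. \<psi> (bdif P x) = 0" using \<psi> by (auto simp: bcoc_def)
      note pl = bder_lin[OF \<psi>'(1)]
      have "Lam \<psi> (bdif P x) = 0" for x
        unfolding Lam_dif[OF pl] \<psi>'(2) by (rule lin_eqI[OF Lam_lin lin_zero]) (simp add: Lam_bas[OF lin_zero] mulv_simps)
      then show "Lam \<psi> \<in> bcoc P K e c i" using Lam_der[OF \<psi>'(1)] by (simp add: bcoc_def)
      interpret P': balg P' by (rule balg_P')
      have pid: "\<psi> (restr (bidx P') x) = \<psi> x" for x
        by (rule lin_eqI[OF lin_comp[OF pl lin_restr] pl]) (use bder_off[OF \<psi>'(1)] in \<open>auto simp: lin_0[OF pl]\<close>)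
      have eid: "e (restr (bidx P') x) = e x" "e' (restr (bidx P') x) = e' x" for x
        by (rule lin_eqI[OF lin_comp[OF e_lin lin_restr] e_lin], use ghom_off[OF e_ghom] in \<open>auto simp: e_simps\<close>)
          (rule lin_eqI[OF lin_comp[OF e'_lin lin_restr] e'_lin], use ghom_off[OF e_ghom] in \<open>auto simp: e'_simps e'_def rho_simps e_simps\<close>)
      \<comment> \<open>On \<open>P'\<close> the map \<open>e\<close> no longer respects weights.
        The homotopy asks of it only linearity, vanishing in nonzero degrees, acyclicity and
        compatibility with \<open>r\<close>; the coefficients are taken along
        \<open>e'\<close>.\<close>
      have "\<exists>\<chi>\<in>bder P' L (\<lambda>x. e' (restr (bidx P') x)) (\<tau> c) (i - 1). \<forall>x. \<psi> (r x) - \<psi> (restr (bidx P') x) = \<chi> (bdif P' x)"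
        by (rule homotopy_der[OF free_P' balg_P' bhom_id[OF balg_P'] r' e_lin _ _ _ e'_bhom \<psi>'(1)])
          (simp_all add: e_deg acyc eid[unfolded P'_simps] r(2) \<psi>'(2))
      then have "(\<lambda>x. \<psi> (r x) - \<psi> x) \<in> bcob P' L e' (\<tau> c) i" unfolding pid eid bcob_def by auto
      moreover have "(\<lambda>x. 0) \<in> bcob P' L e' (\<tau> c) i" using linclosed_bcob unfolding linclosed_def by blast
      ultimately have "(\<lambda>x. 0 - (\<psi> (r x) - \<psi> x)) \<in> bcob P' L e' (\<tau> c) i"
        using linclosed_diff[OF linclosed_bcob] by blast
      then show "(\<lambda>x. \<psi> x - rho (Lam \<psi> x)) \<in> bcob P' L e' (\<tau> c) i" by (simp add: rho_Lam[OF \<psi>'(1)])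
    qed
  qed (rule linclosed_bcob)
qed

end

section \<open>The Koszul extension by a generator whose boundary lifts
  \<open>x_v - 1\<close>\<close>

sublocale vertex_step \<subseteq> T: tens P' 1 kM0 pr p1 p2
proof -
  interpret P': balg P' by (rule balg_P')
  show "tens P' 1 kM0 pr p1 p2" by unfold_locales (use p1_pr p2_pr in auto)
qed

context vertex_step
begin

definition Xv where "Xv = (SOME x. keys x \<subseteq> hidx P 0 (mwt (Poly_Mapping.single v 1)) \<and>
  e x = restr (faces K) (bas (Poly_Mapping.single v 1)))"

definition u where "u = Xv - bone P"

lemma Xv: "keys Xv \<subseteq> hidx P 0 (mwt (Poly_Mapping.single v 1))" "e Xv = restr (faces K) (bas (Poly_Mapping.single v 1))"
proof -
  have "\<exists>x. keys x \<subseteq> hidx P 0 (mwt (Poly_Mapping.single v 1)) \<and> e x = restr (faces K) (bas (Poly_Mapping.single v 1))"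
    by (rule surj_hom) auto
  from someI_ex[OF this] show "keys Xv \<subseteq> hidx P 0 (mwt (Poly_Mapping.single v 1))"
    "e Xv = restr (faces K) (bas (Poly_Mapping.single v 1))" unfolding Xv_def by blast+
qed

text \<open>The lift \<open>Xv\<close> has the weight of \<open>v\<close> alone, which
  \<open>\<tau>\<close> forgets, so that it joins the unit in weight zero.\<close>

lemma u_hom: "keys u \<subseteq> hidx P' 0 0"
proof -
  have "keys Xv \<subseteq> hidx P' 0 (\<tau> (mwt (Poly_Mapping.single v 1)))" using Xv(1) hidx_P' by blast
  moreover have "\<tau> (mwt (Poly_Mapping.single v (1 :: nat))) = 0" by (auto simp: \<tau>_def mwt_single)
  moreover have "keys (bone P) \<subseteq> hidx P' 0 (\<tau> 0)" using one_keys hidx_P' by blast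
  ultimately show ?thesis unfolding u_def by (intro keys_diffI) (simp_all add: \<tau>_add)
qed

lemma u_deg: "keys u \<subseteq> {x. bdeg P x = 0}" "keys u \<subseteq> bidx P"
  using u_hom by (auto simp: hidx_def)

lemma u_sg: "sg P u = u"
  by (rule lin_eq_keys[OF lin_sg lin_id]) (use u_deg in auto)

lemma u_dif: "bdif P u = 0"
  by (simp add: u_def dif_simps dif_hom_0[OF Xv(1)] dif_one)

lemma u_comm: "bmul P u g = bmul P g u"
proof (rule lin_eqI[OF lin_mul_right lin_mul_left])
  fix z show "bmul P u (bas z) = bmul P (bas z) u"
    using comm_hom[OF u_deg(1), of "bas z" "bdeg P z"] by simp
qed

lemma e_one: "e (bone P) = restr (faces K) 1" using ghom_one[OF e_ghom] by simp

lemma e_u: "e u = restr (faces K) (bas (Poly_Mapping.single v 1)) - restr (faces K) 1"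
  by (simp add: u_def e_simps Xv(2) e_one)

lemma rho_v: "rho (restr (faces K) (bas (Poly_Mapping.single v 1))) = restr (faces L) 1"
proof -
  have "rho (restr (faces K) (bas (Poly_Mapping.single v 1))) = restr (faces L) (bas 0)"
    using erase_L[of "Poly_Mapping.single v 1"] by (simp add: rho_bas rho_simps erase_single restr_one)
  then show ?thesis by simp
qed

lemma e'_one: "e' (bone P) = restr (faces L) 1" by (simp add: e'_def e_one rho_one)
lemma e'_Xv: "e' Xv = restr (faces L) 1" by (simp only: e'_def Xv(2) rho_v)
lemma e'_u: "e' u = 0" by (simp add: u_def e'_simps e'_Xv e'_one)

lemma e'_mul_one: "restr (faces L) (f * restr (faces L) 1) = restr (faces L) f"
  "restr (faces L) (restr (faces L) 1 * f) = restr (faces L) f"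
  by (simp_all add: restr_times[OF dcl_L])

text \<open>The Leibniz rule forces this formula once \<open>\<theta>\<close> is given the boundary
  \<open>u\<close>.\<close>

definition kE :: "nat \<times> bool \<Rightarrow> ('x \<Rightarrow>\<^sub>0 'k) \<Rightarrow> ('z \<Rightarrow>\<^sub>0 'k)" where
  "kE m f = T.emb m (bdif P f) + (if snd m then T.emb (0, False) (bmul P (sg P f) u) else 0)"

abbreviation KT where "KT \<equiv> T.T kE"

lemma kM0_E: assumes "m \<in> kM0" obtains \<alpha> where "m = (0, \<alpha>)"
  using assms by (cases m) auto

lemma lin_kE: "lin (kE m)" unfolding kE_def
  by (cases "snd m") (auto intro!: lin_addI lin_comp[OF T.lin_emb] lin_dif lin_comp[OF lin_mul_left lin_sg] lin_zero)

lemma kE_off: "x \<notin> bidx P' \<Longrightarrow> kE m (bas x) = 0"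
  by (simp add: kE_def dif_off mul_off mul_simps T.emb_simps)

lemma kE_emb: "m \<in> kM0 \<Longrightarrow> T.tlift kE (T.emb m f) = kE m f"
  by (rule T.tlift_emb[OF _ lin_kE kE_off])

lemma sgb_P: "T.sgb \<alpha> f = (if \<alpha> then sg P f else f)" by (simp add: T.sgb_def)

sublocale KT: balg KT
proof (rule T.balg_T[OF lin_kE kE_off])
  fix m x assume m: "m \<in> kM0" and x: "x \<in> bidx P'"
  have 1: "keys (T.emb m (bdif P (bas x))) \<subseteq> hidx KT (bdeg P x - 1 + (if snd m then 1 else 0)) (\<tau> (bwt P x))"
    using T.emb_keys[OF m T.dif_keys[of x], of kE] by simp
  have "keys (sg P (bas x)) \<subseteq> hidx P' (bdeg P x) (\<tau> (bwt P x))"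
    using x by (intro subset_trans[OF keys_sg]) (simp add: hidx_def)
  from T.mul_hom[OF this u_hom] have "keys (bmul P (sg P (bas x)) u) \<subseteq> hidx P' (bdeg P x) (\<tau> (bwt P x))" by simp
  from T.emb_keys[OF _ this, of "(0, False)" kE]
  have 2: "keys (T.emb (0, False) (bmul P (sg P (bas x)) u)) \<subseteq> hidx KT (bdeg P x) (\<tau> (bwt P x))" by simp
  show "keys (kE m (bas x)) \<subseteq> hidx KT (bdeg P' x + (if snd m then 1 else 0) - 1) (bwt P' x)"
    using 1 2 by (cases "snd m") (simp_all add: kE_def keys_addI del: sg_bas)
next
  fix m f assume m: "m \<in> kM0"
  then obtain \<alpha> where mm: "m = (0, \<alpha>)" by (rule kM0_E)
  have "bdif P (bmul P (sg P f) u) = - bmul P (sg P (bdif P f)) u"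
    by (simp add: leibniz u_dif sg_dif mul_simps)
  then show "T.tlift kE (kE m f) = 0" unfolding mm
    by (cases \<alpha>) (simp_all add: kE_def T.tlift_simps kE_emb T.emb_simps dif_dif mul_simps dif_simps)
next
  fix m m' f g assume "m \<in> kM0" "m' \<in> kM0"
  then obtain \<alpha> \<beta> where mm: "m = (0, \<alpha>)" "m' = (0, \<beta>)" by (metis kM0_E)
  have a1: "bmul P (bmul P (sg P f) u) g = bmul P (sg P f) (bmul P g u)"
    by (simp add: assoc u_comm)
  show "T.tlift kE (T.tmul (T.emb m f) (T.emb m' g)) =
      T.tmul (kE m f) (T.emb m' g) + T.tmul (sg KT (T.emb m f)) (kE m' g)"
    unfolding mm
    by (cases \<alpha>; cases \<beta>)
      (simp_all add: T.tmul_emb kE_emb kE_def T.sg_emb sgb_P T.tmul_simps T.emb_simps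
        leibniz sg_mul sg_dif mul_simps T.tlift_simps a1 assoc u_sg u_comm lin_simps[OF lin_sg])
qed

definition eA :: "('z \<Rightarrow>\<^sub>0 'k) \<Rightarrow> ('v mon \<Rightarrow>\<^sub>0 'k)" where
  "eA = T.tlift (\<lambda>m f. if snd m then 0 else e' f)"

lemma e'_off: "x \<notin> bidx P \<Longrightarrow> e' (bas x) = 0"
  using ghom_off[OF bhom_ghom[OF e'_bhom]] by simp

lemma eA_emb: "m \<in> kM0 \<Longrightarrow> eA (T.emb m f) = (if snd m then 0 else e' f)"
  unfolding eA_def by (subst T.tlift_emb) (auto simp: e'_off intro: lin_ifI lin_zero e'_lin)

lemma eA_lin: "lin eA" by (simp add: eA_def T.lin_tlift)
lemma eA_off: "z \<notin> T.tidx \<Longrightarrow> eA (bas z) = 0" by (simp add: eA_def T.tlift_off)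
lemmas eA_simps = lin_simps[OF eA_lin]

lemma eA_bhom: "bhom KT (SR L) eA"
  unfolding bhom_def ghom_def T.T_simps
proof (intro conjI allI impI)
  show "lin eA" by (rule eA_lin)
  show "eA (T.tmul y y') = bmul (SR L) (eA y) (eA y')" for y y' unfolding SR_simps
  proof (rule T.tens_eqI[where y = y])
    fix m x assume m: "m \<in> kM0" "x \<in> bidx P'"
    then obtain \<alpha> where mm: "m = (0, \<alpha>)" by (metis kM0_E)
    show "eA (T.tmul (T.emb m (bas x)) y') = restr (faces L) (eA (T.emb m (bas x)) * eA y')"
    proof (rule T.tens_eqI[where y = y'])
      fix m' y assume "m' \<in> kM0" "y \<in> bidx P'"
      then obtain \<beta> where mm': "m' = (0, \<beta>)" by (metis kM0_E)
      show "eA (T.tmul (T.emb m (bas x)) (T.emb m' (bas y))) =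
          restr (faces L) (eA (T.emb m (bas x)) * eA (T.emb m' (bas y)))"
        unfolding mm mm' by (cases \<alpha>; cases \<beta>) (simp_all add: T.tmul_emb eA_emb sgb_P e'_mul eA_simps)
    qed (intro lin_comp[OF eA_lin] bilin_right[OF T.bilin_tmul],
        intro lin_comp[OF bilin_right[OF bilin_restr_times] eA_lin], simp add: T.tmul_off eA_off eA_simps)
  qed (intro lin_comp[OF eA_lin] bilin_left[OF T.bilin_tmul],
      intro lin_comp[OF bilin_left[OF bilin_restr_times] eA_lin], simp add: T.tmul_off eA_off eA_simps)
  show "eA (T.emb (0, False) (bone P')) = bone (SR L)" by (simp add: eA_emb e'_one)
  show "eA (bas z) = 0" if "z \<notin> T.tidx" for z by (rule eA_off[OF that])
  show "keys (eA (bas z)) \<subseteq> hidx (SR L) (bdeg P' (p1 z) + (if snd (p2 z) then 1 else 0)) (bwt P' (p1 z))" for z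
    using ghom_keys[OF bhom_ghom[OF e'_bhom], of "p1 z"] by (simp add: eA_def T.tlift_def hidx_SR)
  show "eA (T.tlift kE y) = bdif (SR L) (eA y)" for y unfolding SR_simps
  proof (rule T.tens_eqI[OF lin_comp[OF eA_lin T.lin_tlift] lin_zero])
    fix m x assume "m \<in> kM0"
    then obtain \<alpha> where mm: "m = (0, \<alpha>)" by (metis kM0_E)
    show "eA (T.tlift kE (T.emb m (bas x))) = 0"
      unfolding mm by (cases \<alpha>) (simp_all add: kE_emb kE_def eA_simps eA_emb e'_dif e'_mul e'_u del: sg_bas)
  qed (simp add: T.tlift_off eA_simps)
qed

lemma restr_times_diff:
  "restr (faces K) (t * (restr (faces K) f - restr (faces K) 1)) = restr (faces K) (t * f) - restr (faces K) (t :: 'v mon \<Rightarrow>\<^sub>0 'k)"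
  by (simp only: right_diff_distrib lin_diff[OF lin_restr] restr_times[OF dcl] mult_1_right)

text \<open>The element \<open>x_v - 1\<close> is a nonzerodivisor: the hypothesis says
  \<open>s = x_v s\<close>, so each coefficient of \<open>s\<close> is zero or equals a coefficient
  at a monomial with smaller \<open>v\<close>-exponent, and induction on that exponent
  applies.\<close>

lemma times_v_minus_1:
  fixes s :: "'v mon \<Rightarrow>\<^sub>0 'k"
  assumes s: "keys s \<subseteq> faces K" and 0: "restr (faces K) (s * (restr (faces K) (bas (Poly_Mapping.single v 1)) - restr (faces K) 1)) = 0"
  shows "s = 0"
proof -
  let ?x = "Poly_Mapping.single v 1 :: 'v mon"
  have "restr (faces K) (s * bas ?x) = s"
    using 0 unfolding restr_times_diff restr_id[OF s] by simp
  moreover have "restr (faces K) (s * bas ?x) = lext (\<lambda>m. restr (faces K) (bas (m + ?x))) s"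
    by (rule lin_eqI[OF bilin_left[OF bilin_restr_times] lin_lext]) simp
  ultimately have s_eq: "s = lext (\<lambda>m. restr (faces K) (bas (m + ?x))) s" by simp
  have "lookup s m = 0" if "lookup m v = n" for m n
    using that
  proof (induction n arbitrary: m)
    case 0
    have "lookup s m = (\<Sum>a\<in>keys s. lookup s a * lookup (restr (faces K) (bas (a + ?x))) m)"
      by (subst s_eq) (simp add: lext_def lookup_sum)
    also have "\<dots> = 0"
    proof (rule sum.neutral, rule ballI)
      fix a have "a + ?x \<noteq> m" using 0 by (auto simp: lookup_add)
      then show "lookup s a * lookup (restr (faces K) (bas (a + ?x))) m = 0" by (simp add: lookup_single)
    qed
    finally show ?case .
  next
    case (Suc n)
    have "lookup s m = (\<Sum>a\<in>keys s. lookup s a * lookup (restr (faces K) (bas (a + ?x))) m)"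
      by (subst s_eq) (simp add: lext_def lookup_sum)
    also have "\<dots> = 0"
    proof (rule sum.neutral, rule ballI)
      fix a show "lookup s a * lookup (restr (faces K) (bas (a + ?x))) m = 0"
      proof (cases "a + ?x = m")
        case True
        then have "lookup a v = n" using Suc.prems by (auto simp: lookup_add)
        then show ?thesis using Suc.IH by simp
      qed (simp add: lookup_single)
    qed
    finally show ?case .
  qed
  then show ?thesis by (intro poly_mapping_eqI) simp
qed

text \<open>The kernel of \<open>x_v = 1\<close> is generated by \<open>x_v - 1\<close>. For a
  monomial the exponent of \<open>v\<close> is lowered step by step, each step costing a multiple of
  \<open>x_v - 1\<close>. A monomial without \<open>v\<close> and outside the link is killed by
  \<open>x_v\<close>, so it is minus its own product with \<open>x_v - 1\<close>.\<close>

lemma rho_kernel: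
  assumes s: "keys s \<subseteq> faces K"
  shows "\<exists>t. keys t \<subseteq> faces K \<and>
    s - rho s = restr (faces K) (t * (restr (faces K) (bas (Poly_Mapping.single v 1)) - restr (faces K) 1))"
proof -
  let ?x = "Poly_Mapping.single v 1 :: 'v mon"
  define yy where "yy = restr (faces K) (bas ?x) - (restr (faces K) 1 :: 'v mon \<Rightarrow>\<^sub>0 'k)"
  have y: "restr (faces K) (t * yy) = restr (faces K) (t * bas ?x) - t" if "keys t \<subseteq> faces K" for t
    unfolding yy_def restr_times_diff restr_id[OF that] ..
  have bas: "\<exists>t. keys t \<subseteq> faces K \<and> bas m - rho (bas m) = restr (faces K) (t * yy)" if "m \<in> faces K" for m
    using that
  proof (induction "lookup m v" arbitrary: m)
    case 0
    then have em: "erase v m = m" by (simp add: erase_id)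
    show ?case
    proof (cases "m \<in> faces L")
      case True
      then show ?thesis by (intro exI[of _ 0]) (simp add: rho_bas em)
    next
      case False
      then have "?x + m \<notin> faces K" using 0 L_iff[of 1 m] by simp
      then show ?thesis using False 0
        by (intro exI[of _ "- bas m"], subst y) (simp_all add: keys_uminusI rho_bas em add.commute restr_simps)
    qed
  next
    case (Suc n)
    define a where "a = m - ?x"
    have m: "a + ?x = m" unfolding a_def
      by (rule poly_mapping_eqI) (use Suc(2) in \<open>auto simp: lookup_add lookup_minus lookup_single when_def\<close>)
    have a: "a \<in> faces K" using faces_add[OF dcl, of a ?x] Suc(3) m by simp
    have "n = lookup a v" using Suc(2) m by (auto simp: lookup_add)
    from Suc(1)[OF this a] obtain t where t: "keys t \<subseteq> faces K" "bas a - rho (bas a) = restr (faces K) (t * yy)" by blast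
    have "erase v m = erase v a" unfolding m[symmetric] by (simp add: erase_add erase_single)
    then have r: "rho (bas m) = rho (bas a)" by (simp add: rho_bas)
    have "restr (faces K) ((t + bas a) * yy) = bas a - rho (bas a) + (bas m - bas a)"
      using y[of "bas a"] a m Suc(3) t(2) by (simp add: distrib_right restr_simps)
    then show ?case using r t(1) a by (intro exI[of _ "t + bas a"]) (simp add: keys_addI)
  qed
  let ?P = "\<lambda>s. \<exists>t. keys t \<subseteq> faces K \<and> s - rho s = restr (faces K) (t * yy)"
  have add: "?P (f + g)" if fg: "?P f" "?P g" for f g
  proof -
    obtain t t' where "keys t \<subseteq> faces K" "f - rho f = restr (faces K) (t * yy)"
      "keys t' \<subseteq> faces K" "g - rho g = restr (faces K) (t' * yy)" using fg by blast
    moreover have "(f + g) - rho (f + g) = (f - rho f) + (g - rho g)" by (simp add: rho_simps)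
    ultimately show ?thesis by (intro exI[of _ "t + t'"]) (simp add: keys_addI distrib_right restr_simps)
  qed
  have sm: "?P (k \<bullet> f)" if f: "?P f" for f k
  proof -
    obtain t where t: "keys t \<subseteq> faces K" "f - rho f = restr (faces K) (t * yy)" using f by blast
    have "k \<bullet> f - rho (k \<bullet> f) = k \<bullet> (f - rho f)" by (simp add: rho_simps smul_simps)
    then show ?thesis using t by (intro exI[of _ "k \<bullet> t"]) (simp add: keys_smulI smul_times restr_simps)
  qed
  have "?P (\<Sum>x\<in>F. lookup s x \<bullet> bas x)" if "finite F" "F \<subseteq> faces K" for F
    using that
  proof (induction F)
    case empty
    show ?case by (intro exI[of _ 0]) (simp add: rho_simps)
  next
    case (insert m F)
    have "?P (lookup s m \<bullet> bas m + (\<Sum>x\<in>F. lookup s x \<bullet> bas x))"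
      by (rule add[OF sm[OF bas]]) (use insert in auto)
    then show ?case using insert by simp
  qed
  from this[of "keys s"] show ?thesis using s bas_expand[of s] unfolding yy_def by simp
qed

definition kpr :: "bool \<Rightarrow> ('z \<Rightarrow>\<^sub>0 'k) \<Rightarrow> ('x \<Rightarrow>\<^sub>0 'k)" where
  "kpr \<alpha> = T.tlift (\<lambda>m f. if snd m = \<alpha> then restr (bidx P) f else 0)"

lemma kpr_emb: "kpr \<alpha> (T.emb (0, \<beta>) f) = (if \<beta> = \<alpha> then restr (bidx P) f else 0)"
  unfolding kpr_def by (subst T.tlift_emb) (auto intro: lin_ifI lin_restr lin_zero)

lemma lin_kpr: "lin (kpr \<alpha>)" by (simp add: kpr_def T.lin_tlift)

lemma tidx_cases:
  assumes "keys y \<subseteq> T.tidx"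
  shows "\<exists>p q. keys p \<subseteq> bidx P \<and> keys q \<subseteq> bidx P \<and> y = T.emb (0, False) p + T.emb (0, True) q"
proof -
  have "y = T.emb (0, False) (kpr False y) + T.emb (0, True) (kpr True y)"
  proof (rule lin_eq_keys[OF lin_id])
    show "lin (\<lambda>y. T.emb (0, False) (kpr False y) + T.emb (0, True) (kpr True y))"
      by (intro lin_addI lin_comp[OF T.lin_emb] lin_kpr)
    fix z assume "z \<in> keys y"
    then have "z \<in> T.tidx" using assms by blast
    then obtain x m where *: "x \<in> bidx P'" "m \<in> kM0" "z = pr x m" by (rule T.tidxE)
    then obtain \<alpha> where mm: "m = (0, \<alpha>)" by (metis kM0_E)
    have "bas z = (T.emb (0, \<alpha>) (bas x) :: 'z \<Rightarrow>\<^sub>0 'k)" using * mm by (simp add: T.emb_bas)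
    then show "bas z = T.emb (0, False) (kpr False (bas z)) + T.emb (0, True) (kpr True (bas z))"
      using *(1) by (cases \<alpha>) (simp_all add: kpr_emb T.emb_simps)
  qed
  moreover have "keys (kpr \<alpha> y) \<subseteq> bidx P" for \<alpha>
    by (rule lin_keys[OF lin_kpr]) (auto simp: kpr_def T.tlift_def keys_restr split: if_splits)
  ultimately show ?thesis by blast
qed

lemma emb_inj: "keys p \<subseteq> bidx P \<Longrightarrow> keys q \<subseteq> bidx P \<Longrightarrow> T.emb (0, False) p + T.emb (0, True) q = 0 \<Longrightarrow> p = 0 \<and> q = 0"
proof -
  assume p: "keys p \<subseteq> bidx P" and q: "keys q \<subseteq> bidx P" and 0: "T.emb (0, False) p + T.emb (0, True) q = 0"
  have "kpr \<alpha> (T.emb (0, False) p + T.emb (0, True) q) = 0" for \<alpha> by (simp add: 0 lin_0[OF lin_kpr])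
  from this[of False] this[of True] show ?thesis using p q by (simp add: lin_add[OF lin_kpr] kpr_emb restr_id)
qed

text \<open>A cycle \<open>p + q \<theta>\<close> is simplified twice. Because
  \<open>x_v - 1\<close> is a nonzerodivisor, \<open>e q = 0\<close>, so \<open>q\<close> is a
  boundary and the \<open>\<theta>\<close>-part can be removed. The remaining cycle lies in the
  kernel of \<open>x_v = 1\<close> after augmentation, so a multiple of \<open>u\<close> makes it a
  cycle that \<open>e\<close> kills.\<close>

lemma KT_acyclic:
  assumes y: "keys y \<subseteq> bidx KT" "bdif KT y = 0" "eA y = 0"
  shows "\<exists>z. keys z \<subseteq> bidx KT \<and> bdif KT z = y"
proof -
  obtain p q where pq: "keys p \<subseteq> bidx P" "keys q \<subseteq> bidx P" "y = T.emb (0, False) p + T.emb (0, True) q"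
    using tidx_cases[of y] y(1) by auto
  have D: "T.tlift kE (T.emb (0, False) f) = T.emb (0, False) (bdif P f)"
    "T.tlift kE (T.emb (0, True) f) = T.emb (0, True) (bdif P f) + T.emb (0, False) (bmul P (sg P f) u)" for f
    by (simp_all add: kE_emb kE_def T.emb_simps)
  have "T.emb (0, False) (bdif P p + bmul P (sg P q) u) + T.emb (0, True) (bdif P q) = 0"
    using y(2) unfolding pq(3) by (simp add: T.tlift_simps D T.emb_simps algebra_simps)
  from emb_inj[OF keys_addI[OF dif_sub mul_sub] dif_sub this]
  have c: "bdif P p + bmul P (sg P q) u = 0" "bdif P q = 0" by auto
  have "e (bdif P p + bmul P (sg P q) u) = 0" by (simp add: c e_simps)
  then have "restr (faces K) (e q * e u) = 0" by (simp add: e_simps e_dif e_mul e_sg)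
  moreover have e_sub: "keys (e f) \<subseteq> faces K" for f
    by (rule lin_keys[OF e_lin]) (use e_keys in blast)
  ultimately have "e q = 0" using times_v_minus_1[OF e_sub, of q] e_u by simp
  then obtain q' where q': "keys q' \<subseteq> bidx P" "bdif P q' = q" using acyc[OF pq(2) c(2)] by blast
  \<comment> \<open>This is what remains of \<open>y\<close> when the boundary of
    \<open>q' \<theta>\<close> is subtracted.\<close>
  define p' where "p' = p - bmul P (sg P q') u"
  have y': "y = T.emb (0, False) p' + T.tlift kE (T.emb (0, True) q')"
    by (simp add: pq(3) D p'_def q' T.emb_simps)
  have p'_sub: "keys p' \<subseteq> bidx P" unfolding p'_def by (intro keys_diffI pq(1) mul_sub)
  \<comment> \<open>As \<open>sg\<close> anticommutes with the differential, the correction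
    contributes the product of \<open>sg P q\<close> with \<open>u\<close>, exactly the missing term
    of the first cycle condition.\<close>
  have dp': "bdif P p' = 0"
    using c(1) q'(2) by (simp add: p'_def dif_simps leibniz u_dif mul_simps sg_dif eq_neg_iff_add_eq_0)
      (metis add.inverse_inverse sg_dif add_eq_0_iff2 mul_simps(4))
  have "eA (T.tlift kE w) = 0" for w using bhom_dif[OF eA_bhom, of w] by simp
  then have "e' p' = 0" using y(3) unfolding y' by (simp add: eA_simps eA_emb)
  then have rp: "rho (e p') = 0" by (simp add: e'_def)
  obtain t where t: "keys t \<subseteq> faces K" "e p' = restr (faces K) (t * e u)"
    using rho_kernel[OF e_sub, of p'] rp unfolding e_u by auto
  obtain t0 where t0: "keys t0 \<subseteq> bidx P" "e t0 = t" using surj[OF t(1)] by blast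
  \<comment> \<open>The degree-zero part has the same augmentation, and it is closed and fixed by
    \<open>sg\<close>; hence the boundary of \<open>t1 \<theta>\<close> is
    \<open>t1 u\<close>.\<close>
  define t1 where "t1 = restr {x \<in> bidx P. bdeg P x = 0} t0"
  have "e t1 = e t0" unfolding t1_def
    by (rule lin_eqI[OF lin_comp[OF e_lin lin_restr] e_lin]) (use ghom_off[OF e_ghom] e_deg in \<open>auto simp: e_simps\<close>)
  moreover have t1: "sg P t1 = t1"
    by (rule lin_eq_keys[OF lin_sg lin_id]) (auto simp: t1_def keys_restr)
  moreover have dt1: "bdif P t1 = 0"
    by (rule lin_eq_keys[OF lin_dif lin_zero], rule dif_deg_0[of _ "bwt P _"]) (auto simp: t1_def keys_restr hidx_def)
  ultimately have e1: "e (p' - bmul P t1 u) = 0" using t(2) t0(2) by (simp add: e_simps e_mul)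
  have "bdif P (p' - bmul P t1 u) = 0" by (simp add: dif_simps dp' leibniz dt1 u_dif mul_simps)
  then obtain w where w: "bdif P w = p' - bmul P t1 u" using acyc[OF keys_diffI[OF p'_sub mul_sub] _ e1] by blast
  define z where "z = T.emb (0, False) w + T.emb (0, True) t1 + T.emb (0, True) q'"
  have "T.tlift kE z = y"
    unfolding z_def y' T.tlift_simps D(1) D(2)[of t1] by (simp add: w t1 dt1 T.emb_simps)
  moreover have emb_sub: "keys (T.emb (0, \<alpha>) f) \<subseteq> T.tidx" for \<alpha> f
    by (rule lin_keys[OF T.lin_emb]) (simp add: T.emb_bas T.pr_tidx)
  then have "keys z \<subseteq> T.tidx" unfolding z_def by (intro keys_addI)
  ultimately show ?thesis by auto
qed

lemma KT_surj:
  assumes "keys s \<subseteq> faces L" shows "\<exists>y. keys y \<subseteq> bidx KT \<and> eA y = s"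
proof -
  \<comment> \<open>A preimage of \<open>s\<close> under \<open>x_v = 1\<close> is
    \<open>x_v s\<close>; the exponent 1 is the smallest one that \<open>rho_mulv\<close>
    admits.\<close>
  have "keys (mulv 1 s) \<subseteq> faces K" unfolding mulv_def by (auto simp: keys_restr)
  then obtain x where x: "keys x \<subseteq> bidx P" "e x = mulv 1 s" using surj by blast
  have "eA (T.emb (0, False) x) = s" using rho_mulv[OF _ assms, of 1] by (simp add: eA_emb e'_def x)
  moreover have "keys (T.emb (0, False) x) \<subseteq> bidx KT"
    by (rule lin_keys[OF T.lin_emb]) (simp add: T.emb_bas T.pr_tidx)
  ultimately show ?thesis by blast
qed

end

section \<open>Free generators of the Koszul extension\<close>

lemma count_map_ge: "count (mset xs) a \<le> count (mset (map f xs)) (f a)"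
  by (induction xs) auto

context vertex_step
begin

text \<open>The index of the unit of \<open>P\<close>; it is needed to name \<open>\<theta>\<close>
  itself as a basis vector.\<close>

definition x0 where "x0 = (SOME x. x \<in> bidx P \<and> word x = [])"

lemma x0: "x0 \<in> bidx P" "word x0 = []" "bas x0 = bone P"
proof -
  have "\<exists>x. x \<in> bidx P \<and> word x = []" using word_ex[of "[]"] by auto
  from someI_ex[OF this] show *: "x0 \<in> bidx P" "word x0 = []" unfolding x0_def by auto
  show "bas x0 = bone P" using bas_word[OF *(1)] *(2) by simp
qed

definition gen0 where "gen0 g = pr g (0, False)"
definition zi where "zi = pr x0 (0, True)"
definition KG where "KG = insert zi (gen0 ` G)"
definition Kword where "Kword j = map gen0 (word (p1 j)) @ (if snd (p2 j) then [zi] else [])"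

lemma gen0_simps: assumes "g \<in> bidx P"
  shows "p1 (gen0 g) = g" "p2 (gen0 g) = (0, False)" "gen0 g \<in> T.tidx" "bas (gen0 g) = T.emb (0, False) (bas g)"
  using assms by (simp_all add: gen0_def p1_pr p2_pr T.pr_tidx T.emb_bas)

lemma zi_simps: "p1 zi = x0" "p2 zi = (0, True)" "zi \<in> T.tidx" "bas zi = T.emb (0, True) (bone P)"
  using x0 by (simp_all add: zi_def p1_pr p2_pr T.pr_tidx T.emb_bas x0(3)[symmetric])

lemma lprod_gen0: "set ws \<subseteq> G \<Longrightarrow> lprod KT (map bas (map gen0 ws)) = T.emb (0, False) (lprod P (map bas ws))"
  by (induction ws) (simp_all add: gen0_simps gen_idx T.tmul_emb sgb_P)

text \<open>A basis vector \<open>x \<theta>^\<alpha>\<close> is the word of \<open>x\<close>,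
  followed by the new letter \<open>zi\<close> if \<open>\<theta>\<close> is present. The letter is
  odd, hence occurs at most once in an admissible list.\<close>

lemma KT_free: "bfree KT KG Kword"
  unfolding bfree_def
proof (intro conjI ballI allI impI)
  show "KG \<subseteq> bidx KT" using gen_idx by (auto simp: KG_def zi_simps gen0_simps)
  show "Kword g = [g]" if "g \<in> KG" for g
    using that gen_idx by (auto simp: KG_def Kword_def zi_simps gen0_simps x0(2) word_gen)
next
  fix j assume j: "j \<in> bidx KT"
  then have "j \<in> T.tidx" by simp
  then obtain x m where *: "x \<in> bidx P'" "m \<in> kM0" "j = pr x m" "p1 j = x" "p2 j = m" by (rule T.tidxE)
  obtain \<alpha> where mm: "m = (0, \<alpha>)" using *(2) by (rule kM0_E)
  have x: "x \<in> bidx P" using *(1) by simp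
  show "0 \<le> bdeg KT j" using * deg_nonneg[OF x] by simp
  show "set (Kword j) \<subseteq> KG" using word_sub[OF x] * by (auto simp: Kword_def KG_def)
  have "lprod KT (map bas (Kword j)) = T.tmul (T.emb (0, False) (bas x)) (lprod KT (if \<alpha> then [bas zi] else []))"
    using lprod_gen0[OF word_sub[OF x]] * mm by (simp add: Kword_def KT.lprod_append bas_word[OF x, symmetric])
  also have "\<dots> = T.emb (0, \<alpha>) (bas x)"
    using x by (simp add: zi_simps T.tmul_emb sgb_P mul_one one_mul one_sub sg_one)
  also have "\<dots> = bas j" using * mm by (simp add: T.emb_bas)
  finally show "bas j = lprod KT (map bas (Kword j))" by simp
next
  fix ws assume ws: "set ws \<subseteq> KG" and odd: "\<forall>g\<in>set ws. odd (bdeg KT g) \<longrightarrow> count (mset ws) g \<le> 1"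
  \<comment> \<open>With \<open>zi\<close> removed, the list comes from generators of
    \<open>P\<close>, and no odd one is repeated in it because none is repeated in
    \<open>ws\<close>.\<close>
  define us' where "us' = filter (\<lambda>j. j \<noteq> zi) ws"
  define us where "us = map p1 us'"
  have us': "\<exists>g\<in>G. j = gen0 g" if "j \<in> set us'" for j using that ws by (auto simp: us'_def KG_def)
  have g0: "map gen0 us = us'" unfolding us_def map_map
  proof (rule map_idI)
    fix j assume "j \<in> set us'"
    then obtain g where "g \<in> G" "j = gen0 g" using us' by blast
    then show "(gen0 \<circ> p1) j = j" using gen0_simps(1)[OF gen_idx] by simp
  qed
  have us: "set us \<subseteq> G" using us' gen0_simps gen_idx unfolding us_def by fastforce
  have "count (mset us) g \<le> 1" if g: "g \<in> set us" "odd (bdeg P g)" for g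
  proof -
    have gi: "g \<in> bidx P" using g us gen_idx by blast
    have "gen0 g \<in> set us'" using g(1) g0 by (metis image_eqI set_map)
    then have gs: "gen0 g \<in> set ws" by (simp add: us'_def)
    have "count (mset us) g \<le> count (mset (map gen0 us)) (gen0 g)" by (rule count_map_ge)
    also have "\<dots> = count (mset us') (gen0 g)" by (simp only: g0)
    also have "\<dots> \<le> count (mset ws) (gen0 g)" by (simp add: us'_def)
    also have "\<dots> \<le> 1" using odd gs g(2) gen0_simps[OF gi] by simp
    finally show ?thesis .
  qed
  then obtain x where x: "x \<in> bidx P" "mset (word x) = mset us" using word_ex[OF us] by blast
  define j where "j = pr x (0, zi \<in> set ws)"
  have j: "j \<in> bidx KT" "p1 j = x" "p2 j = (0, zi \<in> set ws)" using x(1) by (simp_all add: j_def T.pr_tidx p1_pr p2_pr)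
  have "bdeg P x0 = 0" using word_deg(1)[OF x0(1)] x0(2) by simp
  then have oz: "odd (bdeg KT zi)" by (simp add: zi_simps)
  have z: "count (mset ws) zi = 1" if "zi \<in> set ws"
  proof -
    have "count (mset ws) zi \<le> 1" using odd oz that by blast
    moreover have "0 < count (mset ws) zi" using that by simp
    ultimately show ?thesis by linarith
  qed
  have "mset (Kword j) = mset us' + (if zi \<in> set ws then {#zi#} else {#})"
    using x(2) j by (simp add: Kword_def flip: g0)
  also have "\<dots> = mset ws"
    using z by (auto intro!: multiset_eqI simp: us'_def not_in_iff)
  finally show "\<exists>j\<in>bidx KT. mset (Kword j) = mset ws" using j(1) by blast
qed

lemma KT_resolution: "bresol KT KG Kword L eA"
proof (unfold_locales)
  show "bfree KT KG Kword" by (rule KT_free)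
  show "dcl L" by (rule dcl_L)
  show "bhom KT (SR L) eA" by (rule eA_bhom)
qed (use KT_acyclic KT_surj in blast)+

section \<open>Derivations of the Koszul extension\<close>

lemma emb0_bhom: "bhom P' KT (T.emb (0, False))"
  unfolding bhom_def ghom_def
proof (intro conjI allI impI)
  show "keys (T.emb (0, False) (bas x)) \<subseteq> hidx KT (bdeg P' x) (bwt P' x)" for x
  proof (cases "x \<in> bidx P'")
    case True
    then show ?thesis using T.emb_keys[of "(0, False)" "bas x" "bdeg P' x" "bwt P' x" kE] by (simp add: hidx_def)
  qed (simp add: T.emb_bas)
qed (simp_all add: T.lin_emb T.tmul_emb sgb_P T.emb_bas kE_emb kE_def)

lemma eA_emb0: "eA (T.emb (0, False) x) = e' x" by (simp add: eA_emb)

definition dext :: "(('x \<Rightarrow>\<^sub>0 'k) \<Rightarrow> ('v mon \<Rightarrow>\<^sub>0 'k)) \<Rightarrow> ('z \<Rightarrow>\<^sub>0 'k) \<Rightarrow> ('v mon \<Rightarrow>\<^sub>0 'k)" where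
  "dext \<phi> = T.tlift (\<lambda>m f. if snd m then 0 else \<phi> f)"

lemma dext_emb:
  assumes "\<phi> \<in> bder P' L e' c' j" "m \<in> kM0"
  shows "dext \<phi> (T.emb m f) = (if snd m then 0 else \<phi> f)"
  unfolding dext_def
  by (subst T.tlift_emb) (use assms bder_off[OF assms(1)] in \<open>auto intro: lin_ifI lin_zero bder_lin\<close>)

text \<open>Extension by zero over \<open>\<theta>\<close> respects the Leibniz rule because
  \<open>eA\<close> vanishes on the \<open>\<theta>\<close>-summand too.\<close>

lemma dext_der:
  assumes \<phi>: "\<phi> \<in> bder P' L e' c' j" shows "dext \<phi> \<in> bder KT L eA c' j"
  unfolding bder_def
proof (intro CollectI conjI allI impI)
  have l: "lin (dext \<phi>)" by (simp add: dext_def T.lin_tlift)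
  have off: "z \<notin> T.tidx \<Longrightarrow> dext \<phi> (bas z) = 0" for z by (simp add: dext_def T.tlift_off)
  note lr = lin_comp[OF bilin_right[OF bilin_restr_times]] lin_comp[OF bilin_left[OF bilin_restr_times]]
  show "lin (dext \<phi>)" by (rule l)
  show "dext \<phi> (bmul KT y y') = restr (faces L) (dext \<phi> y * eA y') + restr (faces L) (eA y * dext \<phi> y')" for y y'
    unfolding T.T_simps
  proof (rule T.tens_eqI[where y = y])
    fix m x assume m: "m \<in> kM0" "x \<in> bidx P'"
    then obtain \<alpha> where mm: "m = (0, \<alpha>)" by (metis kM0_E)
    show "dext \<phi> (T.tmul (T.emb m (bas x)) y') = restr (faces L) (dext \<phi> (T.emb m (bas x)) * eA y') +
        restr (faces L) (eA (T.emb m (bas x)) * dext \<phi> y')"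
    proof (rule T.tens_eqI[where y = y'])
      fix m' y assume "m' \<in> kM0" "y \<in> bidx P'"
      then obtain \<beta> where mm': "m' = (0, \<beta>)" by (metis kM0_E)
      show "dext \<phi> (T.tmul (T.emb m (bas x)) (T.emb m' (bas y))) =
          restr (faces L) (dext \<phi> (T.emb m (bas x)) * eA (T.emb m' (bas y))) +
          restr (faces L) (eA (T.emb m (bas x)) * dext \<phi> (T.emb m' (bas y)))"
        unfolding mm mm' using bder_mul[OF \<phi>, of "bas x" "bas y"]
        by (cases \<alpha>; cases \<beta>) (simp_all add: T.tmul_emb eA_emb dext_emb[OF \<phi>] sgb_P lin_0[OF l])
    qed (intro lin_comp[OF l] bilin_right[OF T.bilin_tmul],
        intro lin_addI lr(1)[OF eA_lin] lr(1)[OF l], simp add: T.tmul_off eA_off eA_simps off lin_0[OF l])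
  qed (intro lin_comp[OF l] bilin_left[OF T.bilin_tmul],
      intro lin_addI lr(2)[OF eA_lin] lr(2)[OF l], simp add: T.tmul_off eA_off eA_simps off lin_0[OF l])
  show "dext \<phi> (bas z) = 0" if "\<not> (z \<in> bidx KT \<and> bdeg KT z = j)" for z
    using that bder_off[OF \<phi>, of "p1 z"] by (cases "z \<in> T.tidx") (auto simp: off dext_def T.tlift_def)
  show "keys (dext \<phi> (bas z)) \<subseteq> {m \<in> faces L. mwt m = bwt KT z + c'}" for z
    using bder_keys[OF \<phi>, of "p1 z"] by (simp add: dext_def T.tlift_def)
qed

lemma bder_deg:
  assumes "\<phi> \<in> bder A M f c' j" "keys x \<subseteq> hidx A n w" "n \<noteq> j" shows "\<phi> x = 0"
  by (rule lin_eq_keys[OF bder_lin[OF assms(1)] lin_zero])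
    (use bder_off[OF assms(1)] assms(2,3) in \<open>auto simp: hidx_def\<close>)

text \<open>
  For \<open>i = 1\<close> the value of a derivation on \<open>u\<close> need not match its value on the new generator;
  since this derivation takes the value \<open>1\<close> on \<open>u\<close>, adding a multiple of it repairs this.
\<close>

definition euler :: "('x \<Rightarrow>\<^sub>0 'k) \<Rightarrow> ('v mon \<Rightarrow>\<^sub>0 'k)" where
  "euler = lext (\<lambda>x. of_int (bwt P x v) \<bullet> e' (bas x))"

lemma lin_euler: "lin euler" by (simp add: euler_def lin_lext)

lemma euler_hom: "keys f \<subseteq> hidx P n w \<Longrightarrow> euler f = of_int (w v) \<bullet> e' f"
  by (rule lin_eq_keys[OF lin_euler lin_smulI[OF e'_lin]]) (auto simp: euler_def hidx_def)

lemma euler_bas: "euler (bas x) = of_int (bwt P x v) \<bullet> e' (bas x)"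
  by (simp add: euler_def)

lemma euler_dif: "euler (bdif P x) = 0"
  by (rule lin_eqI[OF lin_comp[OF lin_euler lin_dif] lin_zero]) (simp add: euler_hom[OF dif_keys] e'_dif)

lemma euler_u: "euler u = restr (faces L) 1"
  using euler_hom[OF Xv(1)] euler_hom[OF one_keys]
  by (simp add: u_def lin_diff[OF lin_euler] e'_Xv mwt_single)

lemma euler_mul: "euler (bmul P x y) = restr (faces L) (euler x * e' y) + restr (faces L) (e' x * euler y)"
proof (rule bilin_eq_keys[of "\<lambda>x y. euler (bmul P x y)"
      "\<lambda>x y. restr (faces L) (euler x * e' y) + restr (faces L) (e' x * euler y)"])
  show "bilin (\<lambda>x y. euler (bmul P x y))" by (rule bilin_comp[OF lin_euler bilin])
  show "bilin (\<lambda>x y. restr (faces L) (euler x * e' y) + restr (faces L) (e' x * euler y))"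
    unfolding bilin_def
    by (intro conjI allI lin_addI lin_comp[OF bilin_left[OF bilin_restr_times] lin_euler]
        lin_comp[OF bilin_right[OF bilin_restr_times] lin_euler]
        lin_comp[OF bilin_left[OF bilin_restr_times] e'_lin] lin_comp[OF bilin_right[OF bilin_restr_times] e'_lin])
  fix x y
  show "euler (bmul P (bas x) (bas y)) =
      restr (faces L) (euler (bas x) * e' (bas y)) + restr (faces L) (e' (bas x) * euler (bas y))"
    by (simp add: euler_hom[OF mul_keys] e'_mul euler_bas smul_times restr_simps smul_simps)
qed

lemma euler_der:
  assumes q: "keys q \<subseteq> {m \<in> faces L. mwt m = c'}"
  shows "(\<lambda>f. restr (faces L) (q * euler f)) \<in> bder P' L e' c' 0"
  unfolding bder_def
proof (intro CollectI conjI allI impI)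
  show "lin (\<lambda>f. restr (faces L) (q * euler f))" by (rule lin_comp[OF bilin_right[OF bilin_restr_times] lin_euler])
  show "restr (faces L) (q * euler (bmul P' x y)) =
      restr (faces L) (restr (faces L) (q * euler x) * e' y) + restr (faces L) (e' x * restr (faces L) (q * euler y))" for x y
    by (simp add: euler_mul restr_times[OF dcl_L] distrib_left restr_simps ac_simps)
  have ek: "keys (euler (bas x)) \<subseteq> {m \<in> faces L. bdeg P x = 0 \<and> mwt m = \<tau> (bwt P x)}" for x
    using keys_smulI[OF ghom_keys[OF bhom_ghom[OF e'_bhom], of x]] by (simp add: euler_def hidx_SR)
  show "restr (faces L) (q * euler (bas x)) = 0" if "\<not> (x \<in> bidx P' \<and> bdeg P' x = 0)" for x
    using that ek[of x] e'_off[of x] by (cases "x \<in> bidx P") (auto simp: euler_def)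
  show "keys (restr (faces L) (q * euler (bas x))) \<subseteq> {m \<in> faces L. mwt m = bwt P' x + c'}" for x
  proof (rule bilin_keys[OF bilin_restr_times])
    fix m n assume "m \<in> keys q" "n \<in> keys (euler (bas x))"
    then have "mwt m = c'" "mwt n = bwt P' x" using q ek[of x] by auto
    then have "mwt (m + n) = bwt P' x + c'" by (simp add: mwt_add add.commute)
    then show "keys (restr (faces L) (bas m * bas n)) \<subseteq> {m \<in> faces L. mwt m = bwt P' x + c'}" by simp
  qed
qed

text \<open>Restriction along \<open>P'\<close> is surjective on classes: a derivation of degree
  \<open>i \<ge> 1\<close> is zero on \<open>u\<close>, as is \<open>e'\<close>, so a cocycle
  extended by zero to \<open>\<theta>\<close> stays a cocycle. For injectivity, a derivation on
  \<open>P'\<close> whose coboundary is the restriction of \<open>\<phi>\<close> must be adjusted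
  until its value on \<open>u\<close> is that of \<open>\<phi>\<close> on
  \<open>\<theta>\<close>.\<close>

lemma step_extension:
  "hiso (bcoc KT L eA (\<tau> c) i) (bcob KT L eA (\<tau> c) i) (bcoc P' L e' (\<tau> c) i) (bcob P' L e' (\<tau> c) i)"
proof (rule hiso_fun[where F = "\<lambda>\<phi> x. \<phi> (T.emb (0, False) x)", OF refl refl _ _ _ linclosed_bcob])
  show "(\<lambda>x. \<phi> (T.emb (0, False) x)) \<in> bcoc P' L e' (\<tau> c) i" if "\<phi> \<in> bcoc KT L eA (\<tau> c) i" for \<phi>
    using bcoc_comp[OF that emb0_bhom] by (simp add: eA_emb0)
  have D: "T.tlift kE (T.emb (0, False) f) = T.emb (0, False) (bdif P f)"
    "T.tlift kE (T.emb (0, True) f) = T.emb (0, True) (bdif P f) + T.emb (0, False) (bmul P (sg P f) u)" for f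
    by (simp_all add: kE_emb kE_def T.emb_simps)
  show "(\<lambda>x. \<phi> (T.emb (0, False) x)) \<in> bcob P' L e' (\<tau> c) i \<longleftrightarrow> \<phi> \<in> bcob KT L eA (\<tau> c) i"
    if \<phi>: "\<phi> \<in> bcoc KT L eA (\<tau> c) i" for \<phi>
  proof
    assume "\<phi> \<in> bcob KT L eA (\<tau> c) i"
    from bcob_comp[OF this emb0_bhom] show "(\<lambda>x. \<phi> (T.emb (0, False) x)) \<in> bcob P' L e' (\<tau> c) i"
      by (simp add: eA_emb0)
  next
    assume "(\<lambda>x. \<phi> (T.emb (0, False) x)) \<in> bcob P' L e' (\<tau> c) i"
    then obtain \<psi> where \<psi>: "\<psi> \<in> bder P' L e' (\<tau> c) (i - 1)" "\<And>x. \<phi> (T.emb (0, False) x) = \<psi> (bdif P x)"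
      unfolding bcob_def by (auto dest: fun_cong)
    have \<phi>': "\<phi> \<in> bder KT L eA (\<tau> c) i" using \<phi> by (simp add: bcoc_def)
    define m where "m = \<phi> (T.emb (0, True) (bone P))"
    have one': "keys (bone P) \<subseteq> hidx P' 0 0" using subset_trans[OF one_keys hidx_P'] by (simp add: \<tau>_add)
    have z_hom: "keys (T.emb (0, True) (bone P)) \<subseteq> hidx KT 1 0"
      using T.emb_keys[OF _ one', of "(0, True)" kE] by simp
    have m_keys: "keys m \<subseteq> {m \<in> faces L. mwt m = \<tau> c}"
      using bder_hom[OF \<phi>' z_hom] by (simp add: m_def)
    \<comment> \<open>The obstruction to extending the primitive. It can be nonzero only for
      \<open>i = 1\<close>, since \<open>\<phi>\<close> has degree \<open>i\<close> while
      \<open>\<theta>\<close> has degree 1, and \<open>\<psi>\<close> has degree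
      \<open>i - 1\<close> while \<open>u\<close> has degree 0.\<close>
    define q where "q = m - \<psi> u"
    have q_keys: "keys q \<subseteq> {m \<in> faces L. mwt m = \<tau> c}"
      unfolding q_def using bder_hom[OF \<psi>(1) u_hom] m_keys by (intro keys_diffI) simp_all
    have q0: "q = 0" if "i \<noteq> 1"
      using bder_deg[OF \<phi>' z_hom] bder_deg[OF \<psi>(1) u_hom] that by (simp add: q_def m_def)
    define \<psi>' where "\<psi>' f = \<psi> f + restr (faces L) (q * euler f)" for f
    have \<psi>': "\<psi>' \<in> bder P' L e' (\<tau> c) (i - 1)"
    proof (cases "i = 1")
      case True
      then show ?thesis using euler_der[OF q_keys] \<psi>(1) linclosed_bder[of P' L e' "\<tau> c" 0]
        unfolding linclosed_def \<psi>'_def[abs_def] by simp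
    next
      case False
      then show ?thesis using \<psi>(1) q0 by (simp add: \<psi>'_def[abs_def])
    qed
    have \<psi>'_dif: "\<psi>' (bdif P f) = \<psi> (bdif P f)" for f by (simp add: \<psi>'_def euler_dif)
    have "restr (faces L) q = q" using q_keys by (intro restr_id) blast
    then have \<psi>'_u: "\<psi>' u = m" by (simp add: \<psi>'_def euler_u e'_mul_one q_def)
    \<comment> \<open>Every \<open>f \<theta>\<close> is a product with \<open>\<theta>\<close>, and
      \<open>eA\<close> kills \<open>\<theta>\<close>; so the Leibniz rule leaves only the value
      \<open>m\<close>.\<close>
    have \<phi>_z: "\<phi> (T.emb (0, True) f) = restr (faces L) (e' f * m)" for f
    proof (rule lin_eqI[OF lin_comp[OF bder_lin[OF \<phi>'] T.lin_emb]
          lin_comp[OF bilin_left[OF bilin_restr_times] e'_lin]])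
      fix x show "\<phi> (T.emb (0, True) (bas x)) = restr (faces L) (e' (bas x) * m)"
      proof (cases "x \<in> bidx P")
        case True
        have "T.emb (0, True) (bas x) = T.tmul (T.emb (0, False) (bas x)) (T.emb (0, True) (bone P))"
          using True by (simp add: T.tmul_emb sgb_P mul_one)
        then show ?thesis using bder_mul[OF \<phi>', of "T.emb (0, False) (bas x)" "T.emb (0, True) (bone P)"]
          by (simp add: eA_emb m_def)
      qed (simp add: T.emb_bas lin_0[OF bder_lin[OF \<phi>']] e'_off)
    qed
    have "\<phi> y = dext \<psi>' (T.tlift kE y)" for y
    proof (rule T.tens_eqI[OF bder_lin[OF \<phi>'] lin_comp[OF bder_lin[OF dext_der[OF \<psi>']] T.lin_tlift]])
      fix n x assume "n \<in> kM0" "x \<in> bidx P'"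
      then obtain \<alpha> where n: "n = (0, \<alpha>)" by (metis kM0_E)
      have "\<psi>' (bmul P (sg P (bas x)) u) = restr (faces L) (e' (bas x) * m)"
        using bder_mul[OF \<psi>', of "sg P (bas x)" u] by (simp add: e'_u e'_sg \<psi>'_u del: sg_bas)
      then show "\<phi> (T.emb n (bas x)) = dext \<psi>' (T.tlift kE (T.emb n (bas x)))"
        unfolding n by (cases \<alpha>) (simp_all add: D \<phi>_z \<psi>(2) \<psi>'_dif dext_emb[OF \<psi>']
            lin_add[OF bder_lin[OF dext_der[OF \<psi>']]] del: sg_bas)
    next
      fix z assume "z \<notin> T.tidx"
      then show "\<phi> (bas z) = dext \<psi>' (T.tlift kE (bas z))"
        using bder_off[OF \<phi>', of z] by (simp add: T.tlift_off lin_0[OF bder_lin[OF dext_der[OF \<psi>']]])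
    qed
    then have "\<phi> = (\<lambda>y. dext \<psi>' (bdif KT y))" by auto
    then show "\<phi> \<in> bcob KT L eA (\<tau> c) i" unfolding bcob_def using dext_der[OF \<psi>'] by blast
  qed
  show "\<exists>\<phi>\<in>bcoc KT L eA (\<tau> c) i. (\<lambda>x. \<psi> x - \<phi> (T.emb (0, False) x)) \<in> bcob P' L e' (\<tau> c) i"
    if \<psi>: "\<psi> \<in> bcoc P' L e' (\<tau> c) i" for \<psi>
  proof (rule bexI[of _ "dext \<psi>"])
    have \<psi>': "\<psi> \<in> bder P' L e' (\<tau> c) i" "\<And>x. \<psi> (bdif P x) = 0" using \<psi> by (auto simp: bcoc_def)
    have "(\<lambda>x. 0) \<in> bcob P' L e' (\<tau> c) i" using linclosed_bcob unfolding linclosed_def by blast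
    then show "(\<lambda>x. \<psi> x - dext \<psi> (T.emb (0, False) x)) \<in> bcob P' L e' (\<tau> c) i" by (simp add: dext_emb[OF \<psi>'(1)])
    note dl = bder_lin[OF dext_der[OF \<psi>'(1)]]
    have \<psi>u: "\<psi> u = 0" using bder_deg[OF \<psi>'(1) u_hom] i1 by simp
    have "dext \<psi> (T.tlift kE y) = 0" for y
    proof (rule T.tens_eqI[OF lin_comp[OF dl T.lin_tlift] lin_zero])
      fix n x assume "n \<in> kM0" "x \<in> bidx P'"
      then obtain \<alpha> where n: "n = (0, \<alpha>)" by (metis kM0_E)
      have "\<psi> (bmul P (sg P (bas x)) u) = 0"
        using bder_mul[OF \<psi>'(1), of "sg P (bas x)" u] by (simp add: e'_u \<psi>u del: sg_bas)
      then show "dext \<psi> (T.tlift kE (T.emb n (bas x))) = 0"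
        unfolding n by (cases \<alpha>) (simp_all add: D \<psi>'(2) dext_emb[OF \<psi>'(1)] lin_add[OF dl] del: sg_bas)
    qed (simp add: T.tlift_off lin_0[OF dl])
    then show "dext \<psi> \<in> bcoc KT L eA (\<tau> c) i" using dext_der[OF \<psi>'(1)] by (simp add: bcoc_def)
  qed
qed

theorem step:
  "\<exists>A G' word' e'. bresol A G' word' (link {v} K) e' \<and> bidx A = {pr x m | x m. x \<in> bidx P \<and> m \<in> kM0} \<and>
     hiso (bcoc P K e c i) (bcob P K e c i) (bcoc A (link {v} K) e' (c(v := 0)) i) (bcob A (link {v} K) e' (c(v := 0)) i)"
proof (intro exI conjI)
  show "bresol KT KG Kword (link {v} K) eA" using KT_resolution unfolding L_def .
  show "bidx KT = {pr x m | x m. x \<in> bidx P \<and> m \<in> kM0}" by (simp add: T.tidx_def)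
  show "hiso (bcoc P K e c i) (bcob P K e c i) (bcoc KT (link {v} K) eA (c(v := 0)) i) (bcob KT (link {v} K) eA (c(v := 0)) i)"
    using hiso_trans[OF step_coefficients hiso_sym[OF step_extension] linclosed_bcoc] unfolding L_def \<tau>_def .
qed

end

text \<open>
  In an iterated extension the basis is indexed by pairs; the second component records which of
  the odd variables, one for each vertex, occur.
\<close>

theorem link_resolution:
  fixes P :: "('x \<times> 'v set, 'k::field_char_0, 'v \<Rightarrow> int) balg"
  assumes "finite F" "bresol P G word K e" "bidx P \<subseteq> UNIV \<times> {{}}" "\<And>v. v \<in> F \<Longrightarrow> 1 \<le> c v" "1 \<le> i"
  shows "\<exists>A :: ('x \<times> 'v set, 'k, 'v \<Rightarrow> int) balg. \<exists>G' word' e'. bresol A G' word' (link F K) e' \<and> bidx A \<subseteq> UNIV \<times> Pow F \<and>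
     hiso (bcoc P K e c i) (bcob P K e c i) (bcoc A (link F K) e' (\<lambda>v. if v \<in> F then 0 else c v) i)
       (bcob A (link F K) e' (\<lambda>v. if v \<in> F then 0 else c v) i)"
  using assms(1,4)
proof (induction F)
  case empty
  have "hiso Z B Z B" for Z B :: "(('x \<times> 'v set \<Rightarrow>\<^sub>0 'k) \<Rightarrow> ('v mon \<Rightarrow>\<^sub>0 'k)) set"
    unfolding hiso_def by (intro exI[of _ "(=)"]) auto
  moreover have "link {} K = K" by (auto simp: link_def)
  ultimately show ?case using assms(2,3) by (intro exI[of _ P] exI[of _ G] exI[of _ word] exI[of _ e]) auto
next
  case (insert v F)
  let ?c = "\<lambda>v. if v \<in> F then 0 else c v"
  obtain A :: "('x \<times> 'v set, 'k, 'v \<Rightarrow> int) balg" and G' word' e' where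
    A: "bresol A G' word' (link F K) e'" "bidx A \<subseteq> UNIV \<times> Pow F"
    "hiso (bcoc P K e c i) (bcob P K e c i) (bcoc A (link F K) e' ?c i) (bcob A (link F K) e' ?c i)"
    using insert.IH insert.prems by auto
  define pr where "pr = (\<lambda>(x :: 'x, T) (m :: nat \<times> bool). (x, if snd m then insert v T else T))"
  define p1 where "p1 = (\<lambda>(x :: 'x, T). (x, T - {v}))"
  define p2 where "p2 = (\<lambda>(x :: 'x, T). (0 :: nat, v \<in> T))"
  interpret vertex_step A G' word' "link F K" e' v ?c i pr p1 p2
  proof (intro vertex_step.intro[OF A(1)] vertex_step_axioms.intro)
    show "1 \<le> ?c v" using insert by simp
    show "1 \<le> i" by (rule assms(5))
    fix y m assume y: "y \<in> bidx A" and m: "m \<in> kM0"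
    obtain x T where xT: "y = (x, T)" "v \<notin> T" using y A(2) insert.hyps by (cases y) auto
    show "p1 (pr y m) = y" "p2 (pr y m) = m"
      using xT m by (auto simp: pr_def p1_def p2_def kM0_def)
  qed
  obtain B :: "('x \<times> 'v set, 'k, 'v \<Rightarrow> int) balg" and H wordB eB where
    B: "bresol B H wordB (link {v} (link F K)) eB" "bidx B = {pr x m | x m. x \<in> bidx A \<and> m \<in> kM0}"
    "hiso (bcoc A (link F K) e' ?c i) (bcob A (link F K) e' ?c i)
      (bcoc B (link {v} (link F K)) eB (?c(v := 0)) i) (bcob B (link {v} (link F K)) eB (?c(v := 0)) i)"
    using step by blast
  have "dcl K" using assms(2) by (simp add: bresol_def bresol_axioms_def)
  \<comment> \<open>This holds also when \<open>insert v F\<close> is not a face, both sides being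
    void then; the induction thus covers faces and nonfaces alike.\<close>
  have l: "link {v} (link F K) = link (insert v F) K"
  proof (intro Set.set_eqI iffI)
    fix g assume "g \<in> link {v} (link F K)"
    then show "g \<in> link (insert v F) K" unfolding link_def by auto
  next
    fix g assume g: "g \<in> link (insert v F) K"
    then have gK: "insert v F \<union> g \<in> K" by (simp add: link_def)
    have sub: "h \<in> K" if "h \<subseteq> insert v F \<union> g" for h
      using \<open>dcl K\<close> gK that unfolding dcl_def by metis
    have "F \<union> g \<in> K" "{v} \<union> g \<in> K" by (rule sub, blast)+
    then show "g \<in> link {v} (link F K)" using g insert.hyps unfolding link_def by auto
  qed
  have c: "?c(v := 0) = (\<lambda>u. if u \<in> insert v F then 0 else c u)" by auto
  have "bidx B \<subseteq> UNIV \<times> Pow (insert v F)"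
    unfolding B(2) using A(2) by (auto simp: pr_def)
  then show ?case using B(1) hiso_trans[OF A(3) B(3) linclosed_bcoc] unfolding l c by blast
qed

section \<open>Cosets\<close>

text \<open>Coset calculus without group axioms for the record \<open>M\<close>: the additive
  injection \<open>tr\<close> moves all computations to an abelian group type. It is used for
  polynomials with \<open>tr\<close> the identity, and for derivations with \<open>tr\<close> the
  passage to coordinates.\<close>

locale coset_model =
  fixes M :: "('a, 'm) ring_scheme" (structure) and D :: "'a set" and tr :: "'a \<Rightarrow> 'g::ab_group_add" and B :: "'a set"
  assumes add_closed: "x \<in> D \<Longrightarrow> y \<in> D \<Longrightarrow> x \<oplus> y \<in> D"
    and tr_add: "x \<in> D \<Longrightarrow> y \<in> D \<Longrightarrow> tr (x \<oplus> y) = tr x + tr y"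
    and tr_inj: "inj_on tr D"
    and B_sub: "B \<subseteq> D" and B_zero: "0 \<in> tr ` B"
    and B_diff: "g \<in> tr ` B \<Longrightarrow> h \<in> tr ` B \<Longrightarrow> g - h \<in> tr ` B"
begin

lemma coset_mem: "x \<in> D \<Longrightarrow> z \<in> B +> x \<longleftrightarrow> z \<in> D \<and> tr z - tr x \<in> tr ` B"
proof
  assume x: "x \<in> D" and "z \<in> B +> x"
  then obtain b where "b \<in> B" "z = b \<oplus> x" by (auto simp: a_r_coset_def r_coset_def)
  then show "z \<in> D \<and> tr z - tr x \<in> tr ` B" using x B_sub by (auto simp: add_closed tr_add subset_iff)
next
  assume x: "x \<in> D" and z: "z \<in> D \<and> tr z - tr x \<in> tr ` B"
  then obtain b where b: "b \<in> B" "tr z - tr x = tr b" by blast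
  then have "tr z = tr (b \<oplus> x)" using x B_sub tr_add[of b x] by (auto simp: algebra_simps)
  then have "z = b \<oplus> x" using tr_inj z x b B_sub by (meson add_closed inj_onD subsetD)
  then show "z \<in> B +> x" using b(1) by (auto simp: a_r_coset_def r_coset_def)
qed

lemma coset_eq: "x \<in> D \<Longrightarrow> y \<in> D \<Longrightarrow> B +> x = B +> y \<longleftrightarrow> tr x - tr y \<in> tr ` B"
proof
  assume x: "x \<in> D" "y \<in> D" and "B +> x = B +> y"
  then have "x \<in> B +> y" using coset_mem[OF x(1), of x] B_zero x by simp
  then show "tr x - tr y \<in> tr ` B" using coset_mem[OF x(2)] by simp
next
  assume x: "x \<in> D" "y \<in> D" and d: "tr x - tr y \<in> tr ` B"
  have "tr z - tr x \<in> tr ` B \<longleftrightarrow> tr z - tr y \<in> tr ` B" for z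
    using B_diff[OF _ d, of "tr z - tr y"] B_diff[of "tr z - tr x" "0 - (tr x - tr y)"] B_diff[OF B_zero d]
    by (auto simp: algebra_simps)
  then show "B +> x = B +> y" using coset_mem[OF x(1)] coset_mem[OF x(2)] by blast
qed

lemma coset_self: "x \<in> D \<Longrightarrow> x \<in> B +> x"
  using coset_mem[of x x] B_zero by simp

lemma coset_eq_B: "x \<in> D \<Longrightarrow> B +> x = B \<longleftrightarrow> tr x \<in> tr ` B"
proof
  assume x: "x \<in> D"
  show "tr x \<in> tr ` B" if "B +> x = B" using coset_self[OF x] that by blast
  assume t: "tr x \<in> tr ` B"
  have "z \<in> B +> x \<longleftrightarrow> z \<in> B" for z
  proof -
    have "tr z - tr x \<in> tr ` B \<longleftrightarrow> tr z \<in> tr ` B"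
      using B_diff[OF _ t, of "tr z"] B_diff[of "tr z - tr x" "0 - tr x"] B_diff[OF B_zero t] by auto
    moreover have "z \<in> D \<and> tr z \<in> tr ` B \<longleftrightarrow> z \<in> B" using B_sub tr_inj by (auto simp: inj_on_def subset_iff)
    ultimately show ?thesis using coset_mem[OF x, of z] by blast
  qed
  then show "B +> x = B" by blast
qed

lemma coset_add:
  assumes x: "x \<in> D" "y \<in> D" shows "set_add M (B +> x) (B +> y) = B +> (x \<oplus> y)"
proof (intro Set.set_eqI iffI)
  fix z assume "z \<in> set_add M (B +> x) (B +> y)"
  then obtain u w where uw: "u \<in> B +> x" "w \<in> B +> y" "z = u \<oplus> w" by (auto simp: set_add_def set_mult_def)
  then have *: "u \<in> D" "w \<in> D" "tr u - tr x \<in> tr ` B" "tr w - tr y \<in> tr ` B"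
    using coset_mem[OF x(1)] coset_mem[OF x(2)] by auto
  have "(tr u - tr x) - (0 - (tr w - tr y)) \<in> tr ` B" using B_diff[OF *(3) B_diff[OF B_zero *(4)]] .
  then have "tr z - tr (x \<oplus> y) \<in> tr ` B" using * x by (simp add: uw(3) tr_add algebra_simps)
  then show "z \<in> B +> (x \<oplus> y)" using coset_mem[OF add_closed[OF x]] add_closed *(1,2) uw(3) by blast
next
  fix z assume "z \<in> B +> (x \<oplus> y)"
  then have z: "z \<in> D" "tr z - tr (x \<oplus> y) \<in> tr ` B" using coset_mem[OF add_closed[OF x]] by auto
  then obtain b where b: "b \<in> B" "tr z - tr (x \<oplus> y) = tr b" by blast
  have bD: "b \<in> D" using b(1) B_sub by blast
  have "tr z = tr ((b \<oplus> x) \<oplus> y)" using b(2) bD x by (simp add: tr_add add_closed algebra_simps)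
  then have "z = (b \<oplus> x) \<oplus> y" using tr_inj z(1) bD x add_closed by (meson inj_onD)
  moreover have "b \<oplus> x \<in> B +> x" using b(1) by (auto simp: a_r_coset_def r_coset_def)
  ultimately show "z \<in> set_add M (B +> x) (B +> y)" using coset_self[OF x(2)] by (auto simp: set_add_def set_mult_def)
qed

end


section \<open>Normal forms in the Stanley-Reisner ring\<close>

lemma ground_simps [simp]:
  "carrier (ring_of_type_algebra :: 'a::comm_ring_1 ring) = UNIV"
  "x \<oplus>\<^bsub>ring_of_type_algebra\<^esub> y = x + y" "x \<otimes>\<^bsub>ring_of_type_algebra\<^esub> y = x * (y :: 'a)"
  "\<zero>\<^bsub>ring_of_type_algebra\<^esub> = (0 :: 'a)" "\<one>\<^bsub>ring_of_type_algebra\<^esub> = (1 :: 'a)"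
  by (simp_all add: ring_of_type_algebra_def)

lemma mpoly_ring_simps [simp]:
  "p \<in> carrier (mpoly_ring V) \<longleftrightarrow> (\<forall>m\<in>keys p. keys m \<subseteq> V)"
  "x \<oplus>\<^bsub>mpoly_ring V\<^esub> y = x + y" "x \<otimes>\<^bsub>mpoly_ring V\<^esub> y = x * y" "\<zero>\<^bsub>mpoly_ring V\<^esub> = 0" "\<one>\<^bsub>mpoly_ring V\<^esub> = 1"
  by (simp_all add: mpoly_ring_def ring_of_type_algebra_def)

definition mons :: "'v set \<Rightarrow> 'v mon set" where "mons V = {m. keys m \<subseteq> V}"

lemma mpoly_carrier: "p \<in> carrier (mpoly_ring V) \<longleftrightarrow> keys p \<subseteq> mons V"
  by (auto simp: mons_def)

lemma mpoly_carrier': "carrier (mpoly_ring V) = {p. keys p \<subseteq> mons V}"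
  using mpoly_carrier by blast

lemma mons_times: "keys p \<subseteq> mons V \<Longrightarrow> keys q \<subseteq> mons V \<Longrightarrow> keys (p * q) \<subseteq> mons V"
  for p q :: "'v mon \<Rightarrow>\<^sub>0 'k::field"
  by (rule bilin_keys[OF bilin_times]) (auto simp: mons_def keys_add_nat)

lemma cring_mpoly: "cring (mpoly_ring V :: ('v, 'k::field) mpoly ring)"
proof (rule cringI)
  show "abelian_group (mpoly_ring V :: ('v, 'k) mpoly ring)"
  proof (rule abelian_groupI, unfold mpoly_carrier mpoly_ring_simps(2-))
    fix x :: "('v, 'k) mpoly" assume "keys x \<subseteq> mons V"
    then show "\<exists>y\<in>carrier (mpoly_ring V). y + x = 0"
      by (intro bexI[of _ "- x"]) (simp_all add: mpoly_carrier keys_uminusI del: mpoly_ring_simps(1))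
  qed (simp_all add: keys_addI add.assoc add.commute)
  show "comm_monoid (mpoly_ring V :: ('v, 'k) mpoly ring)"
    by (rule comm_monoidI, unfold mpoly_carrier mpoly_ring_simps(2-))
      (simp_all add: mons_times mult.assoc mult.commute, simp add: mons_def)
qed (simp add: distrib_right)

locale sr =
  fixes V :: "'v set" and K :: "'v set set"
  assumes finV: "finite V" and sc: "simplicial_complex V K"
begin

lemma dclK: "dcl K" using sc by (auto simp: simplicial_complex_def dcl_def)

lemma faces_mons: "faces K \<subseteq> mons V" using sc by (auto simp: simplicial_complex_def faces_def mons_def)

definition expo :: "'v set \<Rightarrow> 'v mon" where "expo f = (\<Sum>v\<in>f. Poly_Mapping.single v 1)"

lemma lookup_expo: "finite f \<Longrightarrow> lookup (expo f) v = (if v \<in> f then 1 else 0)"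
  unfolding expo_def lookup_sum by (auto simp: lookup_single when_def sum.delta' cong: sum.cong)

lemma prod_expo: "finite f \<Longrightarrow> (\<Prod>v\<in>f. bas (Poly_Mapping.single v 1)) = (bas (expo f) :: ('v, 'k::field) mpoly)"
  unfolding expo_def by (induction f rule: finite_induct) simp_all

definition SR_gens :: "('v, 'k::field) mpoly set" where
  "SR_gens = {\<Prod>v\<in>f. Poly_Mapping.single (Poly_Mapping.single v 1) 1 | f. f \<subseteq> V \<and> f \<notin> K}"

lemma SR_gens_eq: "(SR_gens :: ('v, 'k::field) mpoly set) = {bas (expo f) | f. f \<subseteq> V \<and> f \<notin> K}"
proof -
  have "(\<Prod>v\<in>f. bas (Poly_Mapping.single v 1)) = (bas (expo f) :: ('v, 'k) mpoly)" if "f \<subseteq> V" for f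
    by (rule prod_expo[OF finite_subset[OF that finV]])
  then show ?thesis unfolding SR_gens_def by (intro Set.set_eqI iffI; (elim CollectE exE conjE, intro CollectI exI conjI; simp))
qed

lemma keys_expo: "f \<subseteq> V \<Longrightarrow> keys (expo f) = f"
  using lookup_expo[OF finite_subset[OF _ finV], of f] by (auto simp: in_keys_iff split: if_splits)

lemma SR_gens_carrier: "(SR_gens :: ('v, 'k::field) mpoly set) \<subseteq> carrier (mpoly_ring V)"
  unfolding SR_gens_eq by (auto simp: keys_expo)

lemma SR_ideal_gens: "SR_ideal V K = Idl\<^bsub>mpoly_ring V\<^esub> (SR_gens :: ('v, 'k::field) mpoly set)"
  unfolding SR_ideal_def SR_gens_def ..

lemma SR_ideal_ideal: "ideal (SR_ideal V K) (mpoly_ring V :: ('v, 'k::field) mpoly ring)"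
  unfolding SR_ideal_gens
  by (rule ring.genideal_ideal[OF cring.axioms(1)[OF cring_mpoly] SR_gens_carrier])

text \<open>The polynomials without face monomials form an ideal that contains the generators.
  Conversely, a monomial whose support is no face is a multiple of the squarefree monomial of its
  support, which is a generator.\<close>

lemma SR_ideal_eq:
  "(SR_ideal V K :: ('v, 'k::field) mpoly set) = {p. keys p \<subseteq> mons V - faces K}" (is "?I = ?J")
proof
  interpret R: cring "mpoly_ring V :: ('v, 'k) mpoly ring" by (rule cring_mpoly)
  interpret I: ideal ?I "mpoly_ring V" by (rule SR_ideal_ideal)
  have J: "keys (p * q) \<subseteq> mons V - faces K" if "keys p \<subseteq> mons V - faces K" "keys q \<subseteq> mons V" for p q :: "('v, 'k) mpoly"
    by (rule bilin_keys[OF bilin_times]) (use that faces_add[OF dclK] in \<open>auto simp: mons_def keys_add_nat subset_iff\<close>)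
  have "ideal ?J (mpoly_ring V)"
  proof (rule idealI)
    show "ring (mpoly_ring V :: ('v, 'k) mpoly ring)" by (rule R.ring_axioms)
    have "\<ominus>\<^bsub>mpoly_ring V\<^esub> p = - p" if "keys p \<subseteq> mons V" for p :: "('v, 'k) mpoly"
      by (rule R.minus_equality) (use that keys_uminusI[of p] in \<open>auto simp: mpoly_carrier simp del: mpoly_ring_simps(1)\<close>)
    then have inv: "inv\<^bsub>add_monoid (mpoly_ring V)\<^esub> p = - p" if "keys p \<subseteq> mons V" for p :: "('v, 'k) mpoly"
      using that by (simp only: a_inv_def)
    show "subgroup ?J (add_monoid (mpoly_ring V))"
    proof (rule subgroup.intro)
      show "?J \<subseteq> carrier (add_monoid (mpoly_ring V))" unfolding partial_object.simps mpoly_carrier' by blast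
      fix x y :: "('v, 'k) mpoly" assume x: "x \<in> ?J"
      then have "inv\<^bsub>add_monoid (mpoly_ring V)\<^esub> x = - x" by (intro inv) blast
      then show "inv\<^bsub>add_monoid (mpoly_ring V)\<^esub> x \<in> ?J" using x keys_uminusI[of x "mons V - faces K"] by simp
      show "x \<otimes>\<^bsub>add_monoid (mpoly_ring V)\<^esub> y \<in> ?J" if "y \<in> ?J" using x that by (simp add: keys_addI)
    qed simp
  next
    fix a x :: "('v, 'k) mpoly" assume a: "a \<in> ?J" "x \<in> carrier (mpoly_ring V)"
    then show "a \<otimes>\<^bsub>mpoly_ring V\<^esub> x \<in> ?J" "x \<otimes>\<^bsub>mpoly_ring V\<^esub> a \<in> ?J"
      using J[of a x] unfolding mpoly_carrier by (simp_all add: mult.commute[of x])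
  qed
  then show "?I \<subseteq> ?J" unfolding SR_ideal_gens
    by (rule R.genideal_minimal) (auto simp: SR_gens_eq mons_def faces_def keys_expo)
  show "?J \<subseteq> ?I"
  proof
    fix p :: "('v, 'k) mpoly" assume p: "p \<in> ?J"
    have mono: "c \<bullet> bas m \<in> ?I" if m: "m \<in> mons V" "m \<notin> faces K" for m c
    proof -
      let ?f = "keys m"
      have "bas (expo ?f) \<in> (SR_gens :: ('v, 'k) mpoly set)" using m by (auto simp: SR_gens_eq mons_def faces_def)
      then have "bas (expo ?f) \<in> ?I" unfolding SR_ideal_gens using R.genideal_self[OF SR_gens_carrier] by blast
      moreover have "c \<bullet> bas (m - expo ?f) \<in> carrier (mpoly_ring V)"
        unfolding mpoly_carrier using m(1)
        by (intro keys_smulI) (auto simp: mons_def in_keys_iff lookup_minus subset_iff)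
      ultimately have "(c \<bullet> bas (m - expo ?f)) * bas (expo ?f) \<in> ?I" using I.I_l_closed by fastforce
      moreover have "m - expo ?f + expo ?f = m"
        by (rule poly_mapping_eqI) (auto simp: lookup_add lookup_minus lookup_expo in_keys_iff)
      ultimately show ?thesis by (simp add: smul_times)
    qed
    have "(\<Sum>m\<in>F. lookup p m \<bullet> bas m) \<in> ?I" if "finite F" "F \<subseteq> keys p" for F
      using that
    proof (induction F)
      case empty
      show ?case using I.zero_closed by simp
    next
      case (insert m F)
      then have "lookup p m \<bullet> bas m \<in> ?I" using mono[of m] p by blast
      then show ?case using I.a_closed insert by fastforce
    qed
    from this[of "keys p"] show "p \<in> ?I" using bas_expand[of p] by simp
  qed
qed

definition cl :: "('v, 'k::field_char_0) mpoly \<Rightarrow> ('v, 'k) mpoly set" where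
  "cl p = SR_ideal V K +>\<^bsub>mpoly_ring V\<^esub> p"

text \<open>All representatives of a class have the same face part, so the choice does not affect
  the result (\<open>nf_cl\<close>).\<close>

definition nf :: "('v, 'k::field_char_0) mpoly set \<Rightarrow> ('v, 'k) mpoly" where
  "nf C = restr (faces K) (SOME p. p \<in> C)"

abbreviation SRA :: "('k::field_char_0, ('v, 'k) mpoly set) module" where "SRA \<equiv> SR_algebra V K"

lemma coset_SR: "coset_model (mpoly_ring V :: ('v, 'k::field_char_0) mpoly ring) {p. keys p \<subseteq> mons V} (\<lambda>p. p) (SR_ideal V K)"
  by unfold_locales (simp_all add: keys_addI keys_diffI SR_ideal_eq, blast)

lemma cl_eq:
  fixes p q :: "('v, 'k::field_char_0) mpoly"
  shows "keys p \<subseteq> mons V \<Longrightarrow> keys q \<subseteq> mons V \<Longrightarrow> cl p = cl q \<longleftrightarrow> restr (faces K) p = restr (faces K) q"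
proof -
  assume p: "keys p \<subseteq> mons V" "keys q \<subseteq> mons V"
  interpret c: coset_model "mpoly_ring V :: ('v, 'k) mpoly ring" "{p. keys p \<subseteq> mons V}" "\<lambda>p. p" "SR_ideal V K" by (rule coset_SR)
  have "cl p = cl q \<longleftrightarrow> p - q \<in> SR_ideal V K" unfolding cl_def using c.coset_eq[of p q] p by simp
  also have "\<dots> \<longleftrightarrow> keys (p - q) \<inter> faces K = {}" using keys_diffI[OF p] by (auto simp: SR_ideal_eq)
  also have "\<dots> \<longleftrightarrow> restr (faces K) p = restr (faces K) q"
    by (auto simp: poly_mapping_eq_iff fun_eq_iff in_keys_iff lookup_minus disjoint_iff)
  finally show ?thesis .
qed

lemma nf_cl:
  fixes p :: "('v, 'k::field_char_0) mpoly"
  assumes "keys p \<subseteq> mons V" shows "nf (cl p) = restr (faces K) p"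
proof -
  interpret c: coset_model "mpoly_ring V :: ('v, 'k) mpoly ring" "{p. keys p \<subseteq> mons V}" "\<lambda>p. p" "SR_ideal V K" by (rule coset_SR)
  have "p \<in> cl p" unfolding cl_def by (rule c.coset_self) (use assms in simp)
  then have "(SOME q. q \<in> cl p) \<in> cl p" by (rule someI)
  then have q: "keys (SOME q. q \<in> cl p) \<subseteq> mons V" "(SOME q. q \<in> cl p) - p \<in> SR_ideal V K"
    using c.coset_mem[of p] assms unfolding cl_def by auto
  then have "cl (SOME q. q \<in> cl p) = cl p" unfolding cl_def by (subst c.coset_eq) (use assms q in \<open>simp_all add: cl_def\<close>)
  then show ?thesis using cl_eq[OF q(1) assms] by (simp add: nf_def)
qed

lemma SRA_sel:
  "carrier SRA = cl ` {p. keys p \<subseteq> mons V}"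
  "\<zero>\<^bsub>SRA\<^esub> = SR_ideal V K" "\<one>\<^bsub>SRA\<^esub> = cl 1"
  "x \<oplus>\<^bsub>SRA\<^esub> y = set_add (mpoly_ring V) x y"
  "x \<otimes>\<^bsub>SRA\<^esub> y = rcoset_mult (mpoly_ring V) (SR_ideal V K) x y"
  "c \<odot>\<^bsub>SRA\<^esub> x = rcoset_mult (mpoly_ring V) (SR_ideal V K) (cl (Poly_Mapping.single 0 c)) x"
proof -
  have "carrier SRA = a_rcosets\<^bsub>mpoly_ring V\<^esub> (SR_ideal V K)"
    by (simp add: SR_algebra_def ring.defs module.defs FactRing_def)
  also have "\<dots> = cl ` carrier (mpoly_ring V)"
    unfolding A_RCOSETS_def RCOSETS_def cl_def[abs_def] a_r_coset_def by (auto simp del: mpoly_ring_simps(1))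
  finally show "carrier SRA = cl ` {p. keys p \<subseteq> mons V}"
    by (simp only: mpoly_carrier')
qed (simp_all add: SR_algebra_def ring.defs module.defs FactRing_def cl_def)

lemma cl_ops:
  fixes p q :: "('v, 'k::field_char_0) mpoly"
  assumes "keys p \<subseteq> mons V" "keys q \<subseteq> mons V"
  shows "cl p \<oplus>\<^bsub>SRA\<^esub> cl q = cl (p + q)" "cl p \<otimes>\<^bsub>SRA\<^esub> cl q = cl (p * q)" "c \<odot>\<^bsub>SRA\<^esub> cl p = cl (c \<bullet> p)"
    "\<zero>\<^bsub>SRA\<^esub> = cl (0 :: ('v, 'k) mpoly)"
proof -
  interpret I: ideal "SR_ideal V K" "mpoly_ring V :: ('v, 'k) mpoly ring" by (rule SR_ideal_ideal)
  interpret c: coset_model "mpoly_ring V :: ('v, 'k) mpoly ring" "{p. keys p \<subseteq> mons V}" "\<lambda>p. p" "SR_ideal V K" by (rule coset_SR)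
  show "cl p \<oplus>\<^bsub>SRA\<^esub> cl q = cl (p + q)" unfolding SRA_sel cl_def
    using c.coset_add[of p q] assms by simp
  have m: "cl a \<otimes>\<^bsub>SRA\<^esub> cl b = cl (a * b)" if "keys a \<subseteq> mons V" "keys b \<subseteq> mons V" for a b :: "('v, 'k) mpoly"
    unfolding SRA_sel cl_def using I.rcoset_mult_add[of a b] that by (simp add: mpoly_carrier' del: mpoly_ring_simps(1))
  show "cl p \<otimes>\<^bsub>SRA\<^esub> cl q = cl (p * q)" by (rule m[OF assms])
  have "c \<odot>\<^bsub>SRA\<^esub> cl p = cl (Poly_Mapping.single 0 c * p)"
    using m[of "Poly_Mapping.single 0 c" p] assms unfolding SRA_sel by (auto simp: mons_def keys_single split: if_splits)
  then show "c \<odot>\<^bsub>SRA\<^esub> cl p = cl (c \<bullet> p)" by (simp add: smul_def mult_map_scale_conv_mult)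
  show "\<zero>\<^bsub>SRA\<^esub> = cl (0 :: ('v, 'k) mpoly)" unfolding SRA_sel cl_def
    using c.coset_eq_B[of 0] c.B_zero by simp
qed

lemma keys_nf: "x \<in> carrier SRA \<Longrightarrow> keys (nf x) \<subseteq> faces K"
  by (auto simp: SRA_sel nf_cl keys_restr)

lemma cl_nf: "x \<in> carrier SRA \<Longrightarrow> cl (nf x) = x"
proof -
  assume "x \<in> carrier SRA"
  then obtain p where p: "keys p \<subseteq> mons V" "x = cl p" by (auto simp: SRA_sel)
  have "keys (restr (faces K) p) \<subseteq> mons V" using faces_mons by (auto simp: keys_restr)
  then show "cl (nf x) = x" using p by (simp add: nf_cl cl_eq restr_id[of "restr (faces K) p"] keys_restr)
qed

lemma cl_carrier: "keys f \<subseteq> faces K \<Longrightarrow> cl f \<in> carrier SRA"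
  using faces_mons by (auto simp: SRA_sel)

lemma nf_cl_faces: "keys f \<subseteq> faces K \<Longrightarrow> nf (cl f) = f"
  using faces_mons by (subst nf_cl) (auto simp: restr_id)

lemma nf_inj: "x \<in> carrier SRA \<Longrightarrow> y \<in> carrier SRA \<Longrightarrow> nf x = nf y \<Longrightarrow> x = y"
  using cl_nf by metis

lemma nf_ops:
  fixes x y :: "('v, 'k::field_char_0) mpoly set"
  assumes "x \<in> carrier SRA" "y \<in> carrier SRA"
  shows "nf (x \<oplus>\<^bsub>SRA\<^esub> y) = nf x + nf y" "nf (x \<otimes>\<^bsub>SRA\<^esub> y) = restr (faces K) (nf x * nf y)"
    "nf (c \<odot>\<^bsub>SRA\<^esub> x) = c \<bullet> nf x" "nf (\<zero>\<^bsub>SRA\<^esub> :: ('v, 'k) mpoly set) = 0" "nf (\<one>\<^bsub>SRA\<^esub> :: ('v, 'k) mpoly set) = restr (faces K) 1"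
    "x \<oplus>\<^bsub>SRA\<^esub> y \<in> carrier SRA" "x \<otimes>\<^bsub>SRA\<^esub> y \<in> carrier SRA" "c \<odot>\<^bsub>SRA\<^esub> x \<in> carrier SRA"
    "(\<zero>\<^bsub>SRA\<^esub> :: ('v, 'k) mpoly set) \<in> carrier SRA" "(\<one>\<^bsub>SRA\<^esub> :: ('v, 'k) mpoly set) \<in> carrier SRA"
proof -
  obtain p q where p: "keys p \<subseteq> mons V" "x = cl p" and q: "keys q \<subseteq> mons V" "y = cl q"
    using assms by (auto simp: SRA_sel(1))
  note k = keys_addI[OF p(1) q(1)] mons_times[OF p(1) q(1)] keys_smulI[OF p(1), of c]
  have one: "keys (1 :: ('v, 'k) mpoly) \<subseteq> mons V" by (simp add: mons_def)
  show "nf (x \<oplus>\<^bsub>SRA\<^esub> y) = nf x + nf y" "nf (x \<otimes>\<^bsub>SRA\<^esub> y) = restr (faces K) (nf x * nf y)"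
    "nf (c \<odot>\<^bsub>SRA\<^esub> x) = c \<bullet> nf x"
    using p q by (simp_all add: cl_ops nf_cl k lin_simps[OF lin_restr] restr_times[OF dclK])
  show "nf (\<zero>\<^bsub>SRA\<^esub> :: ('v, 'k) mpoly set) = 0" using cl_ops(4)[OF p(1) q(1)] nf_cl[of 0] by simp
  show "nf (\<one>\<^bsub>SRA\<^esub> :: ('v, 'k) mpoly set) = restr (faces K) 1" by (simp only: SRA_sel(3) nf_cl[OF one])
  show "x \<oplus>\<^bsub>SRA\<^esub> y \<in> carrier SRA" "x \<otimes>\<^bsub>SRA\<^esub> y \<in> carrier SRA" "c \<odot>\<^bsub>SRA\<^esub> x \<in> carrier SRA"
    using p q k by (auto simp: cl_ops SRA_sel(1))
  show "(\<zero>\<^bsub>SRA\<^esub> :: ('v, 'k) mpoly set) \<in> carrier SRA"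
    unfolding cl_ops(4)[OF p(1) q(1)] SRA_sel(1) by (rule imageI) simp
  show "(\<one>\<^bsub>SRA\<^esub> :: ('v, 'k) mpoly set) \<in> carrier SRA"
    unfolding SRA_sel(3) SRA_sel(1) by (rule imageI) (use one in simp)
qed

lemma SR_weight_iff: "x \<in> SR_weight V K w \<longleftrightarrow> x \<in> carrier SRA \<and> keys (nf x) \<subseteq> {m. mwt m = w}"
proof
  assume "x \<in> SR_weight V K w"
  then obtain p where p: "x = cl p" "p \<in> carrier (mpoly_ring V)" "\<forall>m\<in>keys p. \<forall>v. int (lookup m v) = w v"
    unfolding SR_weight_def cl_def by blast
  then show "x \<in> carrier SRA \<and> keys (nf x) \<subseteq> {m. mwt m = w}"
    unfolding mpoly_carrier by (auto simp: SRA_sel(1) nf_cl keys_restr mwt_def)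
next
  assume x: "x \<in> carrier SRA \<and> keys (nf x) \<subseteq> {m. mwt m = w}"
  then have "x = SR_ideal V K +>\<^bsub>mpoly_ring V\<^esub> nf x" using cl_nf[of x] by (simp add: cl_def)
  moreover have "nf x \<in> carrier (mpoly_ring V)" unfolding mpoly_carrier using x keys_nf[of x] faces_mons by blast
  moreover have "\<forall>m\<in>keys (nf x). \<forall>v. int (lookup m v) = w v" using x by (auto simp: mwt_def)
  ultimately show "x \<in> SR_weight V K w" unfolding SR_weight_def by blast
qed

end

section \<open>Coordinates on a free resolution\<close>

lemma (in module) submodule_finsum:
  assumes "submodule H R M" "\<And>y. y \<in> Y \<Longrightarrow> h y \<in> H"
  shows "(\<Oplus>\<^bsub>M\<^esub>y\<in>Y. h y) \<in> H"
proof -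
  interpret H: submodule H R M by fact
  show ?thesis using assms(2)
  proof (induction Y rule: infinite_finite_induct)
    case (insert y Y)
    then show ?case using H.subset H.m_closed[of "h y" "\<Oplus>\<^bsub>M\<^esub>y\<in>Y. h y"] by (subst M.finsum_insert) auto
  qed (use H.one_closed in \<open>simp_all add: M.finsum_infinite\<close>)
qed

lemma restr_split: "f = (\<Sum>j\<in>a ` keys f. restr {y. a y = j} f)"
proof (rule poly_mapping_eqI)
  fix y
  have "lookup (\<Sum>j\<in>a ` keys f. restr {y. a y = j} f) y = (\<Sum>j\<in>a ` keys f. if a y = j then lookup f y else 0)"
    by (simp add: lookup_sum)
  also have "\<dots> = lookup f y" by (auto simp: sum.delta' in_keys_iff)
  finally show "lookup f y = lookup (\<Sum>j\<in>a ` keys f. restr {y. a y = j} f) y" by simp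
qed

lemma ex1_unique: "\<exists>!f. Q f \<Longrightarrow> Q a \<Longrightarrow> Q b \<Longrightarrow> a = b"
  by blast

text \<open>The parameter \<open>VT\<close> fixes the vertex type that enters the index type of the
  coordinates. The second component of an index is \<open>{}\<close> at this stage and leaves room
  for the odd variables adjoined later.\<close>

locale coord = module ground P for P :: "('k::field_char_0, 'p, 'm) module_scheme" (structure) +
  fixes FM :: "'p multiset set" and mon :: "'p multiset \<Rightarrow> 'p" and VT :: "'v itself"
  assumes mon_FM: "M \<in> FM \<Longrightarrow> mon M \<in> carrier P"
    and basis: "p \<in> carrier P \<Longrightarrow> \<exists>!f :: 'p multiset \<Rightarrow> 'k. finite {M. f M \<noteq> 0} \<and> {M. f M \<noteq> 0} \<subseteq> FM \<and>
      p = (\<Oplus>\<^bsub>P\<^esub>M\<in>{M. f M \<noteq> 0}. f M \<odot>\<^bsub>P\<^esub> mon M)"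
begin

definition X0 :: "('p multiset \<times> 'v set) set" where "X0 = FM \<times> {{}}"

lemma mon_closed: "x \<in> X0 \<Longrightarrow> mon (fst x) \<in> carrier P"
  by (auto simp: X0_def mon_FM)

definition LP :: "('p multiset \<times> 'v set \<Rightarrow>\<^sub>0 'k) \<Rightarrow> 'p" where
  "LP f = (\<Oplus>\<^bsub>P\<^esub>x\<in>keys f. lookup f x \<odot>\<^bsub>P\<^esub> mon (fst x))"

lemma sc_closed: "x \<in> X0 \<Longrightarrow> c \<odot>\<^bsub>P\<^esub> mon (fst x) \<in> carrier P"
  by (rule smult_closed) (simp_all add: mon_closed)

lemma LP_sup:
  assumes "finite Y" "keys f \<subseteq> Y" "Y \<subseteq> X0"
  shows "LP f = (\<Oplus>\<^bsub>P\<^esub>x\<in>Y. lookup f x \<odot>\<^bsub>P\<^esub> mon (fst x))"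
  unfolding LP_def
proof (rule M.add.finprod_mono_neutral_cong_left[OF assms(1,2)])
  fix i assume "i \<in> Y - keys f"
  then have "i \<in> X0" "lookup f i = \<zero>\<^bsub>ground\<^esub>" using assms(3) by (auto simp: in_keys_iff)
  moreover from this(1) have "mon (fst i) \<in> carrier P" by (rule mon_closed)
  ultimately show "lookup f i \<odot>\<^bsub>P\<^esub> mon (fst i) = \<zero>\<^bsub>P\<^esub>" by (simp only: smult_l_null)
qed (use assms sc_closed in auto)

lemma LP_closed: "keys f \<subseteq> X0 \<Longrightarrow> LP f \<in> carrier P"
  unfolding LP_def by (rule M.finsum_closed) (use sc_closed in auto)

lemma LP_add:
  assumes "keys f \<subseteq> X0" "keys g \<subseteq> X0" shows "LP (f + g) = LP f \<oplus>\<^bsub>P\<^esub> LP g"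
proof -
  let ?Y = "keys f \<union> keys g"
  have Y: "finite ?Y" "?Y \<subseteq> X0" using assms by auto
  have "LP (f + g) = (\<Oplus>\<^bsub>P\<^esub>x\<in>?Y. lookup (f + g) x \<odot>\<^bsub>P\<^esub> mon (fst x))"
    by (rule LP_sup[OF Y(1) Poly_Mapping.keys_add Y(2)])
  also have "\<dots> = (\<Oplus>\<^bsub>P\<^esub>x\<in>?Y. (lookup f x \<odot>\<^bsub>P\<^esub> mon (fst x)) \<oplus>\<^bsub>P\<^esub> (lookup g x \<odot>\<^bsub>P\<^esub> mon (fst x)))"
  proof (rule M.finsum_cong'[OF refl])
    fix x assume "x \<in> ?Y"
    then have "mon (fst x) \<in> carrier P" using Y mon_closed by blast
    then show "lookup (f + g) x \<odot>\<^bsub>P\<^esub> mon (fst x) = (lookup f x \<odot>\<^bsub>P\<^esub> mon (fst x)) \<oplus>\<^bsub>P\<^esub> (lookup g x \<odot>\<^bsub>P\<^esub> mon (fst x))"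
      using smult_l_distr[of "lookup f x" "lookup g x" "mon (fst x)"] by (simp add: lookup_add)
  qed (use Y sc_closed in auto)
  also have "\<dots> = (\<Oplus>\<^bsub>P\<^esub>x\<in>?Y. lookup f x \<odot>\<^bsub>P\<^esub> mon (fst x)) \<oplus>\<^bsub>P\<^esub> (\<Oplus>\<^bsub>P\<^esub>x\<in>?Y. lookup g x \<odot>\<^bsub>P\<^esub> mon (fst x))"
    by (rule M.finsum_addf) (use Y sc_closed in auto)
  finally show ?thesis using LP_sup[OF Y(1) _ Y(2)] by simp
qed

lemma LP_smul:
  assumes "keys f \<subseteq> X0" shows "LP (c \<bullet> f) = c \<odot>\<^bsub>P\<^esub> LP f"
proof -
  have "LP (c \<bullet> f) = (\<Oplus>\<^bsub>P\<^esub>x\<in>keys f. lookup (c \<bullet> f) x \<odot>\<^bsub>P\<^esub> mon (fst x))"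
    by (rule LP_sup[OF finite_keys keys_smul assms])
  also have "\<dots> = (\<Oplus>\<^bsub>P\<^esub>x\<in>keys f. c \<odot>\<^bsub>P\<^esub> (lookup f x \<odot>\<^bsub>P\<^esub> mon (fst x)))"
  proof (rule M.finsum_cong'[OF refl])
    fix x assume "x \<in> keys f"
    then have "mon (fst x) \<in> carrier P" using assms mon_closed by blast
    then show "lookup (c \<bullet> f) x \<odot>\<^bsub>P\<^esub> mon (fst x) = c \<odot>\<^bsub>P\<^esub> (lookup f x \<odot>\<^bsub>P\<^esub> mon (fst x))"
      using smult_assoc1[of c "lookup f x" "mon (fst x)"] by simp
  qed (use assms sc_closed smult_closed in auto)
  also have "\<dots> = c \<odot>\<^bsub>P\<^esub> LP f" unfolding LP_def
    by (rule finsum_smult_ldistr[symmetric]) (use assms sc_closed in auto)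
  finally show ?thesis .
qed

lemma LP_0: "LP 0 = \<zero>\<^bsub>P\<^esub>" by (simp add: LP_def)

lemma LP_bas: "x \<in> X0 \<Longrightarrow> LP (bas x) = mon (fst x)"
proof -
  assume x: "x \<in> X0"
  have "LP (bas x) = (\<Oplus>\<^bsub>P\<^esub>y\<in>{x}. lookup (bas x) y \<odot>\<^bsub>P\<^esub> mon (fst y))" by (rule LP_sup) (use x in auto)
  also have "\<dots> = \<one>\<^bsub>ground\<^esub> \<odot>\<^bsub>P\<^esub> mon (fst x)"
    using sc_closed[OF x, of 1] by (subst M.finsum_insert) (simp_all add: M.finsum_empty)
  also have "\<dots> = mon (fst x)" by (rule smult_one[OF mon_closed[OF x]])
  finally show ?thesis .
qed

lemma LP_fun:
  assumes "finite S" "S \<subseteq> FM" "keys f \<subseteq> S \<times> {{}}"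
  shows "LP f = (\<Oplus>\<^bsub>P\<^esub>M\<in>S. lookup f (M, {}) \<odot>\<^bsub>P\<^esub> mon M)"
proof -
  have S: "(\<lambda>M. (M, {})) ` S \<subseteq> X0" using assms(2) by (auto simp: X0_def)
  have "LP f = (\<Oplus>\<^bsub>P\<^esub>x\<in>(\<lambda>M. (M, {})) ` S. lookup f x \<odot>\<^bsub>P\<^esub> mon (fst x))"
    by (rule LP_sup[OF _ _ S]) (use assms in auto)
  also have "\<dots> = (\<Oplus>\<^bsub>P\<^esub>M\<in>S. lookup f (M, {}) \<odot>\<^bsub>P\<^esub> mon (fst (M, {} :: 'v set)))"
    by (rule M.finsum_reindex) (use S sc_closed in \<open>auto simp: inj_on_def\<close>)
  finally show ?thesis by simp
qed

lemma LP_ex: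
  assumes "p \<in> carrier P" shows "\<exists>f. keys f \<subseteq> X0 \<and> LP f = p"
proof -
  obtain a :: "'p multiset \<Rightarrow> 'k" where a: "finite {M. a M \<noteq> 0}" "{M. a M \<noteq> 0} \<subseteq> FM"
    "p = (\<Oplus>\<^bsub>P\<^esub>M\<in>{M. a M \<noteq> 0}. a M \<odot>\<^bsub>P\<^esub> mon M)" using basis[OF assms] by blast
  define f where "f = (\<Sum>M | a M \<noteq> 0. Poly_Mapping.single (M, {} :: 'v set) (a M))"
  have l: "lookup f (M, {}) = a M" for M
    using a(1) by (auto simp: f_def lookup_sum lookup_single when_def sum.delta cong: if_cong)
  have k: "keys f \<subseteq> {M. a M \<noteq> 0} \<times> {{}}" unfolding f_def by (rule keys_sumI) auto
  have "LP f = p" using LP_fun[OF a(1,2) k] a(3) by (simp add: l)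
  moreover have "keys f \<subseteq> X0" using k a(2) by (auto simp: X0_def)
  ultimately show ?thesis by blast
qed

lemma LP_inj:
  assumes "keys f \<subseteq> X0" "keys g \<subseteq> X0" "LP f = LP g" shows "f = g"
proof -
  have *: "finite {M. lookup f (M, {}) \<noteq> 0} \<and> {M. lookup f (M, {}) \<noteq> 0} \<subseteq> FM \<and>
      LP f = (\<Oplus>\<^bsub>P\<^esub>M\<in>{M. lookup f (M, {}) \<noteq> 0}. lookup f (M, {}) \<odot>\<^bsub>P\<^esub> mon M)" if "keys f \<subseteq> X0" for f
  proof -
    have X: "snd x = {}" "fst x \<in> FM" if "x \<in> keys f" for x using that \<open>keys f \<subseteq> X0\<close> by (auto simp: X0_def)
    have S: "{M. lookup f (M, {}) \<noteq> 0} = fst ` keys f"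
    proof (intro Set.set_eqI iffI)
      fix M assume "M \<in> {M. lookup f (M, {}) \<noteq> 0}"
      then have "(M, {}) \<in> keys f" by (simp add: in_keys_iff)
      then show "M \<in> fst ` keys f" by force
    next
      fix M assume "M \<in> fst ` keys f"
      then obtain x where x: "x \<in> keys f" "M = fst x" by blast
      then have "x = (M, {})" using X(1)[OF x(1)] by (cases x) simp
      then show "M \<in> {M. lookup f (M, {}) \<noteq> 0}" using x(1) by (simp add: in_keys_iff)
    qed
    have "keys f \<subseteq> fst ` keys f \<times> {{}}"
    proof
      fix x assume "x \<in> keys f"
      then show "x \<in> fst ` keys f \<times> {{}}" using X(1) by (cases x) force
    qed
    then show ?thesis unfolding S using LP_fun[of "fst ` keys f" f] X(2) by auto
  qed
  have eq: "(\<lambda>M. lookup f (M, {})) = (\<lambda>M. lookup g (M, {}))"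
    by (rule ex1_unique[OF basis[OF LP_closed[OF assms(1)]], OF *[OF assms(1)]])
      (use *[OF assms(2)] assms(3) in simp)
  have "lookup f (M, T) = lookup g (M, T)" for M T
  proof (cases "T = {}")
    case False
    then have "(M, T) \<notin> keys f" "(M, T) \<notin> keys g" using assms(1,2) by (auto simp: X0_def)
    then show ?thesis by (simp add: in_keys_iff)
  qed (use fun_cong[OF eq] in simp)
  then show ?thesis by (intro poly_mapping_eqI) auto
qed

definition co :: "'p \<Rightarrow> ('p multiset \<times> 'v set \<Rightarrow>\<^sub>0 'k)" where
  "co p = (THE f. keys f \<subseteq> X0 \<and> LP f = p)"

lemma co: assumes "p \<in> carrier P" shows "keys (co p) \<subseteq> X0" "LP (co p) = p"
proof -
  have "\<exists>!f. keys f \<subseteq> X0 \<and> LP f = p" using LP_ex[OF assms] LP_inj by metis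
  from theI'[OF this] show "keys (co p) \<subseteq> X0" "LP (co p) = p" unfolding co_def by blast+
qed

lemma co_LP: "keys f \<subseteq> X0 \<Longrightarrow> co (LP f) = f"
  using co[OF LP_closed] LP_inj by metis

lemma co_add: "p \<in> carrier P \<Longrightarrow> q \<in> carrier P \<Longrightarrow> co (p \<oplus>\<^bsub>P\<^esub> q) = co p + co q"
  by (metis LP_add co co_LP keys_addI)

lemma co_smul: "p \<in> carrier P \<Longrightarrow> co (c \<odot>\<^bsub>P\<^esub> p) = c \<bullet> co p"
  by (metis LP_smul co co_LP keys_smulI)

lemma co_0: "co \<zero>\<^bsub>P\<^esub> = 0" using co_LP[of 0] by (simp add: LP_0)

lemma co_mon: "x \<in> X0 \<Longrightarrow> co (mon (fst x)) = bas x"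
  using co_LP[of "bas x"] by (simp add: LP_bas)

lemma LP_sum: "(\<And>j. j \<in> J \<Longrightarrow> keys (h j) \<subseteq> X0) \<Longrightarrow> LP (\<Sum>j\<in>J. h j) = (\<Oplus>\<^bsub>P\<^esub>j\<in>J. LP (h j))"
proof (induction J rule: infinite_finite_induct)
  case (insert j J)
  then show ?case
    by (subst M.finsum_insert) (auto simp: LP_add LP_closed keys_sumI)
qed (simp_all add: LP_0 M.finsum_infinite)

text \<open>Sorting the coordinates of \<open>x\<close> by \<open>a\<close> gives one decomposition
  of \<open>x\<close>, and \<open>x\<close> itself in place \<open>i\<close> is another. Uniqueness
  in the direct sum identifies them, so all other parts vanish.\<close>

lemma decomp_keys:
  assumes d: "direct_sum_decomp P I A" and a: "\<And>y. y \<in> X0 \<Longrightarrow> a y \<in> I \<and> mon (fst y) \<in> A (a y)"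
    and x: "i \<in> I" "x \<in> A i"
  shows "x \<in> carrier P" "keys (co x) \<subseteq> {y \<in> X0. a y = i}"
proof -
  have sub: "submodule (A j) ground P" if "j \<in> I" for j using d that by (simp add: direct_sum_decomp_def)
  show xc: "x \<in> carrier P"
  proof -
    interpret H: submodule "A i" ground P by (rule sub[OF x(1)])
    show ?thesis using H.subset x(2) by auto
  qed
  define f where "f = co x"
  have f: "keys f \<subseteq> X0" "LP f = x" using co[OF xc] by (simp_all add: f_def)
  define r where "r j = restr {y. a y = j} f" for j
  have rk: "keys (r j) \<subseteq> X0" for j using f(1) by (auto simp: r_def keys_restr)
  define F1 where "F1 j = (if j \<in> I then LP (r j) else \<zero>\<^bsub>P\<^esub>)" for j
  define F2 where "F2 j = (if j = i then x else \<zero>\<^bsub>P\<^esub>)" for j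
  have r0: "r j = 0" if "j \<notin> a ` keys f" for j
    unfolding r_def by (rule restr_0) (use that in auto)
  have fin1: "{j. F1 j \<noteq> \<zero>\<^bsub>P\<^esub>} \<subseteq> a ` keys f"
  proof
    fix j assume j: "j \<in> {j. F1 j \<noteq> \<zero>\<^bsub>P\<^esub>}"
    show "j \<in> a ` keys f"
    proof (rule ccontr)
      assume "j \<notin> a ` keys f"
      then show False using j r0[of j] by (simp add: F1_def LP_0 split: if_splits)
    qed
  qed
  have mem1: "F1 j \<in> A j" if "j \<in> I" for j
  proof -
    interpret H: submodule "A j" ground P by (rule sub[OF that])
    have "LP (r j) \<in> A j" unfolding LP_def
    proof (rule submodule_finsum[OF sub[OF that]])
      fix y assume "y \<in> keys (r j)"
      then have "y \<in> X0" "a y = j" using f(1) by (auto simp: r_def keys_restr)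
      then show "lookup (r j) y \<odot>\<^bsub>P\<^esub> mon (fst y) \<in> A j" using a[of y] by (intro H.smult_closed) auto
    qed
    then show ?thesis using that by (simp add: F1_def)
  qed
  have "f = (\<Sum>j\<in>a ` keys f. r j)" unfolding r_def by (rule restr_split)
  then have "x = LP (\<Sum>j\<in>a ` keys f. r j)" using f(2) by simp
  also have "\<dots> = (\<Oplus>\<^bsub>P\<^esub>j\<in>a ` keys f. LP (r j))" by (rule LP_sum) (rule rk)
  also have "\<dots> = (\<Oplus>\<^bsub>P\<^esub>j\<in>{j. F1 j \<noteq> \<zero>\<^bsub>P\<^esub>}. F1 j)"
  proof (rule M.add.finprod_mono_neutral_cong_right)
    have I: "j \<in> I" if "j \<in> a ` keys f" for j using that f(1) a by blast
    show "LP (r j) = \<zero>\<^bsub>P\<^esub>" if "j \<in> a ` keys f - {j. F1 j \<noteq> \<zero>\<^bsub>P\<^esub>}" for j using that I[of j] by (auto simp: F1_def)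
    show "LP (r j) = F1 j" if "j \<in> {j. F1 j \<noteq> \<zero>\<^bsub>P\<^esub>}" for j using that by (auto simp: F1_def split: if_splits)
  qed (use fin1 LP_closed[OF rk] in auto)
  finally have s1: "x = (\<Oplus>\<^bsub>P\<^esub>j\<in>{j. F1 j \<noteq> \<zero>\<^bsub>P\<^esub>}. F1 j)" .
  have s2: "x = (\<Oplus>\<^bsub>P\<^esub>j\<in>{j. F2 j \<noteq> \<zero>\<^bsub>P\<^esub>}. F2 j)"
  proof (cases "x = \<zero>\<^bsub>P\<^esub>")
    case True
    then have "{j. F2 j \<noteq> \<zero>\<^bsub>P\<^esub>} = {}" by (auto simp: F2_def)
    then show ?thesis using True by (simp only: M.finsum_empty)
  next
    case False
    then have "{j. F2 j \<noteq> \<zero>\<^bsub>P\<^esub>} = {i}" by (auto simp: F2_def)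
    then show ?thesis using xc by (simp add: M.finsum_insert F2_def)
  qed
  have zero: "\<zero>\<^bsub>P\<^esub> \<in> A j" if "j \<in> I" for j
  proof -
    interpret H: submodule "A j" ground P by (rule sub[OF that])
    show ?thesis using H.one_closed by simp
  qed
  have ex: "\<exists>!f. (\<forall>i\<in>I. f i \<in> A i) \<and> (\<forall>i. i \<notin> I \<longrightarrow> f i = \<zero>\<^bsub>P\<^esub>) \<and>
        finite {i. f i \<noteq> \<zero>\<^bsub>P\<^esub>} \<and> x = (\<Oplus>\<^bsub>P\<^esub>i\<in>{i. f i \<noteq> \<zero>\<^bsub>P\<^esub>}. f i)"
    using d xc unfolding direct_sum_decomp_def by blast
  have q1: "(\<forall>i\<in>I. F1 i \<in> A i) \<and> (\<forall>i. i \<notin> I \<longrightarrow> F1 i = \<zero>\<^bsub>P\<^esub>) \<and>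
        finite {i. F1 i \<noteq> \<zero>\<^bsub>P\<^esub>} \<and> x = (\<Oplus>\<^bsub>P\<^esub>i\<in>{i. F1 i \<noteq> \<zero>\<^bsub>P\<^esub>}. F1 i)"
    using mem1 s1 finite_subset[OF fin1] by (auto simp: F1_def[of i for i])
  have q2: "(\<forall>i\<in>I. F2 i \<in> A i) \<and> (\<forall>i. i \<notin> I \<longrightarrow> F2 i = \<zero>\<^bsub>P\<^esub>) \<and>
        finite {i. F2 i \<noteq> \<zero>\<^bsub>P\<^esub>} \<and> x = (\<Oplus>\<^bsub>P\<^esub>i\<in>{i. F2 i \<noteq> \<zero>\<^bsub>P\<^esub>}. F2 i)"
  proof (intro conjI)
    show "finite {i. F2 i \<noteq> \<zero>\<^bsub>P\<^esub>}" by (rule finite_subset[of _ "{i}"]) (auto simp: F2_def)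
  qed (use s2 zero x in \<open>auto simp: F2_def\<close>)
  have "F1 = F2" by (rule ex1_unique[OF ex, OF q1, OF q2])
  show "keys (co x) \<subseteq> {y \<in> X0. a y = i}"
  proof
    fix y assume y: "y \<in> keys (co x)"
    then have yf: "y \<in> keys f" by (simp add: f_def)
    have "a y = i"
    proof (rule ccontr)
      assume n: "a y \<noteq> i"
      then have "F1 (a y) = \<zero>\<^bsub>P\<^esub>" using \<open>F1 = F2\<close> by (simp add: F2_def)
      moreover have "a y \<in> I" using a f(1) yf by blast
      ultimately have "LP (r (a y)) = LP 0" by (simp add: F1_def LP_0)
      then have "r (a y) = 0" using LP_inj[OF rk, of 0] by simp
      then have "lookup (r (a y)) y = 0" by simp
      then show False using yf by (simp add: r_def in_keys_iff)
    qed
    then show "y \<in> {y \<in> X0. a y = i}" using yf f(1) by blast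
  qed
qed

end

lemma (in coord) LP_mem:
  assumes "submodule H ground P" "\<And>y. y \<in> keys f \<Longrightarrow> mon (fst y) \<in> H"
  shows "LP f \<in> H"
  unfolding LP_def
proof (rule submodule_finsum[OF assms(1)])
  fix y assume "y \<in> keys f"
  interpret H: submodule H ground P by (rule assms(1))
  show "lookup f y \<odot>\<^bsub>P\<^esub> mon (fst y) \<in> H" using assms(2)[OF \<open>y \<in> keys f\<close>] by (intro H.smult_closed) auto
qed

text \<open>The generators \<open>G\<close>, homogeneous for degree and weight, and the listing
  \<open>arr\<close> are the witnesses of freeness; they are fixed once so that coordinates can be
  built from them.\<close>

locale rec_res = sr V K + cdga P for V :: "'v set" and K and P :: "('k::field_char_0, 'p) dga" (structure) +
  fixes \<epsilon> :: "'p \<Rightarrow> ('v, 'k) mpoly set" and W :: "('v \<Rightarrow> int) \<Rightarrow> 'p set" and G :: "'p set" and arr :: "'p multiset \<Rightarrow> 'p list"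
  assumes quasi: "quasi_isomorphism P (in_degree_zero (SR_algebra V K)) \<epsilon>"
    and W_dec: "direct_sum_decomp P (weights V) W"
    and W_one: "\<one> \<in> W (\<lambda>_. 0)"
    and W_mul: "w \<in> weights V \<Longrightarrow> w' \<in> weights V \<Longrightarrow> x \<in> W w \<Longrightarrow> y \<in> W w' \<Longrightarrow> x \<otimes> y \<in> W (\<lambda>v. w v + w' v)"
    and W_bd: "w \<in> weights V \<Longrightarrow> x \<in> W w \<Longrightarrow> bd P x \<in> W w"
    and W_eps: "w \<in> weights V \<Longrightarrow> x \<in> W w \<Longrightarrow> \<epsilon> x \<in> SR_weight V K w"
    and G_deg: "G \<subseteq> (\<Union>i. deg_part P i)" and G_wt: "G \<subseteq> (\<Union>w\<in>weights V. W w)"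
    and arr: "mset (arr M) = M"
    and free: "p \<in> carrier P \<Longrightarrow> \<exists>!f :: 'p multiset \<Rightarrow> 'k.
       finite {M. f M \<noteq> 0} \<and> {M. f M \<noteq> 0} \<subseteq> free_monomials P G \<and>
       p = (\<Oplus>\<^bsub>P\<^esub>M\<in>{M. f M \<noteq> 0}. f M \<odot>\<^bsub>P\<^esub> foldr (\<otimes>\<^bsub>P\<^esub>) (arr M) \<one>\<^bsub>P\<^esub>)"
begin

definition mon where "mon M = foldr (\<otimes>) (arr M) \<one>"

lemma deg_sub: "submodule (deg_part P i) ground P"
  using deg_decomp by (simp add: direct_sum_decomp_def)

lemma W_sub: "w \<in> weights V \<Longrightarrow> submodule (W w) ground P"
  using W_dec by (simp add: direct_sum_decomp_def)

lemma deg_carrier: "x \<in> deg_part P i \<Longrightarrow> x \<in> carrier P"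
proof -
  interpret H: submodule "deg_part P i" ground P by (rule deg_sub)
  show "x \<in> deg_part P i \<Longrightarrow> x \<in> carrier P" using H.subset by auto
qed

lemma W_carrier: "w \<in> weights V \<Longrightarrow> x \<in> W w \<Longrightarrow> x \<in> carrier P"
proof -
  assume w: "w \<in> weights V"
  interpret H: submodule "W w" ground P by (rule W_sub[OF w])
  show "x \<in> W w \<Longrightarrow> x \<in> carrier P" using H.subset by auto
qed

lemma FM_sub: "M \<in> free_monomials P G \<Longrightarrow> set (arr M) \<subseteq> G"
proof -
  assume "M \<in> free_monomials P G"
  then have "set_mset (mset (arr M)) \<subseteq> G" by (simp add: free_monomials_def arr)
  then show "set (arr M) \<subseteq> G" by simp
qed

lemma G_carrier: "g \<in> G \<Longrightarrow> g \<in> carrier P" using G_deg deg_carrier by blast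

lemma foldr_closed: "set gs \<subseteq> G \<Longrightarrow> foldr (\<otimes>) gs \<one> \<in> carrier P"
  by (induction gs) (auto simp: G_carrier)

sublocale coord P "free_monomials P G" mon "TYPE('v)"
  by unfold_locales (auto simp: mon_def foldr_closed FM_sub free)

text \<open>A generator is only known to lie in some degree; that degree is unique because
  generators are nonzero (\<open>G_nonzero\<close>, \<open>deg_unique\<close>).\<close>

definition dgn :: "'p \<Rightarrow> int" where "dgn g = (SOME i. g \<in> deg_part P i)"
definition wgn :: "'p \<Rightarrow> 'v \<Rightarrow> int" where "wgn g = (SOME w. w \<in> weights V \<and> g \<in> W w)"

lemma dgn: "g \<in> G \<Longrightarrow> g \<in> deg_part P (dgn g)"
  unfolding dgn_def using G_deg by (intro someI_ex[of "\<lambda>i. g \<in> deg_part P i"]) blast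

lemma wgn: "g \<in> G \<Longrightarrow> wgn g \<in> weights V \<and> g \<in> W (wgn g)"
  unfolding wgn_def using G_wt by (intro someI_ex[of "\<lambda>w. w \<in> weights V \<and> g \<in> W w"]) blast

definition dgM where "dgM M = (\<Sum>g\<in>#M. dgn g)"
definition wgM where "wgM M = (\<Sum>g\<in>#M. wgn g)"

lemma weights_0: "0 \<in> weights V" and weights_add: "w \<in> weights V \<Longrightarrow> w' \<in> weights V \<Longrightarrow> w + w' \<in> weights V"
  by (auto simp: weights_def)

lemma foldr_deg: "set gs \<subseteq> G \<Longrightarrow> foldr (\<otimes>) gs \<one> \<in> deg_part P (\<Sum>g\<leftarrow>gs. dgn g)"
  by (induction gs) (auto intro: deg_one deg_mult dgn)

lemma foldr_wt: "set gs \<subseteq> G \<Longrightarrow> (\<Sum>g\<leftarrow>gs. wgn g) \<in> weights V \<and> foldr (\<otimes>) gs \<one> \<in> W (\<Sum>g\<leftarrow>gs. wgn g)"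
proof (induction gs)
  case Nil
  then show ?case using W_one weights_0 by (simp add: zero_fun_def)
next
  case (Cons g gs)
  then show ?case using W_mul[of "wgn g" "\<Sum>g\<leftarrow>gs. wgn g" g "foldr (\<otimes>) gs \<one>"] wgn[of g] weights_add
    by (simp add: plus_fun_def)
qed

lemma sum_arr: "(\<Sum>g\<leftarrow>arr M. dgn g) = dgM M" "(\<Sum>g\<leftarrow>arr M. wgn g) = wgM M"
  unfolding dgM_def wgM_def by (metis arr mset_map sum_mset_sum_list)+

lemma mon_deg: "x \<in> X0 \<Longrightarrow> mon (fst x) \<in> deg_part P (dgM (fst x))"
  using foldr_deg[OF FM_sub, of "fst x"] by (auto simp: X0_def mon_def sum_arr)

lemma mon_wt: "x \<in> X0 \<Longrightarrow> wgM (fst x) \<in> weights V \<and> mon (fst x) \<in> W (wgM (fst x))"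
  using foldr_wt[OF FM_sub, of "fst x"] by (auto simp: X0_def mon_def sum_arr)

text \<open>Projecting to the span of the basis first makes the evaluation of coordinate vectors
  total, so its linearity rules carry no support conditions.\<close>

definition L where "L f = LP (restr X0 f)"

lemma L_closed: "L f \<in> carrier P" unfolding L_def by (rule LP_closed) (auto simp: keys_restr)
lemma L_add: "L (f + g) = L f \<oplus> L g"
  unfolding L_def lin_add[OF lin_restr] by (rule LP_add) (auto simp: keys_restr)
lemma L_smul: "L (c \<bullet> f) = c \<odot> L f"
  unfolding L_def lin_smul[OF lin_restr] by (rule LP_smul) (auto simp: keys_restr)
lemma L_0: "L 0 = \<zero>" by (simp add: L_def LP_0)
lemma L_bas: "x \<in> X0 \<Longrightarrow> L (bas x) = mon (fst x)" and L_off: "x \<notin> X0 \<Longrightarrow> L (bas x) = \<zero>"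
  by (simp_all add: L_def LP_bas LP_0)
lemma co_L: "co (L f) = restr X0 f" unfolding L_def by (rule co_LP) (auto simp: keys_restr)
lemma L_co: "p \<in> carrier P \<Longrightarrow> L (co p) = p" using co[of p] by (simp add: L_def restr_id)

lemma deg_keys: "x \<in> deg_part P n \<Longrightarrow> keys (co x) \<subseteq> {y \<in> X0. dgM (fst y) = n}"
  by (rule decomp_keys(2)[OF deg_decomp, of "\<lambda>y. dgM (fst y)"]) (auto simp: mon_deg)

lemma wt_keys: "w \<in> weights V \<Longrightarrow> x \<in> W w \<Longrightarrow> keys (co x) \<subseteq> {y \<in> X0. wgM (fst y) = w}"
  by (rule decomp_keys(2)[OF W_dec, of "\<lambda>y. wgM (fst y)"]) (auto simp: mon_wt)

lemma bd_closed: "x \<in> carrier P \<Longrightarrow> bd P x \<in> carrier P"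
  and bd_add: "x \<in> carrier P \<Longrightarrow> y \<in> carrier P \<Longrightarrow> bd P (x \<oplus> y) = bd P x \<oplus> bd P y"
  and bd_smul: "x \<in> carrier P \<Longrightarrow> bd P (c \<odot> x) = c \<odot> bd P x"
  using bd_linear by (auto simp: linear_maps_def)

lemma bd_0: "bd P \<zero> = \<zero>"
  using bd_deg[of \<zero> "0"] bd_smul[of \<zero> 0] smult_l_null[of "bd P \<zero>"] smult_l_null[of \<zero>] bd_closed[of \<zero>] by simp

definition Pm :: "('p multiset \<times> 'v set, 'k, 'v \<Rightarrow> int) balg" where
  "Pm = \<lparr>bidx = X0, bmul = (\<lambda>f g. co (L f \<otimes> L g)), bone = co \<one>, bdif = (\<lambda>f. co (bd P (L f))),
     bdeg = (\<lambda>x. dgM (fst x)), bwt = (\<lambda>x. wgM (fst x))\<rparr>"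

lemma Pm_simps [simp]: "bidx Pm = X0" "bmul Pm f g = co (L f \<otimes> L g)" "bone Pm = co \<one>" "bdif Pm f = co (bd P (L f))"
  "bdeg Pm x = dgM (fst x)" "bwt Pm x = wgM (fst x)"
  by (simp_all add: Pm_def)

lemma hidx_Pm: "hidx Pm n w = {y \<in> X0. dgM (fst y) = n} \<inter> {y \<in> X0. wgM (fst y) = w}"
  by (auto simp: hidx_def)

lemmas smult_cl = smult_closed[simplified]

lemma balg_Pm: "balg Pm"
proof
  have bl: "lin (\<lambda>x. co (L x \<otimes> L y))" "lin (\<lambda>x. co (L y \<otimes> L x))" for y
    by (auto intro!: linI simp: L_add L_smul l_distr r_distr L_closed co_add co_smul smult_mult_left smult_mult_right)
  have bm: "bmul Pm = (\<lambda>f g. co (L f \<otimes> L g))" by (simp add: Pm_def)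
  show bil: "bilin (bmul Pm)" unfolding bm bilin_def using bl by blast
  show "bmul Pm (bmul Pm x y) z = bmul Pm x (bmul Pm y z)" for x y z
    by (simp add: L_co L_closed m_assoc)
  show "bmul Pm (bas i) (bas j) = koszul_sign (bdeg Pm i * bdeg Pm j) \<bullet> bmul Pm (bas j) (bas i)" for i j
  proof (cases "i \<in> X0 \<and> j \<in> X0")
    case True
    then show ?thesis using graded_commute[OF mon_deg mon_deg, of i j] by (simp add: L_bas co_smul mon_closed)
  next
    case False
    then have "L (bas i) = \<zero> \<or> L (bas j) = \<zero>" using L_off by blast
    then show ?thesis using L_closed[of "bas i"] L_closed[of "bas j"] by (auto simp: co_0)
  qed
  show "i \<notin> bidx Pm \<Longrightarrow> bmul Pm (bas i) x = 0" for i x by (simp add: L_off co_0 L_closed)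
  show "keys (bmul Pm (bas i) (bas j)) \<subseteq> hidx Pm (bdeg Pm i + bdeg Pm j) (bwt Pm i + bwt Pm j)" for i j
  proof (cases "i \<in> X0 \<and> j \<in> X0")
    case True
    then have ij: "i \<in> X0" "j \<in> X0" by auto
    have "mon (fst i) \<otimes> mon (fst j) \<in> W (\<lambda>v. wgM (fst i) v + wgM (fst j) v)"
      using mon_wt[OF ij(1)] mon_wt[OF ij(2)] by (intro W_mul) auto
    then have "keys (co (mon (fst i) \<otimes> mon (fst j))) \<subseteq> {y \<in> X0. wgM (fst y) = wgM (fst i) + wgM (fst j)}"
      using mon_wt[OF ij(1)] mon_wt[OF ij(2)] weights_add[of "wgM (fst i)" "wgM (fst j)"]
      by (intro wt_keys) (auto simp: plus_fun_def)
    moreover have "keys (co (mon (fst i) \<otimes> mon (fst j))) \<subseteq> {y \<in> X0. dgM (fst y) = dgM (fst i) + dgM (fst j)}"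
      by (intro deg_keys deg_mult mon_deg ij)
    ultimately show ?thesis using ij by (simp add: hidx_Pm L_bas)
  next
    case False
    then have "L (bas i) = \<zero> \<or> L (bas j) = \<zero>" using L_off by blast
    then show ?thesis using L_closed[of "bas i"] L_closed[of "bas j"] by (auto simp: co_0)
  qed
  show "keys (bone Pm) \<subseteq> hidx Pm 0 0"
    using deg_keys[OF deg_one] wt_keys[of 0 \<one>] W_one weights_0 by (simp add: hidx_Pm zero_fun_def)
  show "bmul Pm (bone Pm) (bas i) = bas i" if "i \<in> bidx Pm" for i
    using that by (simp add: L_co L_closed co_L)
  have bd: "bdif Pm = (\<lambda>f. co (bd P (L f)))" by (simp add: Pm_def)
  show "lin (bdif Pm)" unfolding bd
    by (rule linI) (simp_all add: L_add L_smul bd_add bd_smul L_closed co_add co_smul bd_closed)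
  show "i \<notin> bidx Pm \<Longrightarrow> bdif Pm (bas i) = 0" for i by (simp add: L_off bd_0 co_0)
  show "keys (bdif Pm (bas i)) \<subseteq> hidx Pm (bdeg Pm i - 1) (bwt Pm i)" for i
  proof (cases "i \<in> X0")
    case True
    then show ?thesis using deg_keys[OF bd_deg[OF mon_deg[OF True]]] wt_keys[of "wgM (fst i)" "bd P (mon (fst i))"]
        mon_wt[OF True] W_bd by (simp add: hidx_Pm L_bas)
  qed (simp add: L_off bd_0 co_0)
  show "bdif Pm (bdif Pm x) = 0" for x by (simp add: L_co bd_closed L_closed bd_bd co_0)
  show "bdif Pm (bmul Pm x y) = bmul Pm (bdif Pm x) y + bmul Pm (sg Pm x) (bdif Pm y)" for x y
  proof (rule lin_eqI[of "\<lambda>x. bdif Pm (bmul Pm x y)" "\<lambda>x. bmul Pm (bdif Pm x) y + bmul Pm (sg Pm x) (bdif Pm y)"])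
    note l = bilin_left[OF bil]
    show "lin (\<lambda>x. bdif Pm (bmul Pm x y))" by (rule lin_comp[OF \<open>lin (bdif Pm)\<close> l])
    show "lin (\<lambda>x. bmul Pm (bdif Pm x) y + bmul Pm (sg Pm x) (bdif Pm y))"
      by (intro lin_addI lin_comp[OF l \<open>lin (bdif Pm)\<close>] lin_comp[OF l lin_sg])
    fix i
    show "bdif Pm (bmul Pm (bas i) y) = bmul Pm (bdif Pm (bas i)) y + bmul Pm (sg Pm (bas i)) (bdif Pm y)"
    proof (cases "i \<in> X0")
      case True
      have m: "mon (fst i) \<in> carrier P" by (rule mon_closed[OF True])
      have "co (bd P (mon (fst i) \<otimes> L y)) = co (bd P (mon (fst i)) \<otimes> L y) +
          koszul_sign (dgM (fst i)) \<bullet> co (mon (fst i) \<otimes> bd P (L y))"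
        using bd_leibniz[OF mon_deg[OF True] L_closed[of y]] m
        by (simp add: co_add co_smul bd_closed L_closed smult_cl)
      then show ?thesis using True m
        by (simp add: L_bas L_co bd_closed L_closed L_smul smult_mult_left co_smul)
    next
      case False
      then show ?thesis by (simp add: L_off L_smul co_0 L_closed bd_0 L_0 bd_closed L_co smult_mult_left co_smul)
    qed
  qed
qed

interpretation Pm: balg Pm by (rule balg_Pm)

text \<open>A generator is itself a basis monomial, whose coordinate vector is a basis vector and
  not zero.\<close>

lemma G_nonzero: "g \<in> G \<Longrightarrow> g \<noteq> \<zero>"
proof
  assume g: "g \<in> G" "g = \<zero>"
  have "{#g#} \<in> free_monomials P G" using g(1) by (auto simp: free_monomials_def)
  then have x: "({#g#}, {} :: 'v set) \<in> X0" by (simp add: X0_def)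
  have "arr {#g#} = [g]" using arr[of "{#g#}"] by (cases "arr {#g#}") auto
  then have "mon {#g#} = \<zero>" using g(2) by (simp add: mon_def)
  then show False using co_mon[OF x] co_0 by simp
qed

lemma deg_unique: "x \<in> deg_part P i \<Longrightarrow> x \<in> deg_part P j \<Longrightarrow> x \<noteq> \<zero> \<Longrightarrow> i = j"
proof -
  assume x: "x \<in> deg_part P i" "x \<in> deg_part P j" "x \<noteq> \<zero>"
  have "co x \<noteq> 0" using L_co[OF deg_carrier[OF x(1)]] x(3) L_0 by metis
  then have "keys (co x) \<noteq> {}" by simp
  then obtain y where "y \<in> keys (co x)" by blast
  then show "i = j" using deg_keys[OF x(1)] deg_keys[OF x(2)] by blast
qed

lemma dgn_nonneg: "g \<in> G \<Longrightarrow> 0 \<le> dgn g"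
  using dgn[of g] deg_negative[of "dgn g"] G_nonzero[of g] by force

definition sgl :: "'p \<Rightarrow> 'p multiset \<times> 'v set" where "sgl g = ({#g#}, {})"
definition Gm where "Gm = sgl ` G"
definition wordm :: "'p multiset \<times> 'v set \<Rightarrow> ('p multiset \<times> 'v set) list" where "wordm x = map sgl (arr (fst x))"

lemma arr_single: "arr {#g#} = [g]" using arr[of "{#g#}"] by (cases "arr {#g#}") auto

lemma sgl: assumes "g \<in> G" shows "sgl g \<in> X0" "L (bas (sgl g)) = g" "dgM (fst (sgl g)) = dgn g"
proof -
  have "{#g#} \<in> free_monomials P G" using assms by (auto simp: free_monomials_def)
  then show x: "sgl g \<in> X0" by (simp add: X0_def sgl_def)
  show "L (bas (sgl g)) = g" using L_bas[OF x] assms by (simp add: sgl_def mon_def arr_single G_carrier)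
  show "dgM (fst (sgl g)) = dgn g" by (simp add: sgl_def dgM_def)
qed

lemma L_lprod: "set gs \<subseteq> G \<Longrightarrow> L (lprod Pm (map bas (map sgl gs))) = foldr (\<otimes>) gs \<one>"
  by (induction gs) (simp_all add: L_co sgl L_closed foldr_closed G_carrier)

lemma free_Pm: "bfree Pm Gm wordm"
  unfolding bfree_def
proof (intro conjI ballI allI impI)
  show "Gm \<subseteq> bidx Pm" using sgl by (auto simp: Gm_def)
  show "wordm g = [g]" if "g \<in> Gm" for g
    using that by (auto simp: Gm_def wordm_def sgl_def arr_single)
next
  fix x assume x: "x \<in> bidx Pm"
  then have x': "x \<in> X0" "fst x \<in> free_monomials P G" by (auto simp: X0_def)
  have aG: "set (arr (fst x)) \<subseteq> G" by (rule FM_sub[OF x'(2)])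
  show "set (wordm x) \<subseteq> Gm" using aG by (auto simp: wordm_def Gm_def)
  have "0 \<le> (\<Sum>g\<leftarrow>arr (fst x). dgn g)" using aG dgn_nonneg by (intro sum_list_nonneg) auto
  then show "0 \<le> bdeg Pm x" by (simp add: sum_arr)
  have "L (lprod Pm (map bas (wordm x))) = mon (fst x)" unfolding wordm_def mon_def by (rule L_lprod[OF aG])
  then have "co (L (lprod Pm (map bas (wordm x)))) = bas x" using co_mon[OF x'(1)] by simp
  then show "bas x = lprod Pm (map bas (wordm x))"
    using Pm.lprod_sub[of "map bas (wordm x)"] by (simp add: co_L restr_id)
next
  fix ws assume ws: "set ws \<subseteq> Gm" and o: "\<forall>g\<in>set ws. odd (bdeg Pm g) \<longrightarrow> count (mset ws) g \<le> 1"
  from ws have "\<exists>gs. set gs \<subseteq> G \<and> ws = map sgl gs"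
  proof (induction ws)
    case (Cons w ws)
    then obtain gs g where "set gs \<subseteq> G" "ws = map sgl gs" "g \<in> G" "w = sgl g" by (auto simp: Gm_def)
    then show ?case by (intro exI[of _ "g # gs"]) simp
  qed simp
  then obtain gs where gs: "set gs \<subseteq> G" "ws = map sgl gs" by blast
  have "count (mset gs) g \<le> 1" if g: "g \<in> G" "\<exists>i. odd i \<and> g \<in> deg_part P i" for g
  proof (cases "g \<in> set gs")
    case True
    have "odd (dgn g)" using g deg_unique[OF dgn[OF g(1)] _ G_nonzero[OF g(1)]] by blast
    then have "count (mset ws) (sgl g) \<le> 1" using o True gs sgl(3)[OF g(1)] by auto
    then show ?thesis using count_map_ge[of gs g sgl] gs(2) by simp
  next
    case False
    then have "g \<notin># mset gs" by simp
    then show ?thesis by (metis count_inI le0)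
  qed
  then have "mset gs \<in> free_monomials P G" using gs(1) by (auto simp: free_monomials_def)
  then have x: "(mset gs, {}) \<in> X0" by (simp add: X0_def)
  have "mset (wordm (mset gs, {})) = image_mset sgl (mset (arr (mset gs)))" by (simp add: wordm_def)
  also have "\<dots> = mset ws" by (simp add: arr gs(2))
  finally show "\<exists>x\<in>bidx Pm. mset (wordm x) = mset ws" using x by (intro bexI[of _ "(mset gs, {})"]) simp_all
qed

lemma idz_sel: "carrier (in_degree_zero S) = carrier S" "\<zero>\<^bsub>in_degree_zero S\<^esub> = \<zero>\<^bsub>S\<^esub>" "\<one>\<^bsub>in_degree_zero S\<^esub> = \<one>\<^bsub>S\<^esub>"
  "x \<oplus>\<^bsub>in_degree_zero S\<^esub> y = x \<oplus>\<^bsub>S\<^esub> y" "x \<otimes>\<^bsub>in_degree_zero S\<^esub> y = x \<otimes>\<^bsub>S\<^esub> y" "c \<odot>\<^bsub>in_degree_zero S\<^esub> x = c \<odot>\<^bsub>S\<^esub> x"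
  "deg_part (in_degree_zero S) i = (if i = 0 then carrier S else {\<zero>\<^bsub>S\<^esub>})" "bd (in_degree_zero S) x = \<zero>\<^bsub>S\<^esub>"
  for S :: "('c::field, 'd) module"
  by (simp_all add: in_degree_zero_def module.defs dga.defs)

lemma eps:
  shows eps_closed: "x \<in> carrier P \<Longrightarrow> \<epsilon> x \<in> carrier SRA"
    and eps_add: "x \<in> carrier P \<Longrightarrow> y \<in> carrier P \<Longrightarrow> \<epsilon> (x \<oplus> y) = \<epsilon> x \<oplus>\<^bsub>SRA\<^esub> \<epsilon> y"
    and eps_smul: "x \<in> carrier P \<Longrightarrow> \<epsilon> (c \<odot> x) = c \<odot>\<^bsub>SRA\<^esub> \<epsilon> x"
    and eps_mul: "x \<in> carrier P \<Longrightarrow> y \<in> carrier P \<Longrightarrow> \<epsilon> (x \<otimes> y) = \<epsilon> x \<otimes>\<^bsub>SRA\<^esub> \<epsilon> y"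
    and eps_one: "\<epsilon> \<one> = \<one>\<^bsub>SRA\<^esub>"
    and eps_deg: "x \<in> deg_part P i \<Longrightarrow> i \<noteq> 0 \<Longrightarrow> \<epsilon> x = \<zero>\<^bsub>SRA\<^esub>"
    and eps_bd: "x \<in> carrier P \<Longrightarrow> \<epsilon> (bd P x) = \<zero>\<^bsub>SRA\<^esub>"
proof -
  have h: "\<epsilon> \<in> linear_maps P (in_degree_zero SRA)" "\<epsilon> \<in> ring_hom P (in_degree_zero SRA)"
    "\<And>i. \<epsilon> ` deg_part P i \<subseteq> deg_part (in_degree_zero SRA) i" "\<And>x. x \<in> carrier P \<Longrightarrow> \<epsilon> (bd P x) = bd (in_degree_zero SRA) (\<epsilon> x)"
    using quasi unfolding quasi_isomorphism_def dga_homs_def by blast+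
  show "x \<in> carrier P \<Longrightarrow> \<epsilon> x \<in> carrier SRA"
    "x \<in> carrier P \<Longrightarrow> y \<in> carrier P \<Longrightarrow> \<epsilon> (x \<oplus> y) = \<epsilon> x \<oplus>\<^bsub>SRA\<^esub> \<epsilon> y"
    "x \<in> carrier P \<Longrightarrow> \<epsilon> (c \<odot> x) = c \<odot>\<^bsub>SRA\<^esub> \<epsilon> x"
    using h(1) unfolding linear_maps_def idz_sel by auto
  show "x \<in> carrier P \<Longrightarrow> y \<in> carrier P \<Longrightarrow> \<epsilon> (x \<otimes> y) = \<epsilon> x \<otimes>\<^bsub>SRA\<^esub> \<epsilon> y" "\<epsilon> \<one> = \<one>\<^bsub>SRA\<^esub>"
    using h(2) unfolding ring_hom_def idz_sel by auto
  show "x \<in> deg_part P i \<Longrightarrow> i \<noteq> 0 \<Longrightarrow> \<epsilon> x = \<zero>\<^bsub>SRA\<^esub>" using h(3)[of i] unfolding idz_sel by auto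
  show "x \<in> carrier P \<Longrightarrow> \<epsilon> (bd P x) = \<zero>\<^bsub>SRA\<^esub>" using h(4)[of x] unfolding idz_sel by simp
qed

definition em where "em f = nf (\<epsilon> (L f))"

lemma nf_zero: "nf (\<zero>\<^bsub>SRA\<^esub> :: ('v, 'k) mpoly set) = 0" and zero_SRA: "(\<zero>\<^bsub>SRA\<^esub> :: ('v, 'k) mpoly set) \<in> carrier SRA"
  using nf_ops(4,9)[OF eps_closed[OF L_closed[of 0]] eps_closed[OF L_closed[of 0]]] by auto

lemma eps_0: "\<epsilon> \<zero> = \<zero>\<^bsub>SRA\<^esub>"
proof (rule nf_inj)
  have "\<epsilon> \<zero> = \<epsilon> (L (0 \<bullet> 0))" by (simp add: L_0)
  then show "nf (\<epsilon> \<zero>) = nf \<zero>\<^bsub>SRA\<^esub>" using eps_smul[OF L_closed, of 0 0] eps_closed[OF L_closed, of 0]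
    by (simp add: L_smul[symmetric] nf_zero) (metis L_0 L_smul nf_ops(3) smul_0(1,2))
qed (simp_all add: eps_closed zero_SRA)

lemma em_bhom: "bhom Pm (SR K) em"
  unfolding bhom_def ghom_def
proof (intro conjI allI impI)
  note c = eps_closed[OF L_closed]
  show "lin em"
    by (rule linI) (simp_all add: em_def L_add L_smul eps_add eps_smul L_closed nf_ops(1)[OF c c] nf_ops(3)[OF c c])
  show "em (bmul Pm x y) = bmul (SR K) (em x) (em y)" for x y
    by (simp add: em_def L_co L_closed eps_mul nf_ops c)
  show "em (bone Pm) = bone (SR K)" using nf_ops(5)[OF c c] by (simp add: em_def L_co eps_one)
  show "keys (em (bas x)) \<subseteq> hidx (SR K) (bdeg Pm x) (bwt Pm x)" for x
  proof (cases "x \<in> X0")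
    case True
    show ?thesis
    proof (cases "dgM (fst x) = 0")
      case d: True
      have "\<epsilon> (mon (fst x)) \<in> SR_weight V K (wgM (fst x))" using mon_wt[OF True] W_eps by blast
      then show ?thesis using True d keys_nf by (auto simp: em_def L_bas hidx_SR SR_weight_iff subset_iff)
    next
      case False
      then show ?thesis using True eps_deg[OF mon_deg[OF True]] by (simp add: em_def L_bas nf_zero)
    qed
  qed (simp add: em_def L_off eps_0 nf_zero)
  show "em (bas x) = 0" if "x \<notin> bidx Pm" for x using that by (simp add: em_def L_off eps_0 nf_zero)
  show "em (bdif Pm x) = bdif (SR K) (em x)" for x
    by (simp add: em_def L_co bd_closed L_closed eps_bd nf_zero)
qed

end

section \<open>Derivations without weights\<close>

text \<open>By definition the coboundaries arise from derivations of all weights, so these have to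
  be compared with the derivations of a fixed weight in \<open>bder\<close>.\<close>

definition uder :: "('x, 'k::field_char_0, 'v \<Rightarrow> int) balg \<Rightarrow> 'v set set \<Rightarrow> (('x \<Rightarrow>\<^sub>0 'k) \<Rightarrow> ('v mon \<Rightarrow>\<^sub>0 'k)) \<Rightarrow>
    int \<Rightarrow> (('x \<Rightarrow>\<^sub>0 'k) \<Rightarrow> ('v mon \<Rightarrow>\<^sub>0 'k)) set" where
  "uder A L e i = {\<phi>. lin \<phi> \<and>
     (\<forall>x y. \<phi> (bmul A x y) = restr (faces L) (\<phi> x * e y) + restr (faces L) (e x * \<phi> y)) \<and>
     (\<forall>x. \<not> (x \<in> bidx A \<and> bdeg A x = i) \<longrightarrow> \<phi> (bas x) = 0) \<and> (\<forall>x. keys (\<phi> (bas x)) \<subseteq> faces L)}"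

lemma bder_uder: "\<phi> \<in> bder A L e c i \<longleftrightarrow> \<phi> \<in> uder A L e i \<and> (\<forall>x. keys (\<phi> (bas x)) \<subseteq> {m. mwt m = bwt A x + c})"
  unfolding bder_def uder_def by blast

lemma uderD: assumes "\<phi> \<in> uder A L e i"
  shows uder_lin: "lin \<phi>"
    and uder_mul: "\<phi> (bmul A x y) = restr (faces L) (\<phi> x * e y) + restr (faces L) (e x * \<phi> y)"
    and uder_off: "\<not> (z \<in> bidx A \<and> bdeg A z = i) \<Longrightarrow> \<phi> (bas z) = 0"
    and uder_keys: "keys (\<phi> x) \<subseteq> faces L"
proof -
  show l: "lin \<phi>" using assms by (simp add: uder_def)
  show "keys (\<phi> x) \<subseteq> faces L" by (rule lin_keys[OF l]) (use assms in \<open>simp add: uder_def\<close>)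
qed (use assms in \<open>auto simp: uder_def\<close>)

lemma linclosed_uder: "linclosed (uder A L e i)"
  unfolding linclosed_def
proof (intro conjI ballI allI)
  show "(\<lambda>x. 0) \<in> uder A L e i" by (simp add: uder_def lin_zero)
  show "(\<lambda>x. \<phi> x + \<psi> x) \<in> uder A L e i" if p: "\<phi> \<in> uder A L e i" "\<psi> \<in> uder A L e i" for \<phi> \<psi>
    unfolding uder_def
    using keys_addI[OF uder_keys[OF p(1)] uder_keys[OF p(2)]]
    by (auto simp: uder_mul[OF p(1)] uder_mul[OF p(2)] algebra_simps lin_add[OF lin_restr]
        uder_off[OF p(1)] uder_off[OF p(2)] intro!: lin_addI uder_lin[OF p(1)] uder_lin[OF p(2)])
  show "(\<lambda>x. a \<bullet> \<phi> x) \<in> uder A L e i" if p: "\<phi> \<in> uder A L e i" for a \<phi>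
    unfolding uder_def
    using keys_smulI[OF uder_keys[OF p]]
    by (auto simp: uder_mul[OF p] smul_simps smul_times lin_smul[OF lin_restr]
        uder_off[OF p] intro!: lin_smulI uder_lin[OF p])
qed

lemma restr_weight_times:
  fixes p q :: "'v mon \<Rightarrow>\<^sub>0 'k::field"
  assumes "keys q \<subseteq> {m. mwt m = w}"
  shows "restr {m. mwt m = u + w} (restr Y (p * q)) = restr Y (restr {m. mwt m = u} p * q)"
proof (rule bilin_eq_keys[of "\<lambda>p q. restr {m. mwt m = u + w} (restr Y (p * q))" "\<lambda>p q. restr Y (restr {m. mwt m = u} p * q)"])
  show "bilin (\<lambda>p q :: 'v mon \<Rightarrow>\<^sub>0 'k. restr {m. mwt m = u + w} (restr Y (p * q)))"
    by (rule bilin_comp[OF lin_restr bilin_restr_times])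
  show "bilin (\<lambda>p q :: 'v mon \<Rightarrow>\<^sub>0 'k. restr Y (restr {m. mwt m = u} p * q))"
    unfolding bilin_def
    by (intro conjI allI lin_comp[OF bilin_left[OF bilin_restr_times] lin_restr] bilin_right[OF bilin_restr_times])
qed (use assms in \<open>auto simp: mwt_add\<close>)

text \<open>The weight \<open>c\<close> part of a derivation is again a derivation, because products
  add weights and \<open>e\<close> preserves them.\<close>

lemma (in bresol) uder_weight:
  assumes \<psi>: "\<psi> \<in> uder A K e i"
  shows "\<exists>\<psi>'\<in>bder A K e c i. \<forall>x w. keys x \<subseteq> {z. bwt A z = w} \<longrightarrow> \<psi>' x = restr {m. mwt m = w + c} (\<psi> x)"
proof -
  define \<psi>' where "\<psi>' = lext (\<lambda>x. restr {m. mwt m = bwt A x + c} (\<psi> (bas x)))"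
  have l: "lin \<psi>'" by (simp add: \<psi>'_def lin_lext)
  have w: "\<psi>' x = restr {m. mwt m = w + c} (\<psi> x)" if "keys x \<subseteq> {z. bwt A z = w}" for x w
    by (rule lin_eq_keys[OF l lin_comp[OF lin_restr uder_lin[OF \<psi>]]]) (use that in \<open>auto simp: \<psi>'_def\<close>)
  have "\<psi>' (bmul A x y) = restr (faces K) (\<psi>' x * e y) + restr (faces K) (e x * \<psi>' y)" for x y
  proof (rule bilin_eq_keys[of "\<lambda>x y. \<psi>' (bmul A x y)" "\<lambda>x y. restr (faces K) (\<psi>' x * e y) + restr (faces K) (e x * \<psi>' y)"])
    show "bilin (\<lambda>x y. \<psi>' (bmul A x y))" by (rule bilin_comp[OF l bilin])
    show "bilin (\<lambda>x y. restr (faces K) (\<psi>' x * e y) + restr (faces K) (e x * \<psi>' y))"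
      unfolding bilin_def
      by (intro conjI allI lin_addI lin_comp[OF bilin_left[OF bilin_restr_times] l] lin_comp[OF bilin_right[OF bilin_restr_times] l]
          lin_comp[OF bilin_left[OF bilin_restr_times] e_lin] lin_comp[OF bilin_right[OF bilin_restr_times] e_lin])
    fix x y
    have e: "keys (e (bas z)) \<subseteq> {m. mwt m = bwt A z}" for z using e_keys[of z] by blast
    have "keys (bmul A (bas x) (bas y)) \<subseteq> {z. bwt A z = bwt A x + bwt A y}"
      using mul_keys[of x y] by (auto simp: hidx_def)
    from w[OF this] have "\<psi>' (bmul A (bas x) (bas y)) =
      restr {m. mwt m = (bwt A x + c) + bwt A y} (restr (faces K) (\<psi> (bas x) * e (bas y))) +
      restr {m. mwt m = (bwt A y + c) + bwt A x} (restr (faces K) (\<psi> (bas y) * e (bas x)))"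
      by (simp add: uder_mul[OF \<psi>] lin_add[OF lin_restr] mult.commute add.commute add.left_commute)
    then show "\<psi>' (bmul A (bas x) (bas y)) =
      restr (faces K) (\<psi>' (bas x) * e (bas y)) + restr (faces K) (e (bas x) * \<psi>' (bas y))"
      unfolding restr_weight_times[OF e] by (simp add: \<psi>'_def mult.commute)
  qed
  then have "\<psi>' \<in> bder A K e c i"
    unfolding bder_def using l uder_off[OF \<psi>] by (auto simp: \<psi>'_def keys_restr dest: subsetD[OF uder_keys[OF \<psi>]])
  with w show ?thesis by blast
qed

section \<open>Homology and derivations of the given resolution in coordinates\<close>

context rec_res
begin

interpretation Pm: balg Pm by (rule balg_Pm)

lemmas em_lin = bhom_lin[OF em_bhom]

lemma SRA_zero_add:
  fixes x :: "('v, 'k) mpoly set"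
  shows "x \<in> carrier SRA \<Longrightarrow> \<zero>\<^bsub>SRA\<^esub> \<oplus>\<^bsub>SRA\<^esub> x = x"
  by (rule nf_inj) (simp_all add: nf_ops[OF zero_SRA] nf_zero)

lemma boundaries_idz:
  "boundaries (in_degree_zero SRA) i = {\<zero>\<^bsub>SRA\<^esub> :: ('v, 'k) mpoly set}"
  using zero_SRA by (auto simp: boundaries_def idz_sel image_def)

lemma homology_carrier: "carrier (homology P i) = (\<lambda>x. boundaries P i +> x) ` cycles P i"
  unfolding homology_def quot_module_def by (auto simp: A_RCOSETS_def RCOSETS_def a_r_coset_def r_coset_def)

lemma homology_idz:
  "carrier (homology (in_degree_zero SRA) 0) = (\<lambda>s. {s}) ` (carrier SRA :: ('v, 'k) mpoly set set)"
  unfolding homology_def quot_module_def boundaries_idz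
  by (auto simp: A_RCOSETS_def RCOSETS_def cycles_def idz_sel SRA_zero_add r_coset_def image_iff)

lemma zero_deg: "\<zero> \<in> deg_part P i"
proof -
  interpret H: submodule "deg_part P i" ground P by (rule deg_sub)
  show ?thesis using H.one_closed by simp
qed

lemma zero_boundary: "\<zero> \<in> boundaries P i" and zero_cycle: "\<zero> \<in> cycles P i"
  using bd_0 zero_deg by (auto simp: cycles_def boundaries_def intro!: image_eqI[of _ _ \<zero>])

lemma homology_map_coset:
  assumes "x \<in> cycles P i"
  shows "homology_map (in_degree_zero SRA) \<epsilon> i (boundaries P i +> x) = {\<epsilon> x}"
proof -
  have xc: "x \<in> carrier P" using assms deg_carrier by (auto simp: cycles_def)
  have e: "\<epsilon> z = \<epsilon> x" if "z \<in> boundaries P i +> x" for z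
  proof -
    obtain y where y: "y \<in> deg_part P (i + 1)" "z = bd P y \<oplus> x"
      using \<open>z \<in> boundaries P i +> x\<close> by (auto simp: boundaries_def a_r_coset_def r_coset_def)
    show ?thesis using y(2) xc deg_carrier[OF y(1)]
      by (simp add: eps_add bd_closed eps_bd SRA_zero_add eps_closed)
  qed
  have "x \<in> boundaries P i +> x" using xc zero_boundary unfolding a_r_coset_def r_coset_def by force
  moreover have "boundaries (in_degree_zero SRA) i +>\<^bsub>in_degree_zero SRA\<^esub> \<epsilon> z = {\<epsilon> x}" if "z \<in> boundaries P i +> x" for z
    using e[OF that] eps_closed[OF xc] by (simp add: boundaries_idz a_r_coset_def r_coset_def idz_sel SRA_zero_add)
  ultimately show ?thesis unfolding homology_map_def by blast
qed

lemma quasi_bij: "bij_betw (homology_map (in_degree_zero SRA) \<epsilon> i) (carrier (homology P i)) (carrier (homology (in_degree_zero SRA) i))"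
  using quasi by (simp add: quasi_isomorphism_def)

lemma cycle_boundary:
  assumes "x \<in> cycles P i" "\<epsilon> x = \<zero>\<^bsub>SRA\<^esub>" shows "x \<in> boundaries P i"
proof -
  note z = zero_cycle[of i]
  have xc: "x \<in> carrier P" using assms deg_carrier by (auto simp: cycles_def)
  have "homology_map (in_degree_zero SRA) \<epsilon> i (boundaries P i +> x) = homology_map (in_degree_zero SRA) \<epsilon> i (boundaries P i +> \<zero>)"
    using homology_map_coset[OF assms(1)] homology_map_coset[OF z] assms(2) eps_0 by simp
  then have eq: "boundaries P i +> x = boundaries P i +> \<zero>"
    using bij_betw_imp_inj_on[OF quasi_bij[of i]] assms(1) z unfolding homology_carrier by (auto dest: inj_onD)
  have "x \<in> boundaries P i +> x" using xc zero_boundary unfolding a_r_coset_def r_coset_def by force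
  then obtain b where "b \<in> boundaries P i" "x = b \<oplus> \<zero>"
    unfolding eq by (auto simp: a_r_coset_def r_coset_def)
  then show ?thesis using deg_carrier bd_closed by (auto simp: boundaries_def)
qed

lemma eps_surj:
  assumes "s \<in> carrier SRA" shows "\<exists>x\<in>carrier P. \<epsilon> x = s"
proof -
  have "{s} \<in> homology_map (in_degree_zero SRA) \<epsilon> 0 ` carrier (homology P 0)"
    using bij_betw_imp_surj_on[OF quasi_bij[of 0]] assms by (simp add: homology_idz)
  then obtain x where x: "x \<in> cycles P 0" "{s} = {\<epsilon> x}"
    unfolding homology_carrier using homology_map_coset by auto
  then show ?thesis using deg_carrier by (auto simp: cycles_def)
qed

text \<open>The quasi-isomorphism is given degree by degree, whereas acyclicity concerns arbitrary
  vectors. The cycle is therefore split by degree; each part is closed and has augmentation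
  zero.\<close>

lemma Pm_acyc:
  assumes x: "keys x \<subseteq> bidx Pm" "bdif Pm x = 0" "em x = 0"
  shows "\<exists>y. keys y \<subseteq> bidx Pm \<and> bdif Pm y = x"
proof -
  define r where "r n = restr {z. dgM (fst z) = n} x" for n
  have ex: "\<exists>y. y \<in> carrier P \<and> bd P y = L (r n)" for n
  proof -
    have Ld: "L (r n) \<in> deg_part P n" unfolding L_def
      by (rule LP_mem[OF deg_sub]) (use mon_deg in \<open>auto simp: r_def keys_restr\<close>)
    have "bdif Pm (r n) = restr {z. dgM (fst z) = n - 1} (bdif Pm x)" unfolding r_def
    proof (rule lin_eqI[OF lin_comp[OF Pm.lin_dif lin_restr] lin_comp[OF lin_restr Pm.lin_dif]])
      fix z
      have "keys (bdif Pm (bas z)) \<subseteq> {y. dgM (fst y) = dgM (fst z) - 1}"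
        using Pm.dif_keys[of z] by (auto simp: hidx_Pm)
      then show "bdif Pm (restr {z. dgM (fst z) = n} (bas z)) = restr {z. dgM (fst z) = n - 1} (bdif Pm (bas z))"
        by (cases "dgM (fst z) = n") (auto simp: Pm.dif_simps simp del: Pm_simps(4) intro!: restr_id[symmetric] restr_0[symmetric] restr_0)
    qed
    then have "co (bd P (L (r n))) = 0" using x(2) by simp
    then have b: "bd P (L (r n)) = \<zero>" using L_co[OF bd_closed[OF L_closed[of "r n"]]] L_0 by simp
    have "\<epsilon> (L (r n)) = \<zero>\<^bsub>SRA\<^esub>"
    proof (cases "n = 0")
      case True
      have "em (bas z) = 0" if "dgM (fst z) \<noteq> 0" for z
        using ghom_keys[OF bhom_ghom[OF em_bhom], of z] that by (simp add: hidx_SR)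
      then have "em (restr {z. dgM (fst z) = 0} (bas z)) = em (bas z)" for z by (simp add: lin_0[OF em_lin])
      then have "em (r 0) = em x" unfolding r_def by (rule lin_eqI[OF lin_comp[OF em_lin lin_restr] em_lin])
      then show ?thesis using x(3) True nf_inj[OF eps_closed[OF L_closed] zero_SRA] by (simp add: em_def nf_zero)
    qed (rule eps_deg[OF Ld])
    with Ld b have "L (r n) \<in> boundaries P n" by (intro cycle_boundary) (simp_all add: cycles_def)
    then show ?thesis using deg_carrier by (force simp: boundaries_def)
  qed
  then obtain y where y: "\<And>n. y n \<in> carrier P" "\<And>n. bd P (y n) = L (r n)" by metis
  define Y where "Y = (\<Sum>n\<in>(\<lambda>z. dgM (fst z)) ` keys x. co (y n))"
  have rk: "keys (r n) \<subseteq> X0" for n using x(1) by (auto simp: r_def keys_restr)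
  have "bdif Pm Y = (\<Sum>n\<in>(\<lambda>z. dgM (fst z)) ` keys x. bdif Pm (co (y n)))" unfolding Y_def by (rule lin_sum[OF Pm.lin_dif])
  also have "\<dots> = (\<Sum>n\<in>(\<lambda>z. dgM (fst z)) ` keys x. r n)" by (simp add: L_co y co_L restr_id[OF rk])
  also have "\<dots> = x" unfolding r_def by (rule restr_split[symmetric])
  finally have "bdif Pm Y = x" .
  moreover have "keys Y \<subseteq> bidx Pm" unfolding Y_def by (intro keys_sumI) (simp add: co y)
  ultimately show ?thesis by blast
qed

lemma bresol_Pm: "bresol Pm Gm wordm K em"
proof (intro bresol.intro bresol_axioms.intro)
  show "free_balg Pm Gm wordm" by (intro free_balg.intro free_balg_axioms.intro balg_Pm free_Pm)
  show "\<exists>x. keys x \<subseteq> bidx Pm \<and> em x = s" if s: "keys s \<subseteq> faces K" for s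
  proof -
    obtain x where x: "x \<in> carrier P" "\<epsilon> x = cl s" using eps_surj[OF cl_carrier[OF s]] by blast
    then show ?thesis using co(1)[OF x(1)] by (intro exI[of _ "co x"]) (simp add: em_def L_co nf_cl_faces[OF s])
  qed
qed (use Pm_acyc dclK em_bhom in auto)

text \<open>All extensional functions rather than derivations only: closure under the operations is
  immediate for this larger set, and it is all that the coset calculus asks for.\<close>

definition D where "D = carrier P \<rightarrow>\<^sub>E (carrier SRA :: ('v, 'k) mpoly set set)"

text \<open>The bridge between the given definitions and the coordinate calculus: basis monomials
  are used in the source and normal forms in the target.\<close>

definition tr :: "('p \<Rightarrow> ('v, 'k) mpoly set) \<Rightarrow> ('p multiset \<times> 'v set \<Rightarrow>\<^sub>0 'k) \<Rightarrow> ('v, 'k) mpoly" where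
  "tr \<phi> = (\<lambda>f. nf (\<phi> (L f)))"

abbreviation der where "der j \<equiv> Der SRA P \<epsilon> j"

lemma D_closed: "\<phi> \<in> D \<Longrightarrow> x \<in> carrier P \<Longrightarrow> \<phi> x \<in> carrier SRA" by (auto simp: D_def)

lemma DerD:
  assumes "\<phi> \<in> carrier (der j)"
  shows Der_D: "\<phi> \<in> D"
    and Der_add: "x \<in> carrier P \<Longrightarrow> y \<in> carrier P \<Longrightarrow> \<phi> (x \<oplus> y) = \<phi> x \<oplus>\<^bsub>SRA\<^esub> \<phi> y"
    and Der_smul: "x \<in> carrier P \<Longrightarrow> \<phi> (a \<odot> x) = a \<odot>\<^bsub>SRA\<^esub> \<phi> x"
    and Der_off: "l \<noteq> j \<Longrightarrow> x \<in> deg_part P l \<Longrightarrow> \<phi> x = \<zero>\<^bsub>SRA\<^esub>"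
    and Der_mul: "x \<in> deg_part P l \<Longrightarrow> y \<in> carrier P \<Longrightarrow>
      \<phi> (x \<otimes> y) = \<phi> x \<otimes>\<^bsub>SRA\<^esub> \<epsilon> y \<oplus>\<^bsub>SRA\<^esub> koszul_sign (j * l) \<odot>\<^bsub>SRA\<^esub> (\<epsilon> x \<otimes>\<^bsub>SRA\<^esub> \<phi> y)"
  using assms by (auto simp: Der_def D_def linear_maps_def PiE_def)

text \<open>The sign differs from 1 only if \<open>l \<noteq> 0\<close>, and then
  \<open>\<epsilon> x = 0\<close>. This is why the derivations in coordinates carry no
  signs.\<close>

lemma nf_leibniz:
  assumes "x \<in> deg_part P l" "y \<in> carrier P" "a \<in> carrier SRA" "b \<in> carrier SRA"
  shows "nf (a \<otimes>\<^bsub>SRA\<^esub> \<epsilon> y \<oplus>\<^bsub>SRA\<^esub> koszul_sign (j * l) \<odot>\<^bsub>SRA\<^esub> (\<epsilon> x \<otimes>\<^bsub>SRA\<^esub> b)) =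
    restr (faces K) (nf a * nf (\<epsilon> y)) + restr (faces K) (nf (\<epsilon> x) * nf b)"
proof -
  have e: "\<epsilon> x \<in> carrier SRA" "\<epsilon> y \<in> carrier SRA" using assms deg_carrier eps_closed by auto
  note * = nf_ops[OF assms(3) e(2)] nf_ops[OF e(1) assms(4)]
  have "nf (a \<otimes>\<^bsub>SRA\<^esub> \<epsilon> y \<oplus>\<^bsub>SRA\<^esub> koszul_sign (j * l) \<odot>\<^bsub>SRA\<^esub> (\<epsilon> x \<otimes>\<^bsub>SRA\<^esub> b)) =
    restr (faces K) (nf a * nf (\<epsilon> y)) + koszul_sign (j * l) \<bullet> restr (faces K) (nf (\<epsilon> x) * nf b)"
    using nf_ops(1)[OF *(7) nf_ops(8)[OF *(17) *(17)]] nf_ops(3)[OF *(17) *(17)] *(2,12) by simp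
  moreover have "nf (\<epsilon> x) = 0" if "l \<noteq> 0" using eps_deg[OF assms(1) that] nf_zero by simp
  ultimately show ?thesis by (cases "l = 0") simp_all
qed

lemma L_bas_deg: "\<exists>l. L (bas z) \<in> deg_part P l"
  using mon_deg zero_deg L_bas L_off by metis

lemma tr_Der_uder: assumes \<phi>: "\<phi> \<in> carrier (der j)" shows "tr \<phi> \<in> uder Pm K em j"
  unfolding uder_def
proof (intro CollectI conjI allI impI)
  note c = D_closed[OF Der_D[OF \<phi>] L_closed]
  show l: "lin (tr \<phi>)"
    by (rule linI) (simp_all add: tr_def L_add L_smul Der_add[OF \<phi>] Der_smul[OF \<phi>] L_closed nf_ops(1)[OF c c] nf_ops(3)[OF c c])
  show "keys (tr \<phi> (bas z)) \<subseteq> faces K" for z unfolding tr_def by (rule keys_nf[OF c])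
  show "tr \<phi> (bas z) = 0" if "\<not> (z \<in> bidx Pm \<and> bdeg Pm z = j)" for z
  proof -
    have "\<exists>l. l \<noteq> j \<and> L (bas z) \<in> deg_part P l"
    proof (cases "z \<in> X0")
      case True
      then show ?thesis using that mon_deg[of z] by (auto simp: L_bas)
    next
      case False
      then show ?thesis using zero_deg[of "j + 1"] by (intro exI[of _ "j + 1"]) (simp add: L_off)
    qed
    then show ?thesis using Der_off[OF \<phi>] by (auto simp: tr_def nf_zero)
  qed
  show "tr \<phi> (bmul Pm x y) = restr (faces K) (tr \<phi> x * em y) + restr (faces K) (em x * tr \<phi> y)" for x y
  proof (rule lin_eqI[of "\<lambda>x. tr \<phi> (bmul Pm x y)" "\<lambda>x. restr (faces K) (tr \<phi> x * em y) + restr (faces K) (em x * tr \<phi> y)"])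
    show "lin (\<lambda>x. tr \<phi> (bmul Pm x y))" by (rule lin_comp[OF l Pm.lin_mul_left])
    show "lin (\<lambda>x. restr (faces K) (tr \<phi> x * em y) + restr (faces K) (em x * tr \<phi> y))"
      by (intro lin_addI lin_comp[OF bilin_left[OF bilin_restr_times] l] lin_comp[OF bilin_left[OF bilin_restr_times] em_lin])
    fix z
    obtain n where n: "L (bas z) \<in> deg_part P n" using L_bas_deg by blast
    show "tr \<phi> (bmul Pm (bas z) y) = restr (faces K) (tr \<phi> (bas z) * em y) + restr (faces K) (em (bas z) * tr \<phi> y)"
      using nf_leibniz[OF n L_closed c c] by (simp add: tr_def em_def L_co L_closed Der_mul[OF \<phi> n L_closed])
  qed
qed

lemma cl_0: "cl 0 = (\<zero>\<^bsub>SRA\<^esub> :: ('v, 'k) mpoly set)"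
  using cl_ops(4)[of "0 :: ('v, 'k) mpoly" 0] by simp

lemma tr_Der_surj: assumes \<psi>: "\<psi> \<in> uder Pm K em j" shows "\<exists>\<phi>\<in>carrier (der j). tr \<phi> = \<psi>"
proof -
  define \<phi> where "\<phi> = (\<lambda>x\<in>carrier P. cl (\<psi> (co x)))"
  note l = uder_lin[OF \<psi>] and k = uder_keys[OF \<psi>]
  have km: "keys (\<psi> f) \<subseteq> mons V" for f using k[of f] faces_mons by blast
  have cc: "cl (\<psi> f) \<in> carrier SRA" for f by (rule cl_carrier[OF k])
  have nfc: "nf (cl (\<psi> f)) = \<psi> f" for f by (rule nf_cl_faces[OF k])
  have off: "\<psi> (co x) = 0" if "x \<in> deg_part P n" "n \<noteq> j" for x n
    by (rule lin_eq_keys[OF l lin_zero]) (use deg_keys[OF that(1)] that(2) uder_off[OF \<psi>] in auto)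
  have leib: "cl (\<psi> (co (x \<otimes> y))) = cl (\<psi> (co x)) \<otimes>\<^bsub>SRA\<^esub> \<epsilon> y \<oplus>\<^bsub>SRA\<^esub> koszul_sign (j * n) \<odot>\<^bsub>SRA\<^esub> (\<epsilon> x \<otimes>\<^bsub>SRA\<^esub> cl (\<psi> (co y)))"
    if x: "x \<in> deg_part P n" and y: "y \<in> carrier P" for x y n
  proof (rule nf_inj[OF cc])
    have xc: "x \<in> carrier P" by (rule deg_carrier[OF x])
    note e = eps_closed[OF xc] eps_closed[OF y]
    show "cl (\<psi> (co x)) \<otimes>\<^bsub>SRA\<^esub> \<epsilon> y \<oplus>\<^bsub>SRA\<^esub> koszul_sign (j * n) \<odot>\<^bsub>SRA\<^esub> (\<epsilon> x \<otimes>\<^bsub>SRA\<^esub> cl (\<psi> (co y))) \<in> carrier SRA"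
      by (intro nf_ops(6) nf_ops(7)[OF cc e(2)] nf_ops(8)[OF nf_ops(7)[OF e(1) cc] nf_ops(7)[OF e(1) cc]])
    show "nf (cl (\<psi> (co (x \<otimes> y)))) =
        nf (cl (\<psi> (co x)) \<otimes>\<^bsub>SRA\<^esub> \<epsilon> y \<oplus>\<^bsub>SRA\<^esub> koszul_sign (j * n) \<odot>\<^bsub>SRA\<^esub> (\<epsilon> x \<otimes>\<^bsub>SRA\<^esub> cl (\<psi> (co y))))"
      unfolding nf_leibniz[OF x y cc cc] nfc
      using uder_mul[OF \<psi>, of "co x" "co y"] xc y by (simp add: L_co em_def)
  qed
  have "\<phi> \<in> carrier (der j)"
    unfolding Der_def linear_maps_def
    using cc leib off deg_carrier
    by (auto simp: \<phi>_def co_add co_smul lin_add[OF l] lin_smul[OF l] cl_ops(1,3)[OF km km] smult_cl cl_0)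
  moreover have "tr \<phi> = \<psi>"
  proof
    fix f
    have "tr \<phi> f = \<psi> (restr X0 f)" by (simp add: tr_def \<phi>_def L_closed co_L nfc)
    also have "\<dots> = \<psi> f" by (rule lin_eqI[OF lin_comp[OF l lin_restr] l]) (use uder_off[OF \<psi>] lin_0[OF l] in auto)
    finally show "tr \<phi> f = \<psi> f" .
  qed
  ultimately show ?thesis by blast
qed

lemma tr_inj: "inj_on tr D"
proof (rule inj_onI)
  fix \<phi> \<psi> assume d: "\<phi> \<in> D" "\<psi> \<in> D" and e: "tr \<phi> = tr \<psi>"
  show "\<phi> = \<psi>"
  proof (rule PiE_ext)
    show "\<phi> \<in> carrier P \<rightarrow>\<^sub>E carrier SRA" "\<psi> \<in> carrier P \<rightarrow>\<^sub>E carrier SRA" using d by (simp_all add: D_def)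
    fix x assume x: "x \<in> carrier P"
    show "\<phi> x = \<psi> x"
      by (rule nf_inj) (use d x D_closed fun_cong[OF e, of "co x"] in \<open>simp_all add: tr_def L_co\<close>)
  qed
qed

lemma diff_D: "\<phi> \<in> D \<Longrightarrow> der_diff SRA P j \<phi> \<in> D"
  using nf_ops(8)[OF D_closed[OF _ bd_closed] zero_SRA] by (auto simp: D_def der_diff_def)

lemma tr_diff: "\<phi> \<in> D \<Longrightarrow> tr (der_diff SRA P j \<phi>) = (\<lambda>f. koszul_sign (j + 1) \<bullet> tr \<phi> (bdif Pm f))"
  using nf_ops(3)[OF D_closed[OF _ bd_closed] zero_SRA] by (auto simp: tr_def der_diff_def L_closed L_co bd_closed)

lemma zero_D: "\<zero>\<^bsub>der j\<^esub> \<in> D" and tr_zero: "tr \<zero>\<^bsub>der j\<^esub> = (\<lambda>f. 0)"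
  using zero_SRA by (auto simp: D_def Der_def tr_def L_closed nf_zero)

lemma koszul_sign_smul: "koszul_sign n \<bullet> koszul_sign n \<bullet> x = x" "koszul_sign n \<bullet> x = 0 \<longleftrightarrow> x = 0"
  by (auto simp: koszul_sign_def)

lemma tr_weight:
  assumes \<phi>: "\<phi> \<in> carrier (der j)"
  shows "\<phi> \<in> weight_derivations V (SR_weight V K) W c \<longleftrightarrow> (\<forall>z. keys (tr \<phi> (bas z)) \<subseteq> {m. mwt m = bwt Pm z + c})"
proof
  assume w: "\<phi> \<in> weight_derivations V (SR_weight V K) W c"
  show "\<forall>z. keys (tr \<phi> (bas z)) \<subseteq> {m. mwt m = bwt Pm z + c}"
  proof
    fix z
    show "keys (tr \<phi> (bas z)) \<subseteq> {m. mwt m = bwt Pm z + c}"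
    proof (cases "z \<in> X0")
      case True
      then have "\<phi> (mon (fst z)) \<in> SR_weight V K (\<lambda>v. wgM (fst z) v + c v)"
        using w mon_wt[OF True] by (auto simp: weight_derivations_def)
      then show ?thesis using True by (auto simp: SR_weight_iff tr_def L_bas plus_fun_def)
    next
      case False
      then have "tr \<phi> (bas z) = 0" using uder_off[OF tr_Der_uder[OF \<phi>]] by simp
      then show ?thesis by simp
    qed
  qed
next
  assume k: "\<forall>z. keys (tr \<phi> (bas z)) \<subseteq> {m. mwt m = bwt Pm z + c}"
  show "\<phi> \<in> weight_derivations V (SR_weight V K) W c"
    unfolding weight_derivations_def SR_weight_iff
  proof (intro CollectI ballI conjI)
    fix w x assume w: "w \<in> weights V" "x \<in> W w"
    then have xc: "x \<in> carrier P" by (rule W_carrier)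
    show "\<phi> x \<in> carrier SRA" by (rule D_closed[OF Der_D[OF \<phi>] xc])
    have "keys (tr \<phi> (co x)) \<subseteq> {m. mwt m = w + c}"
      by (rule lin_keys[OF uder_lin[OF tr_Der_uder[OF \<phi>]]]) (use k wt_keys[OF w] in force)
    then show "keys (nf (\<phi> x)) \<subseteq> {m. mwt m = (\<lambda>v. w v + c v)}" using xc by (simp add: tr_def L_co plus_fun_def)
  qed
qed

definition Zr where "Zr j c = der_cocycles SRA P \<epsilon> j \<inter> weight_derivations V (SR_weight V K) W c"

lemma Zr_D: "Zr j c \<subseteq> D" by (auto simp: Zr_def der_cocycles_def Der_D)

lemma cocycle_iff:
  assumes \<phi>: "\<phi> \<in> carrier (der j)"
  shows "\<phi> \<in> der_cocycles SRA P \<epsilon> j \<longleftrightarrow> (\<forall>f. tr \<phi> (bdif Pm f) = 0)"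
proof -
  note d = Der_D[OF \<phi>]
  have "der_diff SRA P j \<phi> = \<zero>\<^bsub>der (j + 1)\<^esub> \<longleftrightarrow> tr (der_diff SRA P j \<phi>) = tr \<zero>\<^bsub>der (j + 1)\<^esub>"
    using inj_on_eq_iff[OF tr_inj diff_D[OF d] zero_D] by blast
  also have "\<dots> \<longleftrightarrow> (\<forall>f. tr \<phi> (bdif Pm f) = 0)"
    unfolding tr_diff[OF d] tr_zero fun_eq_iff koszul_sign_smul ..
  finally show ?thesis using \<phi> by (simp add: der_cocycles_def)
qed

lemma tr_Zr: "tr ` Zr j c = bcoc Pm K em c j"
proof (intro Set.set_eqI iffI)
  fix \<psi> assume "\<psi> \<in> tr ` Zr j c"
  then obtain \<phi> where \<phi>: "\<psi> = tr \<phi>" "\<phi> \<in> der_cocycles SRA P \<epsilon> j" "\<phi> \<in> weight_derivations V (SR_weight V K) W c"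
    by (auto simp: Zr_def)
  then have d: "\<phi> \<in> carrier (der j)" by (simp add: der_cocycles_def)
  then show "\<psi> \<in> bcoc Pm K em c j"
    unfolding bcoc_def bder_uder using tr_Der_uder[OF d] tr_weight[OF d, of c] cocycle_iff[OF d] \<phi> by blast
next
  fix \<psi> assume \<psi>: "\<psi> \<in> bcoc Pm K em c j"
  then obtain \<phi> where "\<phi> \<in> carrier (der j)" "tr \<phi> = \<psi>"
    using tr_Der_surj unfolding bcoc_def bder_uder by blast
  then show "\<psi> \<in> tr ` Zr j c"
    using \<psi> tr_weight[of \<phi> j c] cocycle_iff[of \<phi> j] unfolding bcoc_def bder_uder Zr_def by blast
qed

text \<open>The sign in \<open>der_diff\<close> is absorbed by rescaling the derivation.\<close>

lemma tr_cob: "tr ` der_coboundaries SRA P \<epsilon> j = {\<lambda>f. \<psi> (bdif Pm f) | \<psi>. \<psi> \<in> uder Pm K em (j - 1)}"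
proof (intro Set.set_eqI iffI)
  fix \<psi> assume "\<psi> \<in> tr ` der_coboundaries SRA P \<epsilon> j"
  then obtain \<chi> where \<chi>: "\<chi> \<in> carrier (der (j - 1))" "\<psi> = tr (der_diff SRA P (j - 1) \<chi>)"
    by (auto simp: der_coboundaries_def)
  then have "\<psi> = (\<lambda>f. koszul_sign j \<bullet> tr \<chi> (bdif Pm f))" using tr_diff[OF Der_D[OF \<chi>(1)], of "j - 1"] by simp
  then show "\<psi> \<in> {\<lambda>f. \<psi> (bdif Pm f) | \<psi>. \<psi> \<in> uder Pm K em (j - 1)}"
    using tr_Der_uder[OF \<chi>(1)] linclosed_uder[of Pm K em "j - 1"] unfolding linclosed_def
    by (intro CollectI exI[of _ "\<lambda>f. koszul_sign j \<bullet> tr \<chi> f"]) blast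
next
  fix \<phi> assume "\<phi> \<in> {\<lambda>f. \<psi> (bdif Pm f) | \<psi>. \<psi> \<in> uder Pm K em (j - 1)}"
  then obtain \<psi> where \<psi>: "\<psi> \<in> uder Pm K em (j - 1)" "\<phi> = (\<lambda>f. \<psi> (bdif Pm f))" by blast
  then have "(\<lambda>f. koszul_sign j \<bullet> \<psi> f) \<in> uder Pm K em (j - 1)"
    using linclosed_uder[of Pm K em "j - 1"] unfolding linclosed_def by blast
  then obtain \<chi> where \<chi>: "\<chi> \<in> carrier (der (j - 1))" "tr \<chi> = (\<lambda>f. koszul_sign j \<bullet> \<psi> f)" using tr_Der_surj by blast
  then have "tr (der_diff SRA P (j - 1) \<chi>) = \<phi>"
    using tr_diff[OF Der_D[OF \<chi>(1)], of "j - 1"] by (simp add: \<psi>(2) koszul_sign_smul del: Pm_simps(4))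
  then show "\<phi> \<in> tr ` der_coboundaries SRA P \<epsilon> j" using \<chi>(1) by (auto simp: der_coboundaries_def)
qed

text \<open>If a cocycle of weight \<open>c\<close> is the coboundary of some derivation, it is also
  the coboundary of the weight \<open>c\<close> part of that derivation, as the differential
  preserves weights.\<close>

lemma tr_cob_iff:
  assumes \<phi>: "\<phi> \<in> bcoc Pm K em c j"
  shows "\<phi> \<in> tr ` der_coboundaries SRA P \<epsilon> j \<longleftrightarrow> \<phi> \<in> bcob Pm K em c j"
proof
  assume "\<phi> \<in> tr ` der_coboundaries SRA P \<epsilon> j"
  then obtain \<psi> where \<psi>: "\<psi> \<in> uder Pm K em (j - 1)" "\<phi> = (\<lambda>f. \<psi> (bdif Pm f))" unfolding tr_cob by blast
  obtain \<psi>' where \<psi>': "\<psi>' \<in> bder Pm K em c (j - 1)"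
    "\<And>x w. keys x \<subseteq> {z. bwt Pm z = w} \<Longrightarrow> \<psi>' x = restr {m. mwt m = w + c} (\<psi> x)"
    using bresol.uder_weight[OF bresol_Pm \<psi>(1)] by blast
  have b: "\<phi> \<in> bder Pm K em c j" using \<phi> by (simp add: bcoc_def)
  have "\<phi> f = \<psi>' (bdif Pm f)" for f
  proof (rule lin_eqI[OF bder_lin[OF b] lin_comp[OF bder_lin[OF \<psi>'(1)] Pm.lin_dif]])
    fix z
    have "keys (bdif Pm (bas z)) \<subseteq> {y. bwt Pm y = bwt Pm z}" using Pm.dif_keys[of z] by (auto simp: hidx_def)
    from \<psi>'(2)[OF this] have "\<psi>' (bdif Pm (bas z)) = restr {m. mwt m = bwt Pm z + c} (\<phi> (bas z))" by (simp add: \<psi>(2))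
    also have "\<dots> = \<phi> (bas z)" by (rule restr_id) (use bder_keys[OF b, of z] in blast)
    finally show "\<phi> (bas z) = \<psi>' (bdif Pm (bas z))" ..
  qed
  then have "\<phi> = (\<lambda>f. \<psi>' (bdif Pm f))" by (rule ext)
  then show "\<phi> \<in> bcob Pm K em c j" using \<psi>'(1) by (auto simp: bcob_def simp del: Pm_simps)
next
  show "\<phi> \<in> bcob Pm K em c j \<Longrightarrow> \<phi> \<in> tr ` der_coboundaries SRA P \<epsilon> j"
    unfolding tr_cob bcob_def using bder_uder by (elim CollectE bexE) blast
qed

end

section \<open>Isomorphic quotients\<close>

text \<open>The set \<open>B\<close> may reach beyond \<open>Zr\<close>: coboundaries have arbitrary
  weights, while \<open>Zr\<close> consists of the cocycles of one weight. By \<open>B_iff\<close>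
  the elements of \<open>B\<close> inside \<open>Zr\<close> are described by \<open>Bm\<close>, the
  coboundaries of that weight.\<close>

locale quot_model = coset_model M D tr B
  for M :: "('k::field_char_0, 'a, 'm) module_scheme" (structure) and D and tr :: "'a \<Rightarrow> 'x \<Rightarrow> ('y \<Rightarrow>\<^sub>0 'k)" and B +
  fixes Zr :: "'a set" and Bm :: "('x \<Rightarrow> ('y \<Rightarrow>\<^sub>0 'k)) set"
  assumes Zr_sub: "Zr \<subseteq> D" and Z_lin: "linclosed (tr ` Zr)"
    and B_iff: "z \<in> tr ` Zr \<Longrightarrow> z \<in> tr ` B \<longleftrightarrow> z \<in> Bm"
    and smul_closed: "x \<in> D \<Longrightarrow> c \<odot> x \<in> D"
    and tr_smul: "x \<in> D \<Longrightarrow> tr (c \<odot> x) = (\<lambda>f. c \<bullet> tr x f)"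
    and B_smul: "z \<in> tr ` B \<Longrightarrow> (\<lambda>f. c \<bullet> z f) \<in> tr ` B"
begin

lemma Zr_add: "x \<in> Zr \<Longrightarrow> y \<in> Zr \<Longrightarrow> x \<oplus> y \<in> Zr"
proof -
  assume x: "x \<in> Zr" "y \<in> Zr"
  then have "(\<lambda>f. tr x f + tr y f) \<in> tr ` Zr" using Z_lin unfolding linclosed_def by blast
  moreover have "tr (x \<oplus> y) = (\<lambda>f. tr x f + tr y f)" using x Zr_sub tr_add by (auto simp: plus_fun_def)
  ultimately obtain z where "z \<in> Zr" "tr (x \<oplus> y) = tr z" by auto
  then show ?thesis using inj_onD[OF tr_inj, of "x \<oplus> y" z] add_closed x Zr_sub by (metis subsetD)
qed

lemma Zr_smul: "x \<in> Zr \<Longrightarrow> c \<odot> x \<in> Zr"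
proof -
  assume x: "x \<in> Zr"
  then have "(\<lambda>f. c \<bullet> tr x f) \<in> tr ` Zr" using Z_lin unfolding linclosed_def by blast
  moreover have "tr (c \<odot> x) = (\<lambda>f. c \<bullet> tr x f)" using x Zr_sub tr_smul by auto
  ultimately obtain z where "z \<in> Zr" "tr (c \<odot> x) = tr z" by auto
  then show ?thesis using inj_onD[OF tr_inj, of "c \<odot> x" z] smul_closed x Zr_sub by (metis subsetD)
qed

lemma coset_smul: "x \<in> D \<Longrightarrow> (\<Union>y\<in>B +> x. B +> (c \<odot> y)) = B +> (c \<odot> x)"
proof -
  assume x: "x \<in> D"
  have "B +> (c \<odot> y) = B +> (c \<odot> x)" if "y \<in> B +> x" for y
  proof -
    have y: "y \<in> D" "tr y - tr x \<in> tr ` B" using coset_mem[OF x] that by auto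
    have "tr (c \<odot> y) - tr (c \<odot> x) = (\<lambda>f. c \<bullet> (tr y - tr x) f)"
      by (simp add: tr_smul x y fun_diff_def smul_simps)
    then have "tr (c \<odot> y) - tr (c \<odot> x) \<in> tr ` B" using B_smul[OF y(2), of c] by simp
    then show ?thesis using coset_eq smul_closed x y(1) by blast
  qed
  then show ?thesis using coset_self[OF x] by blast
qed

definition Q where
  "Q = \<lparr>carrier = (\<lambda>x. B +> x) ` Zr, monoid.mult = undefined, one = undefined, ring.zero = B, add = set_add M,
      module.smult = (\<lambda>c C. \<Union>x\<in>C. B +> (c \<odot> x))\<rparr>"

lemma coset_Zr_iff: "x \<in> Zr \<Longrightarrow> y \<in> Zr \<Longrightarrow> B +> x = B +> y \<longleftrightarrow> tr x - tr y \<in> Bm"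
proof -
  assume x: "x \<in> Zr" "y \<in> Zr"
  then have "(\<lambda>f. tr x f - tr y f) \<in> tr ` Zr" by (intro linclosed_diff[OF Z_lin]) auto
  then show ?thesis using coset_eq[of x y] B_iff[of "tr x - tr y"] x Zr_sub by (auto simp: fun_diff_def)
qed

lemma Q_trivial:
  assumes "tr ` Zr \<subseteq> Bm" shows "carrier Q = {\<zero>\<^bsub>Q\<^esub>}"
proof -
  have "B +> x = B" if "x \<in> Zr" for x
    using that assms coset_eq_B[of x] B_iff[of "tr x"] Zr_sub by auto
  moreover have "Zr \<noteq> {}" using Z_lin by (auto simp: linclosed_def)
  ultimately show ?thesis by (auto simp: Q_def)
qed

end

text \<open>Differences of related pairs are related, and related cocycles are coboundaries
  simultaneously. Hence the relation matches cosets one to one.\<close>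

lemma hiso_module_isomorphic:
  assumes q1: "quot_model M1 D1 tr1 B1 Zr1 Bm1" and q2: "quot_model M2 D2 tr2 B2 Zr2 Bm2"
    and h: "hiso (tr1 ` Zr1) Bm1 (tr2 ` Zr2) Bm2"
  shows "module_isomorphic (quot_model.Q M1 B1 Zr1) (quot_model.Q M2 B2 Zr2)"
proof -
  interpret q1: quot_model M1 D1 tr1 B1 Zr1 Bm1 by (rule q1)
  interpret q2: quot_model M2 D2 tr2 B2 Zr2 Bm2 by (rule q2)
  obtain R where R: "\<forall>\<phi>\<in>tr1 ` Zr1. \<exists>\<psi>\<in>tr2 ` Zr2. R \<phi> \<psi>" "\<forall>\<psi>\<in>tr2 ` Zr2. \<exists>\<phi>\<in>tr1 ` Zr1. R \<phi> \<psi>"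
     "\<forall>\<phi>\<in>tr1 ` Zr1. \<forall>\<psi>\<in>tr2 ` Zr2. R \<phi> \<psi> \<longrightarrow> (\<phi> \<in> Bm1 \<longleftrightarrow> \<psi> \<in> Bm2)"
     "\<And>\<phi> \<phi>' \<psi> \<psi>'. R \<phi> \<psi> \<Longrightarrow> R \<phi>' \<psi>' \<Longrightarrow> R (\<lambda>x. \<phi> x + \<phi>' x) (\<lambda>x. \<psi> x + \<psi>' x)"
     "\<And>c \<phi> \<psi>. R \<phi> \<psi> \<Longrightarrow> R (\<lambda>x. c \<bullet> \<phi> x) (\<lambda>x. c \<bullet> \<psi> x)"
    using h unfolding hiso_def by blast
  have R_diff: "R (\<lambda>x. \<phi> x - \<phi>' x) (\<lambda>x. \<psi> x - \<psi>' x)" if "R \<phi> \<psi>" "R \<phi>' \<psi>'" for \<phi> \<phi>' \<psi> \<psi>'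
    using R(4)[OF that(1) R(5)[OF that(2), of "- 1"]] by simp
  have eq: "B1 +>\<^bsub>M1\<^esub> x = B1 +>\<^bsub>M1\<^esub> x' \<longleftrightarrow> B2 +>\<^bsub>M2\<^esub> y = B2 +>\<^bsub>M2\<^esub> y'"
    if "x \<in> Zr1" "x' \<in> Zr1" "y \<in> Zr2" "y' \<in> Zr2" "R (tr1 x) (tr2 y)" "R (tr1 x') (tr2 y')" for x x' y y'
  proof -
    have "(\<lambda>f. tr1 x f - tr1 x' f) \<in> tr1 ` Zr1" "(\<lambda>f. tr2 y f - tr2 y' f) \<in> tr2 ` Zr2"
      using that by (auto intro!: linclosed_diff[OF q1.Z_lin] linclosed_diff[OF q2.Z_lin])
    then have "tr1 x - tr1 x' \<in> Bm1 \<longleftrightarrow> tr2 y - tr2 y' \<in> Bm2"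
      using R(3) R_diff[OF that(5,6)] unfolding fun_diff_def by blast
    then show ?thesis using q1.coset_Zr_iff[OF that(1,2)] q2.coset_Zr_iff[OF that(3,4)] by simp
  qed
  have ex: "\<exists>y\<in>Zr2. R (tr1 x) (tr2 y)" if "x \<in> Zr1" for x using R(1) that by blast
  \<comment> \<open>The coset is chosen through some related pair of representatives; by
    \<open>eq\<close> all such pairs give the same result.\<close>
  define F where "F C = (SOME C'. \<exists>x\<in>Zr1. \<exists>y\<in>Zr2. C = B1 +>\<^bsub>M1\<^esub> x \<and> R (tr1 x) (tr2 y) \<and> C' = B2 +>\<^bsub>M2\<^esub> y)" for C
  have F: "F (B1 +>\<^bsub>M1\<^esub> x) = B2 +>\<^bsub>M2\<^esub> y" if "x \<in> Zr1" "y \<in> Zr2" "R (tr1 x) (tr2 y)" for x y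
  proof -
    have "\<exists>x'\<in>Zr1. \<exists>y'\<in>Zr2. B1 +>\<^bsub>M1\<^esub> x = B1 +>\<^bsub>M1\<^esub> x' \<and> R (tr1 x') (tr2 y') \<and> F (B1 +>\<^bsub>M1\<^esub> x) = B2 +>\<^bsub>M2\<^esub> y'"
      unfolding F_def by (rule someI_ex) (use that in blast)
    then show ?thesis using eq that by metis
  qed
  have F_add: "F (set_add M1 (B1 +>\<^bsub>M1\<^esub> x) (B1 +>\<^bsub>M1\<^esub> x')) = set_add M2 (F (B1 +>\<^bsub>M1\<^esub> x)) (F (B1 +>\<^bsub>M1\<^esub> x'))"
    if x: "x \<in> Zr1" "x' \<in> Zr1" for x x'
  proof -
    obtain y y' where y: "y \<in> Zr2" "R (tr1 x) (tr2 y)" "y' \<in> Zr2" "R (tr1 x') (tr2 y')" using ex x by blast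
    note d = subsetD[OF q1.Zr_sub] subsetD[OF q2.Zr_sub]
    have "R (tr1 (x \<oplus>\<^bsub>M1\<^esub> x')) (tr2 (y \<oplus>\<^bsub>M2\<^esub> y'))"
      using R(4)[OF y(2,4)] q1.tr_add[OF d(1)[OF x(1)] d(1)[OF x(2)]] q2.tr_add[OF d(2)[OF y(1)] d(2)[OF y(3)]]
      by (simp add: plus_fun_def)
    from F[OF q1.Zr_add[OF x] q2.Zr_add[OF y(1,3)] this] show ?thesis
      by (simp add: F[OF x(1) y(1,2)] F[OF x(2) y(3,4)] q1.coset_add d x y q2.coset_add)
  qed
  have F_smul: "F (\<Union>z\<in>B1 +>\<^bsub>M1\<^esub> x. B1 +>\<^bsub>M1\<^esub> (c \<odot>\<^bsub>M1\<^esub> z)) = (\<Union>z\<in>F (B1 +>\<^bsub>M1\<^esub> x). B2 +>\<^bsub>M2\<^esub> (c \<odot>\<^bsub>M2\<^esub> z))"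
    if x: "x \<in> Zr1" for x c
  proof -
    obtain y where y: "y \<in> Zr2" "R (tr1 x) (tr2 y)" using ex x by blast
    note d = subsetD[OF q1.Zr_sub x] subsetD[OF q2.Zr_sub y(1)]
    have "R (tr1 (c \<odot>\<^bsub>M1\<^esub> x)) (tr2 (c \<odot>\<^bsub>M2\<^esub> y))"
      using R(5)[OF y(2)] by (simp add: q1.tr_smul[OF d(1)] q2.tr_smul[OF d(2)])
    from F[OF q1.Zr_smul[OF x] q2.Zr_smul[OF y(1)] this] show ?thesis
      by (simp only: F[OF x y] q1.coset_smul[OF d(1)] q2.coset_smul[OF d(2)])
  qed
  have F_mem: "F (B1 +>\<^bsub>M1\<^esub> x) \<in> (\<lambda>y. B2 +>\<^bsub>M2\<^esub> y) ` Zr2" if "x \<in> Zr1" for x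
    using ex[OF that] F[OF that] by auto
  have "F \<in> linear_maps q1.Q q2.Q"
    unfolding linear_maps_def using F_add F_smul by (simp add: q1.Q_def q2.Q_def Pi_iff F_mem)
  moreover have "bij_betw F (carrier q1.Q) (carrier q2.Q)"
  proof (rule bij_betw_imageI)
    show "inj_on F (carrier q1.Q)"
    proof (rule inj_onI)
      fix C C' assume "C \<in> carrier q1.Q" "C' \<in> carrier q1.Q" and FC: "F C = F C'"
      then obtain x x' where x: "x \<in> Zr1" "C = B1 +>\<^bsub>M1\<^esub> x" "x' \<in> Zr1" "C' = B1 +>\<^bsub>M1\<^esub> x'" by (auto simp: q1.Q_def)
      obtain y y' where y: "y \<in> Zr2" "R (tr1 x) (tr2 y)" "y' \<in> Zr2" "R (tr1 x') (tr2 y')" using ex x by blast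
      show "C = C'" using eq[OF x(1,3) y(1,3,2,4)] FC F[OF x(1) y(1,2)] F[OF x(3) y(3,4)] x(2,4) by simp
    qed
    show "F ` carrier q1.Q = carrier q2.Q"
    proof
      show "F ` carrier q1.Q \<subseteq> carrier q2.Q" using F_mem by (auto simp: q1.Q_def q2.Q_def)
      show "carrier q2.Q \<subseteq> F ` carrier q1.Q"
      proof
        fix C assume "C \<in> carrier q2.Q"
        then obtain y where y: "y \<in> Zr2" "C = B2 +>\<^bsub>M2\<^esub> y" by (auto simp: q2.Q_def)
        obtain x where x: "x \<in> Zr1" "R (tr1 x) (tr2 y)" using R(2) y(1) by blast
        then show "C \<in> F ` carrier q1.Q" using F[OF x(1) y(1) x(2)] y(2) by (auto simp: q1.Q_def)
      qed
    qed
  qed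
  ultimately show ?thesis unfolding module_isomorphic_def by blast
qed

section \<open>The cotangent cohomology of one weight as a quotient in coordinates\<close>

context rec_res
begin

lemma der_ops:
  "\<phi> \<oplus>\<^bsub>der j\<^esub> \<psi> = (\<lambda>x\<in>carrier P. \<phi> x \<oplus>\<^bsub>SRA\<^esub> \<psi> x)" "a \<odot>\<^bsub>der j\<^esub> \<phi> = (\<lambda>x\<in>carrier P. a \<odot>\<^bsub>SRA\<^esub> \<phi> x)"
  by (simp_all add: Der_def)

lemma linclosed_tr_cob: "linclosed (tr ` der_coboundaries SRA P \<epsilon> j)"
  unfolding linclosed_def
proof (intro conjI ballI allI)
  note l = linclosed_uder[of Pm K em "j - 1", unfolded linclosed_def]
  show "(\<lambda>x. 0) \<in> tr ` der_coboundaries SRA P \<epsilon> j" unfolding tr_cob using l by (intro CollectI exI[of _ "\<lambda>x. 0"]) simp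
  show "(\<lambda>x. \<phi> x + \<psi> x) \<in> tr ` der_coboundaries SRA P \<epsilon> j"
    if p: "\<phi> \<in> tr ` der_coboundaries SRA P \<epsilon> j" "\<psi> \<in> tr ` der_coboundaries SRA P \<epsilon> j" for \<phi> \<psi>
  proof -
    obtain a b where ab: "a \<in> uder Pm K em (j - 1)" "b \<in> uder Pm K em (j - 1)" "\<phi> = (\<lambda>f. a (bdif Pm f))"
      "\<psi> = (\<lambda>f. b (bdif Pm f))" using p unfolding tr_cob by blast
    then show ?thesis unfolding tr_cob using l by (intro CollectI exI[of _ "\<lambda>x. a x + b x"]) simp
  qed
  show "(\<lambda>x. k \<bullet> \<phi> x) \<in> tr ` der_coboundaries SRA P \<epsilon> j" if p: "\<phi> \<in> tr ` der_coboundaries SRA P \<epsilon> j" for k \<phi>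
  proof -
    obtain a where "a \<in> uder Pm K em (j - 1)" "\<phi> = (\<lambda>f. a (bdif Pm f))" using p unfolding tr_cob by blast
    then show ?thesis unfolding tr_cob using l by (intro CollectI exI[of _ "\<lambda>x. k \<bullet> a x"]) simp
  qed
qed

lemma quot_model_Der:
  "quot_model (der j) D tr (der_coboundaries SRA P \<epsilon> j) (Zr j c) (bcob Pm K em c j)"
proof
  show "x \<oplus>\<^bsub>der j\<^esub> y \<in> D" "tr (x \<oplus>\<^bsub>der j\<^esub> y) = tr x + tr y" if "x \<in> D" "y \<in> D" for x y
    using nf_ops(1,6)[OF D_closed[OF that(1)] D_closed[OF that(2)]]
    by (auto simp: der_ops tr_def L_closed D_def)
  show "c \<odot>\<^bsub>der j\<^esub> x \<in> D" "tr (c \<odot>\<^bsub>der j\<^esub> x) = (\<lambda>f. c \<bullet> tr x f)" if "x \<in> D" for x c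
    using nf_ops(3,8)[OF D_closed[OF that] zero_SRA]
    by (auto simp: der_ops tr_def L_closed D_def)
  show "inj_on tr D" by (rule tr_inj)
  show "der_coboundaries SRA P \<epsilon> j \<subseteq> D" by (auto simp: der_coboundaries_def diff_D Der_D)
  show "0 \<in> tr ` der_coboundaries SRA P \<epsilon> j"
    using linclosed_tr_cob[of j] unfolding linclosed_def zero_fun_def by blast
  show "g - h \<in> tr ` der_coboundaries SRA P \<epsilon> j"
    if "g \<in> tr ` der_coboundaries SRA P \<epsilon> j" "h \<in> tr ` der_coboundaries SRA P \<epsilon> j" for g h
    unfolding fun_diff_def by (rule linclosed_diff[OF linclosed_tr_cob that])
  show "(\<lambda>f. c \<bullet> z f) \<in> tr ` der_coboundaries SRA P \<epsilon> j" if "z \<in> tr ` der_coboundaries SRA P \<epsilon> j" for z c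
    using linclosed_tr_cob[of j] that unfolding linclosed_def by blast
  show "z \<in> tr ` der_coboundaries SRA P \<epsilon> j \<longleftrightarrow> z \<in> bcob Pm K em c j" if "z \<in> tr ` Zr j c" for z
    using tr_cob_iff that unfolding tr_Zr by blast
qed (simp_all add: Zr_D tr_Zr linclosed_bcoc)

lemma SR_cotangent_eq: "SR_cotangent V K P \<epsilon> W j c = quot_model.Q (der j) (der_coboundaries SRA P \<epsilon> j) (Zr j c)"
proof -
  interpret q: quot_model "der j" D tr "der_coboundaries SRA P \<epsilon> j" "Zr j c" "bcob Pm K em c j" by (rule quot_model_Der)
  have "{der_coboundaries SRA P \<epsilon> j +>\<^bsub>der j\<^esub> \<phi> |\<phi>. \<phi> \<in> Zr j c} = (\<lambda>\<phi>. der_coboundaries SRA P \<epsilon> j +>\<^bsub>der j\<^esub> \<phi>) ` Zr j c"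
    by blast
  moreover have "set_add ((der j)\<lparr>carrier := C\<rparr>) = set_add (der j)" for C
    by (intro ext) (simp add: set_add_def set_mult_def)
  ultimately show ?thesis
    unfolding SR_cotangent_def cotangent_cohomology_weight_def cotangent_cohomology_def quot_module_def q.Q_def Zr_def[symmetric]
    by (simp add: a_r_coset_def r_coset_def)
qed

end

section \<open>From arbitrary multigraded resolutions to the comparison with the link\<close>

lemma SR_resolution_rec_res:
  fixes P :: "('k::field_char_0, 'p) dga"
  assumes "finite V" "simplicial_complex V K" "SR_resolution V K P \<epsilon> W"
  obtains G arr where "rec_res V K P \<epsilon> W G arr"
proof -
  have k: "cdga P" "quasi_isomorphism P (in_degree_zero (SR_algebra V K)) \<epsilon>"
    and c: "compatible_grading V (SR_algebra V K) (SR_weight V K) P \<epsilon> W"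
    using assms(3) by (auto simp: SR_resolution_def koszul_tate_resolution_def)
  have "\<exists>G. freely_generates P G \<and> G \<subseteq> (\<Union>w\<in>weights V. W w)"
    using c unfolding compatible_grading_def by (elim conjE)
  then obtain G where G: "freely_generates P G" "G \<subseteq> (\<Union>w\<in>weights V. W w)" by (elim exE conjE)
  have "\<exists>arr. (\<forall>M. mset (arr M) = M) \<and> (\<forall>p\<in>carrier P. \<exists>!f :: 'p multiset \<Rightarrow> 'k.
       finite {M. f M \<noteq> 0} \<and> {M. f M \<noteq> 0} \<subseteq> free_monomials P G \<and>
       p = (\<Oplus>\<^bsub>P\<^esub>M\<in>{M. f M \<noteq> 0}. f M \<odot>\<^bsub>P\<^esub> foldr (\<otimes>\<^bsub>P\<^esub>) (arr M) \<one>\<^bsub>P\<^esub>))"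
    using G(1) unfolding freely_generates_def by (elim conjE)
  then obtain arr :: "'p multiset \<Rightarrow> 'p list" where arr: "\<forall>M. mset (arr M) = M"
    "\<forall>p\<in>carrier P. \<exists>!f :: 'p multiset \<Rightarrow> 'k.
       finite {M. f M \<noteq> 0} \<and> {M. f M \<noteq> 0} \<subseteq> free_monomials P G \<and>
       p = (\<Oplus>\<^bsub>P\<^esub>M\<in>{M. f M \<noteq> 0}. f M \<odot>\<^bsub>P\<^esub> foldr (\<otimes>\<^bsub>P\<^esub>) (arr M) \<one>\<^bsub>P\<^esub>)"
    by (elim exE conjE)
  have "rec_res V K P \<epsilon> W G arr"
  proof (intro rec_res.intro rec_res_axioms.intro)
    show "sr V K" by (simp add: sr_def assms)
    show "G \<subseteq> (\<Union>i. deg_part P i)" using G(1) by (simp add: freely_generates_def)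
    show "cdga P" "quasi_isomorphism P (in_degree_zero (SR_algebra V K)) \<epsilon>" by (rule k)+
    show "G \<subseteq> (\<Union>w\<in>weights V. W w)" by (rule G(2))
  qed (use c arr in \<open>simp_all add: compatible_grading_def image_subset_iff\<close>)
  then show thesis by (rule that)
qed

lemma link_void: "dcl K \<Longrightarrow> F \<notin> K \<Longrightarrow> link F K = {}"
  by (auto simp: link_def dcl_def)

lemma simplicial_complex_link: "simplicial_complex V K \<Longrightarrow> simplicial_complex (V - F) (link F K)"
proof -
  assume K: "simplicial_complex V K"
  then have sub: "g' \<in> K" if "g \<in> K" "g' \<subseteq> g" for g g' using that by (auto simp: simplicial_complex_def)
  have "g' \<in> link F K" if g: "g \<in> link F K" "g' \<subseteq> g" for g g'
    using g sub[of g g'] sub[of "F \<union> g" "F \<union> g'"] by (auto simp: link_def)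
  moreover have "link F K \<subseteq> Pow (V - F)" using K by (fastforce simp: simplicial_complex_def link_def)
  ultimately show ?thesis unfolding simplicial_complex_def by blast
qed

text \<open>For the void complex not even the monomial 1 has its support in a face, so the target of
  the derivations is zero.\<close>

lemma bcoc_void: "\<phi> \<in> bcoc A {} e c i \<Longrightarrow> \<phi> = (\<lambda>x. 0)"
proof
  fix x assume "\<phi> \<in> bcoc A {} e c i"
  then have b: "\<phi> \<in> bder A {} e c i" by (simp add: bcoc_def)
  show "\<phi> x = 0" by (rule lin_eqI[OF bder_lin[OF b] lin_zero]) (use bder_keys[OF b] in \<open>auto simp: faces_def\<close>)
qed

theorem theorem1p2:
  fixes V :: "'v set" and K :: "'v set set" and i :: int and a b :: "'v \<Rightarrow> nat"
    and P :: "('k::field_char_0, 'p) dga" and \<epsilon> :: "'p \<Rightarrow> ('v, 'k) mpoly set"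
    and W :: "('v \<Rightarrow> int) \<Rightarrow> 'p set"
    and Q :: "('k, 'q) dga" and \<eta> :: "'q \<Rightarrow> ('v, 'k) mpoly set"
    and U :: "('v \<Rightarrow> int) \<Rightarrow> 'q set"
  assumes "finite V" and "V \<noteq> {}" and "simplicial_complex V K"
    and "i \<ge> 1"
    and "supp a \<subseteq> V" and "supp b \<subseteq> V" and "supp a \<inter> supp b = {}"
    and "SR_resolution V K P \<epsilon> W"
  shows "(supp a \<notin> K \<longrightarrow>
        carrier (SR_cotangent V K P \<epsilon> W i (\<lambda>v. int (a v) - int (b v))) =
          {\<zero>\<^bsub>SR_cotangent V K P \<epsilon> W i (\<lambda>v. int (a v) - int (b v))\<^esub>}) \<and>
    (supp a \<in> K \<longrightarrow> SR_resolution (V - supp a) (link (supp a) K) Q \<eta> U \<longrightarrow>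
      module_isomorphic
        (SR_cotangent V K P \<epsilon> W i (\<lambda>v. int (a v) - int (b v)))
        (SR_cotangent (V - supp a) (link (supp a) K) Q \<eta> U i (\<lambda>v. - int (b v))))"
proof -
  define c where "c = (\<lambda>v. int (a v) - int (b v))"
  obtain G arr where P: "rec_res V K P \<epsilon> W G arr"
    using SR_resolution_rec_res[OF assms(1,3,8)] by blast
  interpret P: rec_res V K P \<epsilon> W G arr by (rule P)
  \<comment> \<open>On the support of \<open>a\<close> disjointness gives
    \<open>c v = a v > 0\<close>, the hypothesis for removing a vertex; outside of it
    \<open>c\<close> equals \<open>- b\<close>.\<close>
  have c1: "1 \<le> c v" if "v \<in> supp a" for v using that assms(7) by (auto simp: c_def supp_def)
  have c0: "(\<lambda>v. if v \<in> supp a then 0 else c v) = (\<lambda>v. - int (b v))"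
    using assms(7) by (auto simp: c_def supp_def fun_eq_iff)
  have idx: "bidx P.Pm \<subseteq> UNIV \<times> {{}}" by (auto simp: P.X0_def)
  obtain A :: "('p multiset \<times> 'v set, 'k, 'v \<Rightarrow> int) balg" and G' word' e'
    where A: "bresol A G' word' (link (supp a) K) e'"
      "hiso (bcoc P.Pm K P.em c i) (bcob P.Pm K P.em c i)
        (bcoc A (link (supp a) K) e' (\<lambda>v. - int (b v)) i) (bcob A (link (supp a) K) e' (\<lambda>v. - int (b v)) i)"
    using link_resolution[where c = c, OF finite_subset[OF assms(5,1)] P.bresol_Pm idx c1 assms(4)] unfolding c0 by blast
  interpret p: quot_model "P.der i" P.D P.tr "der_coboundaries (SR_algebra V K) P \<epsilon> i" "P.Zr i c" "bcob P.Pm K P.em c i"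
    by (rule P.quot_model_Der)
  have "carrier (SR_cotangent V K P \<epsilon> W i c) = {\<zero>\<^bsub>SR_cotangent V K P \<epsilon> W i c\<^esub>}" if "supp a \<notin> K"
  proof -
    \<comment> \<open>The link is void, so the zero map is the only cocycle there; through the
      isomorphism every cocycle of weight \<open>c\<close> on the given resolution is a
      coboundary.\<close>
    have "\<psi> \<in> bcob A (link (supp a) K) e' (\<lambda>v. - int (b v)) i" if "\<psi> \<in> bcoc A (link (supp a) K) e' (\<lambda>v. - int (b v)) i" for \<psi>
      using that bcoc_void[of \<psi> A] linclosed_bcob[of A "link (supp a) K"]
      unfolding link_void[OF P.dclK \<open>supp a \<notin> K\<close>] linclosed_def by metis
    then have "bcoc P.Pm K P.em c i \<subseteq> bcob P.Pm K P.em c i" using A(2) unfolding hiso_def by fast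
    then show ?thesis unfolding P.SR_cotangent_eq by (intro p.Q_trivial) (simp add: P.tr_Zr)
  qed
  moreover have "module_isomorphic (SR_cotangent V K P \<epsilon> W i c) (SR_cotangent (V - supp a) (link (supp a) K) Q \<eta> U i (\<lambda>v. - int (b v)))"
    if Q: "SR_resolution (V - supp a) (link (supp a) K) Q \<eta> U"
  proof -
    obtain H arr' where "rec_res (V - supp a) (link (supp a) K) Q \<eta> U H arr'"
      using SR_resolution_rec_res[OF finite_Diff[OF assms(1)] simplicial_complex_link[OF assms(3)] Q] by blast
    then interpret Q: rec_res "V - supp a" "link (supp a) K" Q \<eta> U H arr' .
    \<comment> \<open>The iterated Koszul extension and the given \<open>Q\<close> both resolve the
      ring of the link, so their cohomologies are compared by independence of the
      resolution.\<close>
    have "hiso (bcoc P.Pm K P.em c i) (bcob P.Pm K P.em c i)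
        (bcoc Q.Pm (link (supp a) K) Q.em (\<lambda>v. - int (b v)) i) (bcob Q.Pm (link (supp a) K) Q.em (\<lambda>v. - int (b v)) i)"
      by (rule hiso_trans[OF A(2) resolution_independent[OF A(1) Q.bresol_Pm] linclosed_bcoc])
    then show ?thesis unfolding P.SR_cotangent_eq Q.SR_cotangent_eq
      by (intro hiso_module_isomorphic[OF P.quot_model_Der Q.quot_model_Der]) (simp add: P.tr_Zr Q.tr_Zr)
  qed
  ultimately show ?thesis unfolding c_def by blast
qed

end
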